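(* There is a randomized algorithm that solves the single-source shortest paths problem on directed graphs with $n$ vertices and real-valued (possibly negative) edge weights in $O(n^{2.5}\log^{4.5} n)$ time.
   Context: Single-source shortest paths problem with real weights: the input is a directed graph $G=(V,E)$ with $n=|V|$ vertices, $m=|E|$ edges, an edge weight function $w:E\to\mathbb{R}$ (weights may be negative), and a source $s\in V$. The algorithm must either report that $G$ contains a negative-weight cycle, or output the shortest-path distance $d(s,v)$ for every $v\in V$. "Randomized" means the output is correct with high probability (probability at least $1-1/n^c$ for a constant $c$). *)

theory Defs
  imports
    "HOL-Probability.Probability"
    "HOL-Library.Landau_Symbols"
    "Graph_Theory.Graph_Theory"
begin

section \<open>The problem\<close>

text \<open>
  The distance is the library's \<open>wf_digraph.\<mu>\<close>, the infimum in the extended reals of the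
  weights of all walks: it is \<open>\<infinity>\<close> for unreachable vertices and \<open>-\<infinity>\<close> for vertices that are
  reachable through a negative-weight cycle.
\<close>

definition has_negative_cycle :: "nat pair_pre_digraph \<Rightarrow> (nat \<times> nat \<Rightarrow> real) \<Rightarrow> bool" where
  "has_negative_cycle G w \<longleftrightarrow>
     (\<exists>p. pre_digraph.cycle (with_proj G) p \<and> wf_digraph.awalk_cost w p < 0)"

definition sssp_dist :: "nat pair_pre_digraph \<Rightarrow> (nat \<times> nat \<Rightarrow> real) \<Rightarrow> nat \<Rightarrow> nat \<Rightarrow> ereal" where
  "sssp_dist G w s v = wf_digraph.\<mu> (with_proj G) w s v"

text \<open>As inputs of a machine, the vertices are the numbers below \<open>n\<close>.\<close>

definition sssp_instance :: "nat \<Rightarrow> nat pair_pre_digraph \<Rightarrow> nat \<Rightarrow> bool" where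
  "sssp_instance n G s \<longleftrightarrow> pair_fin_digraph G \<and> pverts G = {..<n} \<and> s \<in> pverts G"

datatype sssp_answer = Negative_Cycle | Distances "nat \<Rightarrow> ereal"

fun correct_answer ::
  "nat pair_pre_digraph \<Rightarrow> (nat \<times> nat \<Rightarrow> real) \<Rightarrow> nat \<Rightarrow> sssp_answer \<Rightarrow> bool" where
  "correct_answer G w s Negative_Cycle \<longleftrightarrow> has_negative_cycle G w"
| "correct_answer G w s (Distances d) \<longleftrightarrow> (\<forall>v\<in>pverts G. d v = sssp_dist G w s v)"


section \<open>Randomized real RAM\<close>

text \<open>
  A machine has finitely many named scalars and random-access arrays (all those that the program
  mentions), each either of words or of real numbers. A word is a natural number below a bound
  \<open>M\<close>, and word arithmetic wraps around at \<open>M\<close> (subtraction is truncated at 0). On real numbers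
  the only operations are addition, subtraction and comparison; in particular there is no
  rounding and no conversion between real numbers and words.
\<close>

record machine_state =
  wvar :: "string \<Rightarrow> nat"
  warr :: "string \<Rightarrow> nat \<Rightarrow> nat"
  rvar :: "string \<Rightarrow> real"
  rarr :: "string \<Rightarrow> nat \<Rightarrow> real"

datatype wexp =
    WConst nat
  | WVar string
  | WArr string wexp
  | WAdd wexp wexp
  | WSub wexp wexp
  | WMult wexp wexp
  | WDiv wexp wexp
  | WMod wexp wexp

datatype rexp =
    RZero
  | RVar string
  | RArr string wexp
  | RAdd rexp rexp
  | RSub rexp rexp

datatype bexp =
    WLess wexp wexp
  | WEq wexp wexp
  | RLess rexp rexp
  | BNot bexp
  | BAnd bexp bexp

datatype com =
    Skip
  | WAssign string wexp
  | WStore string wexp wexp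
  | RAssign string rexp
  | RStore string wexp rexp
  | Random string wexp
  | Seq com com
  | Cond bexp com com
  | Loop bexp com

primrec wval :: "nat \<Rightarrow> machine_state \<Rightarrow> wexp \<Rightarrow> nat" where
  "wval M \<sigma> (WConst k) = k mod M"
| "wval M \<sigma> (WVar x) = wvar \<sigma> x"
| "wval M \<sigma> (WArr a i) = warr \<sigma> a (wval M \<sigma> i)"
| "wval M \<sigma> (WAdd e f) = (wval M \<sigma> e + wval M \<sigma> f) mod M"
| "wval M \<sigma> (WSub e f) = wval M \<sigma> e - wval M \<sigma> f"
| "wval M \<sigma> (WMult e f) = (wval M \<sigma> e * wval M \<sigma> f) mod M"
| "wval M \<sigma> (WDiv e f) = wval M \<sigma> e div wval M \<sigma> f"
| "wval M \<sigma> (WMod e f) = wval M \<sigma> e mod wval M \<sigma> f"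

primrec rval :: "nat \<Rightarrow> machine_state \<Rightarrow> rexp \<Rightarrow> real" where
  "rval M \<sigma> RZero = 0"
| "rval M \<sigma> (RVar x) = rvar \<sigma> x"
| "rval M \<sigma> (RArr a i) = rarr \<sigma> a (wval M \<sigma> i)"
| "rval M \<sigma> (RAdd e f) = rval M \<sigma> e + rval M \<sigma> f"
| "rval M \<sigma> (RSub e f) = rval M \<sigma> e - rval M \<sigma> f"

primrec bval :: "nat \<Rightarrow> machine_state \<Rightarrow> bexp \<Rightarrow> bool" where
  "bval M \<sigma> (WLess e f) \<longleftrightarrow> wval M \<sigma> e < wval M \<sigma> f"
| "bval M \<sigma> (WEq e f) \<longleftrightarrow> wval M \<sigma> e = wval M \<sigma> f"
| "bval M \<sigma> (RLess e f) \<longleftrightarrow> rval M \<sigma> e < rval M \<sigma> f"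
| "bval M \<sigma> (BNot b) \<longleftrightarrow> \<not> bval M \<sigma> b"
| "bval M \<sigma> (BAnd b b') \<longleftrightarrow> bval M \<sigma> b \<and> bval M \<sigma> b'"

text \<open>
  Time is the number of steps. The expressions in a step are part of the fixed program, so a step
  stands for a number of elementary operations that is bounded independently of the input.
  \<open>Random x e\<close> draws \<open>x\<close> uniformly from the numbers below the value of \<open>e\<close>, using fresh
  randomness (if that value is 0, then \<open>x\<close> becomes 0).
\<close>

primrec step :: "nat \<Rightarrow> com \<Rightarrow> machine_state \<Rightarrow> (com \<times> machine_state) pmf" where
  "step M Skip \<sigma> = return_pmf (Skip, \<sigma>)"
| "step M (WAssign x e) \<sigma> =
     return_pmf (Skip, \<sigma>\<lparr>wvar := (wvar \<sigma>)(x := wval M \<sigma> e)\<rparr>)"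
| "step M (WStore a i e) \<sigma> =
     return_pmf (Skip, \<sigma>\<lparr>warr := (warr \<sigma>)(a := (warr \<sigma> a)(wval M \<sigma> i := wval M \<sigma> e))\<rparr>)"
| "step M (RAssign x e) \<sigma> =
     return_pmf (Skip, \<sigma>\<lparr>rvar := (rvar \<sigma>)(x := rval M \<sigma> e)\<rparr>)"
| "step M (RStore a i e) \<sigma> =
     return_pmf (Skip, \<sigma>\<lparr>rarr := (rarr \<sigma>)(a := (rarr \<sigma> a)(wval M \<sigma> i := rval M \<sigma> e))\<rparr>)"
| "step M (Random x e) \<sigma> =
     map_pmf (\<lambda>k. (Skip, \<sigma>\<lparr>wvar := (wvar \<sigma>)(x := k)\<rparr>))
       (pmf_of_set {..<max 1 (wval M \<sigma> e)})"
| "step M (Seq c d) \<sigma> =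
     (if c = Skip then return_pmf (d, \<sigma>)
      else map_pmf (\<lambda>(c', \<sigma>'). (Seq c' d, \<sigma>')) (step M c \<sigma>))"
| "step M (Cond b c d) \<sigma> = return_pmf (if bval M \<sigma> b then c else d, \<sigma>)"
| "step M (Loop b c) \<sigma> =
     return_pmf (if bval M \<sigma> b then Seq c (Loop b c) else Skip, \<sigma>)"

primrec run :: "nat \<Rightarrow> nat \<Rightarrow> com \<Rightarrow> machine_state \<Rightarrow> (com \<times> machine_state) pmf" where
  "run M 0 c \<sigma> = return_pmf (c, \<sigma>)"
| "run M (Suc t) c \<sigma> = bind_pmf (step M c \<sigma>) (\<lambda>(c', \<sigma>'). run M t c' \<sigma>')"


section \<open>Algorithms for the problem\<close>

text \<open>
  The input is given by its adjacency matrix and its weight matrix, stored row by row in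
  arrays; all other memory is 0. The weights enter as exact real numbers.
\<close>

definition sssp_input ::
  "nat \<Rightarrow> nat pair_pre_digraph \<Rightarrow> (nat \<times> nat \<Rightarrow> real) \<Rightarrow> nat \<Rightarrow> machine_state" where
  "sssp_input n G w s =
     \<lparr>wvar = (\<lambda>_. 0)(''n'' := n, ''s'' := s),
      warr = (\<lambda>_ _. 0)(''edge'' := (\<lambda>i. if (i div n, i mod n) \<in> parcs G then 1 else 0)),
      rvar = (\<lambda>_. 0),
      rarr = (\<lambda>_ _. 0)(''weight'' :=
        (\<lambda>i. if (i div n, i mod n) \<in> parcs G then w (i div n, i mod n) else 0))\<rparr>"

definition sssp_output :: "machine_state \<Rightarrow> sssp_answer" where
  "sssp_output \<sigma> =
     (if wvar \<sigma> ''negative_cycle'' \<noteq> 0 then Negative_Cycle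
      else Distances (\<lambda>v. if warr \<sigma> ''reachable'' v \<noteq> 0 then ereal (rarr \<sigma> ''dist'' v) else \<infinity>))"

text \<open>Words have \<open>O(log n)\<close> bits: the constant factor \<open>k\<close> is chosen with the program.\<close>

definition word_bound :: "nat \<Rightarrow> nat \<Rightarrow> nat" where
  "word_bound k n = (n + 1) ^ k"

definition runs_in_time :: "nat \<Rightarrow> com \<Rightarrow> (nat \<Rightarrow> nat) \<Rightarrow> bool" where
  "runs_in_time k P T \<longleftrightarrow>
     (\<forall>n G w s. sssp_instance n G s \<longrightarrow>
        (\<forall>(c, \<sigma>) \<in> set_pmf (run (word_bound k n) (T n) P (sssp_input n G w s)). c = Skip))"

text \<open>
  Final configurations are fixed points of \<^const>\<open>step\<close>, so for programs that run in time \<open>T\<close>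
  the configuration after \<open>T n\<close> steps is the final one.
\<close>

definition solves_sssp_whp :: "nat \<Rightarrow> com \<Rightarrow> (nat \<Rightarrow> nat) \<Rightarrow> real \<Rightarrow> bool" where
  "solves_sssp_whp k P T c \<longleftrightarrow>
     (\<forall>n G w s. sssp_instance n G s \<longrightarrow>
        measure_pmf.prob (run (word_bound k n) (T n) P (sssp_input n G w s))
          {(C, \<sigma>). C = Skip \<and> correct_answer G w s (sssp_output \<sigma>)}
        \<ge> 1 - 1 / real n powr c)"

end

theory Submission
  imports Defs
begin

text \<open>
  A round works on a complete weighted graph on \<open>N = O(n log n)\<close> nodes, the vertices and
  auxiliary nodes, for which the sought distances are feasible potentials. It halves the number
  \<open>k\<close> of tight edges, outside of walks over nonnegative edges, by which every vertex is reached
  from the source. About \<open>\<surd>n\<close> random hubs are made to have nonnegative distances from and to all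
  nodes, with respect to walks of an arbitrary edge, nonnegative edges and an arbitrary edge.
  After the corresponding reweighting, with high probability only \<open>m = O(\<surd>n log\<^sup>2 n)\<close> nodes lie on
  such a walk of negative weight between any two nodes. So for all vertices together it is cheap to
  explore the walks with negative prefixes, and shortcuts along these walks halve \<open>k\<close>. A pair of
  shortcuts \<open>u \<rightarrow> w \<rightarrow> t\<close> of nonnegative total weight has to become a walk over nonnegative edges.
  For that every vertex \<open>w\<close> has auxiliary nodes, one for each position \<open>2\<^sup>i\<close> in the sorted list of its
  shortcuts \<open>w \<rightarrow> t\<close>: they shift weight from one shortcut to the other. The pairs that they do not
  serve are, up to a constant factor, as few as those of negative weight and are added explicitly.
  After \<open>log n\<close> rounds, two runs of Dijkstra's algorithm give the distances, and if the result is
  not a feasible potential for the input, then there is a negative cycle.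
\<close>


section \<open>Potentials and two-hop distances\<close>

type_synonym weights = "nat \<Rightarrow> nat \<Rightarrow> real"
type_synonym potential = "nat \<Rightarrow> real"

definition feasible :: "nat \<Rightarrow> weights \<Rightarrow> potential \<Rightarrow> bool" where
  "feasible N X h \<longleftrightarrow> (\<forall>x<N. \<forall>y<N. h y \<le> h x + X x y)"

definition nonneg_feasible :: "nat \<Rightarrow> weights \<Rightarrow> weights \<Rightarrow> potential \<Rightarrow> bool" where
  "nonneg_feasible N G X c \<longleftrightarrow> (\<forall>x<N. \<forall>y<N. 0 \<le> G x y \<longrightarrow> c y \<le> c x + X x y)"

lemma feasibleD: "feasible N X h \<Longrightarrow> x < N \<Longrightarrow> y < N \<Longrightarrow> h y \<le> h x + X x y"
  by (simp add: feasible_def)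

lemma nonneg_feasibleD:
  "nonneg_feasible N G X c \<Longrightarrow> x < N \<Longrightarrow> y < N \<Longrightarrow> 0 \<le> G x y \<Longrightarrow> c y \<le> c x + X x y"
  by (simp add: nonneg_feasible_def)

lemma feasible_imp_nonneg_feasible: "feasible N X h \<Longrightarrow> nonneg_feasible N G X h"
  by (simp add: feasible_def nonneg_feasible_def)

lemma feasible_diff_const: "feasible N X (\<lambda>y. h y - d) = feasible N X h"
  by (simp add: feasible_def)

definition nonneg_closure :: "nat \<Rightarrow> weights \<Rightarrow> potential \<Rightarrow> potential" where
  "nonneg_closure N M a y = Sup {c y | c. nonneg_feasible N M M c \<and> (\<forall>x<N. c x \<le> a x)}"

lemma nonneg_closure_greatest:
  assumes "nonneg_feasible N M M c" "\<And>x. x < N \<Longrightarrow> c x \<le> a x" "y < N"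
  shows "c y \<le> nonneg_closure N M a y"
  unfolding nonneg_closure_def
  by (rule cSup_upper) (use assms in \<open>auto intro!: bdd_aboveI[where M = "a y"]\<close>)

lemma nonneg_closure_least:
  assumes "\<And>c. nonneg_feasible N M M c \<Longrightarrow> (\<forall>x<N. c x \<le> a x) \<Longrightarrow> c y \<le> b"
  shows "nonneg_closure N M a y \<le> b"
proof -
  have "nonneg_feasible N M M (\<lambda>_. Min (a ` {..<N})) \<and> (\<forall>x<N. Min (a ` {..<N}) \<le> a x)"
    by (auto simp: nonneg_feasible_def)
  then have "{c y | c. nonneg_feasible N M M c \<and> (\<forall>x<N. c x \<le> a x)} \<noteq> {}" by blast
  then show ?thesis
    unfolding nonneg_closure_def by (rule cSup_least) (use assms in auto)
qed

lemma nonneg_closure_le: "y < N \<Longrightarrow> nonneg_closure N M a y \<le> a y"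
  by (rule nonneg_closure_least) auto

lemma nonneg_feasible_closure: "nonneg_feasible N M M (nonneg_closure N M a)"
  unfolding nonneg_feasible_def
proof (intro allI impI)
  fix x y assume xy: "x < N" "y < N" "0 \<le> M x y"
  show "nonneg_closure N M a y \<le> nonneg_closure N M a x + M x y"
  proof (rule nonneg_closure_least)
    fix c assume c: "nonneg_feasible N M M c" "\<forall>z<N. c z \<le> a z"
    have "c y \<le> c x + M x y" using nonneg_feasibleD[OF c(1) xy] .
    also have "c x \<le> nonneg_closure N M a x"
      using c xy(1) by (intro nonneg_closure_greatest) auto
    finally show "c y \<le> nonneg_closure N M a x + M x y" by simp
  qed
qed

text \<open>
  The length of a shortest walk that consists of an arbitrary edge, nonnegative edges and an
  arbitrary edge.
\<close>

definition two_hop :: "nat \<Rightarrow> weights \<Rightarrow> weights" where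
  "two_hop N M x y = Min ((\<lambda>p. nonneg_closure N M (M x) p + M p y) ` {..<N})"

lemma two_hop_le: "p < N \<Longrightarrow> two_hop N M x y \<le> nonneg_closure N M (M x) p + M p y"
  unfolding two_hop_def by (rule Min_le) auto

lemma two_hop_greatest:
  assumes "0 < N" and c: "nonneg_feasible N M M c" "\<And>u. u < N \<Longrightarrow> c u \<le> M x u"
    and d: "\<And>p. p < N \<Longrightarrow> d \<le> c p + M p y"
  shows "d \<le> two_hop N M x y"
proof -
  have "d \<le> nonneg_closure N M (M x) p + M p y" if "p < N" for p
    using nonneg_closure_greatest[of N M c "M x" p, OF c that] d[OF that] by simp
  then show ?thesis using assms(1) unfolding two_hop_def by (subst Min_ge_iff) auto
qed

lemma two_hop_le_edge: "x < N \<Longrightarrow> y < N \<Longrightarrow> M x x = 0 \<Longrightarrow> two_hop N M x y \<le> M x y"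
  using two_hop_le[of x N M x y] nonneg_closure_le[of x N M "M x"] by simp

lemma two_hop_le_closure: "p < N \<Longrightarrow> M p p = 0 \<Longrightarrow> two_hop N M x p \<le> nonneg_closure N M (M x) p"
  using two_hop_le[of p N M x p] by simp


section \<open>Dijkstra's algorithm\<close>

definition active :: "bool \<Rightarrow> real \<Rightarrow> real \<Rightarrow> bool" where
  "active full v x \<longleftrightarrow> full \<or> v < 0 \<and> v + x < 0"

text \<open>
  After the nodes in \<open>S\<close> have been settled, \<open>K\<close> holds the keys, initially \<open>a\<close>, and \<open>R\<close> the results
  of relaxing all edges of weight \<open>X\<close> that leave \<open>S\<close>. The keys themselves are only propagated
  along the edges that are nonnegative for \<open>G\<close>. If \<open>full\<close> is false, then an edge is relaxed only
  if its start and its end are at a negative distance.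
\<close>

locale dijkstra_state =
  fixes N :: nat and G X :: weights and full :: bool and a :: potential and S :: "nat set"
    and K R :: potential
  assumes settled_nodes: "S \<subseteq> {..<N}"
    and key_le: "y < N \<Longrightarrow> K y \<le> a y"
    and relaxed_le: "y < N \<Longrightarrow> R y \<le> a y"
    and settled_le: "p \<in> S \<Longrightarrow> w < N \<Longrightarrow> w \<notin> S \<Longrightarrow> K p \<le> K w"
    and relaxed_edge: "p \<in> S \<Longrightarrow> w < N \<Longrightarrow> active full (K p) (X p w) \<Longrightarrow> R w \<le> K p + X p w"
    and key_edge: "p \<in> S \<Longrightarrow> w < N \<Longrightarrow> active full (K p) (X p w) \<Longrightarrow> 0 \<le> G p w \<Longrightarrow>
      K w \<le> K p + X p w"
    and key_greatest: "nonneg_feasible N G X c \<Longrightarrow> (\<And>y. y < N \<Longrightarrow> c y \<le> a y) \<Longrightarrow> y < N \<Longrightarrow> c y \<le> K y"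
    and relaxed_cases: "y < N \<Longrightarrow> R y = a y \<or> (\<exists>p\<in>S. R y = K p + X p y)"

abbreviation dijkstra_result ::
    "nat \<Rightarrow> weights \<Rightarrow> weights \<Rightarrow> bool \<Rightarrow> potential \<Rightarrow> potential \<Rightarrow> potential \<Rightarrow> bool" where
  "dijkstra_result N G X full a K R \<equiv> dijkstra_state N G X full a {..<N} K R"

lemma (in dijkstra_state) relaxed_ge:
  assumes "feasible N X c" "\<And>y. y < N \<Longrightarrow> c y \<le> a y" "y < N"
  shows "c y \<le> R y"
  using relaxed_cases[OF assms(3)]
proof (elim disjE bexE)
  fix p assume p: "p \<in> S" "R y = K p + X p y"
  then have "p < N" using settled_nodes by auto
  then have "c p \<le> K p"
    using key_greatest[OF feasible_imp_nonneg_feasible] assms by blast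
  then show ?thesis using feasibleD[OF assms(1) \<open>p < N\<close> assms(3)] p(2) by simp
qed (use assms in simp)

lemma dijkstra_state_init: "dijkstra_state N G X full a {} a a"
  by unfold_locales auto

lemma dijkstra_state_cong:
  assumes "\<And>y. y < N \<Longrightarrow> K y = K' y" "\<And>y. y < N \<Longrightarrow> R y = R' y" "dijkstra_state N G X full a S K R"
  shows "dijkstra_state N G X full a S K' R'"
proof -
  interpret dijkstra_state N G X full a S K R by fact
  have S: "p < N" if "p \<in> S" for p using settled_nodes that by auto
  show ?thesis
    using settled_nodes key_le relaxed_le settled_le relaxed_edge key_edge key_greatest relaxed_cases
    by unfold_locales (auto simp: assms(1,2)[symmetric] S)
qed

definition edges_relaxed :: "nat \<Rightarrow> weights \<Rightarrow> weights \<Rightarrow> bool \<Rightarrow> nat \<Rightarrow>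
    potential \<Rightarrow> potential \<Rightarrow> potential \<Rightarrow> potential \<Rightarrow> bool" where
  "edges_relaxed N G X full p K R K' R' \<longleftrightarrow> (\<forall>w<N.
     K' w = (if active full (K p) (X p w) \<and> 0 \<le> G p w then min (K w) (K p + X p w) else K w) \<and>
     R' w = (if active full (K p) (X p w) then min (R w) (K p + X p w) else R w))"

locale dijkstra_step = dijkstra_state +
  fixes p :: nat and K' R' :: potential
  assumes unsettled: "p < N" "p \<notin> S"
    and minimal: "w < N \<Longrightarrow> w \<notin> S \<Longrightarrow> K p \<le> K w"
    and nonneg: "x < N \<Longrightarrow> y < N \<Longrightarrow> 0 \<le> G x y \<Longrightarrow> 0 \<le> X x y"
    and edges_relaxed: "edges_relaxed N G X full p K R K' R'"
begin

lemma new_key: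
  "w < N \<Longrightarrow> K' w = (if active full (K p) (X p w) \<and> 0 \<le> G p w then min (K w) (K p + X p w) else K w)"
  using edges_relaxed by (simp add: edges_relaxed_def)

lemma new_relaxed:
  "w < N \<Longrightarrow> R' w = (if active full (K p) (X p w) then min (R w) (K p + X p w) else R w)"
  using edges_relaxed by (simp add: edges_relaxed_def)

lemma settled_key_unchanged:
  assumes "w \<in> insert p S"
  shows "K' w = K w"
proof -
  have w: "w < N" "K w \<le> K p" using assms settled_nodes unsettled settled_le[of w p] by auto
  then show ?thesis using new_key[OF w(1)] nonneg[OF unsettled(1) w(1)] by auto
qed

lemma new_le: "w < N \<Longrightarrow> K' w \<le> K w" "w < N \<Longrightarrow> R' w \<le> R w"
  by (auto simp: new_key new_relaxed)

lemma dijkstra_state_insert: "dijkstra_state N G X full a (insert p S) K' R'"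
proof
  show "insert p S \<subseteq> {..<N}" using settled_nodes unsettled by simp
next
  fix y assume y: "y < N"
  show "K' y \<le> a y" "R' y \<le> a y" using new_le[OF y] key_le[OF y] relaxed_le[OF y] by auto
  show "R' y = a y \<or> (\<exists>u\<in>insert p S. R' y = K' u + X u y)"
  proof (cases "R' y = R y")
    case True
    then show ?thesis using relaxed_cases[OF y] settled_key_unchanged by auto
  next
    case False
    then have "R' y = K p + X p y" using new_relaxed[OF y] by (auto split: if_splits simp: min_def)
    then show ?thesis using settled_key_unchanged by auto
  qed
next
  fix u w assume u: "u \<in> insert p S" and w: "w < N" "w \<notin> insert p S"
  have "K u \<le> K p" "K u \<le> K w" using u w unsettled settled_le minimal by auto
  then show "K' u \<le> K' w"
    using settled_key_unchanged[OF u] new_key[OF w(1)] nonneg[OF unsettled(1) w(1)] by auto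
next
  fix u w assume u: "u \<in> insert p S" and w: "w < N" and act: "active full (K' u) (X u w)"
  note u' = settled_key_unchanged[OF u] and act' = act[unfolded settled_key_unchanged[OF u]]
  show "R' w \<le> K' u + X u w"
    using new_relaxed[OF w] new_le[OF w] relaxed_edge[OF _ w act'] act' u by (auto simp: u')
  show "K' w \<le> K' u + X u w" if "0 \<le> G u w"
    using new_key[OF w] new_le[OF w] key_edge[OF _ w act' that] act' u that by (auto simp: u')
next
  fix c y assume c: "nonneg_feasible N G X c" "\<And>y. y < N \<Longrightarrow> c y \<le> a y" and y: "y < N"
  have K: "c z \<le> K z" if "z < N" for z using key_greatest[OF c that] .
  have "0 \<le> G p y \<Longrightarrow> c y \<le> c p + X p y" using nonneg_feasibleD[OF c(1) unsettled(1) y] .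
  then show "c y \<le> K' y" using new_key[OF y] K[OF y] K[OF unsettled(1)] by (auto simp: min_def)
qed

end


section \<open>Hubs\<close>

text \<open>
  The matrix \<open>H\<close> is \<open>M\<close> reweighted by \<open>\<phi>\<close> and with improved entries, for which \<open>h + \<phi>\<close> is still
  feasible. The hubs \<open>D\<close> have nonnegative distances from and to all nodes.
\<close>

locale hub_reweighted =
  fixes N :: nat and M :: weights and h \<phi> :: potential and H :: weights and D :: "nat set"
  assumes le_reweighted: "x < N \<Longrightarrow> y < N \<Longrightarrow> H x y \<le> M x y - \<phi> x + \<phi> y"
    and feasible: "feasible N H (\<lambda>x. h x + \<phi> x)"
    and nonneg_edge: "x < N \<Longrightarrow> y < N \<Longrightarrow> 0 \<le> M x y \<Longrightarrow> 0 \<le> H x y"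
    and diagonal: "x < N \<Longrightarrow> H x x = 0"
    and hub_less: "r \<in> D \<Longrightarrow> r < N"
    and hub_nonneg: "r \<in> D \<Longrightarrow> x < N \<Longrightarrow> 0 \<le> H x r" "r \<in> D \<Longrightarrow> x < N \<Longrightarrow> 0 \<le> H r x"
    and to_hub_le: "r \<in> D \<Longrightarrow> x < N \<Longrightarrow> H x r + \<phi> x - \<phi> r \<le> two_hop N M x r"
    and from_hub_le: "r \<in> D \<Longrightarrow> x < N \<Longrightarrow> H r x + \<phi> r - \<phi> x \<le> two_hop N M r x"

lemma hub_reweighted_empty:
  assumes "\<And>x y. x < N \<Longrightarrow> y < N \<Longrightarrow> H x y = M x y" "feasible N M h" "\<And>x. x < N \<Longrightarrow> M x x = 0"
  shows "hub_reweighted N M h (\<lambda>_. 0) H {}"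
  using assms by unfold_locales (auto simp: feasible_def)

text \<open>
  Two runs of Dijkstra's algorithm on the reversed graph yield distances \<open>V\<close> to the new hub \<open>r\<close>,
  which serve as the next potential, and one run yields distances \<open>R\<^sub>3\<close> from it.
\<close>

locale hub_insertion = hub_reweighted +
  fixes r :: nat and K\<^sub>1 R\<^sub>1 V R\<^sub>2 K\<^sub>3 R\<^sub>3 :: potential
  assumes new_hub: "r < N"
    and to_hub: "dijkstra_result N (\<lambda>p w. H w p) (\<lambda>p w. H w p) True (\<lambda>x. H x r) K\<^sub>1 R\<^sub>1"
    and to_hub_again: "dijkstra_result N (\<lambda>p w. H w p) (\<lambda>p w. H w p) True R\<^sub>1 V R\<^sub>2"
    and from_hub: "dijkstra_result N H H True (H r) K\<^sub>3 R\<^sub>3"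
begin

abbreviation "g \<equiv> \<lambda>x. h x + \<phi> x"

definition H' :: weights where
  "H' x y = (if x = r then R\<^sub>3 y else if y = r then V x else H x y) - V x + V y"

lemma feasible_reverse: "feasible N (\<lambda>p w. H w p) (\<lambda>x. d - g x)"
  using feasible by (simp add: feasible_def algebra_simps)

lemma to_hub_ge:
  assumes "x < N"
  shows "g r - g x \<le> V x"
proof -
  have "g r - g y \<le> H y r" if "y < N" for y using feasibleD[OF feasible that new_hub] by simp
  then have "g r - g y \<le> R\<^sub>1 y" if "y < N" for y
    using dijkstra_state.relaxed_ge[OF to_hub feasible_reverse _ that] by simp
  then show ?thesis
    using dijkstra_state.key_greatest[OF to_hub_again feasible_imp_nonneg_feasible[OF feasible_reverse] _ assms]
    by simp
qed

lemma from_hub_ge: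
  assumes "x < N"
  shows "g x - g r \<le> R\<^sub>3 x"
proof (rule dijkstra_state.relaxed_ge[OF from_hub _ _ assms, where c = "\<lambda>x. g x - g r"])
  show "feasible N H (\<lambda>x. g x - g r)" unfolding feasible_diff_const by (rule feasible)
  show "g y - g r \<le> H r y" if "y < N" for y using feasibleD[OF feasible new_hub that] by simp
qed

lemma to_hub_le_edge: "x < N \<Longrightarrow> V x \<le> H x r"
  using dijkstra_state.key_le[OF to_hub_again, of x] dijkstra_state.relaxed_le[OF to_hub, of x]
  by simp

lemma from_hub_le_edge: "x < N \<Longrightarrow> R\<^sub>3 x \<le> H r x"
  by (rule dijkstra_state.relaxed_le[OF from_hub])

lemma hub_self: "V r = 0" "R\<^sub>3 r = 0"
  using to_hub_le_edge[OF new_hub] to_hub_ge[OF new_hub] from_hub_le_edge[OF new_hub]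
    from_hub_ge[OF new_hub] diagonal[OF new_hub] by auto

lemma to_hub_le_two_hop:
  assumes x: "x < N"
  shows "V x + \<phi> x - \<phi> r \<le> two_hop N M x r"
proof (rule two_hop_greatest)
  let ?c = "\<lambda>u. V x - K\<^sub>1 u + \<phi> x - \<phi> u"
  show "0 < N" using x by simp
  show "nonneg_feasible N M M ?c"
    unfolding nonneg_feasible_def
  proof (intro allI impI)
    fix u v assume uv: "u < N" "v < N" "0 \<le> M u v"
    have "K\<^sub>1 u \<le> K\<^sub>1 v + H u v"
      using dijkstra_state.key_edge[OF to_hub, of v u] nonneg_edge uv by (simp add: active_def)
    then show "?c v \<le> ?c u + M u v" using le_reweighted[OF uv(1,2)] by simp
  qed
  show "?c u \<le> M x u" if u: "u < N" for u
  proof -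
    have "V x \<le> R\<^sub>1 x" by (rule dijkstra_state.key_le[OF to_hub_again x])
    also have "\<dots> \<le> K\<^sub>1 u + H x u"
      using dijkstra_state.relaxed_edge[OF to_hub, of u x] u x by (simp add: active_def)
    finally show ?thesis using le_reweighted[OF x u] by simp
  qed
  show "V x + \<phi> x - \<phi> r \<le> ?c p + M p r" if p: "p < N" for p
    using dijkstra_state.key_le[OF to_hub p] le_reweighted[OF p new_hub] by simp
qed

lemma from_hub_le_two_hop:
  assumes y: "y < N"
  shows "R\<^sub>3 y + \<phi> r - \<phi> y \<le> two_hop N M r y"
proof (rule two_hop_greatest)
  let ?c = "\<lambda>u. K\<^sub>3 u + \<phi> r - \<phi> u"
  show "0 < N" using y by simp
  show "nonneg_feasible N M M ?c"
    unfolding nonneg_feasible_def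
  proof (intro allI impI)
    fix u v assume uv: "u < N" "v < N" "0 \<le> M u v"
    have "K\<^sub>3 v \<le> K\<^sub>3 u + H u v"
      using dijkstra_state.key_edge[OF from_hub, of u v] nonneg_edge uv by (simp add: active_def)
    then show "?c v \<le> ?c u + M u v" using le_reweighted[OF uv(1,2)] by simp
  qed
  show "?c u \<le> M r u" if u: "u < N" for u
    using dijkstra_state.key_le[OF from_hub u] le_reweighted[OF new_hub u] by simp
  show "R\<^sub>3 y + \<phi> r - \<phi> y \<le> ?c p + M p y" if p: "p < N" for p
    using dijkstra_state.relaxed_edge[OF from_hub, of p y] le_reweighted[OF p y] p y
    by (simp add: active_def)
qed

lemma reweighted_nonneg:
  assumes "x < N" "y < N" "0 \<le> H x y \<or> x = r \<or> y = r"
  shows "0 \<le> H' x y"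
proof (cases "x = r \<or> y = r")
  case True
  then show ?thesis
    using from_hub_ge[OF assms(2)] to_hub_ge[OF assms(2)] hub_self by (auto simp: H'_def)
next
  case False
  then have "V x \<le> V y + H x y"
    using dijkstra_state.key_edge[OF to_hub_again, of y x] assms by (simp add: active_def)
  then show ?thesis using False by (simp add: H'_def)
qed

lemma hub_reweighted_insert:
  assumes \<phi>': "\<And>x. x < N \<Longrightarrow> \<phi>' x = \<phi> x + V x" and H'': "\<And>x y. x < N \<Longrightarrow> y < N \<Longrightarrow> H'' x y = H' x y"
  shows "hub_reweighted N M h \<phi>' H'' (insert r D)"
proof
  fix x y assume xy: "x < N" "y < N"
  show "H'' x y \<le> M x y - \<phi>' x + \<phi>' y"
    using le_reweighted[OF xy] to_hub_le_edge[OF xy(1)] from_hub_le_edge[OF xy(2)] xy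
    by (auto simp: \<phi>' H'' H'_def)
  show "0 \<le> H'' x y" if "0 \<le> M x y" using reweighted_nonneg nonneg_edge xy that by (simp add: H'')
next
  show "feasible N H'' (\<lambda>x. h x + \<phi>' x)"
    unfolding feasible_def
  proof (intro allI impI)
    fix x y assume xy: "x < N" "y < N"
    show "h y + \<phi>' y \<le> h x + \<phi>' x + H'' x y"
      using feasibleD[OF feasible xy] to_hub_ge[OF xy(1)] from_hub_ge[OF xy(2)] xy
      by (auto simp: \<phi>' H'' H'_def)
  qed
next
  fix x assume "x < N"
  then show "H'' x x = 0" using diagonal hub_self by (simp add: H'' H'_def)
next
  fix r' assume "r' \<in> insert r D"
  then show r': "r' < N" using hub_less new_hub by auto
  fix x assume x: "x < N"
  show "0 \<le> H'' x r'" "0 \<le> H'' r' x"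
    using reweighted_nonneg[OF x r'] reweighted_nonneg[OF r' x] hub_nonneg x r' \<open>r' \<in> insert r D\<close>
    by (auto simp: H'')
  show "H'' x r' + \<phi>' x - \<phi>' r' \<le> two_hop N M x r'"
    using to_hub_le[of r' x] to_hub_le_two_hop[OF x] from_hub_le_two_hop[OF r'] hub_self
      from_hub_le_two_hop[OF new_hub] x r' \<open>r' \<in> insert r D\<close> by (auto simp: \<phi>' H'' H'_def)
  show "H'' r' x + \<phi>' r' - \<phi>' x \<le> two_hop N M r' x"
    using from_hub_le[of r' x] to_hub_le_two_hop[OF r'] from_hub_le_two_hop[OF x] hub_self
      x r' \<open>r' \<in> insert r D\<close> by (auto simp: \<phi>' H'' H'_def)
qed

end

definition good_hubs :: "nat \<Rightarrow> nat \<Rightarrow> weights \<Rightarrow> nat \<Rightarrow> nat \<Rightarrow> nat set" where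
  "good_hubs N m M x y = {r. r < N \<and>
     card {z. z < N \<and> two_hop N M x z + two_hop N M z y < two_hop N M x r + two_hop N M r y} \<le> m}"

definition few_between :: "nat \<Rightarrow> nat \<Rightarrow> weights \<Rightarrow> potential \<Rightarrow> bool" where
  "few_between N m M \<phi> \<longleftrightarrow>
     (\<forall>x<N. \<forall>y<N. card {z. z < N \<and> two_hop N M x z + two_hop N M z y < \<phi> x - \<phi> y} \<le> m)"

lemma (in hub_reweighted) few_between_if_good_hubs:
  assumes good: "\<And>x y. x < N \<Longrightarrow> y < N \<Longrightarrow> D \<inter> good_hubs N m M x y \<noteq> {}"
  shows "few_between N m M \<phi>"
  unfolding few_between_def
proof (intro allI impI)
  fix x y assume xy: "x < N" "y < N"
  obtain r where r: "r \<in> D" "r \<in> good_hubs N m M x y" using good[OF xy] by auto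
  have "\<phi> x - \<phi> r \<le> two_hop N M x r" "\<phi> r - \<phi> y \<le> two_hop N M r y"
    using hub_nonneg[OF r(1)] to_hub_le[OF r(1)] from_hub_le[OF r(1)] xy by (smt (verit))+
  then have "card {z. z < N \<and> two_hop N M x z + two_hop N M z y < \<phi> x - \<phi> y} \<le>
      card {z. z < N \<and> two_hop N M x z + two_hop N M z y < two_hop N M x r + two_hop N M r y}"
    by (intro card_mono) auto
  also have "\<dots> \<le> m" using r(2) by (simp add: good_hubs_def)
  finally show "card {z. z < N \<and> two_hop N M x z + two_hop N M z y < \<phi> x - \<phi> y} \<le> m" .
qed

lemma card_low_rank:
  fixes f :: "nat \<Rightarrow> 'a::linorder"
  shows "min N (Suc m) \<le> card {r. r < N \<and> card {z. z < N \<and> f z < f r} \<le> m}" (is "_ \<le> card ?L")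
proof (rule ccontr)
  assume "\<not> ?thesis"
  then have small: "card ?L \<le> m" "card ?L < N" by auto
  have "{..<N} - ?L \<noteq> {}"
    using small(2) card_mono[of ?L "{..<N}"] by auto
  then obtain r where r: "r \<in> {..<N} - ?L" "\<And>u. u \<in> {..<N} - ?L \<Longrightarrow> f r \<le> f u"
    using arg_min_if_finite[of "{..<N} - ?L" f]
    by (metis (no_types, lifting) finite_Diff finite_lessThan linorder_not_le)
  have "{z. z < N \<and> f z < f r} \<subseteq> ?L" using r(2) by force
  then have "card {z. z < N \<and> f z < f r} \<le> card ?L" by (intro card_mono) auto
  then show False using r(1) small by auto
qed

lemma card_good_hubs: "min N (Suc m) \<le> card (good_hubs N m M x y)"
  unfolding good_hubs_def by (rule card_low_rank)


section \<open>Sampling the hubs\<close>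

definition missed_pairs :: "nat \<Rightarrow> nat \<Rightarrow> weights \<Rightarrow> (nat \<Rightarrow> nat) \<Rightarrow> nat \<Rightarrow> (nat \<times> nat) set" where
  "missed_pairs N m M a k = {(x, y). x < N \<and> y < N \<and> (\<forall>j<k. a j \<notin> good_hubs N m M x y)}"

lemma finite_missed_pairs: "finite (missed_pairs N m M a k)"
  and card_missed_pairs_le: "card (missed_pairs N m M a k) \<le> N * N"
proof -
  have sub: "missed_pairs N m M a k \<subseteq> {..<N} \<times> {..<N}" by (auto simp: missed_pairs_def)
  show "finite (missed_pairs N m M a k)" by (rule finite_subset[OF sub]) simp
  show "card (missed_pairs N m M a k) \<le> N * N" using card_mono[OF _ sub] by simp
qed

lemma sum_card_swap:
  assumes "finite A" "finite B"
  shows "(\<Sum>x\<in>A. card {y \<in> B. P x y}) = (\<Sum>y\<in>B. card {x \<in> A. P x y})"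
  by (simp only: card_eq_sum sum.swap_restrict[OF assms])

lemma sum_missed_pairs_le:
  "(\<Sum>v<N. card (missed_pairs N m M (a(k := v)) (Suc k))) \<le>
    card (missed_pairs N m M a k) * (N - min N (Suc m))"
proof -
  let ?U = "missed_pairs N m M a k" and ?h = "\<lambda>z. good_hubs N m M (fst z) (snd z)"
  have U: "missed_pairs N m M (a(k := v)) (Suc k) = {z \<in> ?U. v \<notin> ?h z}" for v
    by (auto simp: missed_pairs_def less_Suc_eq)
  have "(\<Sum>v<N. card (missed_pairs N m M (a(k := v)) (Suc k))) = (\<Sum>z\<in>?U. card {v \<in> {..<N}. v \<notin> ?h z})"
    unfolding U by (rule sum_card_swap[OF _ finite_missed_pairs]) simp
  also have "\<dots> \<le> (\<Sum>z\<in>?U. N - min N (Suc m))"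
  proof (rule sum_mono)
    fix z
    have sub: "?h z \<subseteq> {..<N}" by (auto simp: good_hubs_def)
    have "{v \<in> {..<N}. v \<notin> ?h z} = {..<N} - ?h z" by auto
    also have "card \<dots> = N - card (?h z)" using card_Diff_subset[OF finite_subset[OF sub] sub] by simp
    also have "\<dots> \<le> N - min N (Suc m)" using card_good_hubs[of N m M "fst z" "snd z"] by simp
    finally show "card {v \<in> {..<N}. v \<notin> ?h z} \<le> N - min N (Suc m)" .
  qed
  finally show ?thesis by simp
qed


section \<open>Halving the number of counted edges\<close>

text \<open>Walks from \<open>s\<close> with \<open>k\<close> counted edges \<open>E\<close> and any number of free edges \<open>F\<close>.\<close>

inductive counted_reach ::
    "nat \<Rightarrow> (nat \<Rightarrow> nat \<Rightarrow> bool) \<Rightarrow> (nat \<Rightarrow> nat \<Rightarrow> bool) \<Rightarrow> nat \<Rightarrow> nat \<Rightarrow> bool" for s E F where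
  start: "counted_reach s E F 0 s"
| counted: "counted_reach s E F k p \<Longrightarrow> E p q \<Longrightarrow> counted_reach s E F (Suc k) q"
| free: "counted_reach s E F k p \<Longrightarrow> F p q \<Longrightarrow> counted_reach s E F k q"

definition tight_edge :: "nat \<Rightarrow> weights \<Rightarrow> potential \<Rightarrow> nat \<Rightarrow> nat \<Rightarrow> bool" where
  "tight_edge n A h p q \<longleftrightarrow> p < n \<and> q < n \<and> A p q \<le> h q - h p"

text \<open>
  A token covers a pair by a tight walk of two steps and of nonnegative weight. In the matrix of a
  round there is in addition such a walk over nonnegative edges, which Dijkstra's algorithm follows
  for free.
\<close>

definition token :: "nat \<Rightarrow> weights \<Rightarrow> potential \<Rightarrow> nat \<Rightarrow> nat \<Rightarrow> bool" where
  "token n A h p q \<longleftrightarrow> p < n \<and> q < n \<and> h p \<le> h q \<and> (\<exists>w<n. A p w + A w q \<le> h q - h p)"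

definition free_token :: "nat \<Rightarrow> nat \<Rightarrow> weights \<Rightarrow> weights \<Rightarrow> potential \<Rightarrow> nat \<Rightarrow> nat \<Rightarrow> bool" where
  "free_token n N M W h p q \<longleftrightarrow> p < n \<and> q < n \<and> (\<exists>w<n. W p w + W w q \<le> h q - h p) \<and>
     (\<exists>g<N. 0 \<le> M p g \<and> 0 \<le> M g q \<and> W p g + W g q \<le> h q - h p)"

lemma counted_reach_mono:
  assumes "counted_reach s E F k y" "\<And>p q. E p q \<Longrightarrow> E' p q" "\<And>p q. F p q \<Longrightarrow> F' p q"
  shows "counted_reach s E' F' k y"
  using assms(1) by induction (auto intro: counted_reach.intros assms)

lemma counted_reach_less:
  assumes "counted_reach s E F k y" "s < n" "\<And>p q. E p q \<Longrightarrow> q < n" "\<And>p q. F p q \<Longrightarrow> q < n"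
  shows "y < n"
  using assms(1) by induction (auto intro: assms)

text \<open>
  \<open>A\<close> holds the distances that a run of Dijkstra's algorithm from every vertex finds when it
  explores only the walks with negative prefixes.
\<close>

locale exploration =
  fixes n N s :: nat and h :: potential and M W A :: weights and K R :: "nat \<Rightarrow> potential"
  assumes n_le_N: "n \<le> N" and s_less: "s < n"
    and feasible: "feasible N W h"
    and diagonal: "x < N \<Longrightarrow> W x x = 0"
    and nonneg: "x < N \<Longrightarrow> y < N \<Longrightarrow> 0 \<le> M x y \<Longrightarrow> 0 \<le> W x y"
    and explored: "b < n \<Longrightarrow> dijkstra_result N M W False (W b) (K b) (R b)"
    and shortcut: "b < n \<Longrightarrow> w < n \<Longrightarrow> A b w = R b w"
begin

abbreviation halved :: "nat \<Rightarrow> nat \<Rightarrow> bool" where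
  "halved \<equiv> counted_reach s (tight_edge n A h) (token n A h)"

text \<open>A tight walk from \<open>b\<close> to \<open>y\<close> that the exploration from \<open>b\<close> can still extend.\<close>

definition pending :: "nat \<Rightarrow> nat \<Rightarrow> bool" where
  "pending b y \<longleftrightarrow> b < n \<and> y < n \<and> K b y \<le> h y - h b \<and> h y < h b"

definition halved_or_pending :: "nat \<Rightarrow> nat \<Rightarrow> bool" where
  "halved_or_pending j y \<longleftrightarrow> halved j y \<or> (\<exists>b. halved j b \<and> pending b y)"

lemma shortcut_le: "b < n \<Longrightarrow> w < n \<Longrightarrow> A b w \<le> W b w"
  using dijkstra_state.relaxed_le[OF explored, of b w] shortcut[of b w] n_le_N by simp

lemma token_if_edge: "p < n \<Longrightarrow> q < n \<Longrightarrow> W p q \<le> h q - h p \<Longrightarrow> h p \<le> h q \<Longrightarrow> token n A h p q"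
  unfolding token_def using shortcut_le[of p p] shortcut_le[of p q] diagonal[of p] n_le_N
  by (auto intro!: exI[of _ p])

lemma pending_if_edge: "p < n \<Longrightarrow> q < n \<Longrightarrow> W p q \<le> h q - h p \<Longrightarrow> h q < h p \<Longrightarrow> pending p q"
  unfolding pending_def using dijkstra_state.key_le[OF explored, of p q] n_le_N by auto

lemma tight_edge_if_pending_edge:
  assumes "pending b p" "w < n" "W p w \<le> h w - h p" "h w < h b"
  shows "tight_edge n A h b w"
proof -
  have b: "b < n" "p < n" "K b p \<le> h p - h b" "h p < h b" using assms(1) by (auto simp: pending_def)
  have "R b w \<le> K b p + W p w"
    using dijkstra_state.relaxed_edge[OF explored[OF b(1)], of p w] assms b n_le_N
    by (simp add: active_def)
  then show ?thesis using shortcut[OF b(1) assms(2)] b assms by (simp add: tight_edge_def)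
qed

lemma tight_edge_if_pending: "pending b y \<Longrightarrow> tight_edge n A h b y"
  using tight_edge_if_pending_edge[of b y y] diagonal[of y] n_le_N by (simp add: pending_def)

lemma token_if_pending_edge:
  assumes "pending b p" "q < n" "W p q \<le> h q - h p" "h b \<le> h q"
  shows "token n A h b q"
  unfolding token_def
  using tight_edge_if_pending[OF assms(1)] shortcut_le[of p q] assms
  by (auto simp: tight_edge_def intro!: exI[of _ p])

lemma halved_Suc: "halved j y \<Longrightarrow> halved (Suc j) y"
proof -
  assume y: "halved j y"
  then have "y < n" by (rule counted_reach_less[OF _ s_less]) (auto simp: tight_edge_def token_def)
  then have "tight_edge n A h y y" using shortcut_le[of y y] diagonal[of y] n_le_N by (simp add: tight_edge_def)
  then show "halved (Suc j) y" by (rule counted_reach.counted[OF y])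
qed

lemma halved_Suc_if_halved_or_pending: "halved_or_pending j y \<Longrightarrow> halved (Suc j) y"
  using halved_Suc tight_edge_if_pending
  by (auto simp: halved_or_pending_def intro: counted_reach.counted)

lemma halved_edge:
  assumes "halved j p" "p < n" "q < n" "W p q \<le> h q - h p"
  shows "halved_or_pending j q"
  using counted_reach.free[OF assms(1) token_if_edge] pending_if_edge assms
  unfolding halved_or_pending_def by (metis linorder_not_le)

lemma pending_edge_halved:
  assumes "halved j b" "pending b p" "q < n" "W p q \<le> h q - h p"
  shows "halved (Suc j) q"
proof (cases "h q < h b")
  case True
  then show ?thesis using tight_edge_if_pending_edge assms by (blast intro: counted_reach.counted)
next
  case False
  then have "halved j q" using token_if_pending_edge assms by (intro counted_reach.free[OF assms(1)]) simp
  then show ?thesis by (rule halved_Suc)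
qed

lemma pending_nonneg_edge:
  assumes "pending b p" "w < N" "0 \<le> M p w" "W p w \<le> h w - h p" "h w < h b"
  shows "K b w \<le> h w - h b"
  using dijkstra_state.key_edge[OF explored, of b p w] assms n_le_N
  by (auto simp: pending_def active_def)

lemma pending_free_token:
  assumes b: "halved j b" "pending b p" and token: "free_token n N M W h p q"
  shows "halved_or_pending j q"
proof -
  obtain w g where pq: "p < n" "q < n" and w: "w < n" "W p w + W w q \<le> h q - h p"
    and g: "g < N" "0 \<le> M p g" "0 \<le> M g q" "W p g + W g q \<le> h q - h p"
    using token by (auto simp: free_token_def)
  have N: "p < N" "q < N" "w < N" using pq w n_le_N by auto
  have tight_w: "W p w \<le> h w - h p" "W w q \<le> h q - h w"
    using w feasibleD[OF feasible N(1,3)] feasibleD[OF feasible N(3,2)] by auto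
  have tight_g: "W p g \<le> h g - h p" "W g q \<le> h q - h g"
    using g feasibleD[OF feasible N(1) g(1)] feasibleD[OF feasible g(1) N(2)] by auto
  consider "h q < h b" | "h b \<le> h q" "h w < h b" | "h b \<le> h w" by linarith
  then show ?thesis
  proof cases
    case 1
    have "h g < h b" using 1 tight_g(2) nonneg[OF g(1) N(2) g(3)] by simp
    then have "K b g \<le> h g - h b" using pending_nonneg_edge b(2) g tight_g(1) by blast
    then have "K b q \<le> h q - h b"
      using dijkstra_state.key_edge[OF explored, of b g q] b(2) 1 g N tight_g(2) \<open>h g < h b\<close>
      by (auto simp: pending_def active_def)
    then have "pending b q" using b(2) pq 1 by (simp add: pending_def)
    then show ?thesis using b(1) by (auto simp: halved_or_pending_def)
  next
    case 2
    have "token n A h b q"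
      unfolding token_def
      using tight_edge_if_pending_edge[OF b(2) w(1) tight_w(1) 2(2)] shortcut_le[OF w(1) pq(2)] tight_w(2) 2(1) w(1) pq(2)
      by (auto simp: tight_edge_def intro!: exI[of _ w])
    then show ?thesis using counted_reach.free[OF b(1)] by (simp add: halved_or_pending_def)
  next
    case 3
    have "halved j w" using counted_reach.free[OF b(1) token_if_pending_edge[OF b(2) w(1) tight_w(1) 3]] .
    then show ?thesis using halved_edge w(1) pq(2) tight_w(2) by blast
  qed
qed

lemma halved_free_token:
  assumes "halved j p" and token: "free_token n N M W h p q"
  shows "halved j q"
proof -
  obtain w g where pq: "p < n" "q < n" "w < n" and w: "W p w + W w q \<le> h q - h p"
    and g: "g < N" "0 \<le> M p g" "0 \<le> M g q" "W p g + W g q \<le> h q - h p"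
    using token by (auto simp: free_token_def)
  have "0 \<le> W p g" "0 \<le> W g q" using nonneg g pq n_le_N by auto
  then have "token n A h p q"
    unfolding token_def using pq g w shortcut_le[of p w] shortcut_le[of w q] by (auto intro!: exI[of _ w])
  then show ?thesis by (rule counted_reach.free[OF assms(1)])
qed

theorem halving:
  assumes "counted_reach s (tight_edge n W h) (free_token n N M W h) k y"
  shows "halved ((k + 1) div 2) y"
proof -
  have "if even k then halved (k div 2) y else halved_or_pending (k div 2) y"
    using assms
  proof induction
    case start
    then show ?case by (simp add: counted_reach.start)
  next
    case (counted k p q)
    have pq: "p < n" "q < n" "W p q \<le> h q - h p" using counted.hyps(2) by (auto simp: tight_edge_def)
    show ?case
    proof (cases "even k")
      case True
      then show ?thesis using counted.IH halved_edge pq by simp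
    next
      case False
      then have "halved_or_pending (k div 2) p" using counted.IH by simp
      then have "halved (Suc (k div 2)) q"
        using halved_Suc_if_halved_or_pending[OF halved_edge] pending_edge_halved pq
        by (auto simp: halved_or_pending_def)
      then show ?thesis using False by simp
    qed
  next
    case (free k p q)
    have "halved_or_pending j q" if "halved_or_pending j p" for j
      using that halved_free_token[OF _ free.hyps(2)] pending_free_token[OF _ _ free.hyps(2)]
      unfolding halved_or_pending_def[of j p] by (auto simp: halved_or_pending_def)
    then show ?case using free.IH halved_free_token[OF _ free.hyps(2), of "k div 2"] by simp
  qed
  then show ?thesis using halved_Suc_if_halved_or_pending by (cases "even k") auto
qed

end

lemma dijkstra_key_free_token:
  assumes n_le_N: "n \<le> N" and dijkstra: "dijkstra_result N M M True a K R" and token: "free_token n N M M h p q"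
  shows "K q \<le> K p + (h q - h p)"
proof -
  interpret dijkstra_state N M M True a "{..<N}" K R by (rule dijkstra)
  obtain g where g: "p < n" "q < n" "g < N" "0 \<le> M p g" "0 \<le> M g q" "M p g + M g q \<le> h q - h p"
    using token by (auto simp: free_token_def)
  then have "K g \<le> K p + M p g" "K q \<le> K g + M g q"
    using key_edge[of p g] key_edge[of g q] n_le_N by (auto simp: active_def)
  then show ?thesis using g by simp
qed

text \<open>Without counted edges one run of Dijkstra's algorithm suffices, and every further edge takes one more.\<close>

lemma distances_if_one_counted_edge:
  assumes n_le_N: "n \<le> N" and s_less: "s < n" and feas: "feasible N M h"
    and diag: "\<And>x. x < N \<Longrightarrow> M x x = 0"
    and first: "dijkstra_result N M M True (M s) K R" and second: "dijkstra_result N M M True R K' R'"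
    and reach: "counted_reach s (tight_edge n M h) (free_token n N M M h) k y" and k: "k \<le> 1" and y: "y < n"
  shows "K' y = h y - h s"
proof (rule antisym)
  interpret first: dijkstra_state N M M True "M s" "{..<N}" K R by fact
  interpret second: dijkstra_state N M M True R "{..<N}" K' R' by fact
  have sN: "s < N" and yN: "y < N" using s_less y n_le_N by auto
  have feas_s: "feasible N M (\<lambda>x. h x - h s)" unfolding feasible_diff_const by (rule feas)
  have "h x - h s \<le> M s x" if "x < N" for x using feasibleD[OF feas sN that] by simp
  then have "h x - h s \<le> R x" if "x < N" for x using first.relaxed_ge[OF feas_s _ that] by simp
  then show "h y - h s \<le> K' y"
    using second.key_greatest[OF feasible_imp_nonneg_feasible[OF feas_s] _ yN] by simp
  note step = dijkstra_key_free_token[OF n_le_N]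
  have "(k = 0 \<longrightarrow> K y \<le> h y - h s) \<and> (k \<le> 1 \<longrightarrow> K' y \<le> h y - h s)"
    using reach
  proof induction
    case start
    have "K s \<le> 0" using first.key_le[OF sN] diag[OF sN] by simp
    moreover have "K' s \<le> K s"
      using second.key_le[OF sN] first.relaxed_edge[of s s] diag[OF sN] sN by (simp add: active_def)
    ultimately show ?case by simp
  next
    case (counted k p q)
    then have "p < N" "q < N" "M p q \<le> h q - h p" using n_le_N by (auto simp: tight_edge_def)
    then show ?case
      using second.key_le[of q] first.relaxed_edge[of p q] counted.IH by (auto simp: active_def)
  next
    case (free k p q)
    then show ?case using step[OF first free.hyps(2)] step[OF second free.hyps(2)] by auto
  qed
  then show "K' y \<le> h y - h s" using k by simp
qed


section \<open>Auxiliary nodes\<close>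

definition pivot_rank :: "nat \<Rightarrow> nat \<Rightarrow> nat" where
  "pivot_rank n k = min (2 ^ k - 1) (n - 1)"

lemma pivot_rank_0 [simp]: "pivot_rank n 0 = 0"
  by (simp add: pivot_rank_def)

lemma pivot_rank_less: "1 \<le> n \<Longrightarrow> pivot_rank n k < n"
  by (simp add: pivot_rank_def)

lemma pivot_rank_Suc:
  "pivot_rank n (Suc k) = (if 2 * pivot_rank n k + 1 < n then 2 * pivot_rank n k + 1 else n - 1)"
proof -
  obtain j :: nat where "2 ^ k = Suc j" using not0_implies_Suc[of "2 ^ k"] by auto
  then show ?thesis by (auto simp: pivot_rank_def min_def)
qed

definition padded_weights :: "nat \<Rightarrow> weights \<Rightarrow> real \<Rightarrow> weights" where
  "padded_weights n A g u w = (if u = w then 0 else if u < n \<and> w < n then A u w else 3 * g)"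

lemma padding_le:
  assumes feas: "feasible n A h" and g: "\<And>u w. u < n \<Longrightarrow> w < n \<Longrightarrow> \<bar>A u w\<bar> \<le> g"
    and near: "\<And>x. \<exists>w<n. \<bar>h' x - h w\<bar> \<le> g"
  shows "h' y \<le> h' x + 3 * g"
proof -
  obtain u v where uv: "u < n" "\<bar>h' x - h u\<bar> \<le> g" "v < n" "\<bar>h' y - h v\<bar> \<le> g" using near by metis
  have "h v \<le> h u + A u v" "\<bar>A u v\<bar> \<le> g" using feasibleD[OF feas uv(1,3)] g[OF uv(1,3)] by auto
  then show ?thesis using uv by linarith
qed

locale auxiliary_nodes =
  fixes n N levels :: nat
  assumes n_pos: "1 \<le> n" and levels_pos: "1 \<le> levels" and n_le_power: "n \<le> 2 ^ (levels - 1)"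
    and room: "(levels + 1) * n \<le> N"
begin

lemma n_le_N: "n \<le> N"
  using room by simp

lemma pivot_rank_last: "pivot_rank n (levels - 1) = n - 1"
  using n_le_power by (simp add: pivot_rank_def)

definition aux_node :: "nat \<Rightarrow> nat \<Rightarrow> nat" where
  "aux_node w k = (k + 1) * n + w"

lemma aux_node_not_less [simp]: "\<not> aux_node w k < n"
  by (simp add: aux_node_def)

lemma aux_node_less:
  assumes "w < n" "k < levels"
  shows "aux_node w k < N"
proof -
  have "aux_node w k < (k + 2) * n" using assms(1) by (simp add: aux_node_def)
  also have "\<dots> \<le> (levels + 1) * n" using assms(2) by (intro mult_le_mono1) simp
  finally show ?thesis using room by simp
qed

lemma aux_node_mod_div: "w < n \<Longrightarrow> aux_node w k mod n = w" "w < n \<Longrightarrow> aux_node w k div n = k + 1"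
  unfolding aux_node_def add.commute[of _ w]
  by (simp_all only: mod_mult_self1 div_mult_self1 mod_less div_less)

lemma aux_node_eq_iff: "w < n \<Longrightarrow> w' < n \<Longrightarrow> aux_node w k = aux_node w' k' \<longleftrightarrow> w = w' \<and> k = k'"
  using aux_node_mod_div[of w k] aux_node_mod_div[of w' k'] by auto

end

locale sorted_shortcuts = auxiliary_nodes +
  fixes A :: weights and listed :: "nat \<Rightarrow> nat \<Rightarrow> nat"
  assumes listed_bij: "w < n \<Longrightarrow> bij_betw (listed w) {..<n} {..<n}"
    and listed_mono: "w < n \<Longrightarrow> i \<le> j \<Longrightarrow> j < n \<Longrightarrow> A w (listed w i) \<le> A w (listed w j)"
begin

lemma listed_less: "w < n \<Longrightarrow> i < n \<Longrightarrow> listed w i < n"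
  using listed_bij[of w] by (auto simp: bij_betw_def)

definition pivot_weight :: "nat \<Rightarrow> nat \<Rightarrow> real" where
  "pivot_weight w k = A w (listed w (pivot_rank n k))"

text \<open>
  The pair \<open>u \<rightarrow> w \<rightarrow> t\<close> is served by level \<open>k\<close> of \<open>w\<close> if the pivot weight is at least
  \<open>- A u w\<close> and at most \<open>A w t\<close>. If it is less than \<open>- A u w\<close>, then the pairs up to the next
  pivot are added explicitly.
\<close>

definition explicit_pairs :: "nat \<Rightarrow> nat \<Rightarrow> nat \<Rightarrow> nat" where
  "explicit_pairs w k u = (if A u w + pivot_weight w k < 0 then pivot_rank n (Suc k) else 0)"

definition fill_entry :: "weights \<Rightarrow> nat \<Rightarrow> nat \<Rightarrow> real \<Rightarrow> bool" where
  "fill_entry M\<^sub>0 u v x \<longleftrightarrow>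
     u < n \<and> v < n \<and> (\<exists>w<n. x = A u w + A w v) \<and> x \<le> M\<^sub>0 u v \<or>
     (\<exists>k<levels. \<exists>w<n. u = aux_node w k \<and> v < n \<and> x = A w v - pivot_weight w k) \<or>
     (\<exists>k<levels. \<exists>w<n. v = aux_node w k \<and> u < n \<and> x = A u w + pivot_weight w k)"

lemma fill_entry_aux_out:
  "w < n \<Longrightarrow> fill_entry M\<^sub>0 (aux_node w k) t x \<Longrightarrow> t < n \<Longrightarrow> x = A w t - pivot_weight w k"
  by (auto simp: fill_entry_def aux_node_eq_iff)

lemma fill_entry_aux_in:
  "w < n \<Longrightarrow> fill_entry M\<^sub>0 u (aux_node w k) x \<Longrightarrow> u < n \<Longrightarrow> x = A u w + pivot_weight w k"
  by (auto simp: fill_entry_def aux_node_eq_iff)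

lemma explicit_pairs_le:
  assumes w: "w < n"
  shows "explicit_pairs w k u \<le> 2 * card {t \<in> {..<n}. A u w + A w t < 0}"
proof (cases "A u w + pivot_weight w k < 0")
  case True
  have less: "pivot_rank n k < n" by (rule pivot_rank_less[OF n_pos])
  have "listed w ` {..pivot_rank n k} \<subseteq> {t \<in> {..<n}. A u w + A w t < 0}"
  proof (rule image_subsetI)
    fix i assume i: "i \<in> {..pivot_rank n k}"
    then have "A w (listed w i) \<le> pivot_weight w k"
      unfolding pivot_weight_def using listed_mono[OF w _ less] by simp
    then show "listed w i \<in> {t \<in> {..<n}. A u w + A w t < 0}" using True i less listed_less[OF w] by simp
  qed
  then have "card (listed w ` {..pivot_rank n k}) \<le> card {t \<in> {..<n}. A u w + A w t < 0}"
    by (intro card_mono) auto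
  moreover have "inj_on (listed w) {..pivot_rank n k}"
    using listed_bij[OF w] less by (auto simp: bij_betw_def elim!: inj_on_subset)
  ultimately show ?thesis
    using True pivot_rank_Suc[of n k] n_pos by (auto simp: card_image explicit_pairs_def)
qed (simp add: explicit_pairs_def)

lemma sum_explicit_pairs_le:
  assumes few: "\<And>u t. u < n \<Longrightarrow> t < n \<Longrightarrow> card {w \<in> {..<n}. A u w + A w t < 0} \<le> m"
  shows "(\<Sum>w<n. \<Sum>k<levels. \<Sum>u<n. explicit_pairs w k u) \<le> n * (2 * levels * (n * m))"
proof -
  let ?c = "\<lambda>u w. card {t \<in> {..<n}. A u w + A w t < 0}"
  have "(\<Sum>w<n. \<Sum>k<levels. \<Sum>u<n. explicit_pairs w k u) \<le> (\<Sum>w<n. \<Sum>k<levels. \<Sum>u<n. 2 * ?c u w)"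
    by (intro sum_mono explicit_pairs_le) auto
  also have "\<dots> = 2 * levels * (\<Sum>w<n. \<Sum>u<n. ?c u w)" by (simp add: sum_distrib_left mult_ac)
  also have "(\<Sum>w<n. \<Sum>u<n. ?c u w) = (\<Sum>u<n. \<Sum>w<n. ?c u w)" by (rule sum.swap)
  also have "\<dots> = (\<Sum>u<n. \<Sum>t<n. card {w \<in> {..<n}. A u w + A w t < 0})"
    by (intro sum.cong refl sum_card_swap) auto
  also have "2 * levels * \<dots> \<le> 2 * levels * (\<Sum>u<n. \<Sum>t<n. m)"
    by (intro mult_le_mono2 sum_mono few) auto
  finally show ?thesis by (simp add: mult.left_commute)
qed

end

text \<open>
  The matrix \<open>M\<close> while the entries for auxiliary nodes and the explicit pairs are added to \<open>M\<^sub>0\<close>.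
  The levels of \<open>w\<close> for which the entries to \<open>t\<close> and from \<open>u\<close> have been considered are given by
  \<open>Out\<close> and \<open>In\<close>.
\<close>

locale fill_state = sorted_shortcuts +
  fixes M\<^sub>0 :: weights and Out In :: "nat \<Rightarrow> nat \<Rightarrow> nat \<Rightarrow> bool" and M :: weights
  assumes entry_cases: "u < N \<Longrightarrow> v < N \<Longrightarrow> M u v = M\<^sub>0 u v \<or> fill_entry M\<^sub>0 u v (M u v)"
    and out_entry: "w < n \<Longrightarrow> k < levels \<Longrightarrow> t < n \<Longrightarrow> Out w k t \<Longrightarrow> pivot_weight w k \<le> A w t \<Longrightarrow>
      M (aux_node w k) t = A w t - pivot_weight w k"
    and in_entry: "w < n \<Longrightarrow> k < levels \<Longrightarrow> u < n \<Longrightarrow> In w k u \<Longrightarrow> 0 \<le> A u w + pivot_weight w k \<Longrightarrow>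
      M u (aux_node w k) = A u w + pivot_weight w k"
    and explicit_entry: "w < n \<Longrightarrow> k < levels \<Longrightarrow> u < n \<Longrightarrow> In w k u \<Longrightarrow> i < explicit_pairs w k u \<Longrightarrow>
      M u (listed w i) \<le> A u w + A w (listed w i)"
begin

lemma fill_state_extend:
  assumes "\<And>w k t. w < n \<Longrightarrow> k < levels \<Longrightarrow> t < n \<Longrightarrow> Out' w k t \<Longrightarrow> \<not> Out w k t \<Longrightarrow>
      pivot_weight w k \<le> A w t \<Longrightarrow> M (aux_node w k) t = A w t - pivot_weight w k"
    and "\<And>w k u. w < n \<Longrightarrow> k < levels \<Longrightarrow> u < n \<Longrightarrow> In' w k u \<Longrightarrow> \<not> In w k u \<Longrightarrow>
      0 \<le> A u w + pivot_weight w k \<Longrightarrow> M u (aux_node w k) = A u w + pivot_weight w k"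
    and "\<And>w k u i. w < n \<Longrightarrow> k < levels \<Longrightarrow> u < n \<Longrightarrow> In' w k u \<Longrightarrow> \<not> In w k u \<Longrightarrow>
      i < explicit_pairs w k u \<Longrightarrow> M u (listed w i) \<le> A u w + A w (listed w i)"
  shows "fill_state n N levels A listed M\<^sub>0 Out' In' M"
proof
  fix w k t assume "w < n" "k < levels" "t < n" "Out' w k t" "pivot_weight w k \<le> A w t"
  then show "M (aux_node w k) t = A w t - pivot_weight w k" using out_entry assms(1) by blast
next
  fix w k u assume wku: "w < n" "k < levels" "u < n" "In' w k u"
  show "M u (aux_node w k) = A u w + pivot_weight w k" if "0 \<le> A u w + pivot_weight w k"
    using in_entry assms(2) wku that by blast
  show "M u (listed w i) \<le> A u w + A w (listed w i)" if "i < explicit_pairs w k u" for i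
    using explicit_entry assms(3) wku that by blast
qed (rule entry_cases)

lemma fill_state_mono:
  assumes "\<And>w k t. w < n \<Longrightarrow> k < levels \<Longrightarrow> t < n \<Longrightarrow> Out' w k t \<Longrightarrow> Out w k t"
    and "\<And>w k u. w < n \<Longrightarrow> k < levels \<Longrightarrow> u < n \<Longrightarrow> In' w k u \<Longrightarrow> In w k u"
  shows "fill_state n N levels A listed M\<^sub>0 Out' In' M"
  using assms by (intro fill_state_extend) blast+

lemma explicit_pairs_less: "i < explicit_pairs w k u \<Longrightarrow> i < n"
  using pivot_rank_less[OF n_pos, of "Suc k"] by (simp add: explicit_pairs_def split: if_splits)

lemma le_initial:
  assumes "u < n" "v < n"
  shows "M u v \<le> M\<^sub>0 u v"
proof -
  have "u \<noteq> aux_node w k" "v \<noteq> aux_node w k" for w k using assms by auto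
  then show ?thesis using entry_cases[of u v] assms n_le_N by (auto simp: fill_entry_def)
qed

lemma fill_state_update:
  assumes ab: "a < N" "b < N" and entry: "fill_entry M\<^sub>0 a b x" and le: "a < n \<Longrightarrow> b < n \<Longrightarrow> x \<le> M a b"
    and M': "\<And>u v. u < N \<Longrightarrow> v < N \<Longrightarrow> M' u v = (if u = a \<and> v = b then x else M u v)"
  shows "fill_state n N levels A listed M\<^sub>0 Out In M'"
proof
  show "M' u v = M\<^sub>0 u v \<or> fill_entry M\<^sub>0 u v (M' u v)" if "u < N" "v < N" for u v
    using entry_cases[OF that] entry M'[OF that] by auto
next
  fix w k t assume wkt: "w < n" "k < levels" "t < n" "Out w k t" "pivot_weight w k \<le> A w t"
  then have "M' (aux_node w k) t = (if aux_node w k = a \<and> t = b then x else M (aux_node w k) t)"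
    using M' aux_node_less n_le_N by simp
  then show "M' (aux_node w k) t = A w t - pivot_weight w k"
    using out_entry[OF wkt] fill_entry_aux_out entry wkt by (auto split: if_splits)
next
  fix w k u assume wku: "w < n" "k < levels" "u < n" "In w k u" and pos: "0 \<le> A u w + pivot_weight w k"
  have "M' u (aux_node w k) = (if u = a \<and> aux_node w k = b then x else M u (aux_node w k))"
    using M' aux_node_less n_le_N wku by simp
  then show "M' u (aux_node w k) = A u w + pivot_weight w k"
    using in_entry[OF wku pos] fill_entry_aux_in entry wku by (auto split: if_splits)
next
  fix w k u i assume wku: "w < n" "k < levels" "u < n" "In w k u" and i: "i < explicit_pairs w k u"
  have "listed w i < n" using listed_less wku explicit_pairs_less[OF i] by simp
  then have "M' u (listed w i) \<le> M u (listed w i)" using M' le wku n_le_N by auto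
  also have "\<dots> \<le> A u w + A w (listed w i)" by (rule explicit_entry[OF wku i])
  finally show "M' u (listed w i) \<le> A u w + A w (listed w i)" .
qed

end

locale filled =
  fill_state n N levels A listed "padded_weights n A g" "\<lambda>_ _ _. True" "\<lambda>_ _ _. True" M
  for n N levels A listed g M +
  fixes h :: potential
  assumes feasible_A: "feasible n A h" and bounded: "u < n \<Longrightarrow> w < n \<Longrightarrow> \<bar>A u w\<bar> \<le> g"
begin

definition extended :: potential where
  "extended x = (if x < n then h x
     else if 1 \<le> x div n \<and> x div n \<le> levels then h (x mod n) + pivot_weight (x mod n) (x div n - 1)
     else h 0)"

lemma extended_vertex: "x < n \<Longrightarrow> extended x = h x"
  by (simp add: extended_def)

lemma extended_aux: "w < n \<Longrightarrow> k < levels \<Longrightarrow> extended (aux_node w k) = h w + pivot_weight w k"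
  by (simp add: extended_def aux_node_mod_div)

lemma extended_near: "\<exists>w<n. \<bar>extended x - h w\<bar> \<le> g"
proof -
  have n0: "0 < n" using n_pos by simp
  then have "0 \<le> g" using bounded[of 0 0] by linarith
  moreover have "\<bar>pivot_weight (x mod n) k\<bar> \<le> g" for k
    unfolding pivot_weight_def using n0 by (intro bounded listed_less pivot_rank_less n_pos) auto
  moreover have "x mod n < n" using n0 by simp
  ultimately show ?thesis
    unfolding extended_def
    by (intro exI[of _ "if 1 \<le> x div n \<and> x div n \<le> levels then x mod n else if x < n then x else 0"])
      (auto simp: n0)
qed

lemma feasible_extended: "feasible N M extended"
  unfolding feasible_def
proof (intro allI impI)
  fix x y assume xy: "x < N" "y < N"
  consider "M x y = padded_weights n A g x y" | w where "x < n" "y < n" "w < n" "M x y = A x w + A w y"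
    | k w where "k < levels" "w < n" "x = aux_node w k" "y < n" "M x y = A w y - pivot_weight w k"
    | k w where "k < levels" "w < n" "y = aux_node w k" "x < n" "M x y = A x w + pivot_weight w k"
    using entry_cases[OF xy] unfolding fill_entry_def by blast
  then show "extended y \<le> extended x + M x y"
  proof cases
    case 1
    then show ?thesis
      using padding_le[where h' = extended, OF feasible_A bounded extended_near, of y x] feasibleD[OF feasible_A, of x y]
      by (auto simp: padded_weights_def extended_vertex)
  next
    case 2
    then show ?thesis
      using feasibleD[OF feasible_A, of x w] feasibleD[OF feasible_A, of w y] by (simp add: extended_vertex)
  next
    case 3
    then show ?thesis using feasibleD[OF feasible_A, of w y] by (simp add: extended_vertex extended_aux)
  next
    case 4
    then show ?thesis using feasibleD[OF feasible_A, of x w] by (simp add: extended_vertex extended_aux)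
  qed
qed

lemma diagonal:
  assumes x: "x < N"
  shows "M x x = 0"
proof (rule antisym)
  show "0 \<le> M x x" using feasibleD[OF feasible_extended x x] by simp
  have "x \<noteq> aux_node w k" if "x < n" for w k using that by auto
  then show "M x x \<le> 0"
    using entry_cases[OF x x] by (auto simp: fill_entry_def padded_weights_def)
qed

lemma le_shortcut: "u < n \<Longrightarrow> v < n \<Longrightarrow> M u v \<le> A u v"
  using le_initial[of u v] feasibleD[OF feasible_A, of u v]
  by (auto simp: padded_weights_def split: if_splits)

lemma tight_edge_extended: "tight_edge n A h p r \<Longrightarrow> tight_edge n M extended p r"
  using le_shortcut[of p r] by (auto simp: tight_edge_def extended_vertex)

text \<open>The least level whose pivot weight is not less than \<open>- A p w\<close> serves the pair, or the previous level adds it.\<close>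

lemma nonneg_walk_if_token:
  assumes pr: "p < n" "r < n" "h p \<le> h r" and w: "w < n" "A p w + A w r = h r - h p"
  shows "\<exists>g<N. 0 \<le> M p g \<and> 0 \<le> M g r \<and> M p g + M g r \<le> h r - h p"
proof -
  have N: "p < N" "r < N" using pr n_le_N by auto
  let ?P = "\<lambda>k. 0 \<le> A p w + pivot_weight w k"
  have "r \<in> listed w ` {..<n}" using listed_bij[OF w(1)] pr(2) by (simp add: bij_betw_def)
  then obtain i where i: "i < n" "listed w i = r" by auto
  have "A w r \<le> pivot_weight w (levels - 1)"
    unfolding pivot_weight_def pivot_rank_last using listed_mono[OF w(1), of i "n - 1"] i n_pos by simp
  then have last: "?P (levels - 1)" using w pr by linarith
  define k where "k = (LEAST k. ?P k)"
  have Pk: "?P k" unfolding k_def by (rule LeastI[of ?P, OF last])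
  have "k \<le> levels - 1" unfolding k_def by (rule Least_le[of ?P, OF last])
  then have k: "k < levels" using levels_pos by simp
  show ?thesis
  proof (cases "pivot_weight w k \<le> A w r")
    case True
    have "M p (aux_node w k) = A p w + pivot_weight w k" "M (aux_node w k) r = A w r - pivot_weight w k"
      using in_entry[OF w(1) k pr(1) TrueI Pk] out_entry[OF w(1) k pr(2) TrueI True] by auto
    then show ?thesis
      using aux_node_less[OF w(1) k] Pk True w by (intro exI[of _ "aux_node w k"]) auto
  next
    case False
    have ik: "i < pivot_rank n k"
    proof (rule ccontr)
      assume "\<not> i < pivot_rank n k"
      then have "pivot_weight w k \<le> A w r"
        unfolding pivot_weight_def using listed_mono[OF w(1), of "pivot_rank n k" i] i by simp
      then show False using False by simp
    qed
    then obtain k' where k': "k = Suc k'" by (cases k) auto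
    then have "\<not> ?P k'" using not_less_Least[of k' ?P] unfolding k_def by simp
    then have "i < explicit_pairs w k' p" using ik k' by (simp add: explicit_pairs_def)
    then have "M p r \<le> h r - h p"
      using explicit_entry[OF w(1) _ pr(1) TrueI, of k' i] i w(2) k k' by simp
    moreover have "h r - h p \<le> M p r"
      using feasibleD[OF feasible_extended N] pr by (simp add: extended_vertex)
    ultimately show ?thesis using N pr diagonal[OF N(2)] by (intro exI[of _ r]) simp
  qed
qed

lemma free_token_extended:
  assumes "token n A h p r"
  shows "free_token n N M M extended p r"
proof -
  obtain w where pr: "p < n" "r < n" "h p \<le> h r" and w: "w < n" "A p w + A w r \<le> h r - h p"
    using assms by (auto simp: token_def)
  have "A p w + A w r = h r - h p"
    using w feasibleD[OF feasible_A pr(1) w(1)] feasibleD[OF feasible_A w(1) pr(2)] by linarith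
  from nonneg_walk_if_token[OF pr w(1) this]
  have "\<exists>g<N. 0 \<le> M p g \<and> 0 \<le> M g r \<and> M p g + M g r \<le> extended r - extended p"
    using pr by (simp add: extended_vertex)
  moreover have "M p w + M w r \<le> extended r - extended p"
    using le_shortcut[OF pr(1) w(1)] le_shortcut[OF w(1) pr(2)] w pr by (simp add: extended_vertex)
  ultimately show ?thesis using pr w(1) unfolding free_token_def by blast
qed

end


section \<open>Shortest paths and potentials\<close>

lemma (in wf_digraph) negative_closed_walk_imp_negative_cycle:
  assumes "awalk u c u" "awalk_cost f c < 0"
  shows "\<exists>p. cycle p \<and> awalk_cost f p < 0"
  using assms
proof (induction "length c" arbitrary: c u rule: less_induct)
  case less
  then obtain e c' where c: "c = e # c'" by (cases c) auto
  have e: "e \<in> arcs G" "u = tail G e" "awalk (head G e) c' u"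
    using less.prems c by (auto simp: awalk_Cons_iff)
  show ?case
  proof (cases "distinct (awalk_verts (head G e) c')")
    case True
    then have "distinct (tl (awalk_verts u c))" by (simp add: c)
    then show ?thesis using less.prems c unfolding cycle_def by blast
  next
    case False
    obtain a r t x where d: "c' = a @ r @ t" "0 < length r" "awalk (head G e) a x" "awalk x r x" "awalk x t u"
      using awalk_not_distinct_decomp[OF e(3) False] by blast
    have "awalk u (e # a @ t) u" using e d awalk_appendI[OF d(3,5)] by (simp add: awalk_Cons_iff)
    moreover have "awalk_cost f c = awalk_cost f r + awalk_cost f (e # a @ t)" by (simp add: c d)
    ultimately show ?thesis
      using less.hyps[of r x] less.hyps[of "e # a @ t" u] d less.prems(2) c by fastforce
  qed
qed

lemma (in pair_wf_digraph) potential_le_awalk_cost: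
  assumes d: "\<And>x y. (x, y) \<in> parcs G \<Longrightarrow> d y \<le> d x + w (x, y)" and "awalk u p v"
  shows "d v \<le> d u + awalk_cost w p"
  using assms(2)
proof (induction p arbitrary: u)
  case Nil
  then show ?case by (simp add: awalk_Nil_iff)
next
  case (Cons e p)
  then have e: "e \<in> parcs G" "u = fst e" "awalk (snd e) p v" by (auto simp: awalk_Cons_iff)
  then show ?case using Cons.IH[OF e(3)] d[of "fst e" "snd e"] by simp
qed

lemma potential_imp_no_negative_cycle:
  assumes "pair_fin_digraph G" and "\<And>x y. (x, y) \<in> parcs G \<Longrightarrow> d y \<le> d x + w (x, y)"
  shows "\<not> has_negative_cycle G w"
proof
  interpret pair_fin_digraph G by fact
  assume "has_negative_cycle G w"
  then obtain p u where "awalk u p u" "awalk_cost w p < 0"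
    unfolding has_negative_cycle_def cycle_def by blast
  then show False using potential_le_awalk_cost[of d w u p u] assms(2) by fastforce
qed

definition total_weight :: "nat pair_pre_digraph \<Rightarrow> (nat \<times> nat \<Rightarrow> real) \<Rightarrow> real" where
  "total_weight G w = (\<Sum>e\<in>parcs G. \<bar>w e\<bar>)"

definition adjacency :: "nat pair_pre_digraph \<Rightarrow> (nat \<times> nat \<Rightarrow> real) \<Rightarrow> weights" where
  "adjacency G w x y = (if x = y then 0 else if (x, y) \<notin> parcs G then 2 * total_weight G w else w (x, y))"

locale shortest_potential =
  fixes n :: nat and G :: "nat pair_pre_digraph" and w :: "nat \<times> nat \<Rightarrow> real" and s :: nat
    and h :: potential
  assumes at_source: "h s = 0" and feasible: "feasible n (adjacency G w) h"
    and tight_reach: "y < n \<Longrightarrow> \<exists>j\<le>n. counted_reach s (tight_edge n (adjacency G w) h) (\<lambda>_ _. False) j y"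
    and is_dist: "pre_digraph.awalk (with_proj G) s p v \<Longrightarrow> ereal (h v) = sssp_dist G w s v"
    and arc: "(x, y) \<in> parcs G \<Longrightarrow> h y \<le> h x + w (x, y)"

locale instance_without_negative_cycle = G: pair_fin_digraph G for G :: "nat pair_pre_digraph" +
  fixes n :: nat and w :: "nat \<times> nat \<Rightarrow> real" and s :: nat
  assumes verts: "pverts G = {..<n}" and source: "s < n" and no_negative_cycle: "\<not> has_negative_cycle G w"
begin

lemma arc_less: "(x, y) \<in> parcs G \<Longrightarrow> x < n \<and> y < n"
  using G.in_arcsD1 G.in_arcsD2 verts by auto

lemma abs_sum_le_total_weight:
  assumes "E \<subseteq> parcs G"
  shows "\<bar>\<Sum>e\<in>E. w e\<bar> \<le> total_weight G w"
proof -
  have "\<bar>\<Sum>e\<in>E. w e\<bar> \<le> (\<Sum>e\<in>E. \<bar>w e\<bar>)" by (rule sum_abs)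
  also have "\<dots> \<le> total_weight G w"
    unfolding total_weight_def by (rule sum_mono2[OF G.pair_finite_arcs assms]) simp
  finally show ?thesis .
qed

lemma total_weight_nonneg: "0 \<le> total_weight G w"
  unfolding total_weight_def by (rule sum_nonneg) simp

definition completion :: "nat pair_pre_digraph" where
  "completion = \<lparr>pverts = {..<n}, parcs = {(x, y). x < n \<and> y < n \<and> x \<noteq> y}\<rparr>"

lemma completion_simps [simp]:
  "pverts completion = {..<n}" "parcs completion = {(x, y). x < n \<and> y < n \<and> x \<noteq> y}"
  by (auto simp: completion_def)

sublocale C: pair_fin_digraph completion
proof
  have "parcs completion \<subseteq> {..<n} \<times> {..<n}" by auto
  then show "finite (parcs completion)" by (rule finite_subset) auto
qed auto

abbreviation cost :: "nat \<times> nat \<Rightarrow> real" where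
  "cost e \<equiv> adjacency G w (fst e) (snd e)"

lemma cost_arc: "e \<in> parcs completion \<Longrightarrow> e \<in> parcs G \<Longrightarrow> cost e = w e"
  by (auto simp: adjacency_def)

lemma walk_over_arcs:
  assumes "C.awalk u p v" "set p \<subseteq> parcs G"
  shows "G.awalk u p v" "C.awalk_cost cost p = G.awalk_cost w p"
proof -
  show "G.awalk u p v" using assms verts unfolding C.awalk_def G.awalk_def by simp
  have "map cost p = map w p"
  proof (intro map_cong refl)
    fix e assume "e \<in> set p"
    then have "e \<in> parcs completion" "e \<in> parcs G" using assms by (auto simp: C.awalk_def)
    then show "cost e = w e" by (rule cost_arc)
  qed
  then show "C.awalk_cost cost p = G.awalk_cost w p"
    unfolding C.awalk_cost_def G.awalk_cost_def by (rule arg_cong)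
qed

text \<open>A missing arc costs more than all other arcs of a path can make up for.\<close>

lemma total_weight_le_cost:
  assumes p: "C.awalk u p v" "distinct p" and "\<not> set p \<subseteq> parcs G"
  shows "total_weight G w \<le> C.awalk_cost cost p"
proof -
  let ?I = "set p \<inter> parcs G" and ?D = "set p - parcs G"
  have arcs: "e \<in> parcs completion" if "e \<in> set p" for e using p(1) that by (auto simp: C.awalk_def)
  have "?D \<noteq> {}" using assms(3) by auto
  then have "1 \<le> real (card ?D)" by (simp add: card_gt_0_iff Suc_le_eq)
  then have D: "2 * total_weight G w \<le> real (card ?D) * (2 * total_weight G w)"
    using mult_right_mono[of 1 "real (card ?D)" "2 * total_weight G w"] total_weight_nonneg by simp
  have "C.awalk_cost cost p = (\<Sum>e\<in>set p. cost e)"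
    by (simp add: C.awalk_cost_def sum_list_distinct_conv_sum_set[OF p(2)])
  also have "\<dots> = (\<Sum>e\<in>?I. cost e) + (\<Sum>e\<in>?D. cost e)"
    by (rule sum.Int_Diff) simp
  also have "(\<Sum>e\<in>?I. cost e) = (\<Sum>e\<in>?I. w e)" using arcs by (intro sum.cong refl cost_arc) auto
  also have "(\<Sum>e\<in>?D. cost e) = (\<Sum>e\<in>?D. 2 * total_weight G w)"
    using arcs by (intro sum.cong refl) (auto simp: adjacency_def)
  finally show ?thesis using D abs_sum_le_total_weight[of ?I] by simp
qed

lemma closed_walk_nonneg:
  assumes "C.awalk u p u"
  shows "0 \<le> C.awalk_cost cost p"
proof (rule ccontr)
  assume "\<not> ?thesis"
  then have "C.awalk_cost cost p < 0" by simp
  from C.negative_closed_walk_imp_negative_cycle[OF assms this]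
  obtain q where "C.cycle q" "C.awalk_cost cost q < 0" by blast
  then obtain x where q: "C.awalk x q x" "distinct (tl (C.awalk_verts x q))" "distinct q" "q \<noteq> []"
    "C.awalk_cost cost q < 0" unfolding C.cycle_conv by blast
  then have arcs: "set q \<subseteq> parcs G"
    using total_weight_le_cost[OF q(1,3)] total_weight_nonneg by fastforce
  have "G.cycle q"
    unfolding G.cycle_def using walk_over_arcs(1)[OF q(1) arcs] q(2,4) by auto
  then show False
    using no_negative_cycle walk_over_arcs(2)[OF q(1) arcs] q(5) unfolding has_negative_cycle_def by auto
qed

lemma shortest_path_exists:
  assumes v: "v < n"
  shows "\<exists>p. C.apath s p v \<and> C.\<mu> cost s v = ereal (C.awalk_cost cost p)"
proof (rule C.no_neg_cyc_reach_imp_path)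
  have "C.awalk s (if s = v then [] else [(s, v)]) v"
    using source v by (simp add: C.awalk_simps)
  then show "s \<rightarrow>\<^sup>*\<^bsub>with_proj completion\<^esub> v" using C.reachable_awalk by blast
  show "\<not> (\<exists>x r. C.awalk x r x \<and> x \<in> set (C.awalk_verts s p) \<and> C.awalk_cost cost r < 0)" for p
    using closed_walk_nonneg by fastforce
qed

definition dist :: potential where
  "dist v = real_of_ereal (C.\<mu> cost s v)"

lemma dist_attained: "v < n \<Longrightarrow> \<exists>p. C.apath s p v \<and> dist v = C.awalk_cost cost p"
  using shortest_path_exists[of v] by (auto simp: dist_def)

lemma dist_le_awalk_cost:
  assumes "C.awalk s p v"
  shows "dist v \<le> C.awalk_cost cost p"
proof -
  have "v < n" using C.awalk_last_in_verts[OF assms] by simp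
  then show ?thesis
    using shortest_path_exists C.min_cost_le_walk_cost[OF assms, of cost] by (fastforce simp: dist_def)
qed

lemma dist_source: "dist s = 0"
proof -
  have "C.awalk s [] s" using source by (simp add: C.awalk_Nil_iff)
  then have "dist s \<le> 0" using dist_le_awalk_cost by fastforce
  then show ?thesis using dist_attained[OF source] closed_walk_nonneg by (fastforce simp: C.apath_def)
qed

lemma feasible_dist: "feasible n (adjacency G w) dist"
  unfolding feasible_def
proof (intro allI impI)
  fix x y assume xy: "x < n" "y < n"
  show "dist y \<le> dist x + adjacency G w x y"
  proof (cases "x = y")
    case True
    then show ?thesis by (simp add: adjacency_def)
  next
    case False
    obtain p where p: "C.apath s p x" "dist x = C.awalk_cost cost p" using dist_attained[OF xy(1)] by blast
    have "C.awalk x [(x, y)] y" using False xy by (simp add: C.awalk_simps)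
    then have "C.awalk s (p @ [(x, y)]) y" using p(1) C.awalk_appendI by (auto simp: C.apath_def)
    from dist_le_awalk_cost[OF this] show ?thesis using p(2) by simp
  qed
qed

lemma tight_reach_along_walk:
  assumes "C.awalk s p v" "C.awalk_cost cost p \<le> dist v"
  shows "counted_reach s (tight_edge n (adjacency G w) dist) (\<lambda>_ _. False) (length p) v"
  using assms
proof (induction p arbitrary: v rule: rev_induct)
  case Nil
  then show ?case using counted_reach.start by (auto simp: C.awalk_Nil_iff)
next
  case (snoc e p)
  obtain x where x: "C.awalk s p x" "C.awalk x [e] v" using snoc.prems(1) by auto
  then have e: "e = (x, v)" "x < n" "v < n" by (auto simp: C.awalk_simps)
  have "dist v \<le> dist x + adjacency G w x v" "dist x \<le> C.awalk_cost cost p"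
    using feasibleD[OF feasible_dist] e dist_le_awalk_cost[OF x(1)] by auto
  then have "C.awalk_cost cost p \<le> dist x" "tight_edge n (adjacency G w) dist x v"
    using snoc.prems(2) e by (auto simp: tight_edge_def)
  then show ?case using counted_reach.counted[OF snoc.IH[OF x(1)]] by simp
qed

lemma dist_arc:
  assumes xy: "(x, y) \<in> parcs G"
  shows "dist y \<le> dist x + w (x, y)"
proof (cases "x = y")
  case True
  have "G.cycle [(x, x)]" using xy True verts arc_less unfolding G.cycle_def by (auto simp: G.awalk_simps)
  then have "0 \<le> w (x, x)"
    using no_negative_cycle unfolding has_negative_cycle_def by (force simp: G.awalk_cost_def not_less)
  then show ?thesis using True by simp
next
  case False
  then show ?thesis using feasibleD[OF feasible_dist, of x y] arc_less[OF xy] xy by (simp add: adjacency_def)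
qed

lemma dist_eq_sssp_dist:
  assumes p: "G.awalk s p v"
  shows "ereal (dist v) = sssp_dist G w s v"
proof (rule antisym)
  have "dist v \<le> G.awalk_cost w q" if "G.awalk s q v" for q
    using G.potential_le_awalk_cost[of dist w s q v] dist_arc that dist_source by simp
  then show "ereal (dist v) \<le> sssp_dist G w s v"
    unfolding sssp_dist_def G.\<mu>_def by (intro INF_greatest) auto
  have dist_le: "sssp_dist G w s v \<le> ereal (G.awalk_cost w q)" if "G.awalk s q v" for q
    unfolding sssp_dist_def using that by (rule G.min_cost_le_walk_cost)
  have "v < n" using G.awalk_last_in_verts[OF p] verts by simp
  then obtain q where q: "C.apath s q v" "dist v = C.awalk_cost cost q" using dist_attained by blast
  then have walk: "C.awalk s q v" and distinct: "distinct q"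
    using C.distinct_verts_imp_distinct by (auto simp: C.apath_def)
  show "sssp_dist G w s v \<le> ereal (dist v)"
  proof (cases "set q \<subseteq> parcs G")
    case True
    then show ?thesis using walk_over_arcs[OF walk True] dist_le q(2) by simp
  next
    case False
    obtain r where r: "G.apath s r v" using p G.apath_awalk_to_apath by blast
    then have "G.awalk s r v" "distinct r" "set r \<subseteq> parcs G"
      using G.distinct_verts_imp_distinct by (auto simp: G.apath_def G.awalk_def)
    then have "G.awalk_cost w r \<le> total_weight G w"
      using abs_sum_le_total_weight[of "set r"] by (simp add: G.awalk_cost_def sum_list_distinct_conv_sum_set)
    also have "\<dots> \<le> dist v" using total_weight_le_cost[OF walk distinct False] q(2) by simp
    finally show ?thesis using dist_le[OF \<open>G.awalk s r v\<close>] by (meson ereal_less_eq(3) order_trans)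
  qed
qed

lemma shortest_potential_dist: "shortest_potential n G w s dist"
proof
  show "\<exists>j\<le>n. counted_reach s (tight_edge n (adjacency G w) dist) (\<lambda>_ _. False) j y" if y: "y < n" for y
  proof -
    obtain p where p: "C.apath s p y" "dist y = C.awalk_cost cost p" using dist_attained[OF y] by blast
    then have "length p \<le> n" using C.length_apath_less[OF p(1)] by simp
    then show ?thesis using tight_reach_along_walk[of p y] p by (auto simp: C.apath_def)
  qed
qed (rule dist_source feasible_dist dist_eq_sssp_dist dist_arc; assumption?)+

end

lemma sssp_instanceD:
  assumes "sssp_instance n G s"
  shows "pair_fin_digraph G" "pverts G = {..<n}" "s < n" "s \<in> pverts G"
  using assms by (auto simp: sssp_instance_def)

lemma sssp_instance_arc_less:
  assumes "sssp_instance n G s" "(x, y) \<in> parcs G"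
  shows "x < n" "y < n"
proof -
  interpret pair_fin_digraph G by (rule sssp_instanceD[OF assms(1)])
  show "x < n" "y < n"
    using in_arcsD1[OF assms(2)] in_arcsD2[OF assms(2)] sssp_instanceD(2)[OF assms(1)] by auto
qed

lemma shortest_potential_exists:
  assumes "sssp_instance n G s" "\<not> has_negative_cycle G w"
  obtains h where "shortest_potential n G w s h"
proof -
  interpret pair_fin_digraph G by (rule sssp_instanceD[OF assms(1)])
  interpret instance_without_negative_cycle G n w s
    using sssp_instanceD[OF assms(1)] assms(2) by unfold_locales auto
  show thesis by (rule that[OF shortest_potential_dist])
qed


section \<open>Big-step semantics\<close>

notation Seq (infixr ";;" 55)

inductive big_step :: "nat \<Rightarrow> com \<Rightarrow> machine_state \<Rightarrow> nat \<Rightarrow> machine_state \<Rightarrow> bool" for M where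
  Skip: "big_step M Skip \<sigma> 0 \<sigma>"
| WAssign: "big_step M (WAssign x e) \<sigma> 1 (\<sigma>\<lparr>wvar := (wvar \<sigma>)(x := wval M \<sigma> e)\<rparr>)"
| WStore: "big_step M (WStore a i e) \<sigma> 1
    (\<sigma>\<lparr>warr := (warr \<sigma>)(a := (warr \<sigma> a)(wval M \<sigma> i := wval M \<sigma> e))\<rparr>)"
| RAssign: "big_step M (RAssign x r) \<sigma> 1 (\<sigma>\<lparr>rvar := (rvar \<sigma>)(x := rval M \<sigma> r)\<rparr>)"
| RStore: "big_step M (RStore a i r) \<sigma> 1
    (\<sigma>\<lparr>rarr := (rarr \<sigma>)(a := (rarr \<sigma> a)(wval M \<sigma> i := rval M \<sigma> r))\<rparr>)"
| Seq: "big_step M c \<sigma> t \<sigma>' \<Longrightarrow> big_step M d \<sigma>' u \<sigma>'' \<Longrightarrow> big_step M (c ;; d) \<sigma> (t + 1 + u) \<sigma>''"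
| Cond: "big_step M (if bval M \<sigma> b then c else d) \<sigma> t \<sigma>' \<Longrightarrow> big_step M (Cond b c d) \<sigma> (1 + t) \<sigma>'"
| Loop_False: "\<not> bval M \<sigma> b \<Longrightarrow> big_step M (Loop b c) \<sigma> 1 \<sigma>"
| Loop_True: "bval M \<sigma> b \<Longrightarrow> big_step M c \<sigma> t \<sigma>' \<Longrightarrow> big_step M (Loop b c) \<sigma>' u \<sigma>'' \<Longrightarrow>
    big_step M (Loop b c) \<sigma> (t + u + 2) \<sigma>''"

inductive_cases SkipE: "big_step M Skip \<sigma> t \<sigma>'"
inductive_cases WAssignE: "big_step M (WAssign x e) \<sigma> t \<sigma>'"
inductive_cases WStoreE: "big_step M (WStore a i e) \<sigma> t \<sigma>'"
inductive_cases RAssignE: "big_step M (RAssign x r) \<sigma> t \<sigma>'"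
inductive_cases RStoreE: "big_step M (RStore a i r) \<sigma> t \<sigma>'"
inductive_cases SeqE: "big_step M (c ;; d) \<sigma> t \<sigma>'"
inductive_cases CondE: "big_step M (Cond b c d) \<sigma> t \<sigma>'"

lemma run_Skip: "run M t Skip \<sigma> = return_pmf (Skip, \<sigma>)"
  by (induction t) (simp_all add: bind_return_pmf)

lemma run_add: "run M (t + u) c \<sigma> = bind_pmf (run M t c \<sigma>) (\<lambda>(c', \<sigma>'). run M u c' \<sigma>')"
  by (induction t arbitrary: c \<sigma>)
     (auto simp: bind_return_pmf bind_assoc_pmf intro!: bind_pmf_cong)

definition halts :: "nat \<Rightarrow> nat \<Rightarrow> com \<Rightarrow> machine_state \<Rightarrow> machine_state pmf \<Rightarrow> bool" where
  "halts M t c \<sigma> p \<longleftrightarrow> run M t c \<sigma> = map_pmf (Pair Skip) p"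

lemma halts_mono:
  assumes "halts M t c \<sigma> p" and "t \<le> u"
  shows "halts M u c \<sigma> p"
proof -
  obtain d where u: "u = t + d" using assms(2) le_iff_add by blast
  show ?thesis
    using assms(1) unfolding halts_def u run_add
    by (simp add: bind_map_pmf run_Skip map_pmf_def bind_assoc_pmf bind_return_pmf)
qed

lemma halts_Skip_iff: "halts M t Skip \<sigma> p \<longleftrightarrow> p = return_pmf \<sigma>"
proof -
  have inj: "inj (map_pmf (Pair Skip))" by (intro pmf.inj_map) (simp add: inj_def)
  have "halts M t Skip \<sigma> p \<longleftrightarrow> map_pmf (Pair Skip) (return_pmf \<sigma>) = map_pmf (Pair Skip) p"
    by (simp add: halts_def run_Skip)
  also have "\<dots> \<longleftrightarrow> p = return_pmf \<sigma>"
    unfolding inj_eq[OF inj] by (rule eq_commute)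
  finally show ?thesis .
qed

lemma halts_0_imp_Skip:
  assumes "halts M 0 c \<sigma> p"
  shows "c = Skip"
proof -
  have "set_pmf (return_pmf (c, \<sigma>)) = Pair Skip ` set_pmf p"
    using assms by (simp add: halts_def flip: set_map_pmf)
  then show ?thesis by auto
qed

lemma halts_Suc:
  assumes "\<And>c' \<sigma>'. (c', \<sigma>') \<in> set_pmf (step M c \<sigma>) \<Longrightarrow> halts M t c' \<sigma>' (g (c', \<sigma>'))"
  shows "halts M (Suc t) c \<sigma> (bind_pmf (step M c \<sigma>) g)"
proof -
  have "run M (Suc t) c \<sigma> = bind_pmf (step M c \<sigma>) (\<lambda>x. map_pmf (Pair Skip) (g x))"
    using assms by (auto simp: halts_def intro!: bind_pmf_cong)
  then show ?thesis by (simp add: halts_def map_bind_pmf)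
qed

lemma halts_SucE:
  assumes "halts M (Suc t) c \<sigma> p"
  obtains g where "p = bind_pmf (step M c \<sigma>) g"
    "\<And>c' \<sigma>'. (c', \<sigma>') \<in> set_pmf (step M c \<sigma>) \<Longrightarrow> halts M t c' \<sigma>' (g (c', \<sigma>'))"
proof
  let ?S = "step M c \<sigma>" and ?g = "\<lambda>(c', \<sigma>'). map_pmf snd (run M t c' \<sigma>')"
  have run: "bind_pmf ?S (\<lambda>(c', \<sigma>'). run M t c' \<sigma>') = map_pmf (Pair Skip) p"
    using assms by (simp add: halts_def)
  have "p = map_pmf snd (map_pmf (Pair Skip) p)" by (simp add: map_pmf_comp)
  also have "\<dots> = bind_pmf ?S ?g" unfolding run[symmetric] by (simp add: map_bind_pmf case_prod_beta')
  finally show "p = bind_pmf ?S ?g" .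
  fix c' \<sigma>' assume "(c', \<sigma>') \<in> set_pmf ?S"
  moreover have "set_pmf (bind_pmf ?S (\<lambda>(c', \<sigma>'). run M t c' \<sigma>')) = Pair Skip ` set_pmf p"
    by (simp add: run)
  ultimately have "set_pmf (run M t c' \<sigma>') \<subseteq> Pair Skip ` set_pmf p" by fastforce
  then have "map_pmf (Pair Skip) (?g (c', \<sigma>')) = map_pmf (\<lambda>x. x) (run M t c' \<sigma>')"
    unfolding prod.case map_pmf_comp by (intro map_pmf_cong) auto
  then show "halts M t c' \<sigma>' (?g (c', \<sigma>'))" by (simp add: halts_def map_pmf_ident)
qed

lemma halts_Seq:
  assumes "halts M t c \<sigma> p" and "\<And>\<sigma>'. \<sigma>' \<in> set_pmf p \<Longrightarrow> halts M u d \<sigma>' (g \<sigma>')"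
  shows "halts M (t + 1 + u) (c ;; d) \<sigma> (bind_pmf p g)"
  using assms
proof (induction t arbitrary: c \<sigma> p)
  case 0
  then have "c = Skip" by (intro halts_0_imp_Skip)
  with 0 show ?case by (simp add: halts_Skip_iff bind_return_pmf) (simp add: halts_def bind_return_pmf)
next
  case (Suc t)
  show ?case
  proof (cases "c = Skip")
    case True
    then have "p = return_pmf \<sigma>" using Suc.prems(1) by (simp add: halts_Skip_iff)
    moreover have "halts M (Suc u) (Skip ;; d) \<sigma> (g \<sigma>)"
      using Suc.prems(2)[of \<sigma>] \<open>p = return_pmf \<sigma>\<close> by (simp add: halts_def bind_return_pmf)
    ultimately show ?thesis using True halts_mono by (auto simp: bind_return_pmf)
  next
    case False
    obtain r where p: "p = bind_pmf (step M c \<sigma>) r"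
      and r: "\<And>c' \<sigma>'. (c', \<sigma>') \<in> set_pmf (step M c \<sigma>) \<Longrightarrow> halts M t c' \<sigma>' (r (c', \<sigma>'))"
      using halts_SucE[OF Suc.prems(1)] by blast
    have "halts M (t + 1 + u) (c' ;; d) \<sigma>' (bind_pmf (r (c', \<sigma>')) g)"
      if "(c', \<sigma>') \<in> set_pmf (step M c \<sigma>)" for c' \<sigma>'
      using that Suc.prems(2) by (intro Suc.IH r) (auto simp: p)
    then have "halts M (Suc (t + 1 + u)) (c ;; d) \<sigma> (bind_pmf (step M (c ;; d) \<sigma>)
        (\<lambda>(c', \<sigma>'). case c' of c'' ;; _ \<Rightarrow> bind_pmf (r (c'', \<sigma>')) g | _ \<Rightarrow> return_pmf \<sigma>))"
      using False by (intro halts_Suc) auto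
    then show ?thesis
      using False by (simp add: bind_map_pmf case_prod_beta' p bind_assoc_pmf)
  qed
qed

lemma big_step_halts: "big_step M c \<sigma> t \<sigma>' \<Longrightarrow> halts M t c \<sigma> (return_pmf \<sigma>')"
proof (induction rule: big_step.induct)
  case (Seq c \<sigma> t \<sigma>' d u \<sigma>'')
  then show ?case
    using halts_Seq[of M t c \<sigma> "return_pmf \<sigma>'" u d "\<lambda>_. return_pmf \<sigma>''"]
    by (simp add: bind_return_pmf)
next
  case (Loop_True \<sigma> b c t \<sigma>' u \<sigma>'')
  then have "halts M (t + 1 + u) (c ;; Loop b c) \<sigma> (return_pmf \<sigma>'')"
    using halts_Seq[of M t c \<sigma> "return_pmf \<sigma>'" u "Loop b c" "\<lambda>_. return_pmf \<sigma>''"]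
    by (simp add: bind_return_pmf)
  then show ?case using Loop_True by (simp add: halts_def bind_return_pmf)
qed (auto simp: halts_def bind_return_pmf split: if_splits)

primrec mod_wvars :: "com \<Rightarrow> string set" where
  "mod_wvars Skip = {}" | "mod_wvars (WAssign x e) = {x}" | "mod_wvars (WStore a i e) = {}"
| "mod_wvars (RAssign x r) = {}" | "mod_wvars (RStore a i r) = {}" | "mod_wvars (Random x e) = {x}"
| "mod_wvars (c ;; d) = mod_wvars c \<union> mod_wvars d"
| "mod_wvars (Cond b c d) = mod_wvars c \<union> mod_wvars d" | "mod_wvars (Loop b c) = mod_wvars c"

primrec mod_warrs :: "com \<Rightarrow> string set" where
  "mod_warrs Skip = {}" | "mod_warrs (WAssign x e) = {}" | "mod_warrs (WStore a i e) = {a}"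
| "mod_warrs (RAssign x r) = {}" | "mod_warrs (RStore a i r) = {}" | "mod_warrs (Random x e) = {}"
| "mod_warrs (c ;; d) = mod_warrs c \<union> mod_warrs d"
| "mod_warrs (Cond b c d) = mod_warrs c \<union> mod_warrs d" | "mod_warrs (Loop b c) = mod_warrs c"

primrec mod_rvars :: "com \<Rightarrow> string set" where
  "mod_rvars Skip = {}" | "mod_rvars (WAssign x e) = {}" | "mod_rvars (WStore a i e) = {}"
| "mod_rvars (RAssign x r) = {x}" | "mod_rvars (RStore a i r) = {}" | "mod_rvars (Random x e) = {}"
| "mod_rvars (c ;; d) = mod_rvars c \<union> mod_rvars d"
| "mod_rvars (Cond b c d) = mod_rvars c \<union> mod_rvars d" | "mod_rvars (Loop b c) = mod_rvars c"

primrec mod_rarrs :: "com \<Rightarrow> string set" where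
  "mod_rarrs Skip = {}" | "mod_rarrs (WAssign x e) = {}" | "mod_rarrs (WStore a i e) = {}"
| "mod_rarrs (RAssign x r) = {}" | "mod_rarrs (RStore a i r) = {a}" | "mod_rarrs (Random x e) = {}"
| "mod_rarrs (c ;; d) = mod_rarrs c \<union> mod_rarrs d"
| "mod_rarrs (Cond b c d) = mod_rarrs c \<union> mod_rarrs d" | "mod_rarrs (Loop b c) = mod_rarrs c"

definition frame :: "com \<Rightarrow> machine_state \<Rightarrow> machine_state \<Rightarrow> bool" where
  "frame c \<sigma> \<tau> \<longleftrightarrow>
     (\<forall>x. x \<notin> mod_wvars c \<longrightarrow> wvar \<tau> x = wvar \<sigma> x) \<and> (\<forall>x. x \<notin> mod_warrs c \<longrightarrow> warr \<tau> x = warr \<sigma> x) \<and>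
     (\<forall>x. x \<notin> mod_rvars c \<longrightarrow> rvar \<tau> x = rvar \<sigma> x) \<and> (\<forall>x. x \<notin> mod_rarrs c \<longrightarrow> rarr \<tau> x = rarr \<sigma> x)"

lemma frameD:
  assumes "frame c \<sigma> \<tau>"
  shows "x \<notin> mod_wvars c \<Longrightarrow> wvar \<tau> x = wvar \<sigma> x" "x \<notin> mod_warrs c \<Longrightarrow> warr \<tau> x = warr \<sigma> x"
    "x \<notin> mod_rvars c \<Longrightarrow> rvar \<tau> x = rvar \<sigma> x" "x \<notin> mod_rarrs c \<Longrightarrow> rarr \<tau> x = rarr \<sigma> x"
  using assms by (auto simp: frame_def)

lemma frame_refl: "frame c \<sigma> \<sigma>"
  by (simp add: frame_def)

lemma frame_trans:
  assumes "frame c \<sigma> \<tau>" "frame d \<tau> \<upsilon>"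
    and "mod_wvars c \<union> mod_wvars d \<subseteq> mod_wvars e" "mod_warrs c \<union> mod_warrs d \<subseteq> mod_warrs e"
      "mod_rvars c \<union> mod_rvars d \<subseteq> mod_rvars e" "mod_rarrs c \<union> mod_rarrs d \<subseteq> mod_rarrs e"
  shows "frame e \<sigma> \<upsilon>"
  unfolding frame_def
proof (intro conjI allI impI)
  fix x
  show "wvar \<upsilon> x = wvar \<sigma> x" if "x \<notin> mod_wvars e"
    using that assms(3) frameD(1)[OF assms(1)] frameD(1)[OF assms(2)] by (metis UnCI subsetD)
  show "warr \<upsilon> x = warr \<sigma> x" if "x \<notin> mod_warrs e"
    using that assms(4) frameD(2)[OF assms(1)] frameD(2)[OF assms(2)] by (metis UnCI subsetD)
  show "rvar \<upsilon> x = rvar \<sigma> x" if "x \<notin> mod_rvars e"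
    using that assms(5) frameD(3)[OF assms(1)] frameD(3)[OF assms(2)] by (metis UnCI subsetD)
  show "rarr \<upsilon> x = rarr \<sigma> x" if "x \<notin> mod_rarrs e"
    using that assms(6) frameD(4)[OF assms(1)] frameD(4)[OF assms(2)] by (metis UnCI subsetD)
qed

lemma big_step_frame: "big_step M c \<sigma> t \<sigma>' \<Longrightarrow> frame c \<sigma> \<sigma>'"
  by (induction rule: big_step.induct) (auto simp: frame_def split: if_splits)


section \<open>Loops\<close>

abbreviation wset :: "string \<Rightarrow> nat \<Rightarrow> machine_state \<Rightarrow> machine_state" where
  "wset x v \<sigma> \<equiv> \<sigma>\<lparr>wvar := (wvar \<sigma>)(x := v)\<rparr>"

definition COUNT_UP :: "string \<Rightarrow> string \<Rightarrow> com \<Rightarrow> com" where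
  "COUNT_UP i X c = Loop (WLess (WVar i) (WVar X)) (c ;; WAssign i (WAdd (WVar i) (WConst 1)))"

definition FOR :: "string \<Rightarrow> string \<Rightarrow> com \<Rightarrow> com" where
  "FOR i X c = WAssign i (WConst 0) ;; COUNT_UP i X c"

text \<open>A loop of this form makes at most as many iterations as there is fuel.\<close>

definition FUELLED :: "bexp \<Rightarrow> com \<Rightarrow> com" where
  "FUELLED b c = Loop (BAnd (WLess (WConst 0) (WVar ''fuel'')) b)
     (WAssign ''fuel'' (WSub (WVar ''fuel'') (WConst 1)) ;; c)"

lemma FOR_modifies [simp]:
  "mod_wvars (FOR i X c) = insert i (mod_wvars c)" "mod_warrs (FOR i X c) = mod_warrs c"
  "mod_rvars (FOR i X c) = mod_rvars c" "mod_rarrs (FOR i X c) = mod_rarrs c"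
  by (auto simp: FOR_def COUNT_UP_def)

lemma FUELLED_modifies [simp]:
  "mod_wvars (FUELLED b c) = insert ''fuel'' (mod_wvars c)" "mod_warrs (FUELLED b c) = mod_warrs c"
  "mod_rvars (FUELLED b c) = mod_rvars c" "mod_rarrs (FUELLED b c) = mod_rarrs c"
  by (auto simp: FUELLED_def)

lemma big_step_COUNT_UP_exit: "wvar \<sigma> X \<le> wvar \<sigma> i \<Longrightarrow> big_step M (COUNT_UP i X c) \<sigma> 1 \<sigma>"
  unfolding COUNT_UP_def by (rule big_step.Loop_False) simp

lemma big_step_COUNT_UP_step:
  assumes "wvar \<sigma> i < wvar \<sigma> X" "wvar \<sigma> X < M" "i \<notin> mod_wvars c" "big_step M c \<sigma> t \<tau>"
    and "big_step M (COUNT_UP i X c) (wset i (Suc (wvar \<sigma> i)) \<tau>) u \<upsilon>"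
  shows "big_step M (COUNT_UP i X c) \<sigma> (t + u + 4) \<upsilon>"
proof -
  have "wvar \<tau> i = wvar \<sigma> i" using frameD(1)[OF big_step_frame[OF assms(4)] assms(3)] .
  then have "wval M \<tau> (WAdd (WVar i) (WConst 1)) = Suc (wvar \<sigma> i)" using assms(1,2) by (simp add: mod_simps)
  then have "big_step M (c ;; WAssign i (WAdd (WVar i) (WConst 1))) \<sigma> (t + 1 + 1) (wset i (Suc (wvar \<sigma> i)) \<tau>)"
    using big_step.Seq[OF assms(4) big_step.WAssign[of M i "WAdd (WVar i) (WConst 1)"]] by simp
  then have "big_step M (COUNT_UP i X c) \<sigma> (t + 1 + 1 + u + 2) \<upsilon>"
    unfolding COUNT_UP_def by (rule big_step.Loop_True[rotated]) (use assms in \<open>simp_all add: COUNT_UP_def\<close>)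
  moreover have "t + 1 + 1 + u + 2 = t + u + 4" by simp
  ultimately show ?thesis by (simp only:)
qed

lemma big_step_FOR:
  assumes "big_step M (COUNT_UP i X c) (wset i 0 \<sigma>) t \<tau>"
  shows "big_step M (FOR i X c) \<sigma> (t + 2) \<tau>"
  using big_step.Seq[OF big_step.WAssign[of M i "WConst 0" \<sigma>]] assms by (fastforce simp: FOR_def)


section \<open>Running time\<close>

text \<open>
  The words in \<open>V\<close> are constant while the program runs, and \<open>I\<close> only depends on them. Time is
  amortized: every unit of fuel that is used up pays for 50 steps.
\<close>

locale constant_words =
  fixes M :: nat and I :: "machine_state \<Rightarrow> bool" and V :: "string set"
  assumes M_gt_1: "1 < M" and fuel_not_constant: "''fuel'' \<notin> V"
    and depends_on: "I \<sigma> \<Longrightarrow> (\<And>x. x \<in> V \<Longrightarrow> wvar \<tau> x = wvar \<sigma> x) \<Longrightarrow> I \<tau>"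
begin

abbreviation amortized :: "nat \<Rightarrow> com \<Rightarrow> machine_state \<Rightarrow> bool" where
  "amortized k c \<sigma> \<equiv> \<exists>t \<tau>. big_step M c \<sigma> t \<tau> \<and> t + 50 * wvar \<tau> ''fuel'' \<le> k + 50 * wvar \<sigma> ''fuel''"

definition cost_le :: "nat \<Rightarrow> com \<Rightarrow> bool" where
  "cost_le k c \<longleftrightarrow> mod_wvars c \<inter> V = {} \<and> (\<forall>\<sigma>. I \<sigma> \<longrightarrow> amortized k c \<sigma>)"

lemma invariant_frame: "frame c \<sigma> \<tau> \<Longrightarrow> I \<sigma> \<Longrightarrow> mod_wvars c \<inter> V = {} \<Longrightarrow> I \<tau>"
  by (rule depends_on[of \<sigma>]) (auto simp: frame_def disjoint_iff)

lemma cost_le_mono: "cost_le k c \<Longrightarrow> k \<le> k' \<Longrightarrow> cost_le k' c"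
  unfolding cost_le_def by (meson add_le_mono1 order_trans)

lemma cost_le_Skip: "cost_le 0 Skip"
  unfolding cost_le_def using big_step.Skip by fastforce

lemma cost_le_assign:
  shows "x \<notin> V \<Longrightarrow> x \<noteq> ''fuel'' \<Longrightarrow> cost_le 1 (WAssign x e)" and "cost_le 1 (WStore a i e)"
    and "cost_le 1 (RAssign y r)" and "cost_le 1 (RStore a i r)"
  unfolding cost_le_def
  by (auto intro!: exI[of _ 1] exI[where P = "\<lambda>\<tau>. big_step M _ _ _ \<tau> \<and> _ \<tau>"]
      big_step.intros(2-5)[unfolded One_nat_def])

lemma cost_le_refuel:
  assumes "\<And>\<sigma>. I \<sigma> \<Longrightarrow> wvar \<sigma> X \<le> k"
  shows "cost_le (1 + 50 * k) (WAssign ''fuel'' (WVar X))"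
  unfolding cost_le_def
proof (intro conjI allI impI)
  fix \<sigma> assume "I \<sigma>"
  show "amortized (1 + 50 * k) (WAssign ''fuel'' (WVar X)) \<sigma>"
    using assms[OF \<open>I \<sigma>\<close>] big_step.WAssign[of M "''fuel''" "WVar X" \<sigma>] by (intro exI conjI) auto
qed (simp add: fuel_not_constant)

lemma cost_le_Seq:
  assumes c: "cost_le k c" and d: "cost_le k' d"
  shows "cost_le (k + k' + 1) (c ;; d)"
  unfolding cost_le_def
proof (intro conjI allI impI)
  show "mod_wvars (c ;; d) \<inter> V = {}" using c d by (auto simp: cost_le_def)
  fix \<sigma> assume I: "I \<sigma>"
  then obtain t \<tau> where t: "big_step M c \<sigma> t \<tau>" "t + 50 * wvar \<tau> ''fuel'' \<le> k + 50 * wvar \<sigma> ''fuel''"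
    using c unfolding cost_le_def by blast
  have "I \<tau>" using invariant_frame[OF big_step_frame[OF t(1)] I] c by (simp add: cost_le_def)
  then obtain u \<upsilon> where u: "big_step M d \<tau> u \<upsilon>" "u + 50 * wvar \<upsilon> ''fuel'' \<le> k' + 50 * wvar \<tau> ''fuel''"
    using d unfolding cost_le_def by blast
  show "amortized (k + k' + 1) (c ;; d) \<sigma>"
    by (intro exI conjI, rule big_step.Seq[OF t(1) u(1)]) (use t(2) u(2) in linarith)
qed

lemma cost_le_Cond:
  assumes c: "cost_le k c" and d: "cost_le k' d"
  shows "cost_le (k + k' + 1) (Cond b c d)"
  unfolding cost_le_def
proof (intro conjI allI impI)
  show "mod_wvars (Cond b c d) \<inter> V = {}" using c d by (auto simp: cost_le_def)
  fix \<sigma> assume I: "I \<sigma>"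
  have "cost_le (k + k') (if bval M \<sigma> b then c else d)" using cost_le_mono[OF c] cost_le_mono[OF d] by simp
  then obtain t \<tau> where t: "big_step M (if bval M \<sigma> b then c else d) \<sigma> t \<tau>"
    "t + 50 * wvar \<tau> ''fuel'' \<le> k + k' + 50 * wvar \<sigma> ''fuel''"
    using I unfolding cost_le_def by blast
  show "amortized (k + k' + 1) (Cond b c d) \<sigma>"
    by (intro exI conjI, rule big_step.Cond[OF t(1)]) (use t(2) in linarith)
qed

lemma amortized_COUNT_UP:
  assumes c: "cost_le k c" and i: "i \<notin> V" "i \<notin> mod_wvars c" "i \<noteq> ''fuel''" and X: "X \<in> V"
    and I: "I \<sigma>" and less: "wvar \<sigma> X < M"
  shows "amortized ((wvar \<sigma> X - wvar \<sigma> i) * (k + 4) + 1) (COUNT_UP i X c) \<sigma>"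
  using I less
proof (induction "wvar \<sigma> X - wvar \<sigma> i" arbitrary: \<sigma>)
  case 0
  show ?case by (intro exI conjI, rule big_step_COUNT_UP_exit) (use 0 in auto)
next
  case (Suc d)
  have lt: "wvar \<sigma> i < wvar \<sigma> X" using Suc.hyps(2) by simp
  obtain t \<tau> where t: "big_step M c \<sigma> t \<tau>" "t + 50 * wvar \<tau> ''fuel'' \<le> k + 50 * wvar \<sigma> ''fuel''"
    using c Suc.prems unfolding cost_le_def by blast
  let ?\<tau> = "wset i (Suc (wvar \<sigma> i)) \<tau>"
  have X': "wvar ?\<tau> X = wvar \<sigma> X" "X \<noteq> i"
    using frameD(1)[OF big_step_frame[OF t(1)], of X] X i c by (auto simp: cost_le_def)
  have "I \<tau>" using invariant_frame[OF big_step_frame[OF t(1)]] Suc.prems c by (simp add: cost_le_def)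
  then have "I ?\<tau>" by (rule depends_on) (use i in auto)
  moreover have "d = wvar ?\<tau> X - wvar ?\<tau> i" using Suc.hyps(2) X' by simp
  ultimately obtain u \<upsilon> where u: "big_step M (COUNT_UP i X c) ?\<tau> u \<upsilon>"
    "u + 50 * wvar \<upsilon> ''fuel'' \<le> d * (k + 4) + 1 + 50 * wvar ?\<tau> ''fuel''"
    using Suc.hyps(1)[of ?\<tau>] Suc.prems(2) X' by auto
  have "t + u + 4 + 50 * wvar \<upsilon> ''fuel'' \<le> Suc d * (k + 4) + 1 + 50 * wvar \<sigma> ''fuel''"
    using t(2) u(2) i by (simp add: algebra_simps)
  then show ?case
    using big_step_COUNT_UP_step[OF lt Suc.prems(2) i(2) t(1) u(1)] Suc.hyps(2) by (intro exI conjI) auto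
qed

lemma cost_le_FOR:
  assumes c: "cost_le k c" and X: "X \<in> V" "\<And>\<sigma>. I \<sigma> \<Longrightarrow> wvar \<sigma> X \<le> b \<and> wvar \<sigma> X < M"
    and i: "i \<notin> V" "i \<notin> mod_wvars c" "i \<noteq> ''fuel''"
  shows "cost_le (b * (k + 4) + 3) (FOR i X c)"
  unfolding cost_le_def
proof (intro conjI allI impI)
  show "mod_wvars (FOR i X c) \<inter> V = {}" using c i by (auto simp: cost_le_def)
  fix \<sigma> assume I: "I \<sigma>"
  let ?\<tau> = "wset i 0 \<sigma>"
  have "I ?\<tau>" using I by (rule depends_on) (use i in auto)
  moreover have "i \<noteq> X" using i X by auto
  ultimately obtain t \<tau> where t: "big_step M (COUNT_UP i X c) ?\<tau> t \<tau>"
    "t + 50 * wvar \<tau> ''fuel'' \<le> wvar \<sigma> X * (k + 4) + 1 + 50 * wvar \<sigma> ''fuel''"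
    using amortized_COUNT_UP[OF c i X(1), of ?\<tau>] X(2)[of ?\<tau>] i by auto
  moreover have "wvar \<sigma> X * (k + 4) \<le> b * (k + 4)" using X(2)[OF I] by (intro mult_le_mono1) simp
  ultimately show "amortized (b * (k + 4) + 3) (FOR i X c) \<sigma>"
    using big_step_FOR[OF t(1)] by (intro exI[of _ "t + 2"] exI[of _ \<tau>]) linarith
qed

lemma cost_le_FUELLED:
  assumes c: "cost_le k c" and k: "k \<le> 40" and fuel: "''fuel'' \<notin> mod_wvars c"
  shows "cost_le 1 (FUELLED b c)"
proof -
  have "amortized 1 (FUELLED b c) \<sigma>" if "I \<sigma>" "wvar \<sigma> ''fuel'' = F" for \<sigma> F
    using that
  proof (induction F arbitrary: \<sigma>)
    case 0
    show ?case
      unfolding FUELLED_def by (intro exI conjI, rule big_step.Loop_False) (use 0 in auto)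
  next
    case (Suc F)
    show ?case
    proof (cases "bval M \<sigma> b")
      case False
      show ?thesis
        unfolding FUELLED_def
        by (intro exI conjI, rule big_step.Loop_False) (use False Suc.prems in auto)
    next
      case True
      let ?\<tau> = "wset ''fuel'' F \<sigma>"
      have dec: "big_step M (WAssign ''fuel'' (WSub (WVar ''fuel'') (WConst 1))) \<sigma> 1 ?\<tau>"
        using big_step.WAssign[of M "''fuel''" "WSub (WVar ''fuel'') (WConst 1)" \<sigma>] Suc.prems(2) M_gt_1 by simp
      have "I ?\<tau>" using Suc.prems(1) by (rule depends_on) (use fuel_not_constant in auto)
      then obtain t \<upsilon> where t: "big_step M c ?\<tau> t \<upsilon>" "t + 50 * wvar \<upsilon> ''fuel'' \<le> k + 50 * F"
        using c unfolding cost_le_def by auto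
      have "wvar \<upsilon> ''fuel'' = F" using frameD(1)[OF big_step_frame[OF t(1)] fuel] by simp
      moreover have "I \<upsilon>" using invariant_frame[OF big_step_frame[OF t(1)] \<open>I ?\<tau>\<close>] c by (simp add: cost_le_def)
      ultimately obtain u \<omega> where u: "big_step M (FUELLED b c) \<upsilon> u \<omega>" "u + 50 * wvar \<omega> ''fuel'' \<le> 1 + 50 * F"
        using Suc.IH[of \<upsilon>] by auto
      have "big_step M (FUELLED b c) \<sigma> (1 + 1 + t + u + 2) \<omega>"
        using big_step.Loop_True[OF _ big_step.Seq[OF dec t(1)] u(1)[unfolded FUELLED_def]] True Suc.prems(2)
        by (simp add: FUELLED_def)
      moreover have "1 + 1 + t + u + 2 + 50 * wvar \<omega> ''fuel'' \<le> 1 + 50 * Suc F"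
        using t(2) u(2) k \<open>wvar \<upsilon> ''fuel'' = F\<close> by simp
      ultimately show ?thesis using Suc.prems(2) by (metis (no_types, lifting))
    qed
  qed
  then show ?thesis using c fuel_not_constant by (auto simp: cost_le_def)
qed

end


section \<open>Partial correctness\<close>

definition wlp :: "nat \<Rightarrow> com \<Rightarrow> (machine_state \<Rightarrow> bool) \<Rightarrow> machine_state \<Rightarrow> bool" where
  "wlp M c Q \<sigma> \<longleftrightarrow> (\<forall>t \<tau>. big_step M c \<sigma> t \<tau> \<longrightarrow> Q \<tau>)"

lemma wlp_Skip [simp]: "wlp M Skip Q \<sigma> = Q \<sigma>"
  and wlp_WAssign [simp]: "wlp M (WAssign x e) Q \<sigma> = Q (\<sigma>\<lparr>wvar := (wvar \<sigma>)(x := wval M \<sigma> e)\<rparr>)"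
  and wlp_WStore [simp]: "wlp M (WStore a i e) Q \<sigma> =
    Q (\<sigma>\<lparr>warr := (warr \<sigma>)(a := (warr \<sigma> a)(wval M \<sigma> i := wval M \<sigma> e))\<rparr>)"
  and wlp_RAssign [simp]: "wlp M (RAssign y r) Q \<sigma> = Q (\<sigma>\<lparr>rvar := (rvar \<sigma>)(y := rval M \<sigma> r)\<rparr>)"
  and wlp_RStore [simp]: "wlp M (RStore a i r) Q \<sigma> =
    Q (\<sigma>\<lparr>rarr := (rarr \<sigma>)(a := (rarr \<sigma> a)(wval M \<sigma> i := rval M \<sigma> r))\<rparr>)"
  by (auto simp: wlp_def intro: big_step.intros elim: SkipE WAssignE WStoreE RAssignE RStoreE)

lemma wlp_Seq [simp]: "wlp M (c ;; d) Q \<sigma> = wlp M c (wlp M d Q) \<sigma>"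
  unfolding wlp_def by (blast intro: big_step.Seq elim: SeqE)

lemma wlp_Cond [simp]:
  "wlp M (Cond b c d) Q \<sigma> = (if bval M \<sigma> b then wlp M c Q \<sigma> else wlp M d Q \<sigma>)"
proof -
  have "wlp M (Cond b c d) Q \<sigma> = wlp M (if bval M \<sigma> b then c else d) Q \<sigma>"
    unfolding wlp_def by (blast intro: big_step.Cond elim: CondE)
  then show ?thesis by simp
qed

lemma wlp_True [simp]: "wlp M c (\<lambda>_. True) \<sigma>"
  by (simp add: wlp_def)

lemma wlp_mono:
  assumes "wlp M c Q \<sigma>" and "\<And>\<tau>. frame c \<sigma> \<tau> \<Longrightarrow> Q \<tau> \<Longrightarrow> Q' \<tau>"
  shows "wlp M c Q' \<sigma>"
  using assms big_step_frame unfolding wlp_def by blast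

lemma wlp_Loop:
  assumes init: "I \<sigma>"
    and step: "\<And>\<tau>. frame c \<sigma> \<tau> \<Longrightarrow> I \<tau> \<Longrightarrow> bval M \<tau> b \<Longrightarrow> wlp M c I \<tau>"
    and exit: "\<And>\<tau>. frame c \<sigma> \<tau> \<Longrightarrow> I \<tau> \<Longrightarrow> \<not> bval M \<tau> b \<Longrightarrow> Q \<tau>"
  shows "wlp M (Loop b c) Q \<sigma>"
proof -
  have "Q \<upsilon>" if "big_step M (Loop b c) \<tau> t \<upsilon>" "I \<tau>" "frame c \<sigma> \<tau>" for \<tau> t \<upsilon>
    using that
  proof (induction "Loop b c" \<tau> t \<upsilon> rule: big_step.induct)
    case (Loop_True \<tau> t \<tau>' u \<upsilon>)
    have "frame c \<sigma> \<tau>'"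
      by (rule frame_trans[OF Loop_True.prems(2) big_step_frame[OF Loop_True.hyps(2)]]) auto
    moreover have "I \<tau>'"
      using step[of \<tau>] Loop_True.hyps(1,2) Loop_True.prems by (simp add: wlp_def)
    ultimately show ?case using Loop_True.hyps(5) by simp
  qed (use exit in auto)
  then show ?thesis using init frame_refl unfolding wlp_def by blast
qed

lemma wlp_FOR:
  assumes X: "wvar \<sigma> X < M" and i: "i \<notin> mod_wvars c" "X \<notin> mod_wvars c" "i \<noteq> X"
    and init: "I 0 (wset i 0 \<sigma>)"
    and step: "\<And>k \<tau>. k < wvar \<sigma> X \<Longrightarrow> frame (FOR i X c) \<sigma> \<tau> \<Longrightarrow> I k \<tau> \<Longrightarrow> wvar \<tau> i = k \<Longrightarrow>
      wlp M c (\<lambda>\<tau>'. I (Suc k) (wset i (Suc k) \<tau>')) \<tau>"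
    and exit: "\<And>\<tau>. frame (FOR i X c) \<sigma> \<tau> \<Longrightarrow> I (wvar \<sigma> X) \<tau> \<Longrightarrow> Q \<tau>"
  shows "wlp M (FOR i X c) Q \<sigma>"
proof -
  let ?body = "c ;; WAssign i (WAdd (WVar i) (WConst 1))" and ?\<sigma> = "wset i (0 mod M) \<sigma>"
  let ?I = "\<lambda>\<tau>. wvar \<tau> i \<le> wvar \<sigma> X \<and> I (wvar \<tau> i) \<tau>"
  have frame_FOR: "frame (FOR i X c) \<sigma> \<tau>" if "frame ?body ?\<sigma> \<tau>" for \<tau>
    using that by (auto simp: frame_def)
  have "wlp M (COUNT_UP i X c) Q ?\<sigma>"
    unfolding COUNT_UP_def
  proof (rule wlp_Loop[where I = ?I])
    show "?I ?\<sigma>" using init by simp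
    fix \<tau> assume frame: "frame ?body ?\<sigma> \<tau>" and I: "?I \<tau>"
    have X': "wvar \<tau> X = wvar \<sigma> X" using frameD(1)[OF frame, of X] i by simp
    {
      assume "bval M \<tau> (WLess (WVar i) (WVar X))"
      then have less: "wvar \<tau> i < wvar \<sigma> X" using X' by simp
      have "wlp M c (\<lambda>\<upsilon>. I (Suc (wvar \<tau> i)) (wset i (Suc (wvar \<tau> i)) \<upsilon>)) \<tau>"
        using I frame_FOR[OF frame] less by (intro step) auto
      then show "wlp M ?body ?I \<tau>"
        unfolding wlp_Seq
      proof (rule wlp_mono)
        fix \<upsilon> assume "frame c \<tau> \<upsilon>" and I': "I (Suc (wvar \<tau> i)) (wset i (Suc (wvar \<tau> i)) \<upsilon>)"
        then have "wvar \<upsilon> i = wvar \<tau> i" using i frameD(1) by blast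
        then show "wlp M (WAssign i (WAdd (WVar i) (WConst 1))) ?I \<upsilon>"
          using I' less X by (simp add: mod_simps)
      qed
    }
    {
      assume "\<not> bval M \<tau> (WLess (WVar i) (WVar X))"
      then have "wvar \<tau> i = wvar \<sigma> X" using I X' by simp
      then show "Q \<tau>" using I by (intro exit[OF frame_FOR[OF frame]]) metis
    }
  qed
  then show ?thesis by (simp add: FOR_def)
qed

lemma wlp_FUELLED:
  assumes M: "1 < M" and init: "I \<sigma>"
    and step: "\<And>\<tau>. frame (FUELLED b c) \<sigma> \<tau> \<Longrightarrow> I \<tau> \<Longrightarrow> 0 < wvar \<tau> ''fuel'' \<Longrightarrow> bval M \<tau> b \<Longrightarrow>
      wlp M c I (wset ''fuel'' (wvar \<tau> ''fuel'' - 1) \<tau>)"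
    and exit: "\<And>\<tau>. frame (FUELLED b c) \<sigma> \<tau> \<Longrightarrow> I \<tau> \<Longrightarrow> wvar \<tau> ''fuel'' = 0 \<or> \<not> bval M \<tau> b \<Longrightarrow> Q \<tau>"
  shows "wlp M (FUELLED b c) Q \<sigma>"
  unfolding FUELLED_def
proof (rule wlp_Loop[where I = I])
  show "I \<sigma>" by (rule init)
  let ?body = "WAssign ''fuel'' (WSub (WVar ''fuel'') (WConst 1)) ;; c"
  fix \<tau> assume "frame ?body \<sigma> \<tau>" and I: "I \<tau>"
  then have frame: "frame (FUELLED b c) \<sigma> \<tau>" by (auto simp: frame_def)
  show "wlp M ?body I \<tau>" if "bval M \<tau> (BAnd (WLess (WConst 0) (WVar ''fuel'')) b)"
    using step[OF frame I] that M by simp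
  show "Q \<tau>" if "\<not> bval M \<tau> (BAnd (WLess (WConst 0) (WVar ''fuel'')) b)"
    using exit[OF frame I] that by auto
qed

lemma wlp_FOR2:
  assumes X: "wvar \<sigma> X = a" "a < M" and Y: "wvar \<sigma> Y = b" "b < M"
    and vars: "{i, j} \<inter> mod_wvars c = {}" "{X, Y} \<inter> mod_wvars c = {}" "{i, j} \<inter> {X, Y} = {}" "i \<noteq> j"
    and indep: "\<And>x y v \<tau>. I x y (wset i v \<tau>) = I x y \<tau>" "\<And>x y v \<tau>. I x y (wset j v \<tau>) = I x y \<tau>"
    and init: "I 0 0 \<sigma>"
    and step: "\<And>x y \<tau>. x < a \<Longrightarrow> y < b \<Longrightarrow> frame (FOR i X (FOR j Y c)) \<sigma> \<tau> \<Longrightarrow> I x y \<tau> \<Longrightarrow>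
      wvar \<tau> i = x \<Longrightarrow> wvar \<tau> j = y \<Longrightarrow> wlp M c (I x (Suc y)) \<tau>"
    and row: "\<And>x \<tau>. x < a \<Longrightarrow> I x b \<tau> \<Longrightarrow> I (Suc x) 0 \<tau>"
    and exit: "\<And>\<tau>. frame (FOR i X (FOR j Y c)) \<sigma> \<tau> \<Longrightarrow> I a 0 \<tau> \<Longrightarrow> Q \<tau>"
  shows "wlp M (FOR i X (FOR j Y c)) Q \<sigma>"
proof (rule wlp_FOR[where I = "\<lambda>x. I x 0"])
  fix x \<tau>
  assume x: "x < wvar \<sigma> X" and frame: "frame (FOR i X (FOR j Y c)) \<sigma> \<tau>" and I: "I x 0 \<tau>" and i: "wvar \<tau> i = x"
  have Y': "wvar \<tau> Y = b" using frameD(1)[OF frame, of Y] vars Y by auto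
  show "wlp M (FOR j Y c) (\<lambda>\<upsilon>. I (Suc x) 0 (wset i (Suc x) \<upsilon>)) \<tau>"
    unfolding indep
  proof (rule wlp_FOR[where I = "I x"])
    fix y \<upsilon> assume y: "y < wvar \<tau> Y" and frame': "frame (FOR j Y c) \<tau> \<upsilon>" and I': "I x y \<upsilon>" and j: "wvar \<upsilon> j = y"
    have "frame (FOR i X (FOR j Y c)) \<sigma> \<upsilon>" by (rule frame_trans[OF frame frame']) auto
    moreover have "wvar \<upsilon> i = x" using frameD(1)[OF frame', of i] vars i by auto
    ultimately show "wlp M c (\<lambda>\<upsilon>. I x (Suc y) (wset j (Suc y) \<upsilon>)) \<upsilon>"
      unfolding indep using step x y X Y' I' j by simp
  qed (use I x X Y Y' vars row in \<open>auto simp: indep\<close>)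
qed (use X vars init exit in \<open>auto simp: indep\<close>)


section \<open>Expectations\<close>

definition expected_le :: "nat \<Rightarrow> nat \<Rightarrow> (machine_state \<Rightarrow> bool) \<Rightarrow> (machine_state \<Rightarrow> ennreal) \<Rightarrow> com \<Rightarrow>
    (machine_state \<Rightarrow> bool) \<Rightarrow> (machine_state \<Rightarrow> ennreal) \<Rightarrow> bool" where
  "expected_le M t P f c Q g \<longleftrightarrow> (\<forall>\<sigma>. P \<sigma> \<longrightarrow> (\<exists>p. halts M t c \<sigma> p \<and> (\<forall>\<tau>\<in>set_pmf p. Q \<tau>) \<and>
     (\<integral>\<^sup>+\<tau>. g \<tau> \<partial>measure_pmf p) \<le> f \<sigma>))"

lemma expected_le_big_step:
  assumes "\<And>\<sigma>. P \<sigma> \<Longrightarrow> \<exists>u \<tau>. big_step M c \<sigma> u \<tau> \<and> u \<le> t \<and> Q \<tau> \<and> g \<tau> \<le> f \<sigma>"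
  shows "expected_le M t P f c Q g"
  unfolding expected_le_def
proof (intro allI impI)
  fix \<sigma> assume "P \<sigma>"
  then obtain u \<tau> where u: "big_step M c \<sigma> u \<tau>" "u \<le> t" "Q \<tau>" "g \<tau> \<le> f \<sigma>" using assms by blast
  have "halts M t c \<sigma> (return_pmf \<tau>)" using halts_mono[OF big_step_halts[OF u(1)] u(2)] .
  then show "\<exists>p. halts M t c \<sigma> p \<and> (\<forall>\<tau>\<in>set_pmf p. Q \<tau>) \<and> (\<integral>\<^sup>+\<tau>. g \<tau> \<partial>measure_pmf p) \<le> f \<sigma>"
    using u by (intro exI[of _ "return_pmf \<tau>"]) (simp add: nn_integral_return)
qed

lemma expected_le_WAssign:
  assumes "\<And>\<sigma>. P \<sigma> \<Longrightarrow> Q (wset x (wval M \<sigma> e) \<sigma>) \<and> g (wset x (wval M \<sigma> e) \<sigma>) \<le> f \<sigma>"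
  shows "expected_le M 1 P f (WAssign x e) Q g"
  using assms big_step.WAssign by (intro expected_le_big_step) blast

lemma expected_le_mono:
  assumes "expected_le M t P f c Q g" "\<And>\<sigma>. P' \<sigma> \<Longrightarrow> P \<sigma> \<and> f \<sigma> \<le> f' \<sigma>" "t \<le> u"
  shows "expected_le M u P' f' c Q g"
  using assms halts_mono unfolding expected_le_def by (meson order_trans)

lemma expected_le_Seq:
  assumes c: "expected_le M t P f c Q g" and d: "expected_le M u Q g d R h"
  shows "expected_le M (t + 1 + u) P f (c ;; d) R h"
  unfolding expected_le_def
proof (intro allI impI)
  fix \<sigma> assume "P \<sigma>"
  then obtain p where p: "halts M t c \<sigma> p" "\<And>\<tau>. \<tau> \<in> set_pmf p \<Longrightarrow> Q \<tau>" "(\<integral>\<^sup>+\<tau>. g \<tau> \<partial>measure_pmf p) \<le> f \<sigma>"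
    using c unfolding expected_le_def by blast
  obtain r where r: "\<And>\<tau>. Q \<tau> \<Longrightarrow> halts M u d \<tau> (r \<tau>)" "\<And>\<tau> \<upsilon>. Q \<tau> \<Longrightarrow> \<upsilon> \<in> set_pmf (r \<tau>) \<Longrightarrow> R \<upsilon>"
    "\<And>\<tau>. Q \<tau> \<Longrightarrow> (\<integral>\<^sup>+\<upsilon>. h \<upsilon> \<partial>measure_pmf (r \<tau>)) \<le> g \<tau>"
    using d unfolding expected_le_def by metis
  have "(\<integral>\<^sup>+\<upsilon>. h \<upsilon> \<partial>measure_pmf (bind_pmf p r)) = (\<integral>\<^sup>+\<tau>. \<integral>\<^sup>+\<upsilon>. h \<upsilon> \<partial>measure_pmf (r \<tau>) \<partial>measure_pmf p)" by simp
  also have "\<dots> \<le> (\<integral>\<^sup>+\<tau>. g \<tau> \<partial>measure_pmf p)"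
    by (rule nn_integral_mono_AE) (use r(3) p(2) in \<open>auto simp: AE_measure_pmf_iff\<close>)
  finally have "(\<integral>\<^sup>+\<upsilon>. h \<upsilon> \<partial>measure_pmf (bind_pmf p r)) \<le> f \<sigma>" using p(3) by simp
  moreover have "halts M (t + 1 + u) (c ;; d) \<sigma> (bind_pmf p r)"
    by (rule halts_Seq[OF p(1)]) (rule r(1)[OF p(2)])
  moreover have "\<forall>\<upsilon>\<in>set_pmf (bind_pmf p r). R \<upsilon>" using r(2) p(2) by auto
  ultimately show "\<exists>p. halts M (t + 1 + u) (c ;; d) \<sigma> p \<and> (\<forall>\<upsilon>\<in>set_pmf p. R \<upsilon>) \<and>
      (\<integral>\<^sup>+\<upsilon>. h \<upsilon> \<partial>measure_pmf p) \<le> f \<sigma>" by blast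
qed

lemma expected_le_Loop:
  assumes "expected_le M t P f (c ;; Loop b c) Q g" "\<And>\<sigma>. P \<sigma> \<Longrightarrow> bval M \<sigma> b"
  shows "expected_le M (Suc t) P f (Loop b c) Q g"
  unfolding expected_le_def
proof (intro allI impI)
  fix \<sigma> assume P: "P \<sigma>"
  then obtain p where p: "halts M t (c ;; Loop b c) \<sigma> p" "\<forall>\<tau>\<in>set_pmf p. Q \<tau>" "(\<integral>\<^sup>+\<tau>. g \<tau> \<partial>measure_pmf p) \<le> f \<sigma>"
    using assms(1) unfolding expected_le_def by blast
  have "halts M (Suc t) (Loop b c) \<sigma> p" using p(1) assms(2)[OF P] by (simp add: halts_def bind_return_pmf)
  then show "\<exists>p. halts M (Suc t) (Loop b c) \<sigma> p \<and> (\<forall>\<tau>\<in>set_pmf p. Q \<tau>) \<and> (\<integral>\<^sup>+\<tau>. g \<tau> \<partial>measure_pmf p) \<le> f \<sigma>"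
    using p by blast
qed

lemma expected_le_COUNT_UP:
  assumes body: "\<And>k. k < b \<Longrightarrow> expected_le M t (\<lambda>\<sigma>. I k \<sigma> \<and> wvar \<sigma> i = k) (f k) c
      (\<lambda>\<tau>. I (Suc k) (wset i (Suc k) \<tau>) \<and> wvar \<tau> i = k) (\<lambda>\<tau>. f (Suc k) (wset i (Suc k) \<tau>))"
    and X: "\<And>k \<sigma>. I k \<sigma> \<Longrightarrow> wvar \<sigma> X = b" and b: "b < M" and k: "k \<le> b"
  shows "expected_le M ((b - k) * (t + 4) + 1) (\<lambda>\<sigma>. I k \<sigma> \<and> wvar \<sigma> i = k) (f k) (COUNT_UP i X c) (I b) (f b)"
  using k
proof (induction "b - k" arbitrary: k)
  case 0
  have "k = b" using 0 by simp
  show ?case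
    by (intro expected_le_big_step exI conjI, rule big_step_COUNT_UP_exit) (use X \<open>k = b\<close> in auto)
next
  case (Suc d)
  let ?inc = "WAssign i (WAdd (WVar i) (WConst 1))"
  have k: "k < b" "d = b - Suc k" "b - k = Suc (b - Suc k)" using Suc.hyps(2) by auto
  have inc: "wval M \<sigma> (WAdd (WVar i) (WConst 1)) = Suc k" if "wvar \<sigma> i = k" for \<sigma>
    using that k b by (simp add: mod_simps)
  have "expected_le M 1 (\<lambda>\<tau>. I (Suc k) (wset i (Suc k) \<tau>) \<and> wvar \<tau> i = k) (\<lambda>\<tau>. f (Suc k) (wset i (Suc k) \<tau>))
      ?inc (\<lambda>\<sigma>. I (Suc k) \<sigma> \<and> wvar \<sigma> i = Suc k) (f (Suc k))"
  proof (rule expected_le_WAssign, elim conjE)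
    fix \<sigma> assume i: "wvar \<sigma> i = k" and "I (Suc k) (wset i (Suc k) \<sigma>)"
    then show "(I (Suc k) (wset i (wval M \<sigma> (WAdd (WVar i) (WConst 1))) \<sigma>) \<and>
          wvar (wset i (wval M \<sigma> (WAdd (WVar i) (WConst 1))) \<sigma>) i = Suc k) \<and>
        f (Suc k) (wset i (wval M \<sigma> (WAdd (WVar i) (WConst 1))) \<sigma>) \<le> f (Suc k) (wset i (Suc k) \<sigma>)"
      unfolding inc[OF i] by simp
  qed
  from expected_le_Seq[OF expected_le_Seq[OF body[OF k(1)] this] Suc.hyps(1)[OF k(2)]]
  have "expected_le M (t + 1 + 1 + 1 + ((b - Suc k) * (t + 4) + 1)) (\<lambda>\<sigma>. I k \<sigma> \<and> wvar \<sigma> i = k) (f k)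
      ((c ;; ?inc) ;; COUNT_UP i X c) (I b) (f b)" using k(1) by simp
  then have "expected_le M (Suc (t + 1 + 1 + 1 + ((b - Suc k) * (t + 4) + 1))) (\<lambda>\<sigma>. I k \<sigma> \<and> wvar \<sigma> i = k) (f k)
      (COUNT_UP i X c) (I b) (f b)"
    unfolding COUNT_UP_def by (rule expected_le_Loop) (use X[of k] k in auto)
  then show ?case by (rule expected_le_mono) (simp_all add: k(3))
qed

lemma expected_le_FOR:
  assumes body: "\<And>k. k < b \<Longrightarrow> expected_le M t (\<lambda>\<sigma>. I k \<sigma> \<and> wvar \<sigma> i = k) (f k) c
      (\<lambda>\<tau>. I (Suc k) (wset i (Suc k) \<tau>) \<and> wvar \<tau> i = k) (\<lambda>\<tau>. f (Suc k) (wset i (Suc k) \<tau>))"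
    and X: "\<And>k \<sigma>. I k \<sigma> \<Longrightarrow> wvar \<sigma> X = b" and b: "b < M"
  shows "expected_le M (b * (t + 4) + 3) (\<lambda>\<sigma>. I 0 (wset i 0 \<sigma>)) (\<lambda>\<sigma>. f 0 (wset i 0 \<sigma>)) (FOR i X c) (I b) (f b)"
proof -
  have init: "expected_le M 1 (\<lambda>\<sigma>. I 0 (wset i 0 \<sigma>)) (\<lambda>\<sigma>. f 0 (wset i 0 \<sigma>)) (WAssign i (WConst 0))
      (\<lambda>\<sigma>. I 0 \<sigma> \<and> wvar \<sigma> i = 0) (f 0)"
    by (rule expected_le_WAssign) simp
  have "expected_le M (1 + 1 + ((b - 0) * (t + 4) + 1)) (\<lambda>\<sigma>. I 0 (wset i 0 \<sigma>))
      (\<lambda>\<sigma>. f 0 (wset i 0 \<sigma>)) (FOR i X c) (I b) (f b)"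
    unfolding FOR_def by (intro expected_le_Seq[OF init] expected_le_COUNT_UP body X b) auto
  moreover have "1 + 1 + ((b - 0) * (t + 4) + 1) = b * (t + 4) + 3" by simp
  ultimately show ?thesis by (simp only:)
qed


section \<open>The program\<close>

text \<open>
  The arrays \<open>M\<close>, \<open>H\<close>, \<open>W\<close>, \<open>A\<close>, \<open>sorted\<close> hold matrices over \<open>N\<close> nodes row by row, \<open>K\<close> and \<open>R\<close> hold
  the keys and the relaxed distances of Dijkstra's algorithm, and \<open>P\<close> accumulates the potentials of
  all reweightings. The nodes below \<open>n\<close> are the vertices, and the node \<open>(k + 1) n + w\<close> is the auxiliary
  node of level \<open>k\<close> of the vertex \<open>w\<close>. The fuel bounds the time even if the hubs are bad.
\<close>

definition index :: "string \<Rightarrow> string \<Rightarrow> wexp" where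
  "index a b = WAdd (WMult (WVar a) (WVar ''N'')) (WVar b)"

definition input_index :: "string \<Rightarrow> string \<Rightarrow> wexp" where
  "input_index a b = WAdd (WMult (WVar a) (WVar ''n'')) (WVar b)"

text \<open>
  The priority queue consists of about \<open>\<surd>n\<close> nodes per block, and \<open>first\<close> holds the minimum of each
  block. Nodes that have been extracted are marked in \<open>done\<close>.
\<close>

definition BEFORE :: "string \<Rightarrow> string \<Rightarrow> bexp" where
  "BEFORE a b = BAnd (WEq (WArr ''done'' (WVar a)) (WConst 0))
     (BNot (BAnd (WEq (WArr ''done'' (WVar b)) (WConst 0))
        (BNot (RLess (RArr ''K'' (WVar a)) (RArr ''K'' (WVar b))))))"

definition BLOCK_MIN :: com where
  "BLOCK_MIN =
     WAssign ''o'' (WMult (WVar ''j'') (WVar ''q'')) ;;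
     FOR ''y'' ''q''
       (WAssign ''e'' (WAdd (WMult (WVar ''j'') (WVar ''q'')) (WVar ''y'')) ;;
        Cond (BEFORE ''e'' ''o'') (WAssign ''o'' (WVar ''e'')) Skip) ;;
     WStore ''first'' (WVar ''j'') (WVar ''o'')"

definition EXTRACT_MIN :: com where
  "EXTRACT_MIN =
     WAssign ''p'' (WArr ''first'' (WConst 0)) ;;
     FOR ''y'' ''blocks''
       (WAssign ''e'' (WArr ''first'' (WVar ''y'')) ;;
        Cond (BEFORE ''e'' ''p'') (WAssign ''p'' (WVar ''e'')) Skip) ;;
     WStore ''done'' (WVar ''p'') (WConst 1) ;;
     WAssign ''j'' (WDiv (WVar ''p'') (WVar ''q'')) ;;
     BLOCK_MIN"

definition INIT_QUEUE :: "string \<Rightarrow> com" where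
  "INIT_QUEUE X =
     FOR ''x'' ''N'' (Cond (WLess (WVar ''x'') (WVar X))
       (WStore ''done'' (WVar ''x'') (WConst 0)) (WStore ''done'' (WVar ''x'') (WConst 1))) ;;
     FOR ''j'' ''blocks'' BLOCK_MIN"

definition DECREASE_KEY :: com where
  "DECREASE_KEY =
     WAssign ''j'' (WDiv (WVar ''w'') (WVar ''q'')) ;;
     WAssign ''o'' (WArr ''first'' (WVar ''j'')) ;;
     Cond (BEFORE ''w'' ''o'') (WStore ''first'' (WVar ''j'') (WVar ''w'')) Skip"

definition RELAX :: "string \<Rightarrow> string \<Rightarrow> wexp \<Rightarrow> com" where
  "RELAX G X e =
     RAssign ''x'' (RAdd (RVar ''v'') (RArr X e)) ;;
     Cond (RLess (RVar ''x'') (RArr ''R'' (WVar ''w''))) (RStore ''R'' (WVar ''w'') (RVar ''x'')) Skip ;;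
     Cond (BAnd (BNot (RLess (RArr G e) RZero)) (RLess (RVar ''x'') (RArr ''K'' (WVar ''w''))))
       (RStore ''K'' (WVar ''w'') (RVar ''x'') ;; DECREASE_KEY) Skip"

definition DIJKSTRA :: "com \<Rightarrow> com" where
  "DIJKSTRA c =
     FOR ''x'' ''N'' (RStore ''R'' (WVar ''x'') (RArr ''K'' (WVar ''x''))) ;;
     INIT_QUEUE ''N'' ;;
     FOR ''c'' ''N'' (EXTRACT_MIN ;; RAssign ''v'' (RArr ''K'' (WVar ''p'')) ;; c)"

definition RELAX_ALL :: "string \<Rightarrow> wexp \<Rightarrow> com" where
  "RELAX_ALL G e = FOR ''w'' ''N'' (RELAX G G e)"

definition RELAX_NEGATIVE :: com where
  "RELAX_NEGATIVE =
     WAssign ''i'' (WConst 0) ;;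
     FUELLED (BAnd (WLess (WVar ''i'') (WVar ''N'')) (BAnd (RLess (RVar ''v'') RZero)
         (RLess (RAdd (RVar ''v'') (RArr ''W''
            (WAdd (WMult (WVar ''p'') (WVar ''N'')) (WArr ''sorted'' (index ''p'' ''i''))))) RZero)))
       (WAssign ''w'' (WArr ''sorted'' (index ''p'' ''i'')) ;;
        RELAX ''M'' ''W'' (index ''p'' ''w'') ;;
        WAssign ''i'' (WAdd (WVar ''i'') (WConst 1)))"

definition LOAD_KEYS :: "string \<Rightarrow> wexp \<Rightarrow> com" where
  "LOAD_KEYS X e = FOR ''x'' ''N'' (RStore ''K'' (WVar ''x'') (RArr X e))"

definition DIJKSTRA_TWICE :: "string \<Rightarrow> wexp \<Rightarrow> com" where
  "DIJKSTRA_TWICE X e =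
     DIJKSTRA (RELAX_ALL X e) ;; LOAD_KEYS ''R'' (WVar ''x'') ;; DIJKSTRA (RELAX_ALL X e)"

definition SORT_ROW :: "string \<Rightarrow> string \<Rightarrow> com" where
  "SORT_ROW X e =
     LOAD_KEYS X (index ''r'' ''x'') ;;
     INIT_QUEUE e ;;
     FOR ''c'' e (EXTRACT_MIN ;; WStore ''sorted'' (index ''r'' ''c'') (WVar ''p''))"

definition SORT_ROWS :: "string \<Rightarrow> string \<Rightarrow> com" where
  "SORT_ROWS X e = FOR ''r'' e (SORT_ROW X e)"

definition COPY_MATRIX :: "string \<Rightarrow> string \<Rightarrow> com" where
  "COPY_MATRIX X Y = FOR ''r'' ''N'' (FOR ''x'' ''N'' (RStore Y (index ''r'' ''x'') (RArr X (index ''r'' ''x''))))"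

definition SHIFT_MATRIX :: "string \<Rightarrow> com" where
  "SHIFT_MATRIX X = FOR ''a'' ''N'' (FOR ''x'' ''N'' (RStore X (index ''a'' ''x'')
     (RAdd (RSub (RArr X (index ''a'' ''x'')) (RArr ''V'' (WVar ''a''))) (RArr ''V'' (WVar ''x'')))))"

definition REWEIGHT :: com where
  "REWEIGHT =
     FOR ''x'' ''N'' (RStore ''H'' (index ''x'' ''r'') (RArr ''V'' (WVar ''x''))) ;;
     FOR ''x'' ''N'' (RStore ''H'' (index ''r'' ''x'') (RArr ''R'' (WVar ''x''))) ;;
     SHIFT_MATRIX ''H'' ;;
     SHIFT_MATRIX ''W'' ;;
     FOR ''x'' ''n'' (RStore ''P'' (WVar ''x'') (RAdd (RArr ''P'' (WVar ''x'')) (RArr ''V'' (WVar ''x''))))"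

definition PROCESS_HUB :: com where
  "PROCESS_HUB =
     WAssign ''r'' (WArr ''hub'' (WVar ''h'')) ;;
     LOAD_KEYS ''H'' (index ''x'' ''r'') ;;
     DIJKSTRA_TWICE ''H'' (index ''w'' ''p'') ;;
     FOR ''x'' ''N'' (RStore ''V'' (WVar ''x'') (RArr ''K'' (WVar ''x''))) ;;
     LOAD_KEYS ''H'' (index ''r'' ''x'') ;;
     DIJKSTRA (RELAX_ALL ''H'' (index ''p'' ''w'')) ;;
     REWEIGHT"

definition EXPLORE_FROM :: com where
  "EXPLORE_FROM =
     LOAD_KEYS ''W'' (index ''u'' ''x'') ;;
     DIJKSTRA RELAX_NEGATIVE ;;
     FOR ''x'' ''n'' (RStore ''A'' (index ''u'' ''x'') (RArr ''R'' (WVar ''x'')))"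

definition MAX_ABS :: com where
  "MAX_ABS =
     RAssign ''g'' RZero ;;
     FOR ''u'' ''n'' (FOR ''w'' ''n''
       (Cond (RLess (RVar ''g'') (RArr ''A'' (index ''u'' ''w'')))
          (RAssign ''g'' (RArr ''A'' (index ''u'' ''w''))) Skip ;;
        Cond (RLess (RVar ''g'') (RSub RZero (RArr ''A'' (index ''u'' ''w''))))
          (RAssign ''g'' (RSub RZero (RArr ''A'' (index ''u'' ''w'')))) Skip))"

definition INIT_MATRIX :: com where
  "INIT_MATRIX =
     MAX_ABS ;;
     RAssign ''g'' (RAdd (RVar ''g'') (RAdd (RVar ''g'') (RVar ''g''))) ;;
     FOR ''u'' ''N'' (FOR ''w'' ''N'' (Cond (WEq (WVar ''u'') (WVar ''w''))
       (RStore ''M'' (index ''u'' ''w'') RZero)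
       (Cond (BAnd (WLess (WVar ''u'') (WVar ''n'')) (WLess (WVar ''w'') (WVar ''n'')))
          (RStore ''M'' (index ''u'' ''w'') (RArr ''A'' (index ''u'' ''w'')))
          (RStore ''M'' (index ''u'' ''w'') (RVar ''g'')))))"

definition ADD_SHORTCUTS :: com where
  "ADD_SHORTCUTS =
     WAssign ''i'' (WConst 0) ;;
     FUELLED (WLess (WVar ''i'') (WVar ''o''))
       (WAssign ''t'' (WArr ''sorted'' (index ''w'' ''i'')) ;;
        RAssign ''x'' (RAdd (RArr ''A'' (index ''u'' ''w'')) (RArr ''A'' (index ''w'' ''t''))) ;;
        Cond (RLess (RVar ''x'') (RArr ''M'' (index ''u'' ''t'')))
          (RStore ''M'' (index ''u'' ''t'') (RVar ''x'')) Skip ;;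
        WAssign ''i'' (WAdd (WVar ''i'') (WConst 1)))"

text \<open>The variables \<open>j\<close> and \<open>o\<close> hold the positions of the pivots of the levels \<open>k\<close> and \<open>k + 1\<close>.\<close>

definition SELECT_PIVOT :: com where
  "SELECT_PIVOT =
     WAssign ''a'' (WAdd (WMult (WAdd (WVar ''k'') (WConst 1)) (WVar ''n'')) (WVar ''w'')) ;;
     RAssign ''z'' (RArr ''A'' (WAdd (WMult (WVar ''w'') (WVar ''N'')) (WArr ''sorted'' (index ''w'' ''j'')))) ;;
     WAssign ''o'' (WAdd (WAdd (WVar ''j'') (WVar ''j'')) (WConst 1)) ;;
     Cond (WLess (WVar ''o'') (WVar ''n'')) Skip (WAssign ''o'' (WSub (WVar ''n'') (WConst 1)))"

definition FILL_OUT_EDGES :: com where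
  "FILL_OUT_EDGES = FOR ''t'' ''n'' (Cond (RLess (RArr ''A'' (index ''w'' ''t'')) (RVar ''z'')) Skip
     (RStore ''M'' (index ''a'' ''t'') (RSub (RArr ''A'' (index ''w'' ''t'')) (RVar ''z''))))"

definition FILL_IN_EDGES :: com where
  "FILL_IN_EDGES = FOR ''u'' ''n''
     (RAssign ''x'' (RAdd (RArr ''A'' (index ''u'' ''w'')) (RVar ''z'')) ;;
      Cond (RLess (RVar ''x'') RZero) ADD_SHORTCUTS (RStore ''M'' (index ''u'' ''a'') (RVar ''x'')))"

definition FILL_LEVEL :: com where
  "FILL_LEVEL = SELECT_PIVOT ;; FILL_OUT_EDGES ;; FILL_IN_EDGES ;; WAssign ''j'' (WVar ''o'')"

definition FILL_MATRIX :: com where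
  "FILL_MATRIX = FOR ''w'' ''n'' (WAssign ''j'' (WConst 0) ;; FOR ''k'' ''levels'' FILL_LEVEL)"

definition REFUEL :: "string \<Rightarrow> com" where
  "REFUEL X = WAssign ''fuel'' (WVar X)"

definition REWEIGHT_BY_HUBS :: com where
  "REWEIGHT_BY_HUBS = COPY_MATRIX ''M'' ''H'' ;; COPY_MATRIX ''M'' ''W'' ;; FOR ''h'' ''q'' PROCESS_HUB"

definition EXPLORE :: com where
  "EXPLORE = SORT_ROWS ''W'' ''N'' ;; REFUEL ''explore_fuel'' ;; FOR ''u'' ''n'' EXPLORE_FROM"

definition INSERT_SHORTCUTS :: com where
  "INSERT_SHORTCUTS = SORT_ROWS ''A'' ''n'' ;; INIT_MATRIX ;; REFUEL ''fill_fuel'' ;; FILL_MATRIX"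

definition ROUND :: com where
  "ROUND = REWEIGHT_BY_HUBS ;; EXPLORE ;; INSERT_SHORTCUTS"

definition SAMPLE_HUBS :: com where
  "SAMPLE_HUBS = FOR ''h'' ''q'' (Random ''x'' (WVar ''N'') ;; WStore ''hub'' (WVar ''h'') (WVar ''x''))"

definition COMPUTE_LOG_SIZE :: com where
  "COMPUTE_LOG_SIZE =
     WAssign ''p'' (WConst 1) ;;
     WAssign ''l'' (WConst 2) ;;
     FOR ''x'' ''n'' (Cond (WLess (WVar ''p'') (WVar ''n''))
       (WAssign ''p'' (WAdd (WVar ''p'') (WVar ''p'')) ;; WAssign ''l'' (WAdd (WVar ''l'') (WConst 1))) Skip)"

definition COMPUTE_SQRT_SIZE :: com where
  "COMPUTE_SQRT_SIZE =
     WAssign ''q'' (WConst 0) ;;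
     FOR ''x'' ''n'' (Cond (WLess (WMult (WVar ''q'') (WVar ''q'')) (WVar ''n''))
       (WAssign ''q'' (WAdd (WVar ''q'') (WConst 1))) Skip)"

definition COMPUTE_SIZES :: "nat \<Rightarrow> com" where
  "COMPUTE_SIZES C =
     COMPUTE_LOG_SIZE ;;
     COMPUTE_SQRT_SIZE ;;
     WAssign ''blocks'' (WMult (WVar ''q'') (WVar ''l'')) ;;
     WAssign ''N'' (WMult (WVar ''q'') (WVar ''blocks'')) ;;
     WAssign ''levels'' (WSub (WVar ''l'') (WConst 1)) ;;
     WAssign ''m'' (WMult (WConst C) (WMult (WVar ''l'') (WVar ''blocks''))) ;;
     WAssign ''explore_fuel'' (WMult (WVar ''n'') (WMult (WVar ''N'') (WVar ''m''))) ;;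
     WAssign ''fill_fuel''
       (WMult (WVar ''n'') (WMult (WMult (WConst 2) (WVar ''levels'')) (WMult (WVar ''n'') (WVar ''m''))))"

definition SUM_ABS_WEIGHTS :: com where
  "SUM_ABS_WEIGHTS =
     RAssign ''z'' RZero ;;
     FOR ''x'' ''n'' (FOR ''y'' ''n'' (Cond (RLess (RArr ''weight'' (input_index ''x'' ''y'')) RZero)
       (RAssign ''z'' (RSub (RVar ''z'') (RArr ''weight'' (input_index ''x'' ''y''))))
       (RAssign ''z'' (RAdd (RVar ''z'') (RArr ''weight'' (input_index ''x'' ''y''))))))"

definition LOAD_GRAPH :: com where
  "LOAD_GRAPH =
     SUM_ABS_WEIGHTS ;;
     RAssign ''z'' (RAdd (RVar ''z'') (RVar ''z'')) ;;
     FOR ''x'' ''n'' (FOR ''y'' ''n'' (Cond (WEq (WVar ''x'') (WVar ''y''))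
       (RStore ''A'' (index ''x'' ''y'') RZero)
       (Cond (WEq (WArr ''edge'' (input_index ''x'' ''y'')) (WConst 0))
          (RStore ''A'' (index ''x'' ''y'') (RVar ''z''))
          (RStore ''A'' (index ''x'' ''y'') (RArr ''weight'' (input_index ''x'' ''y''))))))"

definition COMPUTE_DISTANCES :: com where
  "COMPUTE_DISTANCES =
     LOAD_KEYS ''M'' (index ''s'' ''x'') ;;
     DIJKSTRA_TWICE ''M'' (index ''p'' ''w'') ;;
     FOR ''x'' ''n'' (RStore ''dist'' (WVar ''x'')
       (RAdd (RSub (RArr ''K'' (WVar ''x'')) (RArr ''P'' (WVar ''x''))) (RArr ''P'' (WVar ''s''))))"

definition FIND_UNSCANNED :: com where
  "FIND_UNSCANNED =
     WAssign ''p'' (WVar ''n'') ;;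
     FOR ''x'' ''n'' (Cond (BAnd (BNot (WEq (WArr ''reachable'' (WVar ''x'')) (WConst 0)))
         (WEq (WArr ''scanned'' (WVar ''x'')) (WConst 0))) (WAssign ''p'' (WVar ''x'')) Skip)"

definition SCAN_VERTEX :: com where
  "SCAN_VERTEX =
     WStore ''scanned'' (WVar ''p'') (WConst 1) ;;
     FOR ''x'' ''n'' (Cond (WEq (WArr ''edge'' (input_index ''p'' ''x'')) (WConst 0)) Skip
       (WStore ''reachable'' (WVar ''x'') (WConst 1)))"

definition MARK_REACHABLE :: com where
  "MARK_REACHABLE =
     WStore ''reachable'' (WVar ''s'') (WConst 1) ;;
     FOR ''c'' ''n'' (FIND_UNSCANNED ;; Cond (WLess (WVar ''p'') (WVar ''n'')) SCAN_VERTEX Skip)"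

definition CHECK_POTENTIAL :: com where
  "CHECK_POTENTIAL = FOR ''x'' ''n'' (FOR ''y'' ''n''
     (Cond (BAnd (BNot (WEq (WArr ''edge'' (input_index ''x'' ''y'')) (WConst 0)))
         (RLess (RAdd (RArr ''dist'' (WVar ''x'')) (RArr ''weight'' (input_index ''x'' ''y'')))
            (RArr ''dist'' (WVar ''y''))))
       (WAssign ''negative_cycle'' (WConst 1)) Skip))"

definition PASS :: com where
  "PASS = SAMPLE_HUBS ;; ROUND ;; WAssign ''fuel'' (WConst 0)"

definition ANSWER :: com where
  "ANSWER = COMPUTE_DISTANCES ;; MARK_REACHABLE ;; CHECK_POTENTIAL"

definition SSSP :: "nat \<Rightarrow> com" where
  "SSSP C = COMPUTE_SIZES C ;; (LOAD_GRAPH ;; INIT_MATRIX) ;; FOR ''g'' ''l'' PASS ;; ANSWER"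

lemma BLOCK_MIN_modifies [simp]:
  "mod_wvars BLOCK_MIN = {''o'', ''y'', ''e''}" "mod_warrs BLOCK_MIN = {''first''}"
  "mod_rvars BLOCK_MIN = {}" "mod_rarrs BLOCK_MIN = {}"
  by (auto simp: BLOCK_MIN_def)

lemma EXTRACT_MIN_modifies [simp]:
  "mod_wvars EXTRACT_MIN = {''p'', ''y'', ''e'', ''j'', ''o''}" "mod_warrs EXTRACT_MIN = {''first'', ''done''}"
  "mod_rvars EXTRACT_MIN = {}" "mod_rarrs EXTRACT_MIN = {}"
  by (auto simp: EXTRACT_MIN_def)

lemma INIT_QUEUE_modifies [simp]:
  "mod_wvars (INIT_QUEUE X) = {''x'', ''j'', ''o'', ''y'', ''e''}"
  "mod_warrs (INIT_QUEUE X) = {''first'', ''done''}"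
  "mod_rvars (INIT_QUEUE X) = {}" "mod_rarrs (INIT_QUEUE X) = {}"
  by (auto simp: INIT_QUEUE_def)

lemma DECREASE_KEY_modifies [simp]:
  "mod_wvars DECREASE_KEY = {''j'', ''o''}" "mod_warrs DECREASE_KEY = {''first''}"
  "mod_rvars DECREASE_KEY = {}" "mod_rarrs DECREASE_KEY = {}"
  by (auto simp: DECREASE_KEY_def)

lemma RELAX_modifies [simp]:
  "mod_wvars (RELAX G X e) = {''j'', ''o''}" "mod_warrs (RELAX G X e) = {''first''}"
  "mod_rvars (RELAX G X e) = {''x''}" "mod_rarrs (RELAX G X e) = {''R'', ''K''}"
  by (auto simp: RELAX_def)

lemma DIJKSTRA_modifies [simp]:
  "mod_wvars (DIJKSTRA c) = {''x'', ''p'', ''y'', ''e'', ''j'', ''o'', ''c''} \<union> mod_wvars c"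
  "mod_warrs (DIJKSTRA c) = {''first'', ''done''} \<union> mod_warrs c"
  "mod_rvars (DIJKSTRA c) = {''v''} \<union> mod_rvars c" "mod_rarrs (DIJKSTRA c) = {''R''} \<union> mod_rarrs c"
  by (auto simp: DIJKSTRA_def)

lemma RELAX_ALL_modifies [simp]:
  "mod_wvars (RELAX_ALL G e) = {''j'', ''o'', ''w''}" "mod_warrs (RELAX_ALL G e) = {''first''}"
  "mod_rvars (RELAX_ALL G e) = {''x''}" "mod_rarrs (RELAX_ALL G e) = {''R'', ''K''}"
  by (auto simp: RELAX_ALL_def)

lemma RELAX_NEGATIVE_modifies [simp]:
  "mod_wvars RELAX_NEGATIVE = {''j'', ''o'', ''w'', ''i'', ''fuel''}" "mod_warrs RELAX_NEGATIVE = {''first''}"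
  "mod_rvars RELAX_NEGATIVE = {''x''}" "mod_rarrs RELAX_NEGATIVE = {''R'', ''K''}"
  by (auto simp: RELAX_NEGATIVE_def)

lemma LOAD_KEYS_modifies [simp]:
  "mod_wvars (LOAD_KEYS X e) = {''x''}" "mod_warrs (LOAD_KEYS X e) = {}"
  "mod_rvars (LOAD_KEYS X e) = {}" "mod_rarrs (LOAD_KEYS X e) = {''K''}"
  by (auto simp: LOAD_KEYS_def)

lemma DIJKSTRA_TWICE_modifies [simp]:
  "mod_wvars (DIJKSTRA_TWICE X e) = {''x'', ''p'', ''y'', ''e'', ''j'', ''o'', ''c'', ''w''}"
  "mod_warrs (DIJKSTRA_TWICE X e) = {''first'', ''done''}"
  "mod_rvars (DIJKSTRA_TWICE X e) = {''v'', ''x''}" "mod_rarrs (DIJKSTRA_TWICE X e) = {''R'', ''K''}"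
  by (auto simp: DIJKSTRA_TWICE_def)

lemma SORT_ROW_modifies [simp]:
  "mod_wvars (SORT_ROW X e) = {''c'', ''x'', ''p'', ''y'', ''e'', ''j'', ''o''}"
  "mod_warrs (SORT_ROW X e) = {''first'', ''done'', ''sorted''}"
  "mod_rvars (SORT_ROW X e) = {}" "mod_rarrs (SORT_ROW X e) = {''K''}"
  by (auto simp: SORT_ROW_def)

lemma SORT_ROWS_modifies [simp]:
  "mod_wvars (SORT_ROWS X e) = {''r'', ''c'', ''x'', ''p'', ''y'', ''e'', ''j'', ''o''}"
  "mod_warrs (SORT_ROWS X e) = {''first'', ''done'', ''sorted''}"
  "mod_rvars (SORT_ROWS X e) = {}" "mod_rarrs (SORT_ROWS X e) = {''K''}"
  by (auto simp: SORT_ROWS_def)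

lemma COPY_MATRIX_modifies [simp]:
  "mod_wvars (COPY_MATRIX X Y) = {''r'', ''x''}" "mod_warrs (COPY_MATRIX X Y) = {}"
  "mod_rvars (COPY_MATRIX X Y) = {}" "mod_rarrs (COPY_MATRIX X Y) = {Y}"
  by (auto simp: COPY_MATRIX_def)

lemma SHIFT_MATRIX_modifies [simp]:
  "mod_wvars (SHIFT_MATRIX X) = {''a'', ''x''}" "mod_warrs (SHIFT_MATRIX X) = {}"
  "mod_rvars (SHIFT_MATRIX X) = {}" "mod_rarrs (SHIFT_MATRIX X) = {X}"
  by (auto simp: SHIFT_MATRIX_def)

lemma REWEIGHT_modifies [simp]:
  "mod_wvars REWEIGHT = {''a'', ''x''}" "mod_warrs REWEIGHT = {}"
  "mod_rvars REWEIGHT = {}" "mod_rarrs REWEIGHT = {''H'', ''W'', ''P''}"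
  by (auto simp: REWEIGHT_def)

lemma PROCESS_HUB_modifies [simp]:
  "mod_wvars PROCESS_HUB = {''r'', ''a'', ''x'', ''p'', ''y'', ''e'', ''j'', ''o'', ''c'', ''w''}"
  "mod_warrs PROCESS_HUB = {''first'', ''done''}"
  "mod_rvars PROCESS_HUB = {''v'', ''x''}" "mod_rarrs PROCESS_HUB = {''H'', ''W'', ''P'', ''V'', ''K'', ''R''}"
  by (auto simp: PROCESS_HUB_def)

lemma EXPLORE_FROM_modifies [simp]:
  "mod_wvars EXPLORE_FROM = {''x'', ''p'', ''y'', ''e'', ''j'', ''o'', ''c'', ''w'', ''i'', ''fuel''}"
  "mod_warrs EXPLORE_FROM = {''first'', ''done''}"
  "mod_rvars EXPLORE_FROM = {''v'', ''x''}" "mod_rarrs EXPLORE_FROM = {''A'', ''K'', ''R''}"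
  by (auto simp: EXPLORE_FROM_def)

lemma MAX_ABS_modifies [simp]:
  "mod_wvars MAX_ABS = {''u'', ''w''}" "mod_warrs MAX_ABS = {}" "mod_rvars MAX_ABS = {''g''}"
  "mod_rarrs MAX_ABS = {}"
  by (auto simp: MAX_ABS_def)

lemma INIT_MATRIX_modifies [simp]:
  "mod_wvars INIT_MATRIX = {''u'', ''w''}" "mod_warrs INIT_MATRIX = {}"
  "mod_rvars INIT_MATRIX = {''g''}" "mod_rarrs INIT_MATRIX = {''M''}"
  by (auto simp: INIT_MATRIX_def)

lemma ADD_SHORTCUTS_modifies [simp]:
  "mod_wvars ADD_SHORTCUTS = {''i'', ''t'', ''fuel''}" "mod_warrs ADD_SHORTCUTS = {}"
  "mod_rvars ADD_SHORTCUTS = {''x''}" "mod_rarrs ADD_SHORTCUTS = {''M''}"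
  by (auto simp: ADD_SHORTCUTS_def)

lemma SELECT_PIVOT_modifies [simp]:
  "mod_wvars SELECT_PIVOT = {''a'', ''o''}" "mod_warrs SELECT_PIVOT = {}"
  "mod_rvars SELECT_PIVOT = {''z''}" "mod_rarrs SELECT_PIVOT = {}"
  by (auto simp: SELECT_PIVOT_def)

lemma FILL_OUT_EDGES_modifies [simp]:
  "mod_wvars FILL_OUT_EDGES = {''t''}" "mod_warrs FILL_OUT_EDGES = {}"
  "mod_rvars FILL_OUT_EDGES = {}" "mod_rarrs FILL_OUT_EDGES = {''M''}"
  by (auto simp: FILL_OUT_EDGES_def)

lemma FILL_IN_EDGES_modifies [simp]:
  "mod_wvars FILL_IN_EDGES = {''u'', ''i'', ''t'', ''fuel''}" "mod_warrs FILL_IN_EDGES = {}"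
  "mod_rvars FILL_IN_EDGES = {''x''}" "mod_rarrs FILL_IN_EDGES = {''M''}"
  by (auto simp: FILL_IN_EDGES_def)

lemma FILL_LEVEL_modifies [simp]:
  "mod_wvars FILL_LEVEL = {''a'', ''i'', ''t'', ''fuel'', ''o'', ''u'', ''j''}" "mod_warrs FILL_LEVEL = {}"
  "mod_rvars FILL_LEVEL = {''x'', ''z''}" "mod_rarrs FILL_LEVEL = {''M''}"
  by (auto simp: FILL_LEVEL_def)

lemma FILL_MATRIX_modifies [simp]:
  "mod_wvars FILL_MATRIX = {''w'', ''k'', ''a'', ''i'', ''t'', ''fuel'', ''o'', ''u'', ''j''}"
  "mod_warrs FILL_MATRIX = {}"
  "mod_rvars FILL_MATRIX = {''x'', ''z''}" "mod_rarrs FILL_MATRIX = {''M''}"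
  by (auto simp: FILL_MATRIX_def)

lemma REFUEL_modifies [simp]:
  "mod_wvars (REFUEL X) = {''fuel''}" "mod_warrs (REFUEL X) = {}" "mod_rvars (REFUEL X) = {}"
  "mod_rarrs (REFUEL X) = {}"
  by (auto simp: REFUEL_def)

lemma REWEIGHT_BY_HUBS_modifies [simp]:
  "mod_wvars REWEIGHT_BY_HUBS = {''h'', ''r'', ''a'', ''x'', ''p'', ''y'', ''e'', ''j'', ''o'', ''c'', ''w''}"
  "mod_warrs REWEIGHT_BY_HUBS = {''first'', ''done''}"
  "mod_rvars REWEIGHT_BY_HUBS = {''v'', ''x''}"
  "mod_rarrs REWEIGHT_BY_HUBS = {''H'', ''W'', ''P'', ''V'', ''K'', ''R''}"
  by (auto simp: REWEIGHT_BY_HUBS_def)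

lemma EXPLORE_modifies [simp]:
  "mod_wvars EXPLORE = {''r'', ''u'', ''x'', ''p'', ''y'', ''e'', ''j'', ''o'', ''c'', ''w'', ''i'', ''fuel''}"
  "mod_warrs EXPLORE = {''first'', ''done'', ''sorted''}"
  "mod_rvars EXPLORE = {''v'', ''x''}" "mod_rarrs EXPLORE = {''A'', ''K'', ''R''}"
  by (auto simp: EXPLORE_def)

lemma INSERT_SHORTCUTS_modifies [simp]:
  "mod_wvars INSERT_SHORTCUTS =
     {''r'', ''c'', ''x'', ''p'', ''y'', ''e'', ''w'', ''k'', ''a'', ''i'', ''t'', ''fuel'', ''o'', ''u'', ''j''}"
  "mod_warrs INSERT_SHORTCUTS = {''first'', ''done'', ''sorted''}"
  "mod_rvars INSERT_SHORTCUTS = {''g'', ''x'', ''z''}" "mod_rarrs INSERT_SHORTCUTS = {''K'', ''M''}"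
  by (auto simp: INSERT_SHORTCUTS_def)

lemma ROUND_modifies [simp]:
  "mod_wvars ROUND = {''h'', ''w'', ''k'', ''a'', ''i'', ''t'', ''fuel'', ''o'', ''u'', ''j'', ''r'', ''c'', ''x'', ''p'', ''y'', ''e''}"
  "mod_warrs ROUND = {''first'', ''done'', ''sorted''}" "mod_rvars ROUND = {''x'', ''z'', ''g'', ''v''}"
  "mod_rarrs ROUND = {''M'', ''A'', ''H'', ''W'', ''P'', ''V'', ''K'', ''R''}"
  by (auto simp: ROUND_def)

lemma SAMPLE_HUBS_modifies [simp]:
  "mod_wvars SAMPLE_HUBS = {''h'', ''x''}" "mod_warrs SAMPLE_HUBS = {''hub''}"
  "mod_rvars SAMPLE_HUBS = {}" "mod_rarrs SAMPLE_HUBS = {}"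
  by (auto simp: SAMPLE_HUBS_def)

lemma LOAD_GRAPH_modifies [simp]:
  "mod_wvars LOAD_GRAPH = {''x'', ''y''}" "mod_warrs LOAD_GRAPH = {}"
  "mod_rvars LOAD_GRAPH = {''z''}" "mod_rarrs LOAD_GRAPH = {''A''}"
  by (auto simp: LOAD_GRAPH_def SUM_ABS_WEIGHTS_def)

lemma COMPUTE_DISTANCES_modifies [simp]:
  "mod_wvars COMPUTE_DISTANCES = {''x'', ''p'', ''y'', ''e'', ''j'', ''o'', ''c'', ''w''}"
  "mod_warrs COMPUTE_DISTANCES = {''first'', ''done''}"
  "mod_rvars COMPUTE_DISTANCES = {''v'', ''x''}" "mod_rarrs COMPUTE_DISTANCES = {''R'', ''K'', ''dist''}"
  by (auto simp: COMPUTE_DISTANCES_def)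

lemma FIND_UNSCANNED_modifies [simp]:
  "mod_wvars FIND_UNSCANNED = {''p'', ''x''}" "mod_warrs FIND_UNSCANNED = {}"
  "mod_rvars FIND_UNSCANNED = {}" "mod_rarrs FIND_UNSCANNED = {}"
  by (auto simp: FIND_UNSCANNED_def)

lemma SCAN_VERTEX_modifies [simp]:
  "mod_wvars SCAN_VERTEX = {''x''}" "mod_warrs SCAN_VERTEX = {''reachable'', ''scanned''}"
  "mod_rvars SCAN_VERTEX = {}" "mod_rarrs SCAN_VERTEX = {}"
  by (auto simp: SCAN_VERTEX_def)

lemma MARK_REACHABLE_modifies [simp]:
  "mod_wvars MARK_REACHABLE = {''c'', ''p'', ''x''}" "mod_warrs MARK_REACHABLE = {''reachable'', ''scanned''}"
  "mod_rvars MARK_REACHABLE = {}" "mod_rarrs MARK_REACHABLE = {}"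
  by (auto simp: MARK_REACHABLE_def)

lemma CHECK_POTENTIAL_modifies [simp]:
  "mod_wvars CHECK_POTENTIAL = {''x'', ''y'', ''negative_cycle''}" "mod_warrs CHECK_POTENTIAL = {}"
  "mod_rvars CHECK_POTENTIAL = {}" "mod_rarrs CHECK_POTENTIAL = {}"
  by (auto simp: CHECK_POTENTIAL_def)


section \<open>The sizes\<close>

definition log_size :: "nat \<Rightarrow> nat" where
  "log_size n = (LEAST k. n \<le> 2 ^ k) + 2"

definition sqrt_size :: "nat \<Rightarrow> nat" where
  "sqrt_size n = (LEAST k. n \<le> k * k)"

lemma log_size_ge_2: "2 \<le> log_size n"
  and le_power_log_size: "n \<le> 2 ^ (log_size n - 2)"
  and log_size_le: "log_size n \<le> n + 2"
  and power_less_log_size: "k < log_size n - 2 \<Longrightarrow> 2 ^ k < n"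
proof -
  have n: "n \<le> 2 ^ n" by (simp add: less_imp_le)
  show "2 \<le> log_size n" by (simp add: log_size_def)
  show "n \<le> 2 ^ (log_size n - 2)" unfolding log_size_def using LeastI[of "\<lambda>k. n \<le> 2 ^ k", OF n] by simp
  show "log_size n \<le> n + 2" unfolding log_size_def using Least_le[of "\<lambda>k. n \<le> 2 ^ k", OF n] by simp
  show "2 ^ k < n" if "k < log_size n - 2"
    using that not_less_Least[of k "\<lambda>k. n \<le> 2 ^ k"] by (simp add: log_size_def)
qed

lemma le_sqrt_size_square: "n \<le> sqrt_size n * sqrt_size n"
  and sqrt_size_le: "sqrt_size n \<le> n"
  and square_less_sqrt_size: "k < sqrt_size n \<Longrightarrow> k * k < n"
proof -
  have n: "n \<le> n * n" by (cases n) auto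
  show "n \<le> sqrt_size n * sqrt_size n" unfolding sqrt_size_def by (rule LeastI[of "\<lambda>k. n \<le> k * k", OF n])
  show "sqrt_size n \<le> n" unfolding sqrt_size_def by (rule Least_le[of "\<lambda>k. n \<le> k * k", OF n])
  show "k * k < n" if "k < sqrt_size n"
    using that not_less_Least[of k "\<lambda>k. n \<le> k * k"] by (simp add: sqrt_size_def)
qed

locale sizes =
  fixes n s C :: nat
  assumes n_ge_1: "1 \<le> n" and s_less: "s < n"
begin

definition "q = sqrt_size n"
definition "l = log_size n"
definition "limit = word_bound (C + 12) n"
definition "blocks = q * l"
definition "N = q * blocks"
definition "levels = l - 1"
definition "m = C * (l * blocks)"
definition "explore_fuel = n * (N * m)"
definition "fill_fuel = n * (2 * levels * (n * m))"

lemma q_ge_1: "1 \<le> q" and n_le_q_square: "n \<le> q * q" and q_le_n: "q \<le> n"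
  and l_ge_2: "2 \<le> l" and n_le_power_l: "n \<le> 2 ^ (l - 2)"
proof -
  show "n \<le> q * q" unfolding q_def by (rule le_sqrt_size_square)
  then show "1 \<le> q" using n_ge_1 by (cases q) auto
  show "q \<le> n" unfolding q_def by (rule sqrt_size_le)
  show "2 \<le> l" unfolding l_def by (rule log_size_ge_2)
  show "n \<le> 2 ^ (l - 2)" unfolding l_def by (rule le_power_log_size)
qed

lemma le_power_imp_less_limit: "x \<le> (n + 1) ^ e \<Longrightarrow> e < C + 12 \<Longrightarrow> x < limit"
  unfolding limit_def word_bound_def
  by (erule le_less_trans, rule power_strict_increasing) (use n_ge_1 in auto)

lemma size_le_power:
  shows "n \<le> (n + 1) ^ 1" and "q \<le> (n + 1) ^ 1" and "l \<le> (n + 1) ^ 2" and "levels \<le> (n + 1) ^ 2"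
    and "C \<le> (n + 1) ^ C" and "blocks \<le> (n + 1) ^ 3" and "N \<le> (n + 1) ^ 4" and "m \<le> (n + 1) ^ (C + 5)"
    and "n * m \<le> (n + 1) ^ (C + 6)" and "N * m \<le> (n + 1) ^ (C + 9)" and "2 * levels \<le> (n + 1) ^ 3"
    and "2 * levels * (n * m) \<le> (n + 1) ^ (C + 9)" and "explore_fuel \<le> (n + 1) ^ (C + 10)"
    and "fill_fuel \<le> (n + 1) ^ (C + 10)" and "N * N \<le> (n + 1) ^ 8"
proof -
  have mult: "x * y \<le> (n + 1) ^ c" if "x \<le> (n + 1) ^ a" "y \<le> (n + 1) ^ b" "a + b = c" for x y a b c
    using mult_le_mono[OF that(1,2)] that(3) by (simp add: power_add[symmetric])
  show n: "n \<le> (n + 1) ^ 1" and q: "q \<le> (n + 1) ^ 1" using q_le_n by simp_all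
  have "l \<le> n + 2" unfolding l_def by (rule log_size_le)
  also have "\<dots> \<le> (n + 1) * 2" by simp
  also have "\<dots> \<le> (n + 1) ^ 2" unfolding power2_eq_square using n_ge_1 by (intro mult_le_mono2) simp
  finally show l: "l \<le> (n + 1) ^ 2" .
  then show levels: "levels \<le> (n + 1) ^ 2" by (simp add: levels_def)
  have "C \<le> 2 ^ C" by (simp add: less_imp_le)
  also have "\<dots> \<le> (n + 1) ^ C" using n_ge_1 by (intro power_mono) auto
  finally show C: "C \<le> (n + 1) ^ C" .
  show blocks: "blocks \<le> (n + 1) ^ 3" unfolding blocks_def by (rule mult[OF q l]) simp
  show N: "N \<le> (n + 1) ^ 4" unfolding N_def by (rule mult[OF q blocks]) simp
  show "m \<le> (n + 1) ^ (C + 5)" unfolding m_def by (rule mult[OF C mult[OF l blocks refl]]) simp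
  then show nm: "n * m \<le> (n + 1) ^ (C + 6)" and Nm: "N * m \<le> (n + 1) ^ (C + 9)"
    by (rule mult[OF n], simp, rule mult[OF N], simp)
  have "2 \<le> (n + 1) ^ 1" using n_ge_1 by simp
  then show twice: "2 * levels \<le> (n + 1) ^ 3" by (rule mult[OF _ levels]) simp
  show steps: "2 * levels * (n * m) \<le> (n + 1) ^ (C + 9)" by (rule mult[OF twice nm]) simp
  show "explore_fuel \<le> (n + 1) ^ (C + 10)" unfolding explore_fuel_def by (rule mult[OF n Nm]) simp
  show "fill_fuel \<le> (n + 1) ^ (C + 10)" unfolding fill_fuel_def by (rule mult[OF n steps]) simp
  show "N * N \<le> (n + 1) ^ 8" by (rule mult[OF N N]) simp
qed

definition size_table :: "(string \<times> nat) list" where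
  "size_table = [(''n'', n), (''s'', s), (''q'', q), (''l'', l), (''N'', N), (''blocks'', blocks),
     (''levels'', levels), (''m'', m), (''explore_fuel'', explore_fuel), (''fill_fuel'', fill_fuel)]"

definition size_vars :: "string set" where
  "size_vars = fst ` set size_table"

definition sized :: "machine_state \<Rightarrow> bool" where
  "sized \<sigma> \<longleftrightarrow> (\<forall>(x, v)\<in>set size_table. wvar \<sigma> x = v)"

lemma size_vars_eq: "size_vars =
    {''n'', ''s'', ''q'', ''l'', ''N'', ''blocks'', ''levels'', ''m'', ''explore_fuel'', ''fill_fuel''}"
  by (simp add: size_vars_def size_table_def)

lemma size_table_simps [simp]:
  "(''n'', n) \<in> set size_table" "(''q'', q) \<in> set size_table" "(''l'', l) \<in> set size_table"
  "(''N'', N) \<in> set size_table" "(''blocks'', blocks) \<in> set size_table" "(''levels'', levels) \<in> set size_table"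
  by (simp_all add: size_table_def)

lemma sizedD:
  assumes "sized \<sigma>"
  shows "wvar \<sigma> ''n'' = n" "wvar \<sigma> ''s'' = s" "wvar \<sigma> ''q'' = q" "wvar \<sigma> ''l'' = l" "wvar \<sigma> ''N'' = N"
    "wvar \<sigma> ''blocks'' = blocks" "wvar \<sigma> ''levels'' = levels" "wvar \<sigma> ''explore_fuel'' = explore_fuel"
    "wvar \<sigma> ''fill_fuel'' = fill_fuel"
  using assms by (auto simp: sized_def size_table_def)

lemma sized_cong: "(\<And>x. x \<in> size_vars \<Longrightarrow> wvar \<tau> x = wvar \<sigma> x) \<Longrightarrow> sized \<tau> = sized \<sigma>"
  unfolding sized_def size_vars_def by (intro ball_cong) force+

lemma sized_update [simp]:
  "sized (\<sigma>\<lparr>warr := a\<rparr>) = sized \<sigma>" "sized (\<sigma>\<lparr>rvar := r\<rparr>) = sized \<sigma>" "sized (\<sigma>\<lparr>rarr := b\<rparr>) = sized \<sigma>"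
  by (simp_all add: sized_def)

lemma sized_wset [simp]: "x \<notin> size_vars \<Longrightarrow> sized (\<sigma>\<lparr>wvar := f(x := v)\<rparr>) = sized (\<sigma>\<lparr>wvar := f\<rparr>)"
  by (rule sized_cong) auto

lemma sized_frame: "frame c \<sigma> \<tau> \<Longrightarrow> sized \<sigma> \<Longrightarrow> mod_wvars c \<inter> size_vars = {} \<Longrightarrow> sized \<tau>"
  using sized_cong[of \<tau> \<sigma>] by (auto simp: frame_def disjoint_iff)

sublocale auxiliary_nodes n N levels
proof
  show "1 \<le> n" "1 \<le> levels" using n_ge_1 l_ge_2 by (auto simp: levels_def)
  show "n \<le> 2 ^ (levels - 1)" using n_le_power_l by (simp add: levels_def diff_diff_left flip: numeral_2_eq_2)
  have "(levels + 1) * n \<le> l * (q * q)" using n_le_q_square l_ge_2 by (intro mult_le_mono) (auto simp: levels_def)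
  then show "(levels + 1) * n \<le> N" by (simp add: N_def blocks_def ac_simps)
qed

lemma N_ge_1: "1 \<le> N"
  using n_le_N n_ge_1 by linarith

lemma limit_gt_1: "1 < limit"
  unfolding limit_def word_bound_def using n_ge_1 by (intro one_less_power) auto

lemma less_limit:
  shows "n < limit" and "q < limit" and "l < limit" and "levels < limit" and "C < limit" and "blocks < limit"
    and "N < limit" and "m < limit" and "n * m < limit" and "N * m < limit" and "2 * levels < limit"
    and "2 * levels * (n * m) < limit" and "explore_fuel < limit" and "fill_fuel < limit" and "N * N < limit"
  by (rule size_le_power[THEN le_power_imp_less_limit], simp)+

lemma size_less_limit: "(X, b) \<in> set size_table \<Longrightarrow> b < limit"
  using less_limit s_less by (auto simp: size_table_def)

end


section \<open>The running time of the parts\<close>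

context sizes
begin

sublocale constant_words limit sized size_vars
proof
  show "1 < limit" by (rule limit_gt_1)
  show "''fuel'' \<notin> size_vars" by (simp add: size_vars_eq)
  show "sized \<tau>" if "sized \<sigma>" "\<And>x. x \<in> size_vars \<Longrightarrow> wvar \<tau> x = wvar \<sigma> x" for \<sigma> \<tau>
    using that sized_cong by blast
qed

definition poly_cost :: "nat \<Rightarrow> nat \<Rightarrow> nat \<Rightarrow> com \<Rightarrow> bool" where
  "poly_cost k i j c \<longleftrightarrow> cost_le (k * q ^ i * l ^ j) c"

lemma power_le_power:
  assumes "k \<le> k'" "i \<le> i'" "j \<le> j'"
  shows "k * q ^ i * l ^ j \<le> k' * q ^ i' * l ^ j'"
  using assms q_ge_1 l_ge_2 by (intro mult_mono power_increasing) auto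

lemma poly_cost_mono: "poly_cost k i j c \<Longrightarrow> k \<le> k' \<Longrightarrow> i \<le> i' \<Longrightarrow> j \<le> j' \<Longrightarrow> poly_cost k' i' j' c"
  unfolding poly_cost_def using cost_le_mono power_le_power by blast

lemma poly_cost_simple:
  shows "poly_cost 0 0 0 Skip" and "x \<notin> size_vars \<Longrightarrow> x \<noteq> ''fuel'' \<Longrightarrow> poly_cost 1 0 0 (WAssign x e)"
    and "poly_cost 1 0 0 (WStore a i e)" and "poly_cost 1 0 0 (RAssign y r)" and "poly_cost 1 0 0 (RStore a i r)"
  unfolding poly_cost_def using cost_le_Skip cost_le_assign by simp_all

lemma poly_cost_add:
  assumes "\<And>a b. cost_le a c \<Longrightarrow> cost_le b d \<Longrightarrow> cost_le (a + b + 1) e"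
    and "poly_cost k i j c" "poly_cost k' i' j' d"
  shows "poly_cost (k + k' + 1) (max i i') (max j j') e"
proof -
  let ?i = "max i i'" and ?j = "max j j'"
  have "poly_cost k ?i ?j c" "poly_cost k' ?i ?j d" using assms(2,3) by (auto elim: poly_cost_mono)
  then have "cost_le (k * q ^ ?i * l ^ ?j + k' * q ^ ?i * l ^ ?j + 1) e"
    unfolding poly_cost_def by (rule assms(1))
  moreover have "1 \<le> 1 * q ^ ?i * l ^ ?j" using q_ge_1 l_ge_2 by simp
  ultimately show ?thesis
    unfolding poly_cost_def by (elim cost_le_mono) (simp only: distrib_right add_mono order_refl)
qed

lemmas poly_cost_Seq = poly_cost_add[OF cost_le_Seq]
  and poly_cost_Cond = poly_cost_add[OF cost_le_Cond]

lemma poly_cost_FOR: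
  assumes X: "(X, b) \<in> set size_table" "b \<le> q ^ i * l ^ j" and c: "poly_cost k i' j' c"
    and v: "v \<notin> size_vars" "v \<notin> mod_wvars c" "v \<noteq> ''fuel''"
  shows "poly_cost (k + 7) (i + i') (j + j') (FOR v X c)"
proof -
  let ?Q = "q ^ i * l ^ j" and ?R = "q ^ i' * l ^ j'"
  have "cost_le (?Q * (k * q ^ i' * l ^ j' + 4) + 3) (FOR v X c)"
  proof (rule cost_le_FOR[OF c[unfolded poly_cost_def]])
    show "X \<in> size_vars" using X(1) unfolding size_vars_def by force
    show "wvar \<sigma> X \<le> ?Q \<and> wvar \<sigma> X < limit" if "sized \<sigma>" for \<sigma>
      using that X size_less_limit by (fastforce simp: sized_def)
  qed (use v in auto)
  moreover have "?Q * (k * q ^ i' * l ^ j' + 4) + 3 \<le> (k + 7) * q ^ (i + i') * l ^ (j + j')"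
  proof -
    have "1 \<le> ?R" "1 \<le> ?Q" using q_ge_1 l_ge_2 by auto
    then have "?Q * 1 \<le> ?Q * ?R" "1 * 1 \<le> ?Q * ?R" by (blast intro: mult_le_mono2, blast intro: mult_le_mono)
    then have "k * (?Q * ?R) + 4 * (?Q * 1) + 3 * (1 * 1) \<le> k * (?Q * ?R) + 4 * (?Q * ?R) + 3 * (?Q * ?R)"
      by linarith
    then have "?Q * (k * q ^ i' * l ^ j' + 4) + 3 \<le> k * (?Q * ?R) + 4 * (?Q * ?R) + 3 * (?Q * ?R)"
      by (simp add: distrib_left ac_simps)
    also have "\<dots> = (k + 7) * q ^ (i + i') * l ^ (j + j')" by (simp add: power_add algebra_simps)
    finally show ?thesis .
  qed
  ultimately show ?thesis unfolding poly_cost_def by (rule cost_le_mono)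
qed

lemma poly_cost_FOR_n: "poly_cost k i j c \<Longrightarrow> v \<notin> size_vars \<Longrightarrow> v \<notin> mod_wvars c \<Longrightarrow> v \<noteq> ''fuel'' \<Longrightarrow>
    poly_cost (k + 7) (2 + i) (0 + j) (FOR v ''n'' c)"
  by (rule poly_cost_FOR[OF size_table_simps(1)]) (use n_le_q_square in \<open>auto simp: power2_eq_square\<close>)

lemma poly_cost_FOR_N: "poly_cost k i j c \<Longrightarrow> v \<notin> size_vars \<Longrightarrow> v \<notin> mod_wvars c \<Longrightarrow> v \<noteq> ''fuel'' \<Longrightarrow>
    poly_cost (k + 7) (2 + i) (1 + j) (FOR v ''N'' c)"
  by (rule poly_cost_FOR[OF size_table_simps(4)]) (auto simp: power2_eq_square N_def blocks_def)

lemma poly_cost_FOR_blocks: "poly_cost k i j c \<Longrightarrow> v \<notin> size_vars \<Longrightarrow> v \<notin> mod_wvars c \<Longrightarrow> v \<noteq> ''fuel'' \<Longrightarrow>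
    poly_cost (k + 7) (1 + i) (1 + j) (FOR v ''blocks'' c)"
  by (rule poly_cost_FOR[OF size_table_simps(5)]) (auto simp: blocks_def)

lemma poly_cost_FOR_q: "poly_cost k i j c \<Longrightarrow> v \<notin> size_vars \<Longrightarrow> v \<notin> mod_wvars c \<Longrightarrow> v \<noteq> ''fuel'' \<Longrightarrow>
    poly_cost (k + 7) (1 + i) (0 + j) (FOR v ''q'' c)"
  by (rule poly_cost_FOR[OF size_table_simps(2)]) auto

lemma poly_cost_FOR_levels: "poly_cost k i j c \<Longrightarrow> v \<notin> size_vars \<Longrightarrow> v \<notin> mod_wvars c \<Longrightarrow> v \<noteq> ''fuel'' \<Longrightarrow>
    poly_cost (k + 7) (0 + i) (1 + j) (FOR v ''levels'' c)"
  by (rule poly_cost_FOR[OF size_table_simps(6)]) (auto simp: levels_def)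

lemma poly_cost_FUELLED:
  assumes "poly_cost k i j c" "i = 0" "j = 0" "k \<le> 40" "''fuel'' \<notin> mod_wvars c"
  shows "poly_cost 1 0 0 (FUELLED b c)"
  using assms cost_le_FUELLED unfolding poly_cost_def by simp

lemma poly_cost_REFUEL:
  assumes "\<And>\<sigma>. sized \<sigma> \<Longrightarrow> wvar \<sigma> X \<le> k * q ^ i * l ^ j"
  shows "poly_cost (1 + 50 * k) i j (REFUEL X)"
proof -
  have "1 \<le> q ^ i * l ^ j" using q_ge_1 l_ge_2 by simp
  then have "1 + 50 * (k * q ^ i * l ^ j) \<le> (1 + 50 * k) * q ^ i * l ^ j" by (simp add: distrib_right)
  then show ?thesis unfolding poly_cost_def REFUEL_def using cost_le_mono[OF cost_le_refuel[OF assms]] by blast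
qed

lemma poly_cost_REFUEL_explore: "poly_cost (1 + 50 * C) 5 3 (REFUEL ''explore_fuel'')"
proof (rule poly_cost_REFUEL)
  have "explore_fuel \<le> (q * q) * (N * m)" unfolding explore_fuel_def by (intro mult_mono n_le_q_square) auto
  also have "\<dots> = C * q ^ 5 * l ^ 3" by (simp add: N_def blocks_def m_def power_numeral_reduce)
  finally show "wvar \<sigma> ''explore_fuel'' \<le> C * q ^ 5 * l ^ 3" if "sized \<sigma>" for \<sigma> using that by (simp add: sizedD)
qed

lemma poly_cost_REFUEL_fill: "poly_cost (1 + 50 * (2 * C)) 5 3 (REFUEL ''fill_fuel'')"
proof (rule poly_cost_REFUEL)
  have "fill_fuel \<le> (q * q) * (2 * l * ((q * q) * m))"
    unfolding fill_fuel_def levels_def by (intro mult_mono n_le_q_square) auto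
  also have "\<dots> = 2 * C * q ^ 5 * l ^ 3" by (simp add: blocks_def m_def power_numeral_reduce)
  finally show "wvar \<sigma> ''fill_fuel'' \<le> 2 * C * q ^ 5 * l ^ 3" if "sized \<sigma>" for \<sigma> using that by (simp add: sizedD)
qed

lemmas poly_cost_intros = poly_cost_simple poly_cost_Seq poly_cost_Cond poly_cost_FOR_n poly_cost_FOR_N
  poly_cost_FOR_blocks poly_cost_FOR_q poly_cost_FOR_levels poly_cost_FUELLED

lemma poly_cost_BLOCK_MIN: "poly_cost 30 1 0 BLOCK_MIN"
  unfolding BLOCK_MIN_def by (rule poly_cost_mono, (rule poly_cost_intros | (simp add: size_vars_eq; fail))+)

lemma poly_cost_EXTRACT_MIN: "poly_cost 100 1 1 EXTRACT_MIN"
  unfolding EXTRACT_MIN_def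
  by (rule poly_cost_mono, (rule poly_cost_intros poly_cost_BLOCK_MIN | (simp add: size_vars_eq; fail))+)

lemma poly_cost_INIT_QUEUE: "poly_cost 100 2 1 (INIT_QUEUE X)"
  unfolding INIT_QUEUE_def
  by (rule poly_cost_mono, (rule poly_cost_intros poly_cost_BLOCK_MIN | (simp add: size_vars_eq; fail))+)

lemma poly_cost_RELAX: "poly_cost 20 0 0 (RELAX G X e)"
  unfolding RELAX_def DECREASE_KEY_def
  by (rule poly_cost_mono, (rule poly_cost_intros | (simp add: size_vars_eq; fail))+)

lemma poly_cost_RELAX_ALL: "poly_cost 30 2 1 (RELAX_ALL G e)"
  unfolding RELAX_ALL_def
  by (rule poly_cost_mono, (rule poly_cost_intros poly_cost_RELAX | (simp add: size_vars_eq; fail))+)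

lemma poly_cost_RELAX_NEGATIVE: "poly_cost 10 0 0 RELAX_NEGATIVE"
  unfolding RELAX_NEGATIVE_def
  by (rule poly_cost_mono, (rule poly_cost_intros poly_cost_RELAX | (simp add: size_vars_eq; fail))+)

lemma poly_cost_DIJKSTRA_all: "poly_cost 300 4 2 (DIJKSTRA (RELAX_ALL G e))"
  unfolding DIJKSTRA_def
  by (rule poly_cost_mono, (rule poly_cost_intros poly_cost_RELAX_ALL poly_cost_INIT_QUEUE poly_cost_EXTRACT_MIN |
      (simp add: size_vars_eq; fail))+)

lemma poly_cost_DIJKSTRA_negative: "poly_cost 300 3 2 (DIJKSTRA RELAX_NEGATIVE)"
  unfolding DIJKSTRA_def
  by (rule poly_cost_mono, (rule poly_cost_intros poly_cost_RELAX_NEGATIVE poly_cost_INIT_QUEUE poly_cost_EXTRACT_MIN |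
      (simp add: size_vars_eq; fail))+)

lemma poly_cost_LOAD_KEYS: "poly_cost 10 2 1 (LOAD_KEYS X e)"
  unfolding LOAD_KEYS_def by (rule poly_cost_mono, (rule poly_cost_intros | (simp add: size_vars_eq; fail))+)

lemma poly_cost_DIJKSTRA_TWICE: "poly_cost 700 4 2 (DIJKSTRA_TWICE G e)"
  unfolding DIJKSTRA_TWICE_def
  by (rule poly_cost_mono, (rule poly_cost_intros poly_cost_DIJKSTRA_all poly_cost_LOAD_KEYS |
      (simp add: size_vars_eq; fail))+)

lemma poly_cost_SORT_ROWS_N: "poly_cost 300 5 3 (SORT_ROWS X ''N'')"
  unfolding SORT_ROWS_def SORT_ROW_def
  by (rule poly_cost_mono, (rule poly_cost_intros poly_cost_LOAD_KEYS poly_cost_INIT_QUEUE poly_cost_EXTRACT_MIN |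
      (simp add: size_vars_eq; fail))+)

lemma poly_cost_SORT_ROWS_n: "poly_cost 300 5 1 (SORT_ROWS X ''n'')"
  unfolding SORT_ROWS_def SORT_ROW_def
  by (rule poly_cost_mono, (rule poly_cost_intros poly_cost_LOAD_KEYS poly_cost_INIT_QUEUE poly_cost_EXTRACT_MIN |
      (simp add: size_vars_eq; fail))+)

lemma poly_cost_PROCESS_HUB: "poly_cost 2000 4 2 PROCESS_HUB"
  unfolding PROCESS_HUB_def REWEIGHT_def SHIFT_MATRIX_def
  by (rule poly_cost_mono, (rule poly_cost_intros poly_cost_LOAD_KEYS poly_cost_DIJKSTRA_TWICE poly_cost_DIJKSTRA_all |
      (simp add: size_vars_eq; fail))+)

lemma poly_cost_REWEIGHT_BY_HUBS: "poly_cost 2500 5 2 REWEIGHT_BY_HUBS"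
  unfolding REWEIGHT_BY_HUBS_def COPY_MATRIX_def
  by (rule poly_cost_mono, (rule poly_cost_intros poly_cost_PROCESS_HUB | (simp add: size_vars_eq; fail))+)

lemma poly_cost_EXPLORE: "poly_cost (1000 + 50 * C) 5 3 EXPLORE"
  unfolding EXPLORE_def EXPLORE_FROM_def
  by (rule poly_cost_mono, (rule poly_cost_intros poly_cost_SORT_ROWS_N poly_cost_REFUEL_explore poly_cost_LOAD_KEYS
      poly_cost_DIJKSTRA_negative | (simp add: size_vars_eq; fail))+)

lemma poly_cost_INIT_MATRIX: "poly_cost 100 4 2 INIT_MATRIX"
  unfolding INIT_MATRIX_def MAX_ABS_def
  by (rule poly_cost_mono, (rule poly_cost_intros | (simp add: size_vars_eq; fail))+)

lemma poly_cost_ADD_SHORTCUTS: "poly_cost 10 0 0 ADD_SHORTCUTS"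
  unfolding ADD_SHORTCUTS_def by (rule poly_cost_mono, (rule poly_cost_intros | (simp add: size_vars_eq; fail))+)

lemma poly_cost_FILL_MATRIX: "poly_cost 200 4 1 FILL_MATRIX"
  unfolding FILL_MATRIX_def FILL_LEVEL_def SELECT_PIVOT_def FILL_OUT_EDGES_def FILL_IN_EDGES_def
  by (rule poly_cost_mono, (rule poly_cost_intros poly_cost_ADD_SHORTCUTS | (simp add: size_vars_eq; fail))+)

lemma poly_cost_ROUND: "poly_cost (5000 + 150 * C) 5 3 ROUND"
  unfolding ROUND_def INSERT_SHORTCUTS_def
  by (rule poly_cost_mono, (rule poly_cost_intros poly_cost_REWEIGHT_BY_HUBS poly_cost_EXPLORE poly_cost_SORT_ROWS_n
      poly_cost_INIT_MATRIX poly_cost_REFUEL_fill poly_cost_FILL_MATRIX | (simp add: size_vars_eq; fail))+)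

lemma poly_cost_LOAD: "poly_cost 300 4 2 (LOAD_GRAPH ;; INIT_MATRIX)"
  unfolding LOAD_GRAPH_def SUM_ABS_WEIGHTS_def
  by (rule poly_cost_mono, (rule poly_cost_intros poly_cost_INIT_MATRIX | (simp add: size_vars_eq; fail))+)

lemma poly_cost_ANSWER: "poly_cost 2000 4 2 ANSWER"
  unfolding ANSWER_def COMPUTE_DISTANCES_def MARK_REACHABLE_def FIND_UNSCANNED_def SCAN_VERTEX_def CHECK_POTENTIAL_def
  by (rule poly_cost_mono, (rule poly_cost_intros poly_cost_LOAD_KEYS poly_cost_DIJKSTRA_TWICE |
      (simp add: size_vars_eq; fail))+)

lemma sized_time:
  assumes "poly_cost k i j c" "sized \<sigma>" "wvar \<sigma> ''fuel'' = 0"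
  obtains t \<tau> where "big_step limit c \<sigma> t \<tau>" "t \<le> k * q ^ i * l ^ j"
  using assms unfolding poly_cost_def cost_le_def by force

end


section \<open>Verification conditions\<close>

lemma wval_cong: "wvar \<tau> = wvar \<sigma> \<Longrightarrow> warr \<tau> = warr \<sigma> \<Longrightarrow> wval M \<tau> e = wval M \<sigma> e"
  by (induction e) simp_all

context sizes
begin

abbreviation entry :: "machine_state \<Rightarrow> string \<Rightarrow> nat \<Rightarrow> nat \<Rightarrow> real" where
  "entry \<sigma> a x y \<equiv> rarr \<sigma> a (x * N + y)"

lemma limit_simps [simp]: "Suc 0 mod limit = Suc 0" "limit \<noteq> Suc 0" "limit \<noteq> 0"
  using limit_gt_1 by auto

lemma pair_less_limit: "x < N \<Longrightarrow> y < N \<Longrightarrow> x * N + y < limit"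
proof -
  assume x: "x < N" and "y < N"
  then have "x * N + y < Suc x * N" by simp
  also have "\<dots> \<le> N * N" using x by (intro mult_le_mono1) simp
  finally show ?thesis using less_limit(15) by simp
qed

lemma pair_eq_iff: "y < N \<Longrightarrow> y' < N \<Longrightarrow> x * N + y = x' * N + y' \<longleftrightarrow> x = x' \<and> y = y'"
proof
  assume y: "y < N" "y' < N" and "x * N + y = x' * N + y'"
  then have "(x * N + y) div N = (x' * N + y') div N" "(x * N + y) mod N = (x' * N + y') mod N" by simp_all
  then show "x = x' \<and> y = y'" using y by simp
qed simp

lemma wval_index [simp]:
  assumes "wvar \<sigma> ''N'' = N" "wvar \<sigma> a < N" "wvar \<sigma> b < N"
  shows "wval limit \<sigma> (index a b) = wvar \<sigma> a * N + wvar \<sigma> b"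
  using pair_less_limit[OF assms(2,3)] assms by (simp add: index_def)

definition executes :: "com \<Rightarrow> machine_state \<Rightarrow> machine_state \<Rightarrow> bool" where
  "executes c \<sigma> \<tau> \<longleftrightarrow> (\<exists>t. big_step limit c \<sigma> t \<tau>)"

lemma wlpI: "(\<And>\<tau>. executes c \<sigma> \<tau> \<Longrightarrow> Q \<tau>) \<Longrightarrow> wlp limit c Q \<sigma>"
  by (auto simp: wlp_def executes_def)

lemma wlpD: "wlp limit c Q \<sigma> \<Longrightarrow> executes c \<sigma> \<tau> \<Longrightarrow> Q \<tau>"
  by (auto simp: wlp_def executes_def)

lemma executes_Seq: "executes (c ;; d) \<sigma> \<upsilon> \<longleftrightarrow> (\<exists>\<tau>. executes c \<sigma> \<tau> \<and> executes d \<tau> \<upsilon>)"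
  unfolding executes_def by (blast intro: big_step.Seq elim: SeqE)

lemma executes_WAssign: "executes (WAssign x e) \<sigma> \<tau> \<longleftrightarrow> \<tau> = wset x (wval limit \<sigma> e) \<sigma>"
  unfolding executes_def by (auto intro: big_step.WAssign elim: WAssignE)

lemma executes_RAssign: "executes (RAssign x r) \<sigma> \<tau> \<longleftrightarrow> \<tau> = \<sigma>\<lparr>rvar := (rvar \<sigma>)(x := rval limit \<sigma> r)\<rparr>"
  unfolding executes_def by (auto intro: big_step.RAssign elim: RAssignE)

lemma executes_frame: "executes c \<sigma> \<tau> \<Longrightarrow> frame c \<sigma> \<tau>"
  using big_step_frame by (auto simp: executes_def)

lemma executes_sized: "executes c \<sigma> \<tau> \<Longrightarrow> sized \<sigma> \<Longrightarrow> mod_wvars c \<inter> size_vars = {} \<Longrightarrow> sized \<tau>"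
  using executes_frame sized_frame by blast

lemma sized_lookup:
  assumes "sized \<sigma>" "(X, b) \<in> set size_table"
  shows "wvar \<sigma> X = b \<and> b < limit \<and> X \<in> size_vars"
proof (intro conjI)
  show "wvar \<sigma> X = b" using bspec[OF assms(1)[unfolded sized_def] assms(2)] by simp
  show "b < limit" using assms(2) by (rule size_less_limit)
  show "X \<in> size_vars" using imageI[OF assms(2), of fst] by (simp add: size_vars_def)
qed

lemma wlp_FOR_size:
  assumes sized: "sized \<sigma>" and X: "(X, b) \<in> set size_table"
    and vars: "i \<notin> size_vars" "i \<notin> mod_wvars c" "mod_wvars c \<inter> size_vars = {}"
    and indep: "\<And>k v \<tau>. I k (wset i v \<tau>) = I k \<tau>"
    and init: "I 0 \<sigma>"
    and step: "\<And>k \<tau>. k < b \<Longrightarrow> sized \<tau> \<Longrightarrow> frame (FOR i X c) \<sigma> \<tau> \<Longrightarrow> wvar \<tau> i = k \<Longrightarrow> I k \<tau> \<Longrightarrow>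
      wlp limit c (I (Suc k)) \<tau>"
    and exit: "\<And>\<tau>. sized \<tau> \<Longrightarrow> frame (FOR i X c) \<sigma> \<tau> \<Longrightarrow> I b \<tau> \<Longrightarrow> Q \<tau>"
  shows "wlp limit (FOR i X c) Q \<sigma>"
proof -
  note X' = sized_lookup[OF sized X]
  have sized': "sized \<tau>" if "frame (FOR i X c) \<sigma> \<tau>" for \<tau>
    by (rule sized_frame[OF that sized]) (use vars in auto)
  show ?thesis
  proof (rule wlp_FOR[where I = I])
    show "wvar \<sigma> X < limit" "X \<notin> mod_wvars c" "i \<noteq> X" using X' vars by auto
  qed (use X' vars init step exit sized' in \<open>auto simp: indep\<close>)
qed

lemma wlp_FOR2_size:
  assumes sized: "sized \<sigma>" and X: "(X, a) \<in> set size_table" and Y: "(Y, b) \<in> set size_table"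
    and vars: "i \<notin> size_vars" "j \<notin> size_vars" "{i, j} \<inter> mod_wvars c = {}" "mod_wvars c \<inter> size_vars = {}" "i \<noteq> j"
    and indep: "\<And>x y v \<tau>. I x y (wset i v \<tau>) = I x y \<tau>" "\<And>x y v \<tau>. I x y (wset j v \<tau>) = I x y \<tau>"
    and init: "I 0 0 \<sigma>"
    and step: "\<And>x y \<tau>. x < a \<Longrightarrow> y < b \<Longrightarrow> sized \<tau> \<Longrightarrow> frame (FOR i X (FOR j Y c)) \<sigma> \<tau> \<Longrightarrow>
      wvar \<tau> i = x \<Longrightarrow> wvar \<tau> j = y \<Longrightarrow> I x y \<tau> \<Longrightarrow> wlp limit c (I x (Suc y)) \<tau>"
    and row: "\<And>x \<tau>. x < a \<Longrightarrow> I x b \<tau> \<Longrightarrow> I (Suc x) 0 \<tau>"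
    and exit: "\<And>\<tau>. sized \<tau> \<Longrightarrow> frame (FOR i X (FOR j Y c)) \<sigma> \<tau> \<Longrightarrow> I a 0 \<tau> \<Longrightarrow> Q \<tau>"
  shows "wlp limit (FOR i X (FOR j Y c)) Q \<sigma>"
proof -
  note X' = sized_lookup[OF sized X] and Y' = sized_lookup[OF sized Y]
  have sized': "sized \<tau>" if "frame (FOR i X (FOR j Y c)) \<sigma> \<tau>" for \<tau>
    by (rule sized_frame[OF that sized]) (use vars in auto)
  show ?thesis
  proof (rule wlp_FOR2[where I = I])
    show "wvar \<sigma> X = a" "a < limit" "wvar \<sigma> Y = b" "b < limit" using X' Y' by auto
    show "{X, Y} \<inter> mod_wvars c = {}" "{i, j} \<inter> {X, Y} = {}" using X' Y' vars by auto
    show "wlp limit c (I x (Suc y)) \<tau>"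
      if "x < a" "y < b" "frame (FOR i X (FOR j Y c)) \<sigma> \<tau>" "I x y \<tau>" "wvar \<tau> i = x" "wvar \<tau> j = y" for x y \<tau>
      using that sized' by (intro step)
  qed (use vars init row exit sized' in \<open>simp_all add: indep\<close>)
qed

lemma wlp_FOR_store:
  assumes sized: "sized \<sigma>" and X: "(X, b) \<in> set size_table"
    and vars: "i \<notin> size_vars" "i \<notin> mod_wvars c" "mod_wvars c \<inter> size_vars = {}" and inj: "inj_on f {..<b}"
    and body: "\<And>k \<tau>. k < b \<Longrightarrow> sized \<tau> \<Longrightarrow> frame (FOR i X c) \<sigma> \<tau> \<Longrightarrow> wvar \<tau> i = k \<Longrightarrow>
      rarr \<tau> a (f k) = rarr \<sigma> a (f k) \<Longrightarrow> wlp limit c (\<lambda>\<upsilon>. rarr \<upsilon> a = (rarr \<tau> a)(f k := v k)) \<tau>"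
  shows "wlp limit (FOR i X c)
    (\<lambda>\<tau>. (\<forall>k<b. rarr \<tau> a (f k) = v k) \<and> (\<forall>y. y \<notin> f ` {..<b} \<longrightarrow> rarr \<tau> a y = rarr \<sigma> a y)) \<sigma>"
proof (rule wlp_FOR_size[OF sized X vars, where
    I = "\<lambda>k \<tau>. (\<forall>x<k. rarr \<tau> a (f x) = v x) \<and> (\<forall>y. y \<notin> f ` {..<k} \<longrightarrow> rarr \<tau> a y = rarr \<sigma> a y)"])
  fix k \<tau>
  assume k: "k < b" "sized \<tau>" "frame (FOR i X c) \<sigma> \<tau>" "wvar \<tau> i = k"
    and inv: "(\<forall>x<k. rarr \<tau> a (f x) = v x) \<and> (\<forall>y. y \<notin> f ` {..<k} \<longrightarrow> rarr \<tau> a y = rarr \<sigma> a y)"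
  have new: "f x \<noteq> f k" if "x < k" for x using inj_onD[OF inj, of x k] that k(1) by auto
  then have "rarr \<tau> a (f k) = rarr \<sigma> a (f k)" using inv by (metis imageE lessThan_iff)
  from body[OF k this]
  show "wlp limit c (\<lambda>\<tau>. (\<forall>x<Suc k. rarr \<tau> a (f x) = v x) \<and>
      (\<forall>y. y \<notin> f ` {..<Suc k} \<longrightarrow> rarr \<tau> a y = rarr \<sigma> a y)) \<tau>"
    by (rule wlp_mono) (use inv new in \<open>auto simp: less_Suc_eq lessThan_Suc\<close>)
qed auto

lemma wlp_FOR_vector:
  assumes sized: "sized \<sigma>" and X: "(X, b) \<in> set size_table" and i: "i \<notin> size_vars"
    and v: "\<And>k \<tau>. k < b \<Longrightarrow> sized \<tau> \<Longrightarrow> frame (FOR i X (RStore a (WVar i) r)) \<sigma> \<tau> \<Longrightarrow> wvar \<tau> i = k \<Longrightarrow>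
      rarr \<tau> a k = rarr \<sigma> a k \<Longrightarrow> rval limit \<tau> r = v k"
  shows "wlp limit (FOR i X (RStore a (WVar i) r)) (\<lambda>\<tau>. \<forall>k<b. rarr \<tau> a k = v k) \<sigma>"
proof -
  have "wlp limit (FOR i X (RStore a (WVar i) r)) (\<lambda>\<tau>. (\<forall>k<b. rarr \<tau> a (id k) = v k) \<and>
      (\<forall>y. y \<notin> id ` {..<b} \<longrightarrow> rarr \<tau> a y = rarr \<sigma> a y)) \<sigma>"
    by (rule wlp_FOR_store[OF sized X i]) (use v in auto)
  then show ?thesis by (rule wlp_mono) simp
qed

lemma wlp_FOR2_store:
  assumes sized: "sized \<sigma>" and X: "(X, b) \<in> set size_table" "b \<le> N"
    and vars: "i \<notin> size_vars" "j \<notin> size_vars" "{i, j} \<inter> mod_wvars c = {}" "mod_wvars c \<inter> size_vars = {}" "i \<noteq> j"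
    and body: "\<And>x y \<tau>. x < b \<Longrightarrow> y < b \<Longrightarrow> sized \<tau> \<Longrightarrow> frame (FOR i X (FOR j X c)) \<sigma> \<tau> \<Longrightarrow>
      wvar \<tau> i = x \<Longrightarrow> wvar \<tau> j = y \<Longrightarrow> entry \<tau> a x y = entry \<sigma> a x y \<Longrightarrow>
      wlp limit c (\<lambda>\<upsilon>. rarr \<upsilon> a = (rarr \<tau> a)(x * N + y := v x y)) \<tau>"
  shows "wlp limit (FOR i X (FOR j X c)) (\<lambda>\<tau>. \<forall>x<b. \<forall>y<b. entry \<tau> a x y = v x y) \<sigma>"
proof (rule wlp_FOR2_size[OF sized X(1) X(1) vars, where I = "\<lambda>x y \<tau>. \<forall>x'<b. \<forall>y'<b.
      entry \<tau> a x' y' = (if x' < x \<or> x' = x \<and> y' < y then v x' y' else entry \<sigma> a x' y')"])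
  fix x y \<tau>
  assume xy: "x < b" "y < b" "sized \<tau>" "frame (FOR i X (FOR j X c)) \<sigma> \<tau>" "wvar \<tau> i = x" "wvar \<tau> j = y"
    and inv: "\<forall>x'<b. \<forall>y'<b. entry \<tau> a x' y' = (if x' < x \<or> x' = x \<and> y' < y then v x' y' else entry \<sigma> a x' y')"
  have "entry \<tau> a x y = entry \<sigma> a x y" using inv xy(1,2) by simp
  from body[OF xy this]
  show "wlp limit c (\<lambda>\<tau>. \<forall>x'<b. \<forall>y'<b.
      entry \<tau> a x' y' = (if x' < x \<or> x' = x \<and> y' < Suc y then v x' y' else entry \<sigma> a x' y')) \<tau>"
  proof (rule wlp_mono, intro allI impI)
    fix \<upsilon> :: machine_state and x' y' :: nat
    assume "rarr \<upsilon> a = (rarr \<tau> a)(x * N + y := v x y)" and "x' < b" "y' < b"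
    moreover from this(2,3) xy(2) X(2) have "x' * N + y' = x * N + y \<longleftrightarrow> x' = x \<and> y' = y"
      by (intro pair_eq_iff) auto
    ultimately show "entry \<upsilon> a x' y' = (if x' < x \<or> x' = x \<and> y' < Suc y then v x' y' else entry \<sigma> a x' y')"
      using inv by (auto simp: less_Suc_eq)
  qed
qed (auto simp: less_Suc_eq)

end


section \<open>The priority queue\<close>

definition before :: "(nat \<Rightarrow> real) \<Rightarrow> (nat \<Rightarrow> nat) \<Rightarrow> nat \<Rightarrow> nat \<Rightarrow> bool" where
  "before K d a b \<longleftrightarrow> d a = 0 \<and> (d b = 0 \<longrightarrow> K a < K b)"

lemma before_trans: "before K d a b \<Longrightarrow> before K d b c \<Longrightarrow> before K d a c"
  by (auto simp: before_def)

lemma before_cases: "before K d a c \<Longrightarrow> before K d a b \<or> before K d b c"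
  by (auto simp: before_def)

lemma before_irrefl: "\<not> before K d a a"
  by (auto simp: before_def)

lemma bval_BEFORE [simp]:
  "bval M \<sigma> (BEFORE a b) = before (rarr \<sigma> ''K'') (warr \<sigma> ''done'') (wvar \<sigma> a) (wvar \<sigma> b)"
  by (auto simp: BEFORE_def before_def)

lemma running_minimum:
  assumes "\<forall>i<k. \<not> before K d (f i) e"
  shows "\<forall>i<Suc k. \<not> before K d (f i) (if before K d (f k) e then f k else e)"
proof (intro allI impI)
  fix i assume "i < Suc k"
  then show "\<not> before K d (f i) (if before K d (f k) e then f k else e)"
    using assms before_trans[of K d "f i" "f k" e] before_irrefl[of K d "f i"] by (auto simp: less_Suc_eq)
qed

context sizes
begin

definition block_min :: "(nat \<Rightarrow> real) \<Rightarrow> (nat \<Rightarrow> nat) \<Rightarrow> nat \<Rightarrow> nat \<Rightarrow> bool" where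
  "block_min K d j e \<longleftrightarrow> e div q = j \<and> (\<forall>i. i div q = j \<longrightarrow> \<not> before K d i e)"

definition queue_ok :: "(nat \<Rightarrow> real) \<Rightarrow> (nat \<Rightarrow> nat) \<Rightarrow> (nat \<Rightarrow> nat) \<Rightarrow> bool" where
  "queue_ok K d first \<longleftrightarrow> (\<forall>j<blocks. block_min K d j (first j))"

abbreviation queue :: "machine_state \<Rightarrow> bool" where
  "queue \<sigma> \<equiv> queue_ok (rarr \<sigma> ''K'') (warr \<sigma> ''done'') (warr \<sigma> ''first'')"

lemma block_less_iff: "w div q < blocks \<longleftrightarrow> w < N"
  unfolding N_def using q_ge_1 by (simp add: div_less_iff_less_mult mult.commute)

lemma block_min_less_N: "block_min K d j e \<Longrightarrow> j < blocks \<Longrightarrow> e < N"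
  using block_less_iff by (auto simp: block_min_def)

lemma queue_ok_update:
  assumes "queue_ok K d first" and "block_min K' d' j e"
    and "\<And>i. i div q \<noteq> j \<Longrightarrow> K' i = K i \<and> d' i = d i"
  shows "queue_ok K' d' (first(j := e))"
  using assms by (auto simp: queue_ok_def block_min_def before_def)

lemma block_entry:
  assumes j: "j < blocks" and k: "k < q"
  shows "(j * q + k) div q = j" "(j * q + k) mod limit = j * q + k"
proof -
  show div: "(j * q + k) div q = j" using k by simp
  then have "j * q + k < N" using block_less_iff[of "j * q + k"] j by simp
  then show "(j * q + k) mod limit = j * q + k" using less_limit(7) by simp
qed

lemma wlp_BLOCK_MIN:
  assumes sized: "sized \<sigma>" and j: "wvar \<sigma> ''j'' < blocks"
  shows "wlp limit BLOCK_MIN (\<lambda>\<tau>. \<exists>e. block_min (rarr \<sigma> ''K'') (warr \<sigma> ''done'') (wvar \<sigma> ''j'') e \<and>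
    warr \<tau> ''first'' = (warr \<sigma> ''first'')(wvar \<sigma> ''j'' := e)) \<sigma>"
proof -
  let ?compare = "WAssign ''e'' (WAdd (WMult (WVar ''j'') (WVar ''q'')) (WVar ''y'')) ;;
    Cond (BEFORE ''e'' ''o'') (WAssign ''o'' (WVar ''e'')) Skip"
  let ?j = "wvar \<sigma> ''j''" and ?before = "before (rarr \<sigma> ''K'') (warr \<sigma> ''done'')"
  have start: "?j * q div q = ?j" "?j * q mod limit = ?j * q" using block_entry[OF j, of 0] q_ge_1 by auto
  have "wlp limit (FOR ''y'' ''q'' ?compare)
    (wlp limit (WStore ''first'' (WVar ''j'') (WVar ''o''))
      (\<lambda>\<tau>. \<exists>e. block_min (rarr \<sigma> ''K'') (warr \<sigma> ''done'') ?j e \<and>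
      warr \<tau> ''first'' = (warr \<sigma> ''first'')(?j := e))) (wset ''o'' (?j * q) \<sigma>)"
  proof (rule wlp_FOR_size[where I = "\<lambda>k \<tau>. wvar \<tau> ''o'' div q = ?j \<and>
      (\<forall>i<k. \<not> ?before (?j * q + i) (wvar \<tau> ''o''))", OF _ size_table_simps(2)])
    fix k \<tau>
    assume k: "k < q" and \<tau>: "sized \<tau>" "wvar \<tau> ''y'' = k"
      and frame: "frame (FOR ''y'' ''q'' ?compare) (wset ''o'' (?j * q) \<sigma>) \<tau>"
      and inv: "wvar \<tau> ''o'' div q = ?j \<and> (\<forall>i<k. \<not> ?before (?j * q + i) (wvar \<tau> ''o''))"
    have "wvar \<tau> ''j'' = ?j" "rarr \<tau> ''K'' = rarr \<sigma> ''K''" "warr \<tau> ''done'' = warr \<sigma> ''done''"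
      by (simp_all add: frameD[OF frame])
    then show "wlp limit ?compare (\<lambda>\<tau>. wvar \<tau> ''o'' div q = ?j \<and>
        (\<forall>i<Suc k. \<not> ?before (?j * q + i) (wvar \<tau> ''o''))) \<tau>"
      using running_minimum[of k _ _ "\<lambda>i. ?j * q + i", OF conjunct2[OF inv]] inv \<tau> block_entry[OF j k]
      by (simp add: sizedD start split: if_splits)
  next
    fix \<tau>
    assume frame: "frame (FOR ''y'' ''q'' ?compare) (wset ''o'' (?j * q) \<sigma>) \<tau>"
      and inv: "wvar \<tau> ''o'' div q = ?j \<and> (\<forall>i<q. \<not> ?before (?j * q + i) (wvar \<tau> ''o''))"
    have "\<not> ?before i (wvar \<tau> ''o'')" if "i div q = ?j" for i
      using inv that q_ge_1 by (metis div_mult_mod_eq mod_less_divisor less_le_trans zero_less_one)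
    then show "wlp limit (WStore ''first'' (WVar ''j'') (WVar ''o''))
        (\<lambda>\<tau>. \<exists>e. block_min (rarr \<sigma> ''K'') (warr \<sigma> ''done'') ?j e \<and>
      warr \<tau> ''first'' = (warr \<sigma> ''first'')(?j := e)) \<tau>"
      using inv by (auto simp: block_min_def frameD[OF frame])
  qed (use sized start in \<open>auto simp: size_vars_eq\<close>)
  then show ?thesis by (simp add: BLOCK_MIN_def sizedD[OF sized] start)
qed

lemma wlp_remove_from_queue:
  assumes sized: "sized \<sigma>" and queue: "queue \<sigma>" and p: "wvar \<sigma> ''p'' = p" "p < N"
  shows "wlp limit (WStore ''done'' (WVar ''p'') (WConst 1) ;;
      WAssign ''j'' (WDiv (WVar ''p'') (WVar ''q'')) ;; BLOCK_MIN)
    (\<lambda>\<tau>. warr \<tau> ''done'' = (warr \<sigma> ''done'')(p := 1) \<and> queue \<tau>) \<sigma>"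
proof -
  let ?\<tau> = "\<sigma>\<lparr>warr := (warr \<sigma>)(''done'' := (warr \<sigma> ''done'')(p := 1)), wvar := (wvar \<sigma>)(''j'' := p div q)\<rparr>"
  have "sized ?\<tau>" using sized by (simp add: size_vars_eq)
  then have "wlp limit BLOCK_MIN (\<lambda>\<tau>. warr \<tau> ''done'' = (warr \<sigma> ''done'')(p := 1) \<and> queue \<tau>) ?\<tau>"
  proof (rule wlp_mono[OF wlp_BLOCK_MIN])
    show "wvar ?\<tau> ''j'' < blocks" using p block_less_iff by simp
    fix \<tau>
    assume frame: "frame BLOCK_MIN ?\<tau> \<tau>" and "\<exists>e. block_min (rarr ?\<tau> ''K'') (warr ?\<tau> ''done'') (wvar ?\<tau> ''j'') e \<and>
      warr \<tau> ''first'' = (warr ?\<tau> ''first'')(wvar ?\<tau> ''j'' := e)"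
    then obtain e where e: "block_min (rarr \<sigma> ''K'') ((warr \<sigma> ''done'')(p := 1)) (p div q) e"
      "warr \<tau> ''first'' = (warr \<sigma> ''first'')(p div q := e)" by auto
    have "queue_ok (rarr \<sigma> ''K'') ((warr \<sigma> ''done'')(p := 1)) ((warr \<sigma> ''first'')(p div q := e))"
      by (rule queue_ok_update[OF queue e(1)]) auto
    then show "warr \<tau> ''done'' = (warr \<sigma> ''done'')(p := 1) \<and> queue \<tau>"
      by (simp add: frameD[OF frame] e(2))
  qed
  then show ?thesis using p by (simp add: sizedD[OF sized])
qed

definition extracted :: "machine_state \<Rightarrow> nat \<Rightarrow> machine_state \<Rightarrow> bool" where
  "extracted \<sigma> p \<tau> \<longleftrightarrow> p < N \<and> wvar \<tau> ''p'' = p \<and> warr \<sigma> ''done'' p = 0 \<and>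
     (\<forall>w<N. warr \<sigma> ''done'' w = 0 \<longrightarrow> rarr \<sigma> ''K'' p \<le> rarr \<sigma> ''K'' w) \<and>
     warr \<tau> ''done'' = (warr \<sigma> ''done'')(p := 1) \<and> queue \<tau>"

lemma minimum_of_block_minima:
  assumes queue: "queue_ok K d first" and p: "\<forall>j<blocks. \<not> before K d (first j) p" and w: "w < N"
  shows "\<not> before K d w p"
proof
  assume "before K d w p"
  moreover have "\<not> before K d w (first (w div q))"
    using queue w block_less_iff unfolding queue_ok_def block_min_def by blast
  ultimately have "before K d (first (w div q)) p" using before_cases by blast
  then show False using p w block_less_iff by blast
qed

lemma wlp_EXTRACT_MIN:
  assumes sized: "sized \<sigma>" and queue: "queue \<sigma>" and nonempty: "v < N" "warr \<sigma> ''done'' v = 0"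
  shows "wlp limit EXTRACT_MIN (\<lambda>\<tau>. \<exists>p. extracted \<sigma> p \<tau>) \<sigma>"
proof -
  let ?K = "rarr \<sigma> ''K''" and ?d = "warr \<sigma> ''done''" and ?first = "warr \<sigma> ''first''"
  let ?\<sigma> = "wset ''p'' (?first 0) \<sigma>"
  let ?body = "WAssign ''e'' (WArr ''first'' (WVar ''y'')) ;;
      Cond (BEFORE ''e'' ''p'') (WAssign ''p'' (WVar ''e'')) Skip"
  let ?rest = "WStore ''done'' (WVar ''p'') (WConst 1) ;;
    WAssign ''j'' (WDiv (WVar ''p'') (WVar ''q'')) ;; BLOCK_MIN"
  have "0 < blocks" using N_ge_1 by (cases blocks) (auto simp: N_def)
  have "wlp limit (FOR ''y'' ''blocks'' ?body) (wlp limit ?rest (\<lambda>\<tau>. \<exists>p. extracted \<sigma> p \<tau>)) ?\<sigma>"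
  proof (rule wlp_FOR_size[where I = "\<lambda>k \<tau>. (\<exists>j<blocks. wvar \<tau> ''p'' = ?first j) \<and>
      (\<forall>j<k. \<not> before ?K ?d (?first j) (wvar \<tau> ''p''))", OF _ size_table_simps(5)])
    fix k \<tau>
    assume k: "k < blocks" and y: "wvar \<tau> ''y'' = k" and frame: "frame (FOR ''y'' ''blocks'' ?body) ?\<sigma> \<tau>"
      and inv: "(\<exists>j<blocks. wvar \<tau> ''p'' = ?first j) \<and> (\<forall>j<k. \<not> before ?K ?d (?first j) (wvar \<tau> ''p''))"
    have "warr \<tau> ''first'' = ?first" "rarr \<tau> ''K'' = ?K" "warr \<tau> ''done'' = ?d" by (simp_all add: frameD[OF frame])
    then show "wlp limit ?body (\<lambda>\<tau>. (\<exists>j<blocks. wvar \<tau> ''p'' = ?first j) \<and>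
        (\<forall>j<Suc k. \<not> before ?K ?d (?first j) (wvar \<tau> ''p''))) \<tau>"
      using running_minimum[of k _ _ ?first, OF conjunct2[OF inv]] inv k y by (auto split: if_splits)
  next
    fix \<tau>
    assume sized': "sized \<tau>" and frame: "frame (FOR ''y'' ''blocks'' ?body) ?\<sigma> \<tau>"
      and inv: "(\<exists>j<blocks. wvar \<tau> ''p'' = ?first j) \<and> (\<forall>j<blocks. \<not> before ?K ?d (?first j) (wvar \<tau> ''p''))"
    let ?p = "wvar \<tau> ''p''"
    have same: "warr \<tau> ''first'' = ?first" "rarr \<tau> ''K'' = ?K" "warr \<tau> ''done'' = ?d"
      by (simp_all add: frameD[OF frame])
    have p: "?p < N" using inv queue block_min_less_N unfolding queue_ok_def by metis
    have min: "\<not> before ?K ?d w ?p" if "w < N" for w using minimum_of_block_minima[OF queue _ that] inv by blast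
    have "?d ?p = 0" using min[OF nonempty(1)] nonempty(2) by (auto simp: before_def)
    moreover from this have "\<forall>w<N. ?d w = 0 \<longrightarrow> ?K ?p \<le> ?K w" using min by (metis before_def not_less)
    moreover have "queue \<tau>" using queue same by simp
    ultimately show "wlp limit ?rest (\<lambda>\<tau>. \<exists>p. extracted \<sigma> p \<tau>) \<tau>"
    proof (intro wlp_mono[OF wlp_remove_from_queue[OF sized' _ refl p]] exI[of _ ?p])
      fix \<upsilon> assume "frame ?rest \<tau> \<upsilon>" "warr \<upsilon> ''done'' = (warr \<tau> ''done'')(?p := 1) \<and> queue \<upsilon>"
      moreover from this(1) have "wvar \<upsilon> ''p'' = ?p" by (rule frameD(1)) simp
      moreover note \<open>?d ?p = 0\<close> \<open>\<forall>w<N. ?d w = 0 \<longrightarrow> ?K ?p \<le> ?K w\<close>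
      ultimately show "extracted \<sigma> ?p \<upsilon>" using p same(3) by (auto simp: extracted_def)
    qed
  qed (use sized \<open>0 < blocks\<close> in \<open>auto simp: size_vars_eq\<close>)
  then show ?thesis by (simp add: EXTRACT_MIN_def)
qed

lemma wlp_INIT_QUEUE:
  assumes sized: "sized \<sigma>" and X: "(X, b) \<in> set size_table"
  shows "wlp limit (INIT_QUEUE X) (\<lambda>\<tau>. (\<forall>x<N. warr \<tau> ''done'' x = (if x < b then 0 else 1)) \<and> queue \<tau>) \<sigma>"
proof (rule wlpI)
  let ?marked = "\<lambda>k \<tau>. \<forall>x<k. warr \<tau> ''done'' x = (if x < b then 0 else 1)"
  let ?mark = "Cond (WLess (WVar ''x'') (WVar X)) (WStore ''done'' (WVar ''x'') (WConst 0)) (WStore ''done'' (WVar ''x'') (WConst 1))"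
  have mark: "wlp limit (FOR ''x'' ''N'' ?mark) (?marked N) \<sigma>"
  proof (rule wlp_FOR_size[where I = ?marked, OF sized size_table_simps(4)])
    fix k \<tau>
    assume "sized \<tau>" "wvar \<tau> ''x'' = k" "?marked k \<tau>"
    then show "wlp limit ?mark (?marked (Suc k)) \<tau>" using sized_lookup[OF _ X, of \<tau>] by (auto simp: less_Suc_eq)
  qed (auto simp: size_vars_eq)
  fix \<upsilon> assume "executes (INIT_QUEUE X) \<sigma> \<upsilon>"
  then obtain \<tau> where \<tau>: "executes (FOR ''x'' ''N'' ?mark) \<sigma> \<tau>"
    and \<upsilon>: "executes (FOR ''j'' ''blocks'' BLOCK_MIN) \<tau> \<upsilon>"
    by (auto simp: INIT_QUEUE_def executes_Seq)
  have "sized \<tau>" using executes_sized[OF \<tau> sized] by (simp add: size_vars_eq)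
  then have "wlp limit (FOR ''j'' ''blocks'' BLOCK_MIN) queue \<tau>"
  proof (rule wlp_FOR_size[where I = "\<lambda>k \<upsilon>. \<forall>j<k. block_min (rarr \<tau> ''K'') (warr \<tau> ''done'') j (warr \<upsilon> ''first'' j)",
      OF _ size_table_simps(5)])
    fix k \<upsilon>
    assume k: "k < blocks" and \<upsilon>: "sized \<upsilon>" "wvar \<upsilon> ''j'' = k"
      and frame: "frame (FOR ''j'' ''blocks'' BLOCK_MIN) \<tau> \<upsilon>"
      and inv: "\<forall>j<k. block_min (rarr \<tau> ''K'') (warr \<tau> ''done'') j (warr \<upsilon> ''first'' j)"
    show "wlp limit BLOCK_MIN (\<lambda>\<upsilon>. \<forall>j<Suc k. block_min (rarr \<tau> ''K'') (warr \<tau> ''done'') j (warr \<upsilon> ''first'' j)) \<upsilon>"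
      by (rule wlp_mono[OF wlp_BLOCK_MIN[OF \<upsilon>(1)]]) (use k \<upsilon>(2) inv in \<open>auto simp: less_Suc_eq frameD[OF frame]\<close>)
  qed (auto simp: size_vars_eq queue_ok_def frame_def)
  with \<upsilon> have "queue \<upsilon>" by (rule wlpD[rotated])
  moreover have "?marked N \<upsilon>" using wlpD[OF mark \<tau>] frameD(2)[OF executes_frame[OF \<upsilon>], of "''done''"] by simp
  ultimately show "?marked N \<upsilon> \<and> queue \<upsilon>" by simp
qed

lemma block_min_decrease_key:
  assumes old: "block_min K d (w div q) e" and x: "x \<le> K w"
  shows "block_min (K(w := x)) d (w div q) (if before (K(w := x)) d w e then w else e)"
proof (cases "before (K(w := x)) d w e")
  case True
  have "\<not> before (K(w := x)) d i w" if i: "i div q = w div q" for i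
  proof
    assume "before (K(w := x)) d i w"
    moreover from this have "i \<noteq> w" "e \<noteq> w" using True before_irrefl by metis+
    ultimately have "before K d i e" using before_trans[OF _ True, of i] by (auto simp: before_def)
    then show False using old i by (simp add: block_min_def)
  qed
  then show ?thesis using True by (simp add: block_min_def)
next
  case False
  have "\<not> before (K(w := x)) d i e" if "i div q = w div q" for i
    using old that False x by (cases "i = w") (auto simp: block_min_def before_def split: if_splits)
  then show ?thesis using old False by (simp add: block_min_def)
qed

lemma wlp_DECREASE_KEY:
  assumes sized: "sized \<sigma>" and w: "wvar \<sigma> ''w'' = w" "w < N"
    and queue: "queue_ok K (warr \<sigma> ''done'') (warr \<sigma> ''first'')" and x: "x \<le> K w" "rarr \<sigma> ''K'' = K(w := x)"
  shows "wlp limit DECREASE_KEY queue \<sigma>"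
proof -
  let ?d = "warr \<sigma> ''done''" and ?first = "warr \<sigma> ''first''"
  let ?e = "if before (K(w := x)) ?d w (?first (w div q)) then w else ?first (w div q)"
  have "block_min K ?d (w div q) (?first (w div q))" using queue w(2) by (simp add: queue_ok_def block_less_iff)
  note new = block_min_decrease_key[where K = K and w = w and x = x, OF this x(1)]
  have "queue_ok (K(w := x)) ?d (?first(w div q := ?e))"
    by (rule queue_ok_update[OF queue new]) auto
  then show ?thesis
    using w by (auto simp: DECREASE_KEY_def sizedD[OF sized] x(2) split: if_splits)
qed


section \<open>Running Dijkstra's algorithm\<close>

definition edge_relaxed :: "real \<Rightarrow> real \<Rightarrow> nat \<Rightarrow> potential \<Rightarrow> potential \<Rightarrow> potential \<Rightarrow> potential \<Rightarrow> bool" where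
  "edge_relaxed g x w K R K' R' \<longleftrightarrow>
     K' = (if 0 \<le> g then K(w := min (K w) x) else K) \<and> R' = R(w := min (R w) x)"

lemma wlp_RELAX:
  assumes sized: "sized \<sigma>" and w: "wvar \<sigma> ''w'' = w" "w < N" and e: "wval limit \<sigma> e = i"
    and arrays: "G \<notin> {''K'', ''R''}" "X \<notin> {''K'', ''R''}" and queue: "queue \<sigma>"
  shows "wlp limit (RELAX G X e) (\<lambda>\<tau>. edge_relaxed (rarr \<sigma> G i) (rvar \<sigma> ''v'' + rarr \<sigma> X i) w
    (rarr \<sigma> ''K'') (rarr \<sigma> ''R'') (rarr \<tau> ''K'') (rarr \<tau> ''R'') \<and> queue \<tau>) \<sigma>"
proof -
  define x where "x = rvar \<sigma> ''v'' + rarr \<sigma> X i"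
  let ?K = "rarr \<sigma> ''K''" and ?R = "rarr \<sigma> ''R''"
  let ?relaxed = "\<lambda>\<tau>. edge_relaxed (rarr \<sigma> G i) x w ?K ?R (rarr \<tau> ''K'') (rarr \<tau> ''R'') \<and> queue \<tau>"
  let ?key = "Cond (BAnd (BNot (RLess (RArr G e) RZero)) (RLess (RVar ''x'') (RArr ''K'' (WVar ''w''))))
       (RStore ''K'' (WVar ''w'') (RVar ''x'') ;; DECREASE_KEY) Skip"
  have e': "wval limit \<tau> e = i" if "wvar \<tau> = wvar \<sigma>" "warr \<tau> = warr \<sigma>" for \<tau>
    using wval_cong[OF that] e by simp
  have key: "wlp limit ?key ?relaxed \<tau>"
    if \<tau>: "sized \<tau>" "wvar \<tau> = wvar \<sigma>" "warr \<tau> = warr \<sigma>" "rvar \<tau> ''x'' = x" "rarr \<tau> G = rarr \<sigma> G"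
      "rarr \<tau> ''K'' = ?K" "rarr \<tau> ''R'' = ?R(w := min (?R w) x)" for \<tau>
  proof (cases "0 \<le> rarr \<sigma> G i \<and> x < ?K w")
    case True
    let ?\<tau> = "\<tau>\<lparr>rarr := (rarr \<tau>)(''K'' := ?K(w := x))\<rparr>"
    have "wlp limit DECREASE_KEY queue ?\<tau>"
      by (rule wlp_DECREASE_KEY[where K = ?K and x = x and w = w]) (use \<tau> w queue True in auto)
    then have "wlp limit DECREASE_KEY ?relaxed ?\<tau>"
      by (rule wlp_mono) (use \<tau> True in \<open>auto simp: frame_def edge_relaxed_def min_def\<close>)
    then show ?thesis using True \<tau> w e'[OF \<tau>(2,3)] by simp
  next
    case False
    then have "edge_relaxed (rarr \<sigma> G i) x w ?K ?R ?K (?R(w := min (?R w) x))"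
      by (auto simp: edge_relaxed_def min_def)
    then show ?thesis using False \<tau> w queue e'[OF \<tau>(2,3)] by auto
  qed
  have "wlp limit (Cond (RLess (RVar ''x'') (RArr ''R'' (WVar ''w''))) (RStore ''R'' (WVar ''w'') (RVar ''x'')) Skip)
      (wlp limit ?key ?relaxed) (\<sigma>\<lparr>rvar := (rvar \<sigma>)(''x'' := x)\<rparr>)"
  proof (rule wlp_mono)
    show "wlp limit (Cond (RLess (RVar ''x'') (RArr ''R'' (WVar ''w''))) (RStore ''R'' (WVar ''w'') (RVar ''x'')) Skip)
        (\<lambda>\<tau>. sized \<tau> \<and> wvar \<tau> = wvar \<sigma> \<and> warr \<tau> = warr \<sigma> \<and> rvar \<tau> ''x'' = x \<and> rarr \<tau> G = rarr \<sigma> G \<and>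
          rarr \<tau> ''K'' = ?K \<and> rarr \<tau> ''R'' = ?R(w := min (?R w) x)) (\<sigma>\<lparr>rvar := (rvar \<sigma>)(''x'' := x)\<rparr>)"
      using sized w arrays by (auto simp: min_def)
  qed (use key in blast)
  then show ?thesis by (simp add: RELAX_def e x_def del: wlp_Cond)
qed

definition row_relaxed :: "nat set \<Rightarrow> potential \<Rightarrow> potential \<Rightarrow> real \<Rightarrow> potential \<Rightarrow> potential \<Rightarrow> potential \<Rightarrow> potential \<Rightarrow> bool" where
  "row_relaxed Z g x v K R K' R' \<longleftrightarrow> (\<forall>w<N.
     K' w = (if w \<in> Z \<and> 0 \<le> g w then min (K w) (v + x w) else K w) \<and>
     R' w = (if w \<in> Z then min (R w) (v + x w) else R w))"

lemma row_relaxed_insert: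
  assumes "row_relaxed Z g x v K R K' R'" "w \<notin> Z" "w < N" "edge_relaxed (g w) (v + x w) w K' R' K'' R''"
  shows "row_relaxed (insert w Z) g x v K R K'' R''"
  using assms by (auto simp: row_relaxed_def edge_relaxed_def)

lemma edges_relaxed_iff_row_relaxed:
  assumes "\<And>w. w < N \<Longrightarrow> w \<in> Z \<longleftrightarrow> active full (K p) (X p w)"
  shows "edges_relaxed N G X full p K R K' R' \<longleftrightarrow> row_relaxed Z (G p) (X p) (K p) K R K' R'"
  using assms by (auto simp: edges_relaxed_def row_relaxed_def)

lemma wlp_RELAX_ALL:
  assumes sized: "sized \<sigma>" and G: "G \<notin> {''K'', ''R''}" and queue: "queue \<sigma>"
    and e: "\<And>\<tau>. sized \<tau> \<Longrightarrow> wvar \<tau> ''p'' = wvar \<sigma> ''p'' \<Longrightarrow> wvar \<tau> ''w'' < N \<Longrightarrow> wval limit \<tau> e = i (wvar \<tau> ''w'')"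
  shows "wlp limit (RELAX_ALL G e) (\<lambda>\<tau>. row_relaxed {..<N} (\<lambda>w. rarr \<sigma> G (i w)) (\<lambda>w. rarr \<sigma> G (i w)) (rvar \<sigma> ''v'')
    (rarr \<sigma> ''K'') (rarr \<sigma> ''R'') (rarr \<tau> ''K'') (rarr \<tau> ''R'') \<and> queue \<tau>) \<sigma>"
  unfolding RELAX_ALL_def
proof (rule wlp_FOR_size[OF sized size_table_simps(4), where I = "\<lambda>k \<tau>.
    row_relaxed {..<k} (\<lambda>w. rarr \<sigma> G (i w)) (\<lambda>w. rarr \<sigma> G (i w)) (rvar \<sigma> ''v'')
      (rarr \<sigma> ''K'') (rarr \<sigma> ''R'') (rarr \<tau> ''K'') (rarr \<tau> ''R'') \<and> queue \<tau>"])
  fix k \<tau>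
  assume k: "k < N" and \<tau>: "sized \<tau>" "wvar \<tau> ''w'' = k" and frame: "frame (FOR ''w'' ''N'' (RELAX G G e)) \<sigma> \<tau>"
    and inv: "row_relaxed {..<k} (\<lambda>w. rarr \<sigma> G (i w)) (\<lambda>w. rarr \<sigma> G (i w)) (rvar \<sigma> ''v'')
      (rarr \<sigma> ''K'') (rarr \<sigma> ''R'') (rarr \<tau> ''K'') (rarr \<tau> ''R'') \<and> queue \<tau>"
  have same: "rarr \<tau> G = rarr \<sigma> G" "rvar \<tau> ''v'' = rvar \<sigma> ''v''" "wvar \<tau> ''p'' = wvar \<sigma> ''p''"
    using G by (auto simp: frameD[OF frame])
  have "wval limit \<tau> e = i k" using e[OF \<tau>(1) same(3)] k \<tau>(2) by simp
  from wlp_RELAX[OF \<tau> k this G G conjunct2[OF inv]]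
  show "wlp limit (RELAX G G e) (\<lambda>\<tau>. row_relaxed {..<Suc k} (\<lambda>w. rarr \<sigma> G (i w)) (\<lambda>w. rarr \<sigma> G (i w)) (rvar \<sigma> ''v'')
      (rarr \<sigma> ''K'') (rarr \<sigma> ''R'') (rarr \<tau> ''K'') (rarr \<tau> ''R'') \<and> queue \<tau>) \<tau>"
    unfolding same lessThan_Suc
    by (rule wlp_mono) (use row_relaxed_insert[OF conjunct1[OF inv] _ k] in auto)
qed (use queue in \<open>auto simp: size_vars_eq row_relaxed_def\<close>)

lemma wlp_LOAD_KEYS:
  assumes sized: "sized \<sigma>" and X: "X \<noteq> ''K''"
    and e: "\<And>\<tau>. sized \<tau> \<Longrightarrow> frame (LOAD_KEYS X e) \<sigma> \<tau> \<Longrightarrow> wvar \<tau> ''x'' < N \<Longrightarrow> wval limit \<tau> e = i (wvar \<tau> ''x'')"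
  shows "wlp limit (LOAD_KEYS X e) (\<lambda>\<tau>. \<forall>x<N. rarr \<tau> ''K'' x = rarr \<sigma> X (i x)) \<sigma>"
  unfolding LOAD_KEYS_def
  by (rule wlp_FOR_vector[OF sized size_table_simps(4)])
    (use X e in \<open>auto simp: size_vars_eq LOAD_KEYS_def frame_def\<close>)

end

text \<open>
  The inner command relaxes the edges of the extracted node and may consume fuel; \<open>fuel_ok S K f\<close>
  relates the remaining fuel to the settled nodes and their keys.
\<close>

locale dijkstra_run = sizes +
  fixes \<sigma> :: machine_state and c :: com and G X :: weights and full :: bool and a :: potential
    and fuel_ok :: "nat set \<Rightarrow> potential \<Rightarrow> nat \<Rightarrow> bool"
  assumes sized: "sized \<sigma>" and initial_key: "x < N \<Longrightarrow> rarr \<sigma> ''K'' x = a x"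
    and nonneg: "x < N \<Longrightarrow> y < N \<Longrightarrow> 0 \<le> G x y \<Longrightarrow> 0 \<le> X x y"
    and inner_modifies: "mod_wvars c \<inter> size_vars = {}" "''c'' \<notin> mod_wvars c" "mod_warrs c \<subseteq> {''first''}"
    and fuel_ok_init: "fuel_ok {} a (wvar \<sigma> ''fuel'')"
    and fuel_ok_cong: "S \<subseteq> {..<N} \<Longrightarrow> (\<And>w. w \<in> S \<Longrightarrow> K' w = K w) \<Longrightarrow> fuel_ok S K f \<Longrightarrow> fuel_ok S K' f"
    and inner: "sized \<tau> \<Longrightarrow> frame (DIJKSTRA c) \<sigma> \<tau> \<Longrightarrow>
      dijkstra_state N G X full a S (rarr \<tau> ''K'') (rarr \<tau> ''R'') \<Longrightarrow> queue \<tau> \<Longrightarrow>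
      fuel_ok S (rarr \<tau> ''K'') (wvar \<tau> ''fuel'') \<Longrightarrow> p < N \<Longrightarrow> p \<notin> S \<Longrightarrow> wvar \<tau> ''p'' = p \<Longrightarrow>
      rvar \<tau> ''v'' = rarr \<tau> ''K'' p \<Longrightarrow>
      wlp limit c (\<lambda>\<upsilon>. edges_relaxed N G X full p (rarr \<tau> ''K'') (rarr \<tau> ''R'') (rarr \<upsilon> ''K'') (rarr \<upsilon> ''R'') \<and>
        queue \<upsilon> \<and> fuel_ok (insert p S) (rarr \<tau> ''K'') (wvar \<upsilon> ''fuel'')) \<tau>"
begin

definition progress :: "nat \<Rightarrow> machine_state \<Rightarrow> bool" where
  "progress k \<tau> \<longleftrightarrow> (\<exists>S. card S = k \<and> (\<forall>w<N. warr \<tau> ''done'' w = (if w \<in> S then 1 else 0)) \<and>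
     dijkstra_state N G X full a S (rarr \<tau> ''K'') (rarr \<tau> ''R'') \<and> queue \<tau> \<and>
     fuel_ok S (rarr \<tau> ''K'') (wvar \<tau> ''fuel''))"

lemma wlp_settle_node:
  assumes \<tau>: "sized \<tau>" "frame (DIJKSTRA c) \<sigma> \<tau>" and "progress k \<tau>" "k < N"
  shows "wlp limit (EXTRACT_MIN ;; RAssign ''v'' (RArr ''K'' (WVar ''p'')) ;; c) (progress (Suc k)) \<tau>"
proof (rule wlpI)
  fix \<upsilon> assume "executes (EXTRACT_MIN ;; RAssign ''v'' (RArr ''K'' (WVar ''p'')) ;; c) \<tau> \<upsilon>"
  then obtain \<rho> where \<rho>: "executes EXTRACT_MIN \<tau> \<rho>"
    and \<upsilon>: "executes c (\<rho>\<lparr>rvar := (rvar \<rho>)(''v'' := rarr \<rho> ''K'' (wvar \<rho> ''p''))\<rparr>) \<upsilon>" (is "executes c ?\<rho> \<upsilon>")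
    by (auto simp: executes_Seq executes_RAssign)
  obtain S where card: "card S = k" and marked: "\<And>w. w < N \<Longrightarrow> warr \<tau> ''done'' w = (if w \<in> S then 1 else 0)"
    and state: "dijkstra_state N G X full a S (rarr \<tau> ''K'') (rarr \<tau> ''R'')" and queue: "queue \<tau>"
    and fuel: "fuel_ok S (rarr \<tau> ''K'') (wvar \<tau> ''fuel'')" using assms(3) by (auto simp: progress_def)
  have S: "S \<subseteq> {..<N}" "finite S" using dijkstra_state.settled_nodes[OF state] finite_subset by auto
  have "S \<noteq> {..<N}" using card assms(4) by auto
  then obtain v where v: "v < N" "v \<notin> S" using S by auto
  then obtain p where p: "extracted \<tau> p \<rho>"
    using wlpD[OF wlp_EXTRACT_MIN[OF \<tau>(1) queue v(1)] \<rho>] marked by auto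
  have same: "rarr \<rho> = rarr \<tau>" "wvar \<rho> ''fuel'' = wvar \<tau> ''fuel''"
    by (rule ext, rule frameD(4)[OF executes_frame[OF \<rho>]], simp, rule frameD(1)[OF executes_frame[OF \<rho>]], simp)
  have pS: "p < N" "p \<notin> S" "wvar \<rho> ''p'' = p" using p marked[of p] by (auto simp: extracted_def split: if_splits)
  have "sized ?\<rho>" using executes_sized[OF \<rho> \<tau>(1)] by (simp add: size_vars_eq)
  moreover have "frame (DIJKSTRA c) \<sigma> ?\<rho>"
    using frame_trans[OF \<tau>(2) executes_frame[OF \<rho>], of "DIJKSTRA c"] by (auto simp: frame_def)
  moreover have "queue ?\<rho>" using p by (auto simp: extracted_def)
  ultimately have relaxed: "edges_relaxed N G X full p (rarr \<tau> ''K'') (rarr \<tau> ''R'') (rarr \<upsilon> ''K'') (rarr \<upsilon> ''R'')"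
      "queue \<upsilon>" "fuel_ok (insert p S) (rarr \<tau> ''K'') (wvar \<upsilon> ''fuel'')"
    using wlpD[OF inner[of ?\<rho> S p] \<upsilon>] pS state fuel by (simp_all add: same)
  interpret dijkstra_step N G X full a S "rarr \<tau> ''K''" "rarr \<tau> ''R''" p "rarr \<upsilon> ''K''" "rarr \<upsilon> ''R''"
    by (intro dijkstra_step.intro dijkstra_step_axioms.intro state)
      (use pS p marked nonneg relaxed(1) in \<open>auto simp: extracted_def\<close>)
  show "progress (Suc k) \<upsilon>"
    unfolding progress_def
  proof (intro exI[of _ "insert p S"] conjI allI impI)
    show "card (insert p S) = Suc k" using card pS S by simp
    show "fuel_ok (insert p S) (rarr \<upsilon> ''K'') (wvar \<upsilon> ''fuel'')"
      by (rule fuel_ok_cong[OF _ settled_key_unchanged relaxed(3)]) (use S pS in auto)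
    have "warr \<upsilon> ''done'' = warr \<rho> ''done''" using frameD(2)[OF executes_frame[OF \<upsilon>], of "''done''"] inner_modifies
      by auto
    then show "warr \<upsilon> ''done'' w = (if w \<in> insert p S then 1 else 0)" if "w < N" for w
      using p marked[OF that] by (simp add: extracted_def)
  qed (use dijkstra_state_insert relaxed in auto)
qed

lemma wlp_DIJKSTRA: "wlp limit (DIJKSTRA c) (\<lambda>\<tau>. dijkstra_result N G X full a (rarr \<tau> ''K'') (rarr \<tau> ''R'') \<and>
    fuel_ok {..<N} (rarr \<tau> ''K'') (wvar \<tau> ''fuel'')) \<sigma>"
proof (rule wlpI)
  let ?init = "FOR ''x'' ''N'' (RStore ''R'' (WVar ''x'') (RArr ''K'' (WVar ''x'')))"
  let ?step = "EXTRACT_MIN ;; RAssign ''v'' (RArr ''K'' (WVar ''p'')) ;; c"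
  fix \<upsilon> assume "executes (DIJKSTRA c) \<sigma> \<upsilon>"
  then obtain \<rho> \<tau> where exec: "executes ?init \<sigma> \<rho>" "executes (INIT_QUEUE ''N'') \<rho> \<tau>"
    "executes (FOR ''c'' ''N'' ?step) \<tau> \<upsilon>"
    by (auto simp: DIJKSTRA_def executes_Seq)
  note frames = exec(1,2)[THEN executes_frame]
  have sized': "sized \<rho>" "sized \<tau>"
    using exec(1,2)[THEN executes_sized] sized by (auto simp: size_vars_eq)
  have "wlp limit ?init (\<lambda>\<tau>. \<forall>x<N. rarr \<tau> ''R'' x = a x) \<sigma>"
    by (rule wlp_FOR_vector[OF sized size_table_simps(4)]) (auto simp: size_vars_eq frame_def initial_key)
  then have "rarr \<rho> ''R'' x = a x" if "x < N" for x using wlpD[OF _ exec(1)] that by blast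
  then have keys: "a x = rarr \<tau> ''K'' x" "a x = rarr \<tau> ''R'' x" if "x < N" for x
    using that initial_key by (simp_all add: frameD[OF frames(1)] frameD[OF frames(2)])
  have "fuel_ok {} (rarr \<tau> ''K'') (wvar \<tau> ''fuel'')"
    by (rule fuel_ok_cong[of _ _ a]) (use fuel_ok_init in \<open>simp_all add: frameD[OF frames(1)] frameD[OF frames(2)]\<close>)
  then have progress: "progress 0 \<tau>"
    using wlpD[OF wlp_INIT_QUEUE[OF sized'(1) size_table_simps(4)] exec(2)] dijkstra_state_cong[OF keys dijkstra_state_init]
    unfolding progress_def by (intro exI[of _ "{}"]) auto
  have frame: "frame (DIJKSTRA c) \<sigma> \<tau>" by (rule frame_trans[OF frames]) auto
  have "wlp limit (FOR ''c'' ''N'' ?step) (progress N) \<tau>"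
  proof (rule wlp_FOR_size[where I = progress, OF sized'(2) size_table_simps(4)])
    fix k \<tau>' assume "k < N" "sized \<tau>'" and frame': "frame (FOR ''c'' ''N'' ?step) \<tau> \<tau>'" and "progress k \<tau>'"
    moreover have "frame (DIJKSTRA c) \<sigma> \<tau>'" by (rule frame_trans[OF frame frame']) auto
    ultimately show "wlp limit ?step (progress (Suc k)) \<tau>'" by (intro wlp_settle_node)
  qed (use progress inner_modifies in \<open>auto simp: size_vars_eq progress_def\<close>)
  then obtain S where "card S = N" "dijkstra_state N G X full a S (rarr \<upsilon> ''K'') (rarr \<upsilon> ''R'')"
      "fuel_ok S (rarr \<upsilon> ''K'') (wvar \<upsilon> ''fuel'')"
    using wlpD[OF _ exec(3)] unfolding progress_def by blast
  moreover from this(2) have "S \<subseteq> {..<N}" by (rule dijkstra_state.settled_nodes)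
  ultimately show "dijkstra_result N G X full a (rarr \<upsilon> ''K'') (rarr \<upsilon> ''R'') \<and>
      fuel_ok {..<N} (rarr \<upsilon> ''K'') (wvar \<upsilon> ''fuel'')"
    using card_subset_eq[of "{..<N}" S] by simp
qed

end

context sizes
begin

definition index_of :: "wexp \<Rightarrow> (nat \<Rightarrow> nat \<Rightarrow> nat) \<Rightarrow> bool" where
  "index_of e i \<longleftrightarrow> (\<forall>\<tau>. sized \<tau> \<longrightarrow> wvar \<tau> ''p'' < N \<longrightarrow> wvar \<tau> ''w'' < N \<longrightarrow>
     wval limit \<tau> e = i (wvar \<tau> ''p'') (wvar \<tau> ''w''))"

lemma index_of_index:
  "index_of (index ''p'' ''w'') (\<lambda>p w. p * N + w)" "index_of (index ''w'' ''p'') (\<lambda>p w. w * N + p)"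
  by (simp_all add: index_of_def sizedD)

lemma wlp_DIJKSTRA_all:
  assumes sized: "sized \<sigma>" and a: "\<And>x. x < N \<Longrightarrow> rarr \<sigma> ''K'' x = a x" and X: "X \<notin> {''K'', ''R''}"
    and e: "index_of e i"
  shows "wlp limit (DIJKSTRA (RELAX_ALL X e)) (\<lambda>\<tau>. dijkstra_result N (\<lambda>p w. rarr \<sigma> X (i p w))
      (\<lambda>p w. rarr \<sigma> X (i p w))
    True a (rarr \<tau> ''K'') (rarr \<tau> ''R'')) \<sigma>"
proof -
  let ?E = "\<lambda>p w. rarr \<sigma> X (i p w)"
  interpret dijkstra_run n s C \<sigma> "RELAX_ALL X e" ?E ?E True a "\<lambda>_ _ _. True"
  proof
    fix \<tau> S p
    assume \<tau>: "sized \<tau>" "frame (DIJKSTRA (RELAX_ALL X e)) \<sigma> \<tau>" "queue \<tau>" and p: "p < N" "wvar \<tau> ''p'' = p"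
      and v: "rvar \<tau> ''v'' = rarr \<tau> ''K'' p"
    have same: "rarr \<tau> X = rarr \<sigma> X" using X by (auto simp: frameD[OF \<tau>(2)])
    have "wval limit \<tau>' e = i p (wvar \<tau>' ''w'')" if "sized \<tau>'" "wvar \<tau>' ''p'' = wvar \<tau> ''p''" "wvar \<tau>' ''w'' < N"
      for \<tau>'
      using e that p by (simp add: index_of_def)
    from wlp_RELAX_ALL[OF \<tau>(1) X \<tau>(3) this]
    show "wlp limit (RELAX_ALL X e) (\<lambda>\<upsilon>. edges_relaxed N ?E ?E True p (rarr \<tau> ''K'') (rarr \<tau> ''R'') (rarr \<upsilon> ''K'') (rarr \<upsilon> ''R'') \<and>
        queue \<upsilon> \<and> True) \<tau>"
      by (simp add: edges_relaxed_iff_row_relaxed[of "{..<N}"] active_def v same)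
  qed (use sized a in \<open>auto simp: size_vars_eq\<close>)
  show ?thesis using wlp_DIJKSTRA by simp
qed

lemma wlp_DIJKSTRA_TWICE:
  assumes sized: "sized \<sigma>" and a: "\<And>x. x < N \<Longrightarrow> rarr \<sigma> ''K'' x = a x" and X: "X \<notin> {''K'', ''R''}"
    and e: "index_of e i"
  defines "E \<equiv> \<lambda>p w. rarr \<sigma> X (i p w)"
  shows "wlp limit (DIJKSTRA_TWICE X e) (\<lambda>\<tau>. \<exists>K R. dijkstra_result N E E True a K R \<and>
    dijkstra_result N E E True R (rarr \<tau> ''K'') (rarr \<tau> ''R'')) \<sigma>"
proof (rule wlpI)
  fix \<upsilon> assume "executes (DIJKSTRA_TWICE X e) \<sigma> \<upsilon>"
  then obtain \<rho> \<tau> where exec: "executes (DIJKSTRA (RELAX_ALL X e)) \<sigma> \<rho>"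
    "executes (LOAD_KEYS ''R'' (WVar ''x'')) \<rho> \<tau>"
    "executes (DIJKSTRA (RELAX_ALL X e)) \<tau> \<upsilon>" by (auto simp: DIJKSTRA_TWICE_def executes_Seq)
  note frames = exec(1,2)[THEN executes_frame]
  have sized': "sized \<rho>" "sized \<tau>" using exec(1,2)[THEN executes_sized] sized by (auto simp: size_vars_eq)
  have "rarr \<tau> ''K'' x = rarr \<rho> ''R'' x" if "x < N" for x
    using wlpD[OF wlp_LOAD_KEYS[OF sized'(1), where i = "\<lambda>x. x"] exec(2)] that by simp
  from wlpD[OF wlp_DIJKSTRA_all[OF sized'(2) this X e] exec(3)]
  have "dijkstra_result N E E True (rarr \<rho> ''R'') (rarr \<upsilon> ''K'') (rarr \<upsilon> ''R'')"
    using X by (auto simp: E_def frameD[OF frames(1)] frameD[OF frames(2)])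
  then show "\<exists>K R. dijkstra_result N E E True a K R \<and> dijkstra_result N E E True R (rarr \<upsilon> ''K'') (rarr \<upsilon> ''R'')"
    using wlpD[OF wlp_DIJKSTRA_all[OF sized a X e] exec(1)] by (auto simp: E_def)
qed

definition row_sorted :: "(nat \<Rightarrow> nat) \<Rightarrow> (nat \<Rightarrow> real) \<Rightarrow> nat \<Rightarrow> bool" where
  "row_sorted f x k \<longleftrightarrow> bij_betw f {..<k} {..<k} \<and> (\<forall>i j. i \<le> j \<and> j < k \<longrightarrow> x (f i) \<le> x (f j))"

lemma row_sorted_cong:
  assumes sorted: "row_sorted f x k" and g: "\<And>i. i < k \<Longrightarrow> g i = f i" and y: "\<And>w. w < k \<Longrightarrow> y w = x w"
  shows "row_sorted g y k"
proof -
  have bij: "bij_betw f {..<k} {..<k}" using sorted by (simp add: row_sorted_def)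
  then have "bij_betw g {..<k} {..<k}" using bij_betw_cong[of "{..<k}" g f] g by simp
  moreover have "y (g i) \<le> y (g j)" if "i \<le> j" "j < k" for i j
  proof -
    have "f i < k" "f j < k" using bij that by (auto simp: bij_betw_def)
    then show ?thesis using sorted that by (simp add: row_sorted_def g y)
  qed
  ultimately show ?thesis by (simp add: row_sorted_def)
qed

abbreviation sorted_entry :: "machine_state \<Rightarrow> nat \<Rightarrow> nat \<Rightarrow> nat" where
  "sorted_entry \<sigma> r i \<equiv> warr \<sigma> ''sorted'' (r * N + i)"

definition active_targets :: "weights \<Rightarrow> nat \<Rightarrow> real \<Rightarrow> nat set" where
  "active_targets X p v = {w. w < N \<and> active False v (X p w)}"

abbreviation num_active :: "weights \<Rightarrow> nat \<Rightarrow> real \<Rightarrow> nat" where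
  "num_active X p v \<equiv> card (active_targets X p v)"

lemma finite_active_targets: "finite (active_targets X p v)"
  by (simp add: active_targets_def)

lemma num_active_antimono: "v \<le> v' \<Longrightarrow> num_active X p v' \<le> num_active X p v"
  by (rule card_mono[OF finite_active_targets]) (auto simp: active_targets_def active_def)

lemma sorted_prefix_eq_active_targets:
  assumes sorted: "row_sorted f (X p) N" and i: "i \<le> N" "f ` {..<i} \<subseteq> active_targets X p v"
    and stop: "num_active X p v \<le> i \<or> i = N \<or> \<not> active False v (X p (f i))"
  shows "f ` {..<i} = active_targets X p v"
proof -
  have bij: "bij_betw f {..<N} {..<N}" and mono: "\<And>i j. i \<le> j \<Longrightarrow> j < N \<Longrightarrow> X p (f i) \<le> X p (f j)"
    using sorted by (auto simp: row_sorted_def)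
  have card: "card (f ` {..<i}) = i"
    using card_image[OF inj_on_subset[OF bij_betw_imp_inj_on[OF bij]], of "{..<i}"] i(1) by simp
  show ?thesis
  proof (cases "num_active X p v \<le> i")
    case True
    then show ?thesis using card_seteq[OF finite_active_targets i(2)] card by simp
  next
    case False
    have "z \<in> f ` {..<i}" if z: "z \<in> active_targets X p v" for z
    proof -
      have "z \<in> f ` {..<N}" using z bij by (auto simp: active_targets_def bij_betw_def)
      then obtain j where j: "j < N" "z = f j" by auto
      have "j < i"
      proof (rule ccontr)
        assume "\<not> j < i"
        then have "\<not> active False v (X p (f i))" "X p (f i) \<le> X p (f j)" using stop False j mono by auto
        then show False using z j by (auto simp: active_targets_def active_def)
      qed
      then show ?thesis using j by auto
    qed
    then show ?thesis using i(2) by blast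
  qed
qed

abbreviation next_active :: bexp where
  "next_active \<equiv> BAnd (WLess (WVar ''i'') (WVar ''N'')) (BAnd (RLess (RVar ''v'') RZero)
     (RLess (RAdd (RVar ''v'') (RArr ''W'' (WAdd (WMult (WVar ''p'') (WVar ''N'')) (WArr ''sorted'' (index ''p'' ''i''))))) RZero))"

lemma bval_next_active:
  assumes "sized \<tau>" "wvar \<tau> ''p'' = p" "p < N" "rvar \<tau> ''v'' = v" "wvar \<tau> ''i'' \<le> N"
    and "\<And>i. i < N \<Longrightarrow> sorted_entry \<tau> p i = f i \<and> f i < N" "\<And>w. w < N \<Longrightarrow> entry \<tau> ''W'' p w = X p w"
  shows "bval limit \<tau> next_active \<longleftrightarrow> wvar \<tau> ''i'' < N \<and> active False v (X p (f (wvar \<tau> ''i'')))"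
proof (cases "wvar \<tau> ''i'' < N")
  case True
  note f = assms(6)[OF True]
  have "(p * N + f (wvar \<tau> ''i'')) mod limit = p * N + f (wvar \<tau> ''i'')" "p * N mod limit = p * N"
    using pair_less_limit[OF assms(3), of "f (wvar \<tau> ''i'')"] pair_less_limit[OF assms(3), of 0] f N_ge_1 by auto
  then show ?thesis using True assms(1-4) f assms(7)[of "f (wvar \<tau> ''i'')"] by (simp add: sizedD active_def)
qed (simp add: assms(1) sizedD)

end

locale relax_negative_run = sizes n s C for n s C +
  fixes \<sigma> :: machine_state and p :: nat and G X :: weights
  assumes sized: "sized \<sigma>" and p: "wvar \<sigma> ''p'' = p" "p < N" and queue: "queue \<sigma>"
    and X: "w < N \<Longrightarrow> entry \<sigma> ''W'' p w = X p w" and G: "w < N \<Longrightarrow> entry \<sigma> ''M'' p w = G p w"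
    and sorted: "row_sorted (sorted_entry \<sigma> p) (X p) N"
    and fuel: "num_active X p (rvar \<sigma> ''v'') \<le> wvar \<sigma> ''fuel''"
begin

abbreviation v :: real where
  "v \<equiv> rvar \<sigma> ''v''"

abbreviation f :: "nat \<Rightarrow> nat" where
  "f \<equiv> sorted_entry \<sigma> p"

abbreviation relax_next :: com where
  "relax_next \<equiv> WAssign ''w'' (WArr ''sorted'' (index ''p'' ''i'')) ;; RELAX ''M'' ''W'' (index ''p'' ''w'') ;;
     WAssign ''i'' (WAdd (WVar ''i'') (WConst 1))"

definition relaxed_to :: "nat set \<Rightarrow> machine_state \<Rightarrow> bool" where
  "relaxed_to S \<tau> \<longleftrightarrow>
     row_relaxed S (G p) (X p) v (rarr \<sigma> ''K'') (rarr \<sigma> ''R'') (rarr \<tau> ''K'') (rarr \<tau> ''R'') \<and> queue \<tau>"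

definition prefix_relaxed :: "machine_state \<Rightarrow> bool" where
  "prefix_relaxed \<tau> \<longleftrightarrow> wvar \<tau> ''i'' \<le> N \<and> f ` {..<wvar \<tau> ''i''} \<subseteq> active_targets X p v \<and>
     relaxed_to (f ` {..<wvar \<tau> ''i''}) \<tau> \<and> wvar \<tau> ''fuel'' + wvar \<tau> ''i'' = wvar \<sigma> ''fuel''"

lemma f_less: "i < N \<Longrightarrow> f i < N"
  using sorted by (auto simp: row_sorted_def bij_betw_def)

lemma inj_f: "inj_on f {..<N}"
  using sorted by (simp add: row_sorted_def bij_betw_def)

lemma unchanged:
  assumes "frame (FUELLED next_active relax_next) (wset ''i'' 0 \<sigma>) \<tau>"
  shows "sized \<tau>" "wvar \<tau> ''p'' = p" "rvar \<tau> ''v'' = v" "warr \<tau> ''sorted'' = warr \<sigma> ''sorted''"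
    "rarr \<tau> ''W'' = rarr \<sigma> ''W''" "rarr \<tau> ''M'' = rarr \<sigma> ''M''"
  using sized_frame[OF assms] sized by (auto simp: size_vars_eq frameD[OF assms] p)

lemma next_active_iff:
  assumes frame: "frame (FUELLED next_active relax_next) (wset ''i'' 0 \<sigma>) \<tau>" and "wvar \<tau> ''i'' \<le> N"
  shows "bval limit \<tau> next_active \<longleftrightarrow> wvar \<tau> ''i'' < N \<and> active False v (X p (f (wvar \<tau> ''i'')))"
  by (rule bval_next_active) (use unchanged[OF frame] assms(2) p f_less X in auto)

lemma relaxed_all_if_stopped:
  assumes frame: "frame (FUELLED next_active relax_next) (wset ''i'' 0 \<sigma>) \<tau>" and inv: "prefix_relaxed \<tau>"
    and stop: "wvar \<tau> ''fuel'' = 0 \<or> \<not> bval limit \<tau> next_active"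
  shows "relaxed_to (active_targets X p v) \<tau>" "wvar \<tau> ''fuel'' = wvar \<sigma> ''fuel'' - num_active X p v"
proof -
  let ?i = "wvar \<tau> ''i''"
  have i: "?i \<le> N" using inv by (simp add: prefix_relaxed_def)
  have prefix: "f ` {..<?i} = active_targets X p v"
    by (rule sorted_prefix_eq_active_targets[where X = X and p = p, OF sorted])
      (use inv stop next_active_iff[OF frame i] fuel in \<open>auto simp: prefix_relaxed_def\<close>)
  then have "num_active X p v = ?i" using card_image[OF inj_on_subset[OF inj_f], of "{..<?i}"] i by auto
  then show "relaxed_to (active_targets X p v) \<tau>" "wvar \<tau> ''fuel'' = wvar \<sigma> ''fuel'' - num_active X p v"
    using inv prefix by (auto simp: prefix_relaxed_def)
qed

lemma wlp_relax_next:
  assumes frame: "frame (FUELLED next_active relax_next) (wset ''i'' 0 \<sigma>) \<tau>" and inv: "prefix_relaxed \<tau>"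
    and pos: "0 < wvar \<tau> ''fuel''" and guard: "bval limit \<tau> next_active"
  shows "wlp limit relax_next prefix_relaxed (wset ''fuel'' (wvar \<tau> ''fuel'' - 1) \<tau>)"
proof -
  let ?i = "wvar \<tau> ''i''" and ?inc = "WAssign ''i'' (WAdd (WVar ''i'') (WConst 1))"
  let ?\<tau> = "\<tau>\<lparr>wvar := (wvar \<tau>)(''fuel'' := wvar \<tau> ''fuel'' - 1, ''w'' := f (wvar \<tau> ''i''))\<rparr>"
  note same = unchanged[OF frame] and inv' = inv[unfolded prefix_relaxed_def relaxed_to_def]
  have i: "?i < N" "f ?i \<in> active_targets X p v"
    using next_active_iff[OF frame] guard inv' f_less by (auto simp: active_targets_def)
  have "f ?i \<notin> f ` {..<?i}" using inj_f i(1) by (auto dest: inj_onD)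
  note insert = row_relaxed_insert[where g = "G p" and x = "X p", OF _ this f_less[OF i(1)]]
  have "wval limit ?\<tau> (index ''p'' ''w'') = p * N + f ?i" using same p f_less[OF i(1)] by (simp add: sizedD)
  moreover have "sized ?\<tau>" using same by (simp add: size_vars_eq)
  ultimately have "wlp limit (RELAX ''M'' ''W'' (index ''p'' ''w''))
      (\<lambda>\<upsilon>. edge_relaxed (G p (f ?i)) (v + X p (f ?i)) (f ?i)
      (rarr \<tau> ''K'') (rarr \<tau> ''R'') (rarr \<upsilon> ''K'') (rarr \<upsilon> ''R'') \<and> queue \<upsilon>) ?\<tau>"
    using wlp_RELAX[of ?\<tau> "f ?i" "index ''p'' ''w''" _ "''M''" "''W''"] f_less[OF i(1)] inv' X G by (simp add: same)
  then have "wlp limit (RELAX ''M'' ''W'' (index ''p'' ''w'')) (wlp limit ?inc prefix_relaxed) ?\<tau>"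
  proof (rule wlp_mono)
    fix \<upsilon>
    assume frame': "frame (RELAX ''M'' ''W'' (index ''p'' ''w'')) ?\<tau> \<upsilon>"
      and relaxed: "edge_relaxed (G p (f ?i)) (v + X p (f ?i)) (f ?i) (rarr \<tau> ''K'') (rarr \<tau> ''R'')
        (rarr \<upsilon> ''K'') (rarr \<upsilon> ''R'') \<and> queue \<upsilon>"
    have "wvar \<upsilon> ''i'' = ?i" "Suc ?i mod limit = Suc ?i" "wvar \<upsilon> ''fuel'' = wvar \<tau> ''fuel'' - 1"
      using i(1) less_limit(7) by (simp_all add: frameD[OF frame'])
    then show "wlp limit ?inc prefix_relaxed \<upsilon>"
      unfolding prefix_relaxed_def relaxed_to_def using insert relaxed inv' i pos by (auto simp: lessThan_Suc)
  qed
  then show ?thesis using same p i(1) by (simp add: sizedD)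
qed

lemma wlp_RELAX_NEGATIVE: "wlp limit RELAX_NEGATIVE (\<lambda>\<tau>. relaxed_to (active_targets X p v) \<tau> \<and>
    wvar \<tau> ''fuel'' = wvar \<sigma> ''fuel'' - num_active X p v) \<sigma>"
proof -
  have "wlp limit (FUELLED next_active relax_next) (\<lambda>\<tau>. relaxed_to (active_targets X p v) \<tau> \<and>
      wvar \<tau> ''fuel'' = wvar \<sigma> ''fuel'' - num_active X p v) (wset ''i'' 0 \<sigma>)"
  proof (rule wlp_FUELLED[OF limit_gt_1, where I = prefix_relaxed])
    show "prefix_relaxed (wset ''i'' 0 \<sigma>)"
      using queue by (simp add: prefix_relaxed_def relaxed_to_def row_relaxed_def)
  qed (use relaxed_all_if_stopped wlp_relax_next in blast)+
  then show ?thesis by (simp add: RELAX_NEGATIVE_def)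
qed

end


section \<open>Sorting\<close>

definition sorted_prefix :: "(nat \<Rightarrow> nat) \<Rightarrow> (nat \<Rightarrow> real) \<Rightarrow> nat \<Rightarrow> nat \<Rightarrow> bool" where
  "sorted_prefix f x k c \<longleftrightarrow> inj_on f {..<c} \<and> f ` {..<c} \<subseteq> {..<k} \<and>
     (\<forall>i j. i \<le> j \<and> j < c \<longrightarrow> x (f i) \<le> x (f j)) \<and> (\<forall>i<c. \<forall>w<k. w \<notin> f ` {..<c} \<longrightarrow> x (f i) \<le> x w)"

lemma sorted_prefix_Suc:
  assumes f: "sorted_prefix f x k c" and p: "p < k" "p \<notin> f ` {..<c}"
    and min: "\<And>w. w < k \<Longrightarrow> w \<notin> f ` {..<c} \<Longrightarrow> x p \<le> x w"
    and g: "\<And>i. i < c \<Longrightarrow> g i = f i" "g c = p"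
  shows "sorted_prefix g x k (Suc c)"
proof -
  have "g ` {..<c} = f ` {..<c}" by (rule image_cong) (auto simp: g)
  then have image: "g ` {..<Suc c} = insert p (f ` {..<c})" using g(2) by (simp add: lessThan_Suc)
  have "inj_on g {..<c}" using f inj_on_cong[of "{..<c}" g f] g(1) by (simp add: sorted_prefix_def)
  then have "inj_on g {..<Suc c}"
    using p(2) g(2) \<open>g ` {..<c} = f ` {..<c}\<close> by (simp add: lessThan_Suc)
  moreover have "x (g i) \<le> x (g j)" if "i \<le> j" "j < Suc c" for i j
    using f p g that unfolding sorted_prefix_def by (cases "i < c"; cases "j < c") (auto simp: less_Suc_eq)
  moreover have "x (g i) \<le> x w" if "i < Suc c" "w < k" "w \<notin> insert p (f ` {..<c})" for i w
    using f min g that unfolding sorted_prefix_def by (auto simp: less_Suc_eq)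
  moreover have "g ` {..<Suc c} \<subseteq> {..<k}" using f p(1) unfolding image by (auto simp: sorted_prefix_def)
  ultimately show ?thesis unfolding sorted_prefix_def image by blast
qed

context sizes
begin

lemma row_sorted_if_sorted_prefix: "sorted_prefix f x k k \<Longrightarrow> row_sorted f x k"
  unfolding sorted_prefix_def row_sorted_def bij_betw_def
  by (simp add: card_image card_subset_eq)

definition row_prefix_sorted ::
    "nat \<Rightarrow> nat \<Rightarrow> (nat \<Rightarrow> real) \<Rightarrow> (nat \<Rightarrow> nat) \<Rightarrow> nat \<Rightarrow> machine_state \<Rightarrow> bool" where
  "row_prefix_sorted r k x rest c \<sigma> \<longleftrightarrow> sorted_prefix (sorted_entry \<sigma> r) x k c \<and>
     (\<forall>w<N. warr \<sigma> ''done'' w = 0 \<longleftrightarrow> w < k \<and> w \<notin> sorted_entry \<sigma> r ` {..<c}) \<and> queue \<sigma> \<and>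
     (\<forall>y. y \<notin> (\<lambda>i. r * N + i) ` {..<k} \<longrightarrow> warr \<sigma> ''sorted'' y = rest y)"

lemma row_prefix_sorted_store:
  assumes inv: "row_prefix_sorted r k (rarr \<sigma> ''K'') rest c \<sigma>" and p: "extracted \<sigma> p \<tau>" and c: "c < k" "k \<le> N"
    and frame: "frame EXTRACT_MIN \<sigma> \<tau>"
  shows "row_prefix_sorted r k (rarr \<sigma> ''K'') rest (Suc c)
    (\<tau>\<lparr>warr := (warr \<tau>)(''sorted'' := (warr \<sigma> ''sorted'')(r * N + c := p))\<rparr>)"
proof -
  let ?S = "(warr \<sigma> ''sorted'')(r * N + c := p)"
  note inv = inv[unfolded row_prefix_sorted_def]
  have pk: "p < k" "p \<notin> sorted_entry \<sigma> r ` {..<c}" using p inv by (auto simp: extracted_def)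
  have "rarr \<sigma> ''K'' p \<le> rarr \<sigma> ''K'' w" if "w < k" "w \<notin> sorted_entry \<sigma> r ` {..<c}" for w
    using p inv that c(2) by (simp add: extracted_def)
  then have "sorted_prefix (\<lambda>i. ?S (r * N + i)) (rarr \<sigma> ''K'') k (Suc c)"
    by (rule sorted_prefix_Suc[OF conjunct1[OF inv] pk]) auto
  moreover have "(\<lambda>i. ?S (r * N + i)) ` {..<c} = sorted_entry \<sigma> r ` {..<c}" by (rule image_cong) auto
  then have image: "(\<lambda>i. ?S (r * N + i)) ` {..<Suc c} = insert p (sorted_entry \<sigma> r ` {..<c})"
    unfolding lessThan_Suc image_insert by simp
  have "warr \<tau> ''done'' w = 0 \<longleftrightarrow> w < k \<and> w \<notin> (\<lambda>i. ?S (r * N + i)) ` {..<Suc c}" if "w < N" for w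
    using p inv that unfolding image by (auto simp: extracted_def)
  moreover have "queue \<tau>" using p by (auto simp: extracted_def)
  ultimately show ?thesis using inv c(1) unfolding row_prefix_sorted_def by auto
qed

lemma wlp_sort_step:
  assumes sized: "sized \<sigma>" and r: "wvar \<sigma> ''r'' = r" "r < N" and c: "wvar \<sigma> ''c'' = c" "c < k" "k \<le> N"
    and inv: "row_prefix_sorted r k (rarr \<sigma> ''K'') rest c \<sigma>"
  shows "wlp limit (EXTRACT_MIN ;; WStore ''sorted'' (index ''r'' ''c'') (WVar ''p''))
    (row_prefix_sorted r k (rarr \<sigma> ''K'') rest (Suc c)) \<sigma>"
proof -
  have "card (sorted_entry \<sigma> r ` {..<c}) \<noteq> card {..<k}"
    using card_image_le[of "{..<c}" "sorted_entry \<sigma> r"] c by simp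
  moreover have "sorted_entry \<sigma> r ` {..<c} \<subseteq> {..<k}"
    using inv by (simp add: row_prefix_sorted_def sorted_prefix_def)
  ultimately have "sorted_entry \<sigma> r ` {..<c} \<subset> {..<k}" by (metis psubsetI)
  then obtain v where "v < k" "v \<notin> sorted_entry \<sigma> r ` {..<c}" by auto
  then have "v < N" "warr \<sigma> ''done'' v = 0" "queue \<sigma>" using inv c(3) by (auto simp: row_prefix_sorted_def)
  then have "wlp limit EXTRACT_MIN (\<lambda>\<tau>. \<exists>p. extracted \<sigma> p \<tau>) \<sigma>" by (intro wlp_EXTRACT_MIN[OF sized])
  then show ?thesis
    unfolding wlp_Seq
  proof (rule wlp_mono)
    fix \<tau> assume frame: "frame EXTRACT_MIN \<sigma> \<tau>" and "\<exists>p. extracted \<sigma> p \<tau>"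
    then obtain p where p: "extracted \<sigma> p \<tau>" by blast
    then have "wvar \<tau> ''p'' = p" by (simp add: extracted_def)
    moreover have "sized \<tau>" using sized_frame[OF frame sized] by (simp add: size_vars_eq)
    then have "wval limit \<tau> (index ''r'' ''c'') = r * N + c" using c r by (simp add: sizedD frameD[OF frame])
    ultimately show "wlp limit (WStore ''sorted'' (index ''r'' ''c'') (WVar ''p''))
        (row_prefix_sorted r k (rarr \<sigma> ''K'') rest (Suc c)) \<tau>"
      using row_prefix_sorted_store[OF inv p c(2,3) frame] by (simp add: frameD[OF frame])
  qed
qed

lemma wlp_SORT_ROW:
  assumes sized: "sized \<sigma>" and e: "(e, k) \<in> set size_table" "k \<le> N" and X: "X \<noteq> ''K''"
    and r: "wvar \<sigma> ''r'' = r" "r < N"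
  shows "wlp limit (SORT_ROW X e) (\<lambda>\<tau>. row_sorted (sorted_entry \<tau> r) (entry \<sigma> X r) k \<and>
    (\<forall>y. y \<notin> (\<lambda>i. r * N + i) ` {..<k} \<longrightarrow> warr \<tau> ''sorted'' y = warr \<sigma> ''sorted'' y)) \<sigma>"
proof (rule wlpI)
  let ?step = "EXTRACT_MIN ;; WStore ''sorted'' (index ''r'' ''c'') (WVar ''p'')"
  fix \<upsilon> assume "executes (SORT_ROW X e) \<sigma> \<upsilon>"
  then obtain \<rho> \<tau> where exec: "executes (LOAD_KEYS X (index ''r'' ''x'')) \<sigma> \<rho>" "executes (INIT_QUEUE e) \<rho> \<tau>"
    "executes (FOR ''c'' e ?step) \<tau> \<upsilon>" by (auto simp: SORT_ROW_def executes_Seq)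
  note frames = exec(1,2)[THEN executes_frame]
  have sized': "sized \<rho>" "sized \<tau>" using exec(1,2)[THEN executes_sized] sized by (auto simp: size_vars_eq)
  have "wlp limit (LOAD_KEYS X (index ''r'' ''x'')) (\<lambda>\<tau>. \<forall>x<N. rarr \<tau> ''K'' x = entry \<sigma> X r x) \<sigma>"
    by (rule wlp_LOAD_KEYS[OF sized X]) (use r in \<open>simp add: sizedD frame_def\<close>)
  from wlpD[OF this exec(1)] have K: "rarr \<tau> ''K'' x = entry \<sigma> X r x" if "x < N" for x
    using that by (simp add: frameD[OF frames(2)])
  have same: "wvar \<tau> ''r'' = r" "warr \<tau> ''sorted'' = warr \<sigma> ''sorted''"
    by (simp_all add: frameD[OF frames(1)] frameD[OF frames(2)] r)
  let ?inv = "row_prefix_sorted r k (rarr \<tau> ''K'') (warr \<sigma> ''sorted'')"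
  have "wlp limit (FOR ''c'' e ?step) (?inv k) \<tau>"
  proof (rule wlp_FOR_size[where I = ?inv, OF sized'(2) e(1)])
    show "?inv 0 \<tau>"
      using wlpD[OF wlp_INIT_QUEUE[OF sized'(1) e(1)] exec(2)] same
      by (simp add: row_prefix_sorted_def sorted_prefix_def)
    fix c \<upsilon>
    assume c: "c < k" "wvar \<upsilon> ''c'' = c" and \<upsilon>: "sized \<upsilon>" "frame (FOR ''c'' e ?step) \<tau> \<upsilon>" and inv: "?inv c \<upsilon>"
    have "rarr \<upsilon> ''K'' = rarr \<tau> ''K''" "wvar \<upsilon> ''r'' = r" using e(1) by (auto simp: frameD[OF \<upsilon>(2)] same)
    with wlp_sort_step[OF \<upsilon>(1) _ r(2) c(2,1) e(2)] inv show "wlp limit ?step (?inv (Suc c)) \<upsilon>" by metis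
  qed (use e in \<open>auto simp: size_vars_eq size_table_def row_prefix_sorted_def\<close>)
  note sorted = wlpD[OF this exec(3), unfolded row_prefix_sorted_def]
  then have "row_sorted (sorted_entry \<upsilon> r) (rarr \<tau> ''K'') k" by (simp add: row_sorted_if_sorted_prefix)
  then have "row_sorted (sorted_entry \<upsilon> r) (entry \<sigma> X r) k" by (rule row_sorted_cong) (use K e(2) in auto)
  with sorted show "row_sorted (sorted_entry \<upsilon> r) (entry \<sigma> X r) k \<and>
      (\<forall>y. y \<notin> (\<lambda>i. r * N + i) ` {..<k} \<longrightarrow> warr \<upsilon> ''sorted'' y = warr \<sigma> ''sorted'' y)" by blast
qed

lemma wlp_SORT_ROWS:
  assumes sized: "sized \<sigma>" and e: "(e, k) \<in> set size_table" "k \<le> N" and X: "X \<noteq> ''K''"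
  shows "wlp limit (SORT_ROWS X e) (\<lambda>\<tau>. \<forall>r<k. row_sorted (sorted_entry \<tau> r) (entry \<sigma> X r) k) \<sigma>"
  unfolding SORT_ROWS_def
proof (rule wlp_FOR_size[OF sized e(1), where I = "\<lambda>r \<tau>. \<forall>r'<r. row_sorted (sorted_entry \<tau> r') (entry \<sigma> X r') k"])
  fix r \<tau>
  assume r: "r < k" "wvar \<tau> ''r'' = r" and \<tau>: "sized \<tau>" "frame (FOR ''r'' e (SORT_ROW X e)) \<sigma> \<tau>"
    and inv: "\<forall>r'<r. row_sorted (sorted_entry \<tau> r') (entry \<sigma> X r') k"
  have X': "rarr \<tau> X = rarr \<sigma> X" and rN: "r < N" using X r e by (simp_all add: frameD[OF \<tau>(2)])
  show "wlp limit (SORT_ROW X e) (\<lambda>\<tau>. \<forall>r'<Suc r. row_sorted (sorted_entry \<tau> r') (entry \<sigma> X r') k) \<tau>"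
  proof (rule wlp_mono[OF wlp_SORT_ROW[OF \<tau>(1) e X r(2) rN]], intro allI impI)
    fix \<upsilon> :: machine_state and r'
    assume \<upsilon>: "row_sorted (sorted_entry \<upsilon> r) (entry \<tau> X r) k \<and>
      (\<forall>y. y \<notin> (\<lambda>i. r * N + i) ` {..<k} \<longrightarrow> warr \<upsilon> ''sorted'' y = warr \<tau> ''sorted'' y)" and "r' < Suc r"
    show "row_sorted (sorted_entry \<upsilon> r') (entry \<sigma> X r') k"
    proof (cases "r' = r")
      case False
      then have "r' * N + i \<notin> (\<lambda>i. r * N + i) ` {..<k}" if "i < k" for i
        using that e(2) by (auto simp: pair_eq_iff)
      then have same: "sorted_entry \<upsilon> r' i = sorted_entry \<tau> r' i" if "i < k" for i
        using conjunct2[OF \<upsilon>] that by simp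
      have "row_sorted (sorted_entry \<tau> r') (entry \<sigma> X r') k" using inv \<open>r' < Suc r\<close> False by simp
      then show ?thesis by (rule row_sorted_cong) (simp_all only: same)
    qed (use \<upsilon> X' in simp)
  qed
qed (auto simp: size_vars_eq)

end


section \<open>Processing the hubs\<close>

context sizes
begin

lemma wlp_COPY_MATRIX:
  assumes "sized \<sigma>" "X \<noteq> Y"
  shows "wlp limit (COPY_MATRIX X Y) (\<lambda>\<tau>. \<forall>x<N. \<forall>y<N. entry \<tau> Y x y = entry \<sigma> X x y) \<sigma>"
  unfolding COPY_MATRIX_def
  by (rule wlp_FOR2_store[OF assms(1) size_table_simps(4)])
    (use assms in \<open>auto simp: size_vars_eq sizedD frame_def\<close>)

lemma wlp_SHIFT_MATRIX:
  assumes "sized \<sigma>" "X \<noteq> ''V''"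
  shows "wlp limit (SHIFT_MATRIX X) (\<lambda>\<tau>. \<forall>x<N. \<forall>y<N.
    entry \<tau> X x y = entry \<sigma> X x y - rarr \<sigma> ''V'' x + rarr \<sigma> ''V'' y) \<sigma>"
  unfolding SHIFT_MATRIX_def
  by (rule wlp_FOR2_store[OF assms(1) size_table_simps(4)])
    (use assms in \<open>auto simp: size_vars_eq sizedD frame_def\<close>)

lemma wlp_store_column:
  assumes sized: "sized \<sigma>" and r: "wvar \<sigma> ''r'' = r" "r < N"
  shows "wlp limit (FOR ''x'' ''N'' (RStore ''H'' (index ''x'' ''r'') (RArr ''V'' (WVar ''x''))))
    (\<lambda>\<tau>. \<forall>x<N. \<forall>y<N. entry \<tau> ''H'' x y = (if y = r then rarr \<sigma> ''V'' x else entry \<sigma> ''H'' x y)) \<sigma>"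
proof (rule wlp_mono)
  show "wlp limit (FOR ''x'' ''N'' (RStore ''H'' (index ''x'' ''r'') (RArr ''V'' (WVar ''x''))))
      (\<lambda>\<tau>. (\<forall>x<N. entry \<tau> ''H'' x r = rarr \<sigma> ''V'' x) \<and>
        (\<forall>y. y \<notin> (\<lambda>x. x * N + r) ` {..<N} \<longrightarrow> rarr \<tau> ''H'' y = rarr \<sigma> ''H'' y)) \<sigma>"
    by (rule wlp_FOR_store[OF sized size_table_simps(4)])
      (use r in \<open>auto simp: size_vars_eq sizedD frame_def inj_on_def\<close>)
  fix \<tau>
  assume \<tau>: "(\<forall>x<N. entry \<tau> ''H'' x r = rarr \<sigma> ''V'' x) \<and>
    (\<forall>y. y \<notin> (\<lambda>x. x * N + r) ` {..<N} \<longrightarrow> rarr \<tau> ''H'' y = rarr \<sigma> ''H'' y)"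
  have "x * N + y \<notin> (\<lambda>x. x * N + r) ` {..<N}" if "y < N" "y \<noteq> r" for x y
    using that r(2) by (auto simp: pair_eq_iff)
  with \<tau> show "\<forall>x<N. \<forall>y<N. entry \<tau> ''H'' x y = (if y = r then rarr \<sigma> ''V'' x else entry \<sigma> ''H'' x y)" by simp
qed

lemma wlp_store_row:
  assumes sized: "sized \<sigma>" and r: "wvar \<sigma> u = r" "r < N" and X: "(X, b) \<in> set size_table" "b \<le> N"
    and u: "u \<noteq> ''x''" and Y: "Y \<noteq> ''R''"
  shows "wlp limit (FOR ''x'' X (RStore Y (index u ''x'') (RArr ''R'' (WVar ''x''))))
    (\<lambda>\<tau>. \<forall>x<N. \<forall>y<N. entry \<tau> Y x y = (if x = r \<and> y < b then rarr \<sigma> ''R'' y else entry \<sigma> Y x y)) \<sigma>"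
proof (rule wlp_mono)
  show "wlp limit (FOR ''x'' X (RStore Y (index u ''x'') (RArr ''R'' (WVar ''x''))))
      (\<lambda>\<tau>. (\<forall>y<b. entry \<tau> Y r y = rarr \<sigma> ''R'' y) \<and>
        (\<forall>y. y \<notin> (\<lambda>y. r * N + y) ` {..<b} \<longrightarrow> rarr \<tau> Y y = rarr \<sigma> Y y)) \<sigma>"
    by (rule wlp_FOR_store[OF sized X(1)]) (use r u X Y in \<open>auto simp: size_vars_eq sizedD frame_def\<close>)
  fix \<tau>
  assume \<tau>: "(\<forall>y<b. entry \<tau> Y r y = rarr \<sigma> ''R'' y) \<and>
    (\<forall>y. y \<notin> (\<lambda>y. r * N + y) ` {..<b} \<longrightarrow> rarr \<tau> Y y = rarr \<sigma> Y y)"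
  have "x * N + y \<notin> (\<lambda>y. r * N + y) ` {..<b}" if "y < N" "\<not> (x = r \<and> y < b)" for x y
    using that X(2) by (auto simp: pair_eq_iff)
  with \<tau> show "\<forall>x<N. \<forall>y<N. entry \<tau> Y x y = (if x = r \<and> y < b then rarr \<sigma> ''R'' y else entry \<sigma> Y x y)" by auto
qed

lemma wlp_REWEIGHT:
  assumes sized: "sized \<sigma>" and r: "wvar \<sigma> ''r'' = r" "r < N"
  defines "V \<equiv> rarr \<sigma> ''V''"
  shows "wlp limit REWEIGHT (\<lambda>\<tau>. (\<forall>x<N. \<forall>y<N.
      entry \<tau> ''H'' x y = (if x = r then rarr \<sigma> ''R'' y else if y = r then V x else entry \<sigma> ''H'' x y) - V x + V y) \<and>
    (\<forall>x<N. \<forall>y<N. entry \<tau> ''W'' x y = entry \<sigma> ''W'' x y - V x + V y) \<and>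
    (\<forall>x<n. rarr \<tau> ''P'' x = rarr \<sigma> ''P'' x + V x)) \<sigma>"
proof (rule wlpI)
  let ?column = "FOR ''x'' ''N'' (RStore ''H'' (index ''x'' ''r'') (RArr ''V'' (WVar ''x'')))"
    and ?row = "FOR ''x'' ''N'' (RStore ''H'' (index ''r'' ''x'') (RArr ''R'' (WVar ''x'')))"
    and ?add = "FOR ''x'' ''n'' (RStore ''P'' (WVar ''x'') (RAdd (RArr ''P'' (WVar ''x'')) (RArr ''V'' (WVar ''x''))))"
  fix \<upsilon> assume "executes REWEIGHT \<sigma> \<upsilon>"
  then obtain \<tau>\<^sub>1 \<tau>\<^sub>2 \<tau>\<^sub>3 \<tau>\<^sub>4 where exec: "executes ?column \<sigma> \<tau>\<^sub>1" "executes ?row \<tau>\<^sub>1 \<tau>\<^sub>2"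
    "executes (SHIFT_MATRIX ''H'') \<tau>\<^sub>2 \<tau>\<^sub>3" "executes (SHIFT_MATRIX ''W'') \<tau>\<^sub>3 \<tau>\<^sub>4" "executes ?add \<tau>\<^sub>4 \<upsilon>"
    by (auto simp: REWEIGHT_def executes_Seq)
  note frames = exec[THEN executes_frame]
  note same = frameD[OF frames(1)] frameD[OF frames(2)] frameD[OF frames(3)] frameD[OF frames(4)] frameD[OF frames(5)]
  have sized': "sized \<tau>\<^sub>1" "sized \<tau>\<^sub>2" "sized \<tau>\<^sub>3" "sized \<tau>\<^sub>4"
    using exec(1-4)[THEN executes_sized] sized by (auto simp: size_vars_eq)
  have "entry \<tau>\<^sub>2 ''H'' x y = (if x = r then rarr \<sigma> ''R'' y else if y = r then V x else entry \<sigma> ''H'' x y)"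
    if "x < N" "y < N" for x y
    using wlpD[OF wlp_store_column[OF sized r] exec(1)] wlpD[OF wlp_store_row[OF sized'(1) _ r(2) size_table_simps(4)] exec(2)] that
    by (simp add: V_def same r)
  moreover have "rarr \<tau>\<^sub>2 ''V'' = V" by (simp add: same V_def)
  ultimately have H: "entry \<tau>\<^sub>3 ''H'' x y =
      (if x = r then rarr \<sigma> ''R'' y else if y = r then V x else entry \<sigma> ''H'' x y) - V x + V y"
    if "x < N" "y < N" for x y
    using wlpD[OF wlp_SHIFT_MATRIX[OF sized'(2)] exec(3)] that by simp
  have W: "entry \<tau>\<^sub>4 ''W'' x y = entry \<sigma> ''W'' x y - V x + V y" if "x < N" "y < N" for x y
    using wlpD[OF wlp_SHIFT_MATRIX[OF sized'(3)] exec(4)] that by (simp add: same V_def)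
  have "wlp limit ?add (\<lambda>\<tau>. \<forall>x<n. rarr \<tau> ''P'' x = rarr \<tau>\<^sub>4 ''P'' x + rarr \<tau>\<^sub>4 ''V'' x) \<tau>\<^sub>4"
    by (rule wlp_FOR_vector[OF sized'(4) size_table_simps(1)]) (auto simp: size_vars_eq frame_def)
  from wlpD[OF this exec(5)] have "\<forall>x<n. rarr \<upsilon> ''P'' x = rarr \<sigma> ''P'' x + V x" by (simp add: same V_def)
  with H W show "(\<forall>x<N. \<forall>y<N. entry \<upsilon> ''H'' x y =
      (if x = r then rarr \<sigma> ''R'' y else if y = r then V x else entry \<sigma> ''H'' x y) - V x + V y) \<and>
      (\<forall>x<N. \<forall>y<N. entry \<upsilon> ''W'' x y = entry \<sigma> ''W'' x y - V x + V y) \<and>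
      (\<forall>x<n. rarr \<upsilon> ''P'' x = rarr \<sigma> ''P'' x + V x)" by (simp add: same)
qed

lemma distances_to_hub:
  assumes sized: "sized \<sigma>" and r: "wvar \<sigma> ''r'' = r" "r < N"
    and exec: "executes (LOAD_KEYS ''H'' (index ''x'' ''r'')) \<sigma> \<rho>"
      "executes (DIJKSTRA_TWICE ''H'' (index ''w'' ''p'')) \<rho> \<tau>"
  defines "E \<equiv> \<lambda>p w. entry \<sigma> ''H'' w p"
  obtains K R where "dijkstra_result N E E True (\<lambda>x. entry \<sigma> ''H'' x r) K R"
    "dijkstra_result N E E True R (rarr \<tau> ''K'') (rarr \<tau> ''R'')"
proof -
  note same = frameD[OF executes_frame[OF exec(1)]]
  have sized': "sized \<rho>" using executes_sized[OF exec(1) sized] by (simp add: size_vars_eq)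
  have "wlp limit (LOAD_KEYS ''H'' (index ''x'' ''r'')) (\<lambda>\<tau>. \<forall>x<N. rarr \<tau> ''K'' x = rarr \<sigma> ''H'' (x * N + r)) \<sigma>"
    by (rule wlp_LOAD_KEYS[OF sized]) (use r in \<open>auto simp: sizedD frame_def\<close>)
  from wlpD[OF this exec(1)] have "\<And>x. x < N \<Longrightarrow> rarr \<rho> ''K'' x = entry \<sigma> ''H'' x r" by simp
  from wlpD[OF wlp_DIJKSTRA_TWICE[OF sized' this _ index_of_index(2)] exec(2)] show thesis
    using that by (auto simp: same E_def)
qed

lemma wlp_PROCESS_HUB:
  assumes sized: "sized \<sigma>" and r: "warr \<sigma> ''hub'' (wvar \<sigma> ''h'') = r" "r < N"
    and hubs: "hub_reweighted N M h \<phi> (entry \<sigma> ''H'') D"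
  shows "wlp limit PROCESS_HUB (\<lambda>\<tau>. \<exists>V. hub_reweighted N M h (\<lambda>x. \<phi> x + V x) (entry \<tau> ''H'') (insert r D) \<and>
    (\<forall>x<N. \<forall>y<N. entry \<tau> ''W'' x y = entry \<sigma> ''W'' x y - V x + V y) \<and>
    (\<forall>x<n. rarr \<tau> ''P'' x = rarr \<sigma> ''P'' x + V x)) \<sigma>"
proof (rule wlpI)
  let ?H = "entry \<sigma> ''H''" and ?store = "FOR ''x'' ''N'' (RStore ''V'' (WVar ''x'') (RArr ''K'' (WVar ''x'')))"
  let ?\<sigma> = "wset ''r'' r \<sigma>"
  fix \<upsilon> assume "executes PROCESS_HUB \<sigma> \<upsilon>"
  then obtain \<tau>\<^sub>1 \<tau>\<^sub>2 \<tau>\<^sub>3 \<tau>\<^sub>4 \<tau>\<^sub>5 where exec: "executes (LOAD_KEYS ''H'' (index ''x'' ''r'')) ?\<sigma> \<tau>\<^sub>1"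
    "executes (DIJKSTRA_TWICE ''H'' (index ''w'' ''p'')) \<tau>\<^sub>1 \<tau>\<^sub>2" "executes ?store \<tau>\<^sub>2 \<tau>\<^sub>3"
    "executes (LOAD_KEYS ''H'' (index ''r'' ''x'')) \<tau>\<^sub>3 \<tau>\<^sub>4"
    "executes (DIJKSTRA (RELAX_ALL ''H'' (index ''p'' ''w''))) \<tau>\<^sub>4 \<tau>\<^sub>5" "executes REWEIGHT \<tau>\<^sub>5 \<upsilon>"
    by (auto simp: PROCESS_HUB_def executes_Seq executes_WAssign r(1))
  note frames = exec[THEN executes_frame]
  note same = frameD[OF frames(1)] frameD[OF frames(2)] frameD[OF frames(3)] frameD[OF frames(4)] frameD[OF frames(5)]
  have sized_\<sigma>: "sized ?\<sigma>" using sized by (simp add: size_vars_eq)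
  then have sized': "sized \<tau>\<^sub>1" "sized \<tau>\<^sub>2" "sized \<tau>\<^sub>3" "sized \<tau>\<^sub>4" "sized \<tau>\<^sub>5"
    using exec(1-5)[THEN executes_sized] by (auto simp: size_vars_eq)
  obtain K\<^sub>1 R\<^sub>1 where to: "dijkstra_result N (\<lambda>p w. ?H w p) (\<lambda>p w. ?H w p) True (\<lambda>x. ?H x r) K\<^sub>1 R\<^sub>1"
    "dijkstra_result N (\<lambda>p w. ?H w p) (\<lambda>p w. ?H w p) True R\<^sub>1 (rarr \<tau>\<^sub>2 ''K'') (rarr \<tau>\<^sub>2 ''R'')"
    using distances_to_hub[OF sized_\<sigma> _ r(2) exec(1,2)] by auto
  have "wlp limit ?store (\<lambda>\<tau>. \<forall>x<N. rarr \<tau> ''V'' x = rarr \<tau>\<^sub>2 ''K'' x) \<tau>\<^sub>2"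
    by (rule wlp_FOR_vector[OF sized'(2) size_table_simps(4)]) (auto simp: size_vars_eq frame_def)
  from wlpD[OF this exec(3)] have V: "rarr \<tau>\<^sub>2 ''K'' x = rarr \<tau>\<^sub>3 ''V'' x" if "x < N" for x using that by simp
  have "wlp limit (LOAD_KEYS ''H'' (index ''r'' ''x'')) (\<lambda>\<tau>. \<forall>x<N. rarr \<tau> ''K'' x = rarr \<tau>\<^sub>3 ''H'' (r * N + x)) \<tau>\<^sub>3"
    by (rule wlp_LOAD_KEYS[OF sized'(3)]) (use r(2) in \<open>auto simp: sizedD frame_def same\<close>)
  from wlpD[OF this exec(4)] have "\<And>x. x < N \<Longrightarrow> rarr \<tau>\<^sub>4 ''K'' x = ?H r x" by (simp add: same)
  from wlpD[OF wlp_DIJKSTRA_all[OF sized'(4) this _ index_of_index(1)] exec(5)]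
  have from_hub: "dijkstra_result N ?H ?H True (?H r) (rarr \<tau>\<^sub>5 ''K'') (rarr \<tau>\<^sub>5 ''R'')" by (simp add: same)
  interpret hub_insertion N M h \<phi> ?H D r K\<^sub>1 R\<^sub>1 "rarr \<tau>\<^sub>3 ''V''" "rarr \<tau>\<^sub>2 ''R''" "rarr \<tau>\<^sub>5 ''K''" "rarr \<tau>\<^sub>5 ''R''"
    by (intro hub_insertion.intro hub_insertion_axioms.intro hubs r(2) to(1) from_hub dijkstra_state_cong[OF V refl to(2)])
  have "wvar \<tau>\<^sub>5 ''r'' = r" by (simp add: same)
  note reweighted = wlpD[OF wlp_REWEIGHT[OF sized'(5) this r(2)] exec(6)]
  have "hub_reweighted N M h (\<lambda>x. \<phi> x + rarr \<tau>\<^sub>3 ''V'' x) (entry \<upsilon> ''H'') (insert r D)"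
    by (rule hub_reweighted_insert) (use reweighted in \<open>simp_all add: H'_def same\<close>)
  then show "\<exists>V. hub_reweighted N M h (\<lambda>x. \<phi> x + V x) (entry \<upsilon> ''H'') (insert r D) \<and>
      (\<forall>x<N. \<forall>y<N. entry \<upsilon> ''W'' x y = entry \<sigma> ''W'' x y - V x + V y) \<and>
      (\<forall>x<n. rarr \<upsilon> ''P'' x = rarr \<sigma> ''P'' x + V x)"
    using reweighted by (intro exI[of _ "rarr \<tau>\<^sub>3 ''V''"]) (simp add: same)
qed

abbreviation hubs :: "machine_state \<Rightarrow> nat set" where
  "hubs \<sigma> \<equiv> warr \<sigma> ''hub'' ` {..<q}"

lemma wlp_REWEIGHT_BY_HUBS:
  assumes sized: "sized \<sigma>" and hubs_less: "hubs \<sigma> \<subseteq> {..<N}"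
    and M: "M = entry \<sigma> ''M''" and feasible: "feasible N M h" and diagonal: "\<And>x. x < N \<Longrightarrow> M x x = 0"
  shows "wlp limit REWEIGHT_BY_HUBS (\<lambda>\<tau>. \<exists>\<phi>. hub_reweighted N M h \<phi> (entry \<tau> ''H'') (hubs \<sigma>) \<and>
    (\<forall>x<N. \<forall>y<N. entry \<tau> ''W'' x y = M x y - \<phi> x + \<phi> y) \<and> (\<forall>x<n. rarr \<tau> ''P'' x = rarr \<sigma> ''P'' x + \<phi> x)) \<sigma>"
proof (rule wlpI)
  fix \<upsilon> assume "executes REWEIGHT_BY_HUBS \<sigma> \<upsilon>"
  then obtain \<rho> \<tau> where exec: "executes (COPY_MATRIX ''M'' ''H'') \<sigma> \<rho>" "executes (COPY_MATRIX ''M'' ''W'') \<rho> \<tau>"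
    "executes (FOR ''h'' ''q'' PROCESS_HUB) \<tau> \<upsilon>" by (auto simp: REWEIGHT_BY_HUBS_def executes_Seq)
  note frames = exec(1,2)[THEN executes_frame]
    and same = frameD[OF exec(1)[THEN executes_frame]] frameD[OF exec(2)[THEN executes_frame]]
  have sized': "sized \<rho>" "sized \<tau>" using exec(1,2)[THEN executes_sized] sized by (auto simp: size_vars_eq)
  have copies: "entry \<tau> ''H'' x y = M x y" "entry \<tau> ''W'' x y = M x y" if "x < N" "y < N" for x y
    using that wlpD[OF wlp_COPY_MATRIX[OF sized] exec(1)] wlpD[OF wlp_COPY_MATRIX[OF sized'(1)] exec(2)]
    by (simp_all add: same M)
  let ?inv = "\<lambda>k \<upsilon>. \<exists>\<phi>. hub_reweighted N M h \<phi> (entry \<upsilon> ''H'') (warr \<sigma> ''hub'' ` {..<k}) \<and>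
    (\<forall>x<N. \<forall>y<N. entry \<upsilon> ''W'' x y = M x y - \<phi> x + \<phi> y) \<and> (\<forall>x<n. rarr \<upsilon> ''P'' x = rarr \<sigma> ''P'' x + \<phi> x)"
  have "wlp limit (FOR ''h'' ''q'' PROCESS_HUB) (?inv q) \<tau>"
  proof (rule wlp_FOR_size[where I = ?inv, OF sized'(2) size_table_simps(2)])
    show "?inv 0 \<tau>"
      using hub_reweighted_empty[OF copies(1) feasible diagonal] copies(2)
      by (intro exI[of _ "\<lambda>_. 0"]) (simp add: same)
    fix k \<upsilon> assume k: "k < q" "wvar \<upsilon> ''h'' = k" and \<upsilon>: "sized \<upsilon>" "frame (FOR ''h'' ''q'' PROCESS_HUB) \<tau> \<upsilon>"
      and "?inv k \<upsilon>"
    then obtain \<phi> where \<phi>: "hub_reweighted N M h \<phi> (entry \<upsilon> ''H'') (warr \<sigma> ''hub'' ` {..<k})"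
      "\<forall>x<N. \<forall>y<N. entry \<upsilon> ''W'' x y = M x y - \<phi> x + \<phi> y" "\<forall>x<n. rarr \<upsilon> ''P'' x = rarr \<sigma> ''P'' x + \<phi> x" by blast
    have hub: "warr \<upsilon> ''hub'' (wvar \<upsilon> ''h'') = warr \<sigma> ''hub'' k" "warr \<sigma> ''hub'' k < N"
      using hubs_less k by (auto simp: frameD[OF \<upsilon>(2)] same)
    show "wlp limit PROCESS_HUB (?inv (Suc k)) \<upsilon>"
    proof (rule wlp_mono[OF wlp_PROCESS_HUB[OF \<upsilon>(1) hub \<phi>(1)]], elim exE conjE)
      fix \<omega> V
      assume "hub_reweighted N M h (\<lambda>x. \<phi> x + V x) (entry \<omega> ''H'') (insert (warr \<sigma> ''hub'' k) (warr \<sigma> ''hub'' ` {..<k}))"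
        "\<forall>x<N. \<forall>y<N. entry \<omega> ''W'' x y = entry \<upsilon> ''W'' x y - V x + V y"
        "\<forall>x<n. rarr \<omega> ''P'' x = rarr \<upsilon> ''P'' x + V x"
      then show "?inv (Suc k) \<omega>" using \<phi>(2,3) by (intro exI[of _ "\<lambda>x. \<phi> x + V x"]) (simp add: lessThan_Suc)
    qed
  qed (auto simp: size_vars_eq)
  from wlpD[OF this exec(3)] show "?inv q \<upsilon>" .
qed


section \<open>Exploring walks with negative prefixes\<close>

lemma wlp_DIJKSTRA_negative:
  assumes sized: "sized \<sigma>" and a: "\<And>x. x < N \<Longrightarrow> rarr \<sigma> ''K'' x = a x"
    and M: "M = entry \<sigma> ''M''" and W: "W = entry \<sigma> ''W''"
    and nonneg: "\<And>x y. x < N \<Longrightarrow> y < N \<Longrightarrow> 0 \<le> M x y \<Longrightarrow> 0 \<le> W x y"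
    and sorted: "\<And>r. r < N \<Longrightarrow> row_sorted (sorted_entry \<sigma> r) (W r) N"
    and low: "nonneg_feasible N M W low" "\<And>y. y < N \<Longrightarrow> low y \<le> a y"
    and few: "(\<Sum>p<N. num_active W p (low p)) \<le> b" and fuel: "b \<le> wvar \<sigma> ''fuel''"
  shows "wlp limit (DIJKSTRA RELAX_NEGATIVE) (\<lambda>\<tau>. dijkstra_result N M W False a (rarr \<tau> ''K'') (rarr \<tau> ''R'') \<and>
    wvar \<sigma> ''fuel'' \<le> wvar \<tau> ''fuel'' + b) \<sigma>"
proof -
  let ?F = "wvar \<sigma> ''fuel''"
  have used: "(\<Sum>p\<in>S. num_active W p (K p)) \<le> b"
    if "dijkstra_state N M W False a S' K R" "S \<subseteq> {..<N}" for S S' K R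
  proof -
    have "(\<Sum>p\<in>S. num_active W p (K p)) \<le> (\<Sum>p\<in>S. num_active W p (low p))"
      using dijkstra_state.key_greatest[OF that(1) low] that(2) by (intro sum_mono num_active_antimono) auto
    also have "\<dots> \<le> (\<Sum>p<N. num_active W p (low p))" using that(2) by (intro sum_mono2) auto
    finally show ?thesis using few by simp
  qed
  interpret dijkstra_run n s C \<sigma> RELAX_NEGATIVE M W False a "\<lambda>S K f. f + (\<Sum>p\<in>S. num_active W p (K p)) = ?F"
  proof
    fix \<tau> S p
    assume \<tau>: "sized \<tau>" "frame (DIJKSTRA RELAX_NEGATIVE) \<sigma> \<tau>" "queue \<tau>"
      and state: "dijkstra_state N M W False a S (rarr \<tau> ''K'') (rarr \<tau> ''R'')"
      and spent: "wvar \<tau> ''fuel'' + (\<Sum>p\<in>S. num_active W p (rarr \<tau> ''K'' p)) = ?F"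
      and p: "p < N" "p \<notin> S" "wvar \<tau> ''p'' = p" and v: "rvar \<tau> ''v'' = rarr \<tau> ''K'' p"
    have S: "finite S" "insert p S \<subseteq> {..<N}" using dijkstra_state.settled_nodes[OF state] p(1) finite_subset by auto
    note same = frameD[OF \<tau>(2)]
    have enough: "num_active W p (rarr \<tau> ''K'' p) \<le> wvar \<tau> ''fuel''"
      using used[OF state S(2)] fuel spent S(1) p(2) by simp
    interpret R: relax_negative_run n s C \<tau> p M W
      by unfold_locales (use \<tau> p sorted[OF p(1)] enough in \<open>simp_all add: M W same v\<close>)
    have "wlp limit RELAX_NEGATIVE (\<lambda>\<upsilon>. row_relaxed (active_targets W p (rvar \<tau> ''v'')) (M p) (W p) (rvar \<tau> ''v'')
        (rarr \<tau> ''K'') (rarr \<tau> ''R'') (rarr \<upsilon> ''K'') (rarr \<upsilon> ''R'') \<and> queue \<upsilon> \<and>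
        wvar \<upsilon> ''fuel'' = wvar \<tau> ''fuel'' - num_active W p (rvar \<tau> ''v'')) \<tau>"
      using R.wlp_RELAX_NEGATIVE by (simp add: R.relaxed_to_def)
    then show "wlp limit RELAX_NEGATIVE (\<lambda>\<upsilon>. edges_relaxed N M W False p (rarr \<tau> ''K'') (rarr \<tau> ''R'') (rarr \<upsilon> ''K'') (rarr \<upsilon> ''R'') \<and>
        queue \<upsilon> \<and> wvar \<upsilon> ''fuel'' + (\<Sum>z\<in>insert p S. num_active W z (rarr \<tau> ''K'' z)) = ?F) \<tau>"
      by (rule wlp_mono) (use spent enough S(1) p(2) in
        \<open>simp add: v edges_relaxed_iff_row_relaxed[of "active_targets W p (rarr \<tau> ''K'' p)"] active_targets_def\<close>)
  qed (use sized a nonneg in \<open>auto simp: size_vars_eq\<close>)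
  show ?thesis
    by (rule wlp_mono[OF wlp_DIJKSTRA]) (use used[of "{..<N}" _ _ "{..<N}"] in fastforce)
qed

lemma wlp_EXPLORE_FROM:
  assumes sized: "sized \<sigma>" and u: "wvar \<sigma> ''u'' = u" "u < n"
    and M: "M = entry \<sigma> ''M''" and W: "W = entry \<sigma> ''W''"
    and nonneg: "\<And>x y. x < N \<Longrightarrow> y < N \<Longrightarrow> 0 \<le> M x y \<Longrightarrow> 0 \<le> W x y"
    and sorted: "\<And>r. r < N \<Longrightarrow> row_sorted (sorted_entry \<sigma> r) (W r) N"
    and low: "nonneg_feasible N M W low" "\<And>y. y < N \<Longrightarrow> low y \<le> W u y"
    and few: "(\<Sum>p<N. num_active W p (low p)) \<le> b" and fuel: "b \<le> wvar \<sigma> ''fuel''"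
  shows "wlp limit EXPLORE_FROM (\<lambda>\<tau>. wvar \<sigma> ''fuel'' \<le> wvar \<tau> ''fuel'' + b \<and>
    (\<exists>K R. dijkstra_result N M W False (W u) K R \<and>
      (\<forall>x<N. \<forall>y<N. entry \<tau> ''A'' x y = (if x = u \<and> y < n then R y else entry \<sigma> ''A'' x y)))) \<sigma>"
proof (rule wlpI)
  let ?store = "FOR ''x'' ''n'' (RStore ''A'' (index ''u'' ''x'') (RArr ''R'' (WVar ''x'')))"
  fix \<upsilon> assume "executes EXPLORE_FROM \<sigma> \<upsilon>"
  then obtain \<rho> \<tau> where exec: "executes (LOAD_KEYS ''W'' (index ''u'' ''x'')) \<sigma> \<rho>"
    "executes (DIJKSTRA RELAX_NEGATIVE) \<rho> \<tau>" "executes ?store \<tau> \<upsilon>" by (auto simp: EXPLORE_FROM_def executes_Seq)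
  note frames = exec[THEN executes_frame]
  note same = frameD[OF frames(1)] frameD[OF frames(2)] frameD[OF frames(3)]
  have sized': "sized \<rho>" "sized \<tau>" using exec(1,2)[THEN executes_sized] sized by (auto simp: size_vars_eq)
  have uN: "u < N" using u n_le_N by simp
  have "wlp limit (LOAD_KEYS ''W'' (index ''u'' ''x'')) (\<lambda>\<tau>. \<forall>x<N. rarr \<tau> ''K'' x = rarr \<sigma> ''W'' (u * N + x)) \<sigma>"
    by (rule wlp_LOAD_KEYS[OF sized]) (use u uN in \<open>auto simp: sizedD frame_def\<close>)
  from wlpD[OF this exec(1)] have keys: "\<And>x. x < N \<Longrightarrow> rarr \<rho> ''K'' x = W u x" by (simp add: W)
  have "wlp limit (DIJKSTRA RELAX_NEGATIVE) (\<lambda>\<tau>. dijkstra_result N M W False (W u) (rarr \<tau> ''K'') (rarr \<tau> ''R'') \<and>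
      wvar \<rho> ''fuel'' \<le> wvar \<tau> ''fuel'' + b) \<rho>"
    by (rule wlp_DIJKSTRA_negative[OF sized'(1) keys _ _ nonneg _ low few])
      (use sorted fuel in \<open>auto simp: M W frameD[OF frames(1)]\<close>)
  note explored = wlpD[OF this exec(2)]
  have "wvar \<tau> ''u'' = u" by (simp add: same u)
  from wlpD[OF wlp_store_row[OF sized'(2) this uN size_table_simps(1) n_le_N] exec(3)]
  have "\<forall>x<N. \<forall>y<N. entry \<upsilon> ''A'' x y = (if x = u \<and> y < n then rarr \<tau> ''R'' y else entry \<sigma> ''A'' x y)"
    by (simp add: same)
  then show "wvar \<sigma> ''fuel'' \<le> wvar \<upsilon> ''fuel'' + b \<and> (\<exists>K R. dijkstra_result N M W False (W u) K R \<and>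
      (\<forall>x<N. \<forall>y<N. entry \<upsilon> ''A'' x y = (if x = u \<and> y < n then R y else entry \<sigma> ''A'' x y)))"
    using explored by (auto simp: same)
qed

definition explored :: "weights \<Rightarrow> weights \<Rightarrow> nat \<Rightarrow> weights \<Rightarrow> bool" where
  "explored M W k A \<longleftrightarrow>
     (\<exists>K R. \<forall>b<k. dijkstra_result N M W False (W b) (K b) (R b) \<and> (\<forall>w<n. A b w = R b w))"

lemma explored_Suc:
  assumes "explored M W u A" and u: "u < n" and new: "dijkstra_result N M W False (W u) K' R'"
    and A': "\<forall>x<N. \<forall>y<N. A' x y = (if x = u \<and> y < n then R' y else A x y)"
  shows "explored M W (Suc u) A'"
proof -
  obtain K R where "\<And>b. b < u \<Longrightarrow> dijkstra_result N M W False (W b) (K b) (R b)"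
    "\<And>b w. b < u \<Longrightarrow> w < n \<Longrightarrow> A b w = R b w" using assms(1) unfolding explored_def by blast
  then show ?thesis
    unfolding explored_def using u n_le_N new A'
    by (intro exI[of _ "K(u := K')"] exI[of _ "R(u := R')"]) (auto simp: less_Suc_eq)
qed

lemma wlp_EXPLORE:
  assumes sized: "sized \<sigma>" and M: "M = entry \<sigma> ''M''" and W: "W = entry \<sigma> ''W''"
    and nonneg: "\<And>x y. x < N \<Longrightarrow> y < N \<Longrightarrow> 0 \<le> M x y \<Longrightarrow> 0 \<le> W x y"
    and low: "\<And>b. b < n \<Longrightarrow> nonneg_feasible N M W (low b)" "\<And>b y. b < n \<Longrightarrow> y < N \<Longrightarrow> low b y \<le> W b y"
    and few: "\<And>b. b < n \<Longrightarrow> (\<Sum>p<N. num_active W p (low b p)) \<le> N * m"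
  shows "wlp limit EXPLORE (\<lambda>\<tau>. explored M W n (entry \<tau> ''A'')) \<sigma>"
proof (rule wlpI)
  fix \<upsilon> assume "executes EXPLORE \<sigma> \<upsilon>"
  then obtain \<rho> where exec: "executes (SORT_ROWS ''W'' ''N'') \<sigma> \<rho>"
    "executes (FOR ''u'' ''n'' EXPLORE_FROM) (wset ''fuel'' (wvar \<rho> ''explore_fuel'') \<rho>) \<upsilon>"
    by (auto simp: EXPLORE_def REFUEL_def executes_Seq executes_WAssign)
  have "sized \<rho>" using executes_sized[OF exec(1) sized] by (simp add: size_vars_eq)
  then have "wvar \<rho> ''explore_fuel'' = explore_fuel" "sized (wset ''fuel'' explore_fuel \<rho>)" (is "sized ?\<rho>")
    by (simp_all add: sizedD size_vars_eq)
  note exec' = exec(2)[unfolded this(1)] and sized' = this(2)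
  note same = frameD[OF executes_frame[OF exec(1)]]
  have sorted: "row_sorted (sorted_entry \<rho> r) (W r) N" if "r < N" for r
    using wlpD[OF wlp_SORT_ROWS[OF sized size_table_simps(4)] exec(1)] that by (simp add: W)
  let ?inv = "\<lambda>k \<tau>. (n - k) * (N * m) \<le> wvar \<tau> ''fuel'' \<and> explored M W k (entry \<tau> ''A'')"
  have "wlp limit (FOR ''u'' ''n'' EXPLORE_FROM) (?inv n) ?\<rho>"
  proof (rule wlp_FOR_size[where I = ?inv, OF sized' size_table_simps(1)])
    show "?inv 0 ?\<rho>" by (simp add: explore_fuel_def explored_def)
    fix u \<tau>
    assume u: "u < n" "wvar \<tau> ''u'' = u" and \<tau>: "sized \<tau>" "frame (FOR ''u'' ''n'' EXPLORE_FROM) ?\<rho> \<tau>"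
      and inv: "?inv u \<tau>"
    have "n - u = Suc (n - Suc u)" using u by simp
    then have fuel: "(n - Suc u) * (N * m) + N * m \<le> wvar \<tau> ''fuel''" using inv by simp
    have "wlp limit EXPLORE_FROM (\<lambda>\<upsilon>. wvar \<tau> ''fuel'' \<le> wvar \<upsilon> ''fuel'' + N * m \<and>
        (\<exists>K R. dijkstra_result N M W False (W u) K R \<and>
          (\<forall>x<N. \<forall>y<N. entry \<upsilon> ''A'' x y = (if x = u \<and> y < n then R y else entry \<tau> ''A'' x y)))) \<tau>"
      by (rule wlp_EXPLORE_FROM[OF \<tau>(1) u(2,1) _ _ nonneg _ low[OF u(1)] few[OF u(1)]])
        (use sorted fuel in \<open>auto simp: M W frameD[OF \<tau>(2)] same\<close>)
    then show "wlp limit EXPLORE_FROM (?inv (Suc u)) \<tau>"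
      by (rule wlp_mono) (use fuel explored_Suc[OF _ u(1)] inv in auto)
  qed (auto simp: size_vars_eq)
  from wlpD[OF this exec'] show "explored M W n (entry \<upsilon> ''A'')" by simp
qed


section \<open>The padded matrix\<close>

lemma wlp_MAX_ABS:
  assumes sized: "sized \<sigma>"
  shows "wlp limit MAX_ABS (\<lambda>\<tau>. 0 \<le> rvar \<tau> ''g'' \<and> (\<forall>u<n. \<forall>w<n. \<bar>entry \<sigma> ''A'' u w\<bar> \<le> rvar \<tau> ''g'')) \<sigma>"
proof -
  let ?body = "Cond (RLess (RVar ''g'') (RArr ''A'' (index ''u'' ''w''))) (RAssign ''g'' (RArr ''A'' (index ''u'' ''w''))) Skip ;;
    Cond (RLess (RVar ''g'') (RSub RZero (RArr ''A'' (index ''u'' ''w''))))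
      (RAssign ''g'' (RSub RZero (RArr ''A'' (index ''u'' ''w'')))) Skip"
  let ?bound = "\<lambda>u w \<tau>. 0 \<le> rvar \<tau> ''g'' \<and>
    (\<forall>x<n. \<forall>y<n. x < u \<or> x = u \<and> y < w \<longrightarrow> \<bar>entry \<sigma> ''A'' x y\<bar> \<le> rvar \<tau> ''g'')"
  have "wlp limit (FOR ''u'' ''n'' (FOR ''w'' ''n'' ?body)) (?bound n 0) (\<sigma>\<lparr>rvar := (rvar \<sigma>)(''g'' := 0)\<rparr>)"
  proof (rule wlp_FOR2_size[where I = ?bound, OF _ size_table_simps(1) size_table_simps(1)])
    fix u w \<tau>
    assume uw: "u < n" "w < n" "wvar \<tau> ''u'' = u" "wvar \<tau> ''w'' = w" and \<tau>: "sized \<tau>"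
      "frame (FOR ''u'' ''n'' (FOR ''w'' ''n'' ?body)) (\<sigma>\<lparr>rvar := (rvar \<sigma>)(''g'' := 0)\<rparr>) \<tau>" and inv: "?bound u w \<tau>"
    have "u < N" "w < N" "rarr \<tau> ''A'' = rarr \<sigma> ''A''" using uw n_le_N by (simp_all add: frameD[OF \<tau>(2)])
    then have index: "\<And>r. rval limit (\<tau>\<lparr>rvar := r\<rparr>) (RArr ''A'' (index ''u'' ''w'')) = entry \<sigma> ''A'' u w"
      "rval limit \<tau> (RArr ''A'' (index ''u'' ''w'')) = entry \<sigma> ''A'' u w" using uw \<tau>(1) by (simp_all add: sizedD)
    have bound: "?bound u (Suc w) (\<tau>\<lparr>rvar := (rvar \<tau>)(''g'' := g')\<rparr>)"
      if g': "g' = max (max (rvar \<tau> ''g'') (entry \<sigma> ''A'' u w)) (- entry \<sigma> ''A'' u w)" for g'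
    proof -
      have "\<bar>entry \<sigma> ''A'' x y\<bar> \<le> g'" if "x < n" "y < n" "x < u \<or> x = u \<and> y < Suc w" for x y
      proof (cases "x = u \<and> y = w")
        case False
        then have "\<bar>entry \<sigma> ''A'' x y\<bar> \<le> rvar \<tau> ''g''" using inv that by (meson less_Suc_eq)
        then show ?thesis using g' by linarith
      qed (use g' in auto)
      moreover have "0 \<le> g'" using inv g' by linarith
      ultimately show ?thesis by simp
    qed
    have "wlp limit ?body Q \<tau> = Q (\<tau>\<lparr>rvar := (rvar \<tau>)(''g'' :=
        max (max (rvar \<tau> ''g'') (entry \<sigma> ''A'' u w)) (- entry \<sigma> ''A'' u w))\<rparr>)" for Q
      using index by (simp add: max_def fun_upd_idem)
    then show "wlp limit ?body (?bound u (Suc w)) \<tau>" by (rule iffD2[OF _ bound[OF refl]])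
  qed (use sized in \<open>auto simp: size_vars_eq less_Suc_eq\<close>)
  then show ?thesis by (simp add: MAX_ABS_def)
qed

lemma wlp_INIT_MATRIX:
  assumes sized: "sized \<sigma>"
  shows "wlp limit INIT_MATRIX (\<lambda>\<tau>. \<exists>g\<ge>0. (\<forall>u<n. \<forall>w<n. \<bar>entry \<sigma> ''A'' u w\<bar> \<le> g) \<and>
    (\<forall>u<N. \<forall>w<N. entry \<tau> ''M'' u w = padded_weights n (entry \<sigma> ''A'') g u w)) \<sigma>"
proof (rule wlpI)
  let ?fill = "FOR ''u'' ''N'' (FOR ''w'' ''N'' (Cond (WEq (WVar ''u'') (WVar ''w''))
     (RStore ''M'' (index ''u'' ''w'') RZero)
     (Cond (BAnd (WLess (WVar ''u'') (WVar ''n'')) (WLess (WVar ''w'') (WVar ''n'')))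
        (RStore ''M'' (index ''u'' ''w'') (RArr ''A'' (index ''u'' ''w''))) (RStore ''M'' (index ''u'' ''w'') (RVar ''g'')))))"
  fix \<upsilon> assume "executes INIT_MATRIX \<sigma> \<upsilon>"
  then obtain \<tau> where \<tau>: "executes MAX_ABS \<sigma> \<tau>"
    and \<upsilon>: "executes ?fill (\<tau>\<lparr>rvar := (rvar \<tau>)(''g'' := rvar \<tau> ''g'' + (rvar \<tau> ''g'' + rvar \<tau> ''g''))\<rparr>) \<upsilon>"
      (is "executes _ ?\<tau> _")
    by (auto simp: INIT_MATRIX_def executes_Seq executes_RAssign)
  have "sized ?\<tau>" using executes_sized[OF \<tau> sized] by (simp add: size_vars_eq)
  then have "wlp limit ?fill (\<lambda>\<upsilon>. \<forall>u<N. \<forall>w<N. entry \<upsilon> ''M'' u w =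
      padded_weights n (entry \<tau> ''A'') (rvar \<tau> ''g'') u w) ?\<tau>"
    by (rule wlp_FOR2_store[OF _ size_table_simps(4)]) (auto simp: size_vars_eq sizedD frame_def padded_weights_def)
  note filled = wlpD[OF this \<upsilon>]
  show "\<exists>g\<ge>0. (\<forall>u<n. \<forall>w<n. \<bar>entry \<sigma> ''A'' u w\<bar> \<le> g) \<and>
      (\<forall>u<N. \<forall>w<N. entry \<upsilon> ''M'' u w = padded_weights n (entry \<sigma> ''A'') g u w)"
    using wlpD[OF wlp_MAX_ABS[OF sized] \<tau>] filled by (auto simp: frameD[OF executes_frame[OF \<tau>]])
qed

end


section \<open>Adding the auxiliary nodes\<close>

locale shortcut_filling = sizes n s C + sorted_shortcuts n "sizes.N n" "sizes.levels n" A listed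
  for n s C A listed +
  fixes M\<^sub>0 :: weights
begin

abbreviation fill_invariant where
  "fill_invariant Out In M \<equiv> fill_state n N levels A listed M\<^sub>0 Out In M"

definition filling :: "machine_state \<Rightarrow> bool" where
  "filling \<sigma> \<longleftrightarrow> sized \<sigma> \<and> A = entry \<sigma> ''A'' \<and> listed = sorted_entry \<sigma>"

lemma fillingD:
  assumes "filling \<sigma>"
  shows "sized \<sigma>" "entry \<sigma> ''A'' u w = A u w" "sorted_entry \<sigma> w i = listed w i"
  using assms by (auto simp: filling_def)

lemma filling_frame:
  "frame c \<sigma> \<tau> \<Longrightarrow> filling \<sigma> \<Longrightarrow> mod_wvars c \<inter> size_vars = {} \<Longrightarrow> ''A'' \<notin> mod_rarrs c \<Longrightarrow> ''sorted'' \<notin> mod_warrs c \<Longrightarrow>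
    filling \<tau>"
  unfolding filling_def using sized_frame frameD(2)[of c \<sigma> \<tau> "''sorted''"] frameD(4)[of c \<sigma> \<tau> "''A''"] by simp

lemma filling_update [simp]:
  "x \<notin> size_vars \<Longrightarrow> filling (wset x v \<sigma>) = filling \<sigma>" "filling (\<sigma>\<lparr>rvar := r\<rparr>) = filling \<sigma>"
  by (simp_all add: filling_def)

lemma fill_invariant_shortcut:
  assumes inv: "fill_invariant Out In (entry \<tau> ''M'')" and u: "u < n" and w: "w < n" and t: "t < n"
  shows "fill_invariant Out In
    (\<lambda>a b. ((rarr \<tau> ''M'')(u * N + t := min (entry \<tau> ''M'' u t) (A u w + A w t))) (a * N + b))"
proof -
  interpret fill_state n N levels A listed M\<^sub>0 Out In "entry \<tau> ''M''" by (rule inv)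
  let ?x = "min (entry \<tau> ''M'' u t) (A u w + A w t)"
  have less: "t < N" "u < N" using u t n_le_N by auto
  have entry: "((rarr \<tau> ''M'')(u * N + t := ?x)) (a * N + b) = (if a = u \<and> b = t then ?x else entry \<tau> ''M'' a b)"
    if "b < N" for a b using that less by (simp add: pair_eq_iff)
  show ?thesis
  proof (cases "entry \<tau> ''M'' u t \<le> A u w + A w t")
    case True
    then show ?thesis by (simp add: min_def fun_upd_idem fill_state_axioms)
  next
    case False
    then have "fill_entry M\<^sub>0 u t ?x"
      using le_initial[OF u t] u t w unfolding fill_entry_def by force
    then show ?thesis by (rule fill_state_update[OF less(2,1)]) (simp_all add: entry del: fun_upd_apply)
  qed
qed

lemma wlp_add_shortcut:
  assumes filling: "filling \<sigma>" and w: "wvar \<sigma> ''w'' = w" "w < n" and u: "wvar \<sigma> ''u'' = u" "u < n"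
    and i: "wvar \<sigma> ''i'' = i" "i < n"
  shows "wlp limit (WAssign ''t'' (WArr ''sorted'' (index ''w'' ''i'')) ;;
      RAssign ''x'' (RAdd (RArr ''A'' (index ''u'' ''w'')) (RArr ''A'' (index ''w'' ''t''))) ;;
      Cond (RLess (RVar ''x'') (RArr ''M'' (index ''u'' ''t''))) (RStore ''M'' (index ''u'' ''t'') (RVar ''x'')) Skip ;;
      WAssign ''i'' (WAdd (WVar ''i'') (WConst 1)))
    (\<lambda>\<tau>. wvar \<tau> ''i'' = Suc i \<and> rarr \<tau> ''M'' = (rarr \<sigma> ''M'')
      (u * N + listed w i := min (entry \<sigma> ''M'' u (listed w i)) (A u w + A w (listed w i)))) \<sigma>"
proof -
  have "w < N" "u < N" "i < N" "listed w i < N" using w u i listed_less[OF w(2) i(2)] n_le_N by auto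
  moreover have "Suc i mod limit = Suc i" using i(2) less_limit(1) by simp
  ultimately show ?thesis
    using w(1) u(1) i(1) sizedD(5)[OF fillingD(1)[OF filling]] fillingD(2,3)[OF filling]
    by (auto simp: min_def)
qed

lemma wlp_ADD_SHORTCUTS:
  assumes filling: "filling \<sigma>" and w: "wvar \<sigma> ''w'' = w" "w < n" and u: "wvar \<sigma> ''u'' = u" "u < n"
    and e: "wvar \<sigma> ''o'' = e" "e \<le> n" and inv: "fill_invariant Out In (entry \<sigma> ''M'')"
    and fuel: "e \<le> wvar \<sigma> ''fuel''"
  shows "wlp limit ADD_SHORTCUTS (\<lambda>\<tau>. fill_invariant Out In (entry \<tau> ''M'') \<and>
    (\<forall>i<e. entry \<tau> ''M'' u (listed w i) \<le> A u w + A w (listed w i)) \<and> wvar \<tau> ''fuel'' = wvar \<sigma> ''fuel'' - e) \<sigma>"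
proof -
  let ?body = "WAssign ''t'' (WArr ''sorted'' (index ''w'' ''i'')) ;;
      RAssign ''x'' (RAdd (RArr ''A'' (index ''u'' ''w'')) (RArr ''A'' (index ''w'' ''t''))) ;;
      Cond (RLess (RVar ''x'') (RArr ''M'' (index ''u'' ''t''))) (RStore ''M'' (index ''u'' ''t'') (RVar ''x'')) Skip ;;
      WAssign ''i'' (WAdd (WVar ''i'') (WConst 1))"
  let ?short = "\<lambda>k \<tau>. \<forall>i<k. entry \<tau> ''M'' u (listed w i) \<le> A u w + A w (listed w i)"
  let ?inv = "\<lambda>\<tau>. fill_invariant Out In (entry \<tau> ''M'') \<and> wvar \<tau> ''i'' \<le> e \<and> ?short (wvar \<tau> ''i'') \<tau> \<and>
    wvar \<tau> ''fuel'' + wvar \<tau> ''i'' = wvar \<sigma> ''fuel''"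
  have "wlp limit (FUELLED (WLess (WVar ''i'') (WVar ''o'')) ?body) (\<lambda>\<tau>. fill_invariant Out In (entry \<tau> ''M'') \<and>
      ?short e \<tau> \<and> wvar \<tau> ''fuel'' = wvar \<sigma> ''fuel'' - e) (wset ''i'' 0 \<sigma>)"
  proof (rule wlp_FUELLED[OF limit_gt_1, where I = ?inv])
    show "?inv (wset ''i'' 0 \<sigma>)" using inv by simp
  next
    fix \<tau>
    assume frame: "frame (FUELLED (WLess (WVar ''i'') (WVar ''o'')) ?body) (wset ''i'' 0 \<sigma>) \<tau>" and inv: "?inv \<tau>"
      and stop: "wvar \<tau> ''fuel'' = 0 \<or> \<not> bval limit \<tau> (WLess (WVar ''i'') (WVar ''o''))"
    have "wvar \<tau> ''o'' = e" by (simp add: frameD[OF frame] e)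
    then have "wvar \<tau> ''i'' = e" using stop inv fuel by auto
    then show "fill_invariant Out In (entry \<tau> ''M'') \<and> ?short e \<tau> \<and> wvar \<tau> ''fuel'' = wvar \<sigma> ''fuel'' - e"
      using inv by auto
  next
    fix \<tau>
    assume frame: "frame (FUELLED (WLess (WVar ''i'') (WVar ''o'')) ?body) (wset ''i'' 0 \<sigma>) \<tau>" and inv: "?inv \<tau>"
      and pos: "0 < wvar \<tau> ''fuel''" and less: "bval limit \<tau> (WLess (WVar ''i'') (WVar ''o''))"
    let ?i = "wvar \<tau> ''i''" and ?t = "listed w (wvar \<tau> ''i'')" and ?\<tau> = "wset ''fuel'' (wvar \<tau> ''fuel'' - 1) \<tau>"
    let ?x = "min (entry \<tau> ''M'' u ?t) (A u w + A w ?t)"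
    have "filling \<tau>" by (rule filling_frame[OF frame]) (use filling in \<open>simp_all add: size_vars_eq\<close>)
    have same: "wvar \<tau> ''w'' = w" "wvar \<tau> ''u'' = u" "wvar \<tau> ''o'' = e" by (simp_all add: frameD[OF frame] w u e)
    have i: "?i < e" "?i < n" using less same e by auto
    have updated: "fill_invariant Out In (\<lambda>a b. ((rarr \<tau> ''M'')(u * N + ?t := ?x)) (a * N + b))"
      using fill_invariant_shortcut[OF conjunct1[OF inv] u(2) w(2) listed_less[OF w(2) i(2)]] .
    have short: "((rarr \<tau> ''M'')(u * N + ?t := ?x)) (u * N + listed w j) \<le> A u w + A w (listed w j)"
      if "j < Suc ?i" for j
    proof (cases "u * N + listed w j = u * N + ?t")
      case False
      then show ?thesis using that inv by (auto simp: less_Suc_eq)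
    qed simp
    have step: "wlp limit ?body (\<lambda>\<upsilon>. wvar \<upsilon> ''i'' = Suc ?i \<and> rarr \<upsilon> ''M'' = (rarr \<tau> ''M'')(u * N + ?t := ?x)) ?\<tau>"
      using wlp_add_shortcut[of ?\<tau> w u ?i] \<open>filling \<tau>\<close> same w(2) u(2) i by (simp add: size_vars_eq)
    show "wlp limit ?body ?inv ?\<tau>"
      by (rule wlp_mono[OF step]) (use updated short inv pos i in \<open>auto simp: frame_def\<close>)
  qed
  then show ?thesis by (simp add: ADD_SHORTCUTS_def)
qed

lemma wlp_SELECT_PIVOT:
  assumes filling: "filling \<sigma>" and w: "wvar \<sigma> ''w'' = w" "w < n" and k: "wvar \<sigma> ''k'' = k" "k < levels"
    and j: "wvar \<sigma> ''j'' = pivot_rank n k"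
  shows "wlp limit SELECT_PIVOT (\<lambda>\<tau>. wvar \<tau> ''a'' = aux_node w k \<and> rvar \<tau> ''z'' = pivot_weight w k \<and>
    wvar \<tau> ''o'' = pivot_rank n (Suc k)) \<sigma>"
proof -
  note c = sizedD[OF fillingD(1)[OF filling]]
  have aux: "aux_node w k < N" by (rule aux_node_less[OF w(2) k(2)])
  have rank: "pivot_rank n k < n" "pivot_rank n k < N" "w < N" "listed w (pivot_rank n k) < N"
    using pivot_rank_less[OF n_ge_1, of k] listed_less[OF w(2), of "pivot_rank n k"] w n_le_N by auto
  have "Suc k < limit" using k(2) less_limit(4) by simp
  moreover have "Suc k * n < limit" "Suc k * n + w < limit" using aux less_limit(7) by (auto simp: aux_node_def)
  ultimately have a: "((k + 1) mod limit * n mod limit + w) mod limit = aux_node w k"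
    by (simp add: aux_node_def)
  have "(w * N mod limit + listed w (pivot_rank n k)) mod limit = w * N + listed w (pivot_rank n k)"
    using pair_less_limit[OF rank(3,4)] by simp
  then have z: "wval limit (wset ''a'' x \<sigma>) (WAdd (WMult (WVar ''w'') (WVar ''N'')) (WArr ''sorted'' (index ''w'' ''j''))) =
      w * N + listed w (pivot_rank n k)" for x
    using w j c rank fillingD(3)[OF filling] by simp
  have "2 * n \<le> (levels + 1) * n" using levels_pos n_ge_1 by (intro mult_le_mono1) simp
  also have "\<dots> \<le> N" by (rule room)
  finally have "2 * pivot_rank n k + 1 < limit" using rank less_limit(7) by linarith
  then have o: "((pivot_rank n k + pivot_rank n k) mod limit + 1) mod limit = 2 * pivot_rank n k + 1"
    by (simp add: mult_2)
  show ?thesis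
    unfolding SELECT_PIVOT_def wlp_Seq wlp_WAssign[of _ "''a''"] wlp_RAssign rval.simps z
    using a o w k j c fillingD(2)[OF filling] by (simp add: pivot_rank_Suc pivot_weight_def)
qed

definition processed :: "nat \<Rightarrow> nat \<Rightarrow> nat \<Rightarrow> nat \<Rightarrow> bool" where
  "processed w k w' k' \<longleftrightarrow> w' < w \<or> w' = w \<and> k' < k"

abbreviation processed_to :: "nat \<Rightarrow> nat \<Rightarrow> nat \<Rightarrow> nat \<Rightarrow> nat \<Rightarrow> nat \<Rightarrow> bool" where
  "processed_to w k x w' k' x' \<equiv> processed w k w' k' \<or> w' = w \<and> k' = k \<and> x' < x"

lemma wlp_FILL_OUT_EDGES:
  assumes filling: "filling \<sigma>" and w: "wvar \<sigma> ''w'' = w" "w < n" and k: "k < levels"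
    and a: "wvar \<sigma> ''a'' = aux_node w k" and z: "rvar \<sigma> ''z'' = pivot_weight w k"
    and inv: "fill_invariant (\<lambda>w' k' _. processed w k w' k') In (entry \<sigma> ''M'')"
  shows "wlp limit FILL_OUT_EDGES (\<lambda>\<tau>. fill_invariant (\<lambda>w' k' _. processed w (Suc k) w' k') In (entry \<tau> ''M'')) \<sigma>"
  unfolding FILL_OUT_EDGES_def
proof (rule wlp_FOR_size[OF fillingD(1)[OF filling] size_table_simps(1), where
    I = "\<lambda>t \<tau>. fill_invariant (processed_to w k t) In (entry \<tau> ''M'')"])
  let ?a = "aux_node w k" and ?z = "pivot_weight w k"
  let ?body = "Cond (RLess (RArr ''A'' (index ''w'' ''t'')) (RVar ''z'')) Skip
     (RStore ''M'' (index ''a'' ''t'') (RSub (RArr ''A'' (index ''w'' ''t'')) (RVar ''z'')))"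
  fix t \<tau>
  assume t: "t < n" "wvar \<tau> ''t'' = t" and \<tau>: "sized \<tau>" "frame (FOR ''t'' ''n'' ?body) \<sigma> \<tau>"
    and inv: "fill_invariant (processed_to w k t) In (entry \<tau> ''M'')"
  have less: "w < N" "t < N" "?a < N" using w t n_le_N aux_node_less[OF w(2) k] by auto
  have "filling \<tau>" by (rule filling_frame[OF \<tau>(2) filling]) (auto simp: size_vars_eq)
  let ?M = "(rarr \<tau> ''M'')(?a * N + t := A w t - ?z)"
  have entry: "?M (x * N + y) = (if x = ?a \<and> y = t then A w t - ?z else entry \<tau> ''M'' x y)" if "y < N" for x y
    using that less by (simp add: pair_eq_iff)
  have skip: "fill_invariant (processed_to w k (Suc t)) In (entry \<tau> ''M'')" if "A w t < ?z"
    by (rule fill_state.fill_state_extend[OF inv]) (use that in \<open>auto simp: less_Suc_eq\<close>)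
  have "fill_entry M\<^sub>0 ?a t (A w t - ?z)" unfolding fill_entry_def using k w(2) t(1) by blast
  then have "fill_invariant (processed_to w k t) In (\<lambda>x y. ?M (x * N + y))"
    by (rule fill_state.fill_state_update[OF inv less(3,2)]) (simp_all add: entry del: fun_upd_apply)
  then have "fill_invariant (processed_to w k (Suc t)) In (\<lambda>x y. ?M (x * N + y))"
    by (rule fill_state.fill_state_extend) (auto simp: less_Suc_eq)
  with skip show "wlp limit ?body (\<lambda>\<tau>. fill_invariant (processed_to w k (Suc t)) In (entry \<tau> ''M'')) \<tau>"
    using less t fillingD[OF \<open>filling \<tau>\<close>] by (simp add: sizedD frameD[OF \<tau>(2)] w a z)
next
  fix \<tau> assume "fill_invariant (processed_to w k n) In (entry \<tau> ''M'')"
  then show "fill_invariant (\<lambda>w' k' _. processed w (Suc k) w' k') In (entry \<tau> ''M'')"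
    by (rule fill_state.fill_state_mono) (auto simp: processed_def less_Suc_eq)
qed (use inv in \<open>auto simp: size_vars_eq\<close>)

lemma fill_invariant_in_edge:
  assumes inv: "fill_invariant Out (processed_to w k u) (entry \<sigma> ''M'')" and wku: "w < n" "k < levels" "u < n"
    and nonneg: "0 \<le> A u w + pivot_weight w k"
  shows "fill_invariant Out (processed_to w k (Suc u))
    (\<lambda>x y. ((rarr \<sigma> ''M'')(u * N + aux_node w k := A u w + pivot_weight w k)) (x * N + y))"
proof -
  let ?a = "aux_node w k" and ?x = "A u w + pivot_weight w k"
  let ?M = "(rarr \<sigma> ''M'')(u * N + ?a := ?x)"
  have less: "u < N" "?a < N" using wku n_le_N aux_node_less by auto
  then have entry: "?M (y * N + x) = (if y = u \<and> x = ?a then ?x else entry \<sigma> ''M'' y x)" if "x < N" for x y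
    using that by (simp add: pair_eq_iff)
  have "fill_entry M\<^sub>0 u ?a ?x" unfolding fill_entry_def using wku by blast
  then have "fill_invariant Out (processed_to w k u) (\<lambda>x y. ?M (x * N + y))"
    by (rule fill_state.fill_state_update[OF inv less]) (simp_all add: entry del: fun_upd_apply)
  then show ?thesis
    by (rule fill_state.fill_state_extend) (use nonneg in \<open>auto simp: less_Suc_eq explicit_pairs_def\<close>)
qed

lemma wlp_FILL_IN_EDGE:
  assumes filling: "filling \<sigma>" and w: "wvar \<sigma> ''w'' = w" "w < n" and k: "k < levels"
    and u: "wvar \<sigma> ''u'' = u" "u < n"
    and a: "wvar \<sigma> ''a'' = aux_node w k" and z: "rvar \<sigma> ''z'' = pivot_weight w k"
    and e: "wvar \<sigma> ''o'' = pivot_rank n (Suc k)"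
    and inv: "fill_invariant Out (processed_to w k u) (entry \<sigma> ''M'')"
    and fuel: "explicit_pairs w k u \<le> wvar \<sigma> ''fuel''"
  shows "wlp limit (RAssign ''x'' (RAdd (RArr ''A'' (index ''u'' ''w'')) (RVar ''z'')) ;;
      Cond (RLess (RVar ''x'') RZero) ADD_SHORTCUTS (RStore ''M'' (index ''u'' ''a'') (RVar ''x'')))
    (\<lambda>\<tau>. fill_invariant Out (processed_to w k (Suc u)) (entry \<tau> ''M'') \<and>
      wvar \<tau> ''fuel'' = wvar \<sigma> ''fuel'' - explicit_pairs w k u) \<sigma>"
proof -
  let ?a = "aux_node w k" and ?x = "A u w + pivot_weight w k"
  let ?\<sigma> = "\<sigma>\<lparr>rvar := (rvar \<sigma>)(''x'' := ?x)\<rparr>"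
  note A = fillingD(2)[OF filling] and c = sizedD[OF fillingD(1)[OF filling]]
  have less: "w < N" "u < N" "?a < N" using w u n_le_N aux_node_less[OF w(2) k] by auto
  have "wlp limit (Cond (RLess (RVar ''x'') RZero) ADD_SHORTCUTS (RStore ''M'' (index ''u'' ''a'') (RVar ''x'')))
      (\<lambda>\<tau>. fill_invariant Out (processed_to w k (Suc u)) (entry \<tau> ''M'') \<and>
        wvar \<tau> ''fuel'' = wvar \<sigma> ''fuel'' - explicit_pairs w k u) ?\<sigma>"
  proof (cases "?x < 0")
    case True
    then have pairs: "explicit_pairs w k u = pivot_rank n (Suc k)" by (simp add: explicit_pairs_def)
    have "wlp limit ADD_SHORTCUTS (\<lambda>\<tau>. fill_invariant Out (processed_to w k u) (entry \<tau> ''M'') \<and>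
        (\<forall>i<explicit_pairs w k u. entry \<tau> ''M'' u (listed w i) \<le> A u w + A w (listed w i)) \<and>
        wvar \<tau> ''fuel'' = wvar ?\<sigma> ''fuel'' - explicit_pairs w k u) ?\<sigma>"
      by (rule wlp_ADD_SHORTCUTS[OF _ _ w(2) _ u(2)])
        (use filling w u e inv fuel pairs pivot_rank_less[OF n_ge_1, of "Suc k"] in auto)
    then have "wlp limit ADD_SHORTCUTS (\<lambda>\<tau>. fill_invariant Out (processed_to w k (Suc u)) (entry \<tau> ''M'') \<and>
        wvar \<tau> ''fuel'' = wvar \<sigma> ''fuel'' - explicit_pairs w k u) ?\<sigma>"
    proof (rule wlp_mono, elim conjE, intro conjI)
      fix \<tau> :: machine_state
      assume filled: "fill_invariant Out (processed_to w k u) (entry \<tau> ''M'')"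
        and short: "\<forall>i<explicit_pairs w k u. entry \<tau> ''M'' u (listed w i) \<le> A u w + A w (listed w i)"
      from filled show "fill_invariant Out (processed_to w k (Suc u)) (entry \<tau> ''M'')"
        by (rule fill_state.fill_state_extend) (use True short in \<open>auto simp: less_Suc_eq\<close>)
    qed simp
    then show ?thesis using True by simp
  next
    case False
    then have pairs: "explicit_pairs w k u = 0" by (simp add: explicit_pairs_def)
    have "fill_invariant Out (processed_to w k (Suc u)) (\<lambda>x y. ((rarr \<sigma> ''M'')(u * N + ?a := ?x)) (x * N + y))"
      using fill_invariant_in_edge[OF inv w(2) k u(2)] False by simp
    then show ?thesis using False pairs less u a c by simp
  qed
  then show ?thesis using less w u z A c by simp
qed

lemma wlp_FILL_IN_EDGES:
  assumes filling: "filling \<sigma>" and w: "wvar \<sigma> ''w'' = w" "w < n" and k: "k < levels"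
    and a: "wvar \<sigma> ''a'' = aux_node w k" and z: "rvar \<sigma> ''z'' = pivot_weight w k"
    and e: "wvar \<sigma> ''o'' = pivot_rank n (Suc k)"
    and inv: "fill_invariant Out (\<lambda>w' k' _. processed w k w' k') (entry \<sigma> ''M'')"
    and fuel: "(\<Sum>u<n. explicit_pairs w k u) \<le> wvar \<sigma> ''fuel''"
  shows "wlp limit FILL_IN_EDGES (\<lambda>\<tau>. fill_invariant Out (\<lambda>w' k' _. processed w (Suc k) w' k') (entry \<tau> ''M'') \<and>
    wvar \<tau> ''fuel'' = wvar \<sigma> ''fuel'' - (\<Sum>u<n. explicit_pairs w k u)) \<sigma>"
  unfolding FILL_IN_EDGES_def
proof (rule wlp_FOR_size[OF fillingD(1)[OF filling] size_table_simps(1), where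
    I = "\<lambda>u \<tau>. fill_invariant Out (processed_to w k u) (entry \<tau> ''M'') \<and>
      wvar \<tau> ''fuel'' = wvar \<sigma> ''fuel'' - (\<Sum>u'<u. explicit_pairs w k u')"])
  let ?body = "RAssign ''x'' (RAdd (RArr ''A'' (index ''u'' ''w'')) (RVar ''z'')) ;;
      Cond (RLess (RVar ''x'') RZero) ADD_SHORTCUTS (RStore ''M'' (index ''u'' ''a'') (RVar ''x''))"
  fix u \<tau>
  assume u: "u < n" "wvar \<tau> ''u'' = u" and \<tau>: "frame (FOR ''u'' ''n'' ?body) \<sigma> \<tau>"
    and inv: "fill_invariant Out (processed_to w k u) (entry \<tau> ''M'') \<and>
      wvar \<tau> ''fuel'' = wvar \<sigma> ''fuel'' - (\<Sum>u'<u. explicit_pairs w k u')"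
  have "filling \<tau>" by (rule filling_frame[OF \<tau> filling]) (auto simp: size_vars_eq)
  moreover have "(\<Sum>u'<Suc u. explicit_pairs w k u') \<le> (\<Sum>u'<n. explicit_pairs w k u')"
    using u by (intro sum_mono2) auto
  ultimately have "wlp limit ?body (\<lambda>\<upsilon>. fill_invariant Out (processed_to w k (Suc u)) (entry \<upsilon> ''M'') \<and>
      wvar \<upsilon> ''fuel'' = wvar \<tau> ''fuel'' - explicit_pairs w k u) \<tau>"
    by (intro wlp_FILL_IN_EDGE) (use w k u a z e inv fuel in \<open>simp_all add: frameD[OF \<tau>]\<close>)
  then show "wlp limit ?body (\<lambda>\<tau>. fill_invariant Out (processed_to w k (Suc u)) (entry \<tau> ''M'') \<and>
      wvar \<tau> ''fuel'' = wvar \<sigma> ''fuel'' - (\<Sum>u'<Suc u. explicit_pairs w k u')) \<tau>"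
    by (rule wlp_mono) (use inv in simp)
next
  fix \<tau>
  assume "fill_invariant Out (processed_to w k n) (entry \<tau> ''M'') \<and>
      wvar \<tau> ''fuel'' = wvar \<sigma> ''fuel'' - (\<Sum>u<n. explicit_pairs w k u)"
  moreover from this have "fill_invariant Out (\<lambda>w' k' _. processed w (Suc k) w' k') (entry \<tau> ''M'')"
    by (elim conjE fill_state.fill_state_mono) (auto simp: processed_def less_Suc_eq)
  ultimately show "fill_invariant Out (\<lambda>w' k' _. processed w (Suc k) w' k') (entry \<tau> ''M'') \<and>
      wvar \<tau> ''fuel'' = wvar \<sigma> ''fuel'' - (\<Sum>u<n. explicit_pairs w k u)" by simp
qed (use inv in \<open>auto simp: size_vars_eq\<close>)

abbreviation filled_before :: "nat \<Rightarrow> nat \<Rightarrow> weights \<Rightarrow> bool" where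
  "filled_before w k \<equiv> fill_invariant (\<lambda>w' k' _. processed w k w' k') (\<lambda>w' k' _. processed w k w' k')"

lemma wlp_FILL_LEVEL:
  assumes filling: "filling \<sigma>" and w: "wvar \<sigma> ''w'' = w" "w < n" and k: "wvar \<sigma> ''k'' = k" "k < levels"
    and j: "wvar \<sigma> ''j'' = pivot_rank n k" and inv: "filled_before w k (entry \<sigma> ''M'')"
    and fuel: "(\<Sum>u<n. explicit_pairs w k u) \<le> wvar \<sigma> ''fuel''"
  shows "wlp limit FILL_LEVEL (\<lambda>\<tau>. filled_before w (Suc k) (entry \<tau> ''M'') \<and> wvar \<tau> ''j'' = pivot_rank n (Suc k) \<and>
    wvar \<tau> ''fuel'' = wvar \<sigma> ''fuel'' - (\<Sum>u<n. explicit_pairs w k u)) \<sigma>"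
proof (rule wlpI)
  fix \<omega> assume "executes FILL_LEVEL \<sigma> \<omega>"
  then obtain \<rho> \<tau> \<upsilon> where exec: "executes SELECT_PIVOT \<sigma> \<rho>" "executes FILL_OUT_EDGES \<rho> \<tau>"
    "executes FILL_IN_EDGES \<tau> \<upsilon>"
    and \<omega>: "\<omega> = wset ''j'' (wvar \<upsilon> ''o'') \<upsilon>" by (auto simp: FILL_LEVEL_def executes_Seq executes_WAssign)
  note frames = exec[THEN executes_frame]
  note same = frameD[OF frames(1)] frameD[OF frames(2)] frameD[OF frames(3)]
  have \<rho>: "filling \<rho>" by (rule filling_frame[OF frames(1) filling]) (auto simp: size_vars_eq)
  have \<tau>: "filling \<tau>" by (rule filling_frame[OF frames(2) \<rho>]) (auto simp: size_vars_eq)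
  note pivot = wlpD[OF wlp_SELECT_PIVOT[OF filling w k j] exec(1)]
  have "wlp limit FILL_OUT_EDGES (\<lambda>\<tau>. fill_invariant (\<lambda>w' k' _. processed w (Suc k) w' k')
      (\<lambda>w' k' _. processed w k w' k')
      (entry \<tau> ''M'')) \<rho>"
    by (rule wlp_FILL_OUT_EDGES[OF \<rho> _ w(2) k(2)]) (use pivot inv in \<open>auto simp: frameD[OF frames(1)] w\<close>)
  note out = wlpD[OF this exec(2)]
  have "wlp limit FILL_IN_EDGES (\<lambda>\<upsilon>. filled_before w (Suc k) (entry \<upsilon> ''M'') \<and>
      wvar \<upsilon> ''fuel'' = wvar \<tau> ''fuel'' - (\<Sum>u<n. explicit_pairs w k u)) \<tau>"
    by (rule wlp_FILL_IN_EDGES[OF \<tau> _ w(2) k(2)]) (use pivot out fuel in \<open>auto simp: same w\<close>)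
  from wlpD[OF this exec(3)] pivot
  show "filled_before w (Suc k) (entry \<omega> ''M'') \<and> wvar \<omega> ''j'' = pivot_rank n (Suc k) \<and>
      wvar \<omega> ''fuel'' = wvar \<sigma> ''fuel'' - (\<Sum>u<n. explicit_pairs w k u)"
    by (simp add: \<omega> same)
qed

lemma wlp_FILL_LEVELS:
  assumes filling: "filling \<sigma>" and w: "wvar \<sigma> ''w'' = w" "w < n" and j: "wvar \<sigma> ''j'' = 0"
    and inv: "filled_before w 0 (entry \<sigma> ''M'')"
    and fuel: "(\<Sum>k<levels. \<Sum>u<n. explicit_pairs w k u) \<le> wvar \<sigma> ''fuel''"
  shows "wlp limit (FOR ''k'' ''levels'' FILL_LEVEL) (\<lambda>\<tau>. filled_before (Suc w) 0 (entry \<tau> ''M'') \<and>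
    wvar \<tau> ''fuel'' = wvar \<sigma> ''fuel'' - (\<Sum>k<levels. \<Sum>u<n. explicit_pairs w k u)) \<sigma>"
proof (rule wlp_FOR_size[OF fillingD(1)[OF filling] size_table_simps(6), where
    I = "\<lambda>k \<tau>. filled_before w k (entry \<tau> ''M'') \<and> wvar \<tau> ''j'' = pivot_rank n k \<and>
      wvar \<tau> ''fuel'' = wvar \<sigma> ''fuel'' - (\<Sum>k'<k. \<Sum>u<n. explicit_pairs w k' u)"])
  fix k \<tau>
  assume k: "k < levels" "wvar \<tau> ''k'' = k" and \<tau>: "frame (FOR ''k'' ''levels'' FILL_LEVEL) \<sigma> \<tau>"
    and inv: "filled_before w k (entry \<tau> ''M'') \<and> wvar \<tau> ''j'' = pivot_rank n k \<and>
      wvar \<tau> ''fuel'' = wvar \<sigma> ''fuel'' - (\<Sum>k'<k. \<Sum>u<n. explicit_pairs w k' u)"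
  have "filling \<tau>" by (rule filling_frame[OF \<tau> filling]) (auto simp: size_vars_eq)
  moreover have "(\<Sum>k'<Suc k. \<Sum>u<n. explicit_pairs w k' u) \<le> (\<Sum>k'<levels. \<Sum>u<n. explicit_pairs w k' u)"
    using k by (intro sum_mono2) auto
  ultimately have "wlp limit FILL_LEVEL (\<lambda>\<upsilon>. filled_before w (Suc k) (entry \<upsilon> ''M'') \<and>
      wvar \<upsilon> ''j'' = pivot_rank n (Suc k) \<and>
      wvar \<upsilon> ''fuel'' = wvar \<tau> ''fuel'' - (\<Sum>u<n. explicit_pairs w k u)) \<tau>"
    by (intro wlp_FILL_LEVEL) (use w k inv fuel in \<open>simp_all add: frameD[OF \<tau>]\<close>)
  then show "wlp limit FILL_LEVEL (\<lambda>\<tau>. filled_before w (Suc k) (entry \<tau> ''M'') \<and>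
      wvar \<tau> ''j'' = pivot_rank n (Suc k) \<and>
      wvar \<tau> ''fuel'' = wvar \<sigma> ''fuel'' - (\<Sum>k'<Suc k. \<Sum>u<n. explicit_pairs w k' u)) \<tau>"
    by (rule wlp_mono) (use inv in simp)
next
  fix \<tau>
  assume inv: "filled_before w levels (entry \<tau> ''M'') \<and> wvar \<tau> ''j'' = pivot_rank n levels \<and>
      wvar \<tau> ''fuel'' = wvar \<sigma> ''fuel'' - (\<Sum>k<levels. \<Sum>u<n. explicit_pairs w k u)"
  have "filled_before (Suc w) 0 (entry \<tau> ''M'')"
    by (rule fill_state.fill_state_mono[OF conjunct1[OF inv]]) (auto simp: processed_def less_Suc_eq)
  with inv show "filled_before (Suc w) 0 (entry \<tau> ''M'') \<and>
      wvar \<tau> ''fuel'' = wvar \<sigma> ''fuel'' - (\<Sum>k<levels. \<Sum>u<n. explicit_pairs w k u)" by simp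
qed (use inv j in \<open>auto simp: size_vars_eq\<close>)

lemma wlp_FILL_MATRIX:
  assumes filling: "filling \<sigma>" and M: "\<And>u v. u < N \<Longrightarrow> v < N \<Longrightarrow> entry \<sigma> ''M'' u v = M\<^sub>0 u v"
    and fuel: "(\<Sum>w<n. \<Sum>k<levels. \<Sum>u<n. explicit_pairs w k u) \<le> wvar \<sigma> ''fuel''"
  shows "wlp limit FILL_MATRIX (\<lambda>\<tau>. fill_invariant (\<lambda>_ _ _. True) (\<lambda>_ _ _. True) (entry \<tau> ''M'')) \<sigma>"
  unfolding FILL_MATRIX_def
proof (rule wlp_FOR_size[OF fillingD(1)[OF filling] size_table_simps(1), where
    I = "\<lambda>w \<tau>. filled_before w 0 (entry \<tau> ''M'') \<and>
      wvar \<tau> ''fuel'' = wvar \<sigma> ''fuel'' - (\<Sum>w'<w. \<Sum>k<levels. \<Sum>u<n. explicit_pairs w' k u)"])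
  let ?body = "WAssign ''j'' (WConst 0) ;; FOR ''k'' ''levels'' FILL_LEVEL"
  show "filled_before 0 0 (entry \<sigma> ''M'') \<and>
      wvar \<sigma> ''fuel'' = wvar \<sigma> ''fuel'' - (\<Sum>w'<0. \<Sum>k<levels. \<Sum>u<n. explicit_pairs w' k u)"
    by (auto simp: processed_def M intro!: fill_state.intro sorted_shortcuts_axioms fill_state_axioms.intro)
  fix w \<tau>
  assume w: "w < n" "wvar \<tau> ''w'' = w" and \<tau>: "frame (FOR ''w'' ''n'' ?body) \<sigma> \<tau>"
    and inv: "filled_before w 0 (entry \<tau> ''M'') \<and>
      wvar \<tau> ''fuel'' = wvar \<sigma> ''fuel'' - (\<Sum>w'<w. \<Sum>k<levels. \<Sum>u<n. explicit_pairs w' k u)"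
  have "filling \<tau>" by (rule filling_frame[OF \<tau> filling]) (auto simp: size_vars_eq)
  moreover have "(\<Sum>w'<Suc w. \<Sum>k<levels. \<Sum>u<n. explicit_pairs w' k u) \<le>
      (\<Sum>w'<n. \<Sum>k<levels. \<Sum>u<n. explicit_pairs w' k u)"
    using w by (intro sum_mono2) auto
  ultimately have "wlp limit (FOR ''k'' ''levels'' FILL_LEVEL) (\<lambda>\<upsilon>. filled_before (Suc w) 0 (entry \<upsilon> ''M'') \<and>
      wvar \<upsilon> ''fuel'' = wvar (wset ''j'' 0 \<tau>) ''fuel'' - (\<Sum>k<levels. \<Sum>u<n. explicit_pairs w k u)) (wset ''j'' 0 \<tau>)"
    by (intro wlp_FILL_LEVELS) (use w inv fuel in \<open>simp_all add: size_vars_eq\<close>)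
  then show "wlp limit ?body (\<lambda>\<tau>. filled_before (Suc w) 0 (entry \<tau> ''M'') \<and>
      wvar \<tau> ''fuel'' = wvar \<sigma> ''fuel'' - (\<Sum>w'<Suc w. \<Sum>k<levels. \<Sum>u<n. explicit_pairs w' k u)) \<tau>"
    using inv by simp
next
  fix \<tau>
  assume "filled_before n 0 (entry \<tau> ''M'') \<and>
      wvar \<tau> ''fuel'' = wvar \<sigma> ''fuel'' - (\<Sum>w'<n. \<Sum>k<levels. \<Sum>u<n. explicit_pairs w' k u)"
  then show "fill_invariant (\<lambda>_ _ _. True) (\<lambda>_ _ _. True) (entry \<tau> ''M'')"
    by (elim conjE fill_state.fill_state_mono) (auto simp: processed_def)
qed (auto simp: size_vars_eq)

end


section \<open>The effect of a round\<close>

text \<open>Every vertex is reached by a tight walk in which at most \<open>k\<close> edges are not covered by free tokens.\<close>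

definition reaching_potential :: "nat \<Rightarrow> nat \<Rightarrow> nat \<Rightarrow> nat \<Rightarrow> weights \<Rightarrow> potential \<Rightarrow> bool" where
  "reaching_potential n N s k M h \<longleftrightarrow> feasible N M h \<and> (\<forall>x<N. M x x = 0) \<and>
     (\<forall>y<n. \<exists>j\<le>k. counted_reach s (tight_edge n M h) (free_token n N M M h) j y)"

lemma reaching_potentialD:
  assumes "reaching_potential n N s k M h"
  shows "feasible N M h" "x < N \<Longrightarrow> M x x = 0"
    "y < n \<Longrightarrow> \<exists>j\<le>k. counted_reach s (tight_edge n M h) (free_token n N M M h) j y"
  using assms by (auto simp: reaching_potential_def)

locale reweighting =
  fixes N m :: nat and M W :: weights and \<phi> :: potential
  assumes loopless: "x < N \<Longrightarrow> M x x = 0"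
    and reweighted: "x < N \<Longrightarrow> y < N \<Longrightarrow> W x y = M x y - \<phi> x + \<phi> y"
    and few: "few_between N m M \<phi>"
begin

definition lower_bound :: weights where
  "lower_bound b y = nonneg_closure N M (M b) y - \<phi> b + \<phi> y"

lemma lower_bound_le: "b < N \<Longrightarrow> y < N \<Longrightarrow> lower_bound b y \<le> W b y"
  using nonneg_closure_le[of y N M "M b"] by (simp add: lower_bound_def reweighted)

lemma nonneg_feasible_lower_bound: "nonneg_feasible N M W (lower_bound b)"
  using nonneg_feasible_closure[of N M "M b"]
  by (auto simp: nonneg_feasible_def lower_bound_def reweighted)

lemma two_hop_less_if_active:
  assumes "b < N" "p < N" "w < N" and active: "active False (lower_bound b p) (W p w)"
  shows "two_hop N M b p + two_hop N M p w < \<phi> b - \<phi> w"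
  using two_hop_le_closure[of p N M b] two_hop_le_edge[of p N w M] assms
  by (simp add: active_def lower_bound_def reweighted loopless)

lemma sum_active_le:
  assumes b: "b < N"
  shows "(\<Sum>p<N. card {w \<in> {..<N}. active False (lower_bound b p) (W p w)}) \<le> N * m"
proof -
  have "(\<Sum>p<N. card {w \<in> {..<N}. active False (lower_bound b p) (W p w)}) =
      (\<Sum>w<N. card {p \<in> {..<N}. active False (lower_bound b p) (W p w)})"
    by (rule sum_card_swap) auto
  also have "\<dots> \<le> (\<Sum>w<N. m)"
  proof (rule sum_mono)
    fix w assume w: "w \<in> {..<N}"
    then have "card {p \<in> {..<N}. active False (lower_bound b p) (W p w)} \<le>
        card {z. z < N \<and> two_hop N M b z + two_hop N M z w < \<phi> b - \<phi> w}"
      using two_hop_less_if_active[OF b] by (intro card_mono) auto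
    also have "\<dots> \<le> m" using few b w by (simp add: few_between_def)
    finally show "card {p \<in> {..<N}. active False (lower_bound b p) (W p w)} \<le> m" .
  qed
  finally show ?thesis by simp
qed

lemma feasible_reweighted: "feasible N M h \<Longrightarrow> feasible N W (\<lambda>x. h x + \<phi> x)"
  by (auto simp: feasible_def reweighted)

lemma tight_edge_reweighted:
  "n \<le> N \<Longrightarrow> tight_edge n M h p q \<Longrightarrow> tight_edge n W (\<lambda>x. h x + \<phi> x) p q"
  by (simp add: tight_edge_def reweighted)

lemma free_token_reweighted:
  assumes n: "n \<le> N" and token: "free_token n N M M h p q"
  shows "free_token n N M W (\<lambda>x. h x + \<phi> x) p q"
proof -
  obtain w g where pq: "p < n" "q < n" and w: "w < n" "M p w + M w q \<le> h q - h p"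
    and g: "g < N" "0 \<le> M p g" "0 \<le> M g q" "M p g + M g q \<le> h q - h p"
    using token by (auto simp: free_token_def)
  have "W p x + W x q = M p x + M x q - \<phi> p + \<phi> q" if "x < N" for x
    using pq n that by (simp add: reweighted)
  then have "W p w + W w q \<le> (h q + \<phi> q) - (h p + \<phi> p)" "W p g + W g q \<le> (h q + \<phi> q) - (h p + \<phi> p)"
    using w g n by simp_all
  then show ?thesis using pq w(1) g(1-3) unfolding free_token_def by blast
qed

lemma two_hop_le_relaxed:
  assumes dijkstra: "dijkstra_result N M W False (W u) K R" and u: "u < N" and w: "w < N"
  shows "two_hop N M u w - \<phi> u + \<phi> w \<le> R w"
proof -
  interpret dijkstra_state N M W False "W u" "{..<N}" K R by (rule dijkstra)
  from relaxed_cases[OF w] show ?thesis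
  proof (elim disjE bexE)
    assume "R w = W u w"
    then show ?thesis using two_hop_le_edge[of u N w M] u w by (simp add: reweighted loopless)
  next
    fix p assume "p \<in> {..<N}" "R w = K p + W p w"
    moreover from this have "lower_bound u p \<le> K p"
      using key_greatest[OF nonneg_feasible_lower_bound lower_bound_le[OF u]] by simp
    ultimately show ?thesis using two_hop_le[of p N M u w] w by (simp add: lower_bound_def reweighted)
  qed
qed

end

locale explored_reweighting =
  reweighting N m M W \<phi> + exploration n N s "\<lambda>x. h x + \<phi> x" M W A K R
  for n N m s M W \<phi> h A K R
begin

lemma feasible_shortcuts: "feasible n A (\<lambda>x. h x + \<phi> x)"
  unfolding feasible_def
proof (intro allI impI)
  fix u w assume uw: "u < n" "w < n"
  let ?h = "\<lambda>x. h x + \<phi> x - (h u + \<phi> u)"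
  have "feasible N W ?h" unfolding feasible_diff_const by (rule feasible)
  moreover have "?h y \<le> W u y" if "y < N" for y using feasibleD[OF feasible _ that, of u] uw n_le_N by simp
  ultimately have "?h w \<le> R u w" using uw n_le_N by (intro dijkstra_state.relaxed_ge[OF explored]) auto
  then show "h w + \<phi> w \<le> h u + \<phi> u + A u w" using shortcut[OF uw] by simp
qed

lemma card_negative_shortcuts_le:
  assumes ut: "u < n" "t < n"
  shows "card {w \<in> {..<n}. A u w + A w t < 0} \<le> m"
proof -
  have bound: "two_hop N M x y - \<phi> x + \<phi> y \<le> A x y" if "x < n" "y < n" for x y
    using two_hop_le_relaxed[OF explored, of x y] shortcut that n_le_N by simp
  have "{w \<in> {..<n}. A u w + A w t < 0} \<subseteq> {z. z < N \<and> two_hop N M u z + two_hop N M z t < \<phi> u - \<phi> t}"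
  proof
    fix w assume "w \<in> {w \<in> {..<n}. A u w + A w t < 0}"
    then show "w \<in> {z. z < N \<and> two_hop N M u z + two_hop N M z t < \<phi> u - \<phi> t}"
      using bound[OF ut(1), of w] bound[OF _ ut(2), of w] n_le_N by simp
  qed
  then have "card {w \<in> {..<n}. A u w + A w t < 0} \<le>
      card {z. z < N \<and> two_hop N M u z + two_hop N M z t < \<phi> u - \<phi> t}" by (intro card_mono) auto
  also have "\<dots> \<le> m" using few ut n_le_N by (simp add: few_between_def)
  finally show ?thesis .
qed

lemma reaching_potential_halved:
  assumes reaching: "reaching_potential n N s k M h"
    and filled: "filled n N levels A listed g M' (\<lambda>x. h x + \<phi> x)"
  obtains h' where "\<And>x. x < n \<Longrightarrow> h' x = h x + \<phi> x" "reaching_potential n N s ((k + 1) div 2) M' h'"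
proof -
  interpret F: filled n N levels A listed g M' "\<lambda>x. h x + \<phi> x" by (rule filled)
  have "\<exists>j\<le>(k + 1) div 2. counted_reach s (tight_edge n M' F.extended) (free_token n N M' M' F.extended) j y"
    if y: "y < n" for y
  proof -
    obtain j where j: "j \<le> k" and reach: "counted_reach s (tight_edge n M h) (free_token n N M M h) j y"
      using reaching_potentialD(3)[OF reaching y] by blast
    have "counted_reach s (tight_edge n W (\<lambda>x. h x + \<phi> x)) (free_token n N M W (\<lambda>x. h x + \<phi> x)) j y"
      using reach by (rule counted_reach_mono) (rule tight_edge_reweighted free_token_reweighted; use n_le_N in simp)+
    then have "halved ((j + 1) div 2) y" by (rule halving)
    then have "counted_reach s (tight_edge n M' F.extended) (free_token n N M' M' F.extended) ((j + 1) div 2) y"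
      by (rule counted_reach_mono) (rule F.tight_edge_extended F.free_token_extended; assumption)+
    moreover have "(j + 1) div 2 \<le> (k + 1) div 2" using j by (intro div_le_mono) simp
    ultimately show ?thesis by blast
  qed
  then show thesis
    using F.extended_vertex F.feasible_extended F.diagonal
    by (intro that[of F.extended]) (auto simp: reaching_potential_def)
qed

end

context sizes
begin

lemma wlp_INSERT_SHORTCUTS:
  assumes sized: "sized \<sigma>" and A: "A = entry \<sigma> ''A''" and feasible: "feasible n A h"
    and few: "\<And>u t. u < n \<Longrightarrow> t < n \<Longrightarrow> card {w \<in> {..<n}. A u w + A w t < 0} \<le> m"
  shows "wlp limit INSERT_SHORTCUTS (\<lambda>\<tau>. \<exists>listed g. filled n N levels A listed g (entry \<tau> ''M'') h) \<sigma>"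
proof (rule wlpI)
  fix \<upsilon> assume "executes INSERT_SHORTCUTS \<sigma> \<upsilon>"
  then obtain \<rho> \<tau> where exec: "executes (SORT_ROWS ''A'' ''n'') \<sigma> \<rho>" "executes INIT_MATRIX \<rho> \<tau>"
    "executes FILL_MATRIX (wset ''fuel'' (wvar \<tau> ''fill_fuel'') \<tau>) \<upsilon>" (is "executes _ ?\<tau> _")
    by (auto simp: INSERT_SHORTCUTS_def REFUEL_def executes_Seq executes_WAssign)
  note same = frameD[OF executes_frame[OF exec(1)]] frameD[OF executes_frame[OF exec(2)]]
  have sized': "sized \<rho>" "sized \<tau>" using exec(1,2)[THEN executes_sized] sized by (auto simp: size_vars_eq)
  let ?listed = "sorted_entry \<rho>"
  have sorted: "row_sorted (?listed w) (A w) n" if "w < n" for w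
    using wlpD[OF wlp_SORT_ROWS[OF sized size_table_simps(1) n_le_N] exec(1)] that by (simp add: A)
  have "rarr \<rho> ''A'' = rarr \<sigma> ''A''" by (simp add: same)
  from wlpD[OF wlp_INIT_MATRIX[OF sized'(1)] exec(2), unfolded this]
  obtain g where g: "\<forall>u<n. \<forall>w<n. \<bar>A u w\<bar> \<le> g" "\<forall>u<N. \<forall>w<N. entry \<tau> ''M'' u w = padded_weights n A g u w"
    unfolding A by blast
  interpret F: shortcut_filling n s C A ?listed "padded_weights n A g"
    by unfold_locales (use sorted in \<open>auto simp: row_sorted_def\<close>)
  have "F.filling ?\<tau>" unfolding F.filling_def using sized' by (simp add: same A size_vars_eq)
  moreover have "(\<Sum>w<n. \<Sum>k<levels. \<Sum>u<n. F.explicit_pairs w k u) \<le> wvar ?\<tau> ''fuel''"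
    using F.sum_explicit_pairs_le[OF few] sized' by (simp add: sizedD fill_fuel_def)
  ultimately have "wlp limit FILL_MATRIX (\<lambda>\<upsilon>. F.fill_invariant (\<lambda>_ _ _. True) (\<lambda>_ _ _. True) (entry \<upsilon> ''M'')) ?\<tau>"
    by (intro F.wlp_FILL_MATRIX) (simp_all add: g(2))
  from wlpD[OF this exec(3)] have "filled n N levels A ?listed g (entry \<upsilon> ''M'') h"
    by (intro filled.intro filled_axioms.intro feasible g(1)[rule_format])
  then show "\<exists>listed g. filled n N levels A listed g (entry \<upsilon> ''M'') h" by blast
qed

text \<open>\<open>h\<^sub>0\<close> is the sought distance, which the rounds shift by \<open>P\<close>.\<close>

definition round_invariant :: "potential \<Rightarrow> nat \<Rightarrow> machine_state \<Rightarrow> bool" where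
  "round_invariant h\<^sub>0 k \<sigma> \<longleftrightarrow>
     (\<exists>h. (\<forall>x<n. h x = h\<^sub>0 x + rarr \<sigma> ''P'' x) \<and> reaching_potential n N s k (entry \<sigma> ''M'') h)"

lemma wlp_ROUND:
  assumes sized: "sized \<sigma>" and inv: "round_invariant h\<^sub>0 k \<sigma>" and hubs_less: "hubs \<sigma> \<subseteq> {..<N}"
    and good: "\<And>x y. x < N \<Longrightarrow> y < N \<Longrightarrow> hubs \<sigma> \<inter> good_hubs N m (entry \<sigma> ''M'') x y \<noteq> {}"
  shows "wlp limit ROUND (round_invariant h\<^sub>0 ((k + 1) div 2)) \<sigma>"
proof (rule wlpI)
  let ?M = "entry \<sigma> ''M''"
  fix \<upsilon> assume "executes ROUND \<sigma> \<upsilon>"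
  then obtain \<rho> \<tau> where exec: "executes REWEIGHT_BY_HUBS \<sigma> \<rho>" "executes EXPLORE \<rho> \<tau>" "executes INSERT_SHORTCUTS \<tau> \<upsilon>"
    by (auto simp: ROUND_def executes_Seq)
  note frames = exec[THEN executes_frame]
  note same = frameD[OF frames(1)] frameD[OF frames(2)] frameD[OF frames(3)]
  have sized': "sized \<rho>" "sized \<tau>" using exec(1,2)[THEN executes_sized] sized by (auto simp: size_vars_eq)
  obtain h where h: "\<And>x. x < n \<Longrightarrow> h x = h\<^sub>0 x + rarr \<sigma> ''P'' x" and reaching: "reaching_potential n N s k ?M h"
    using inv by (auto simp: round_invariant_def)
  note feasible_h = reaching_potentialD(1)[OF reaching] and M_diagonal = reaching_potentialD(2)[OF reaching]
  obtain \<phi> where \<phi>: "hub_reweighted N ?M h \<phi> (entry \<rho> ''H'') (hubs \<sigma>)"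
    and W: "\<And>x y. x < N \<Longrightarrow> y < N \<Longrightarrow> entry \<rho> ''W'' x y = ?M x y - \<phi> x + \<phi> y"
    and P: "\<And>x. x < n \<Longrightarrow> rarr \<rho> ''P'' x = rarr \<sigma> ''P'' x + \<phi> x"
    using wlpD[OF wlp_REWEIGHT_BY_HUBS[OF sized hubs_less refl feasible_h M_diagonal] exec(1)] by blast
  interpret hub_reweighted N ?M h \<phi> "entry \<rho> ''H''" "hubs \<sigma>" by (rule \<phi>)
  interpret R: reweighting N m ?M "entry \<rho> ''W''" \<phi>
    by unfold_locales (auto simp: M_diagonal W few_between_if_good_hubs[OF good])
  have nonneg: "0 \<le> entry \<rho> ''W'' x y" if "x < N" "y < N" "0 \<le> ?M x y" for x y
    using nonneg_edge[OF that] le_reweighted[OF that(1,2)] W[OF that(1,2)] by simp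
  have "wlp limit EXPLORE (\<lambda>\<tau>. explored ?M (entry \<rho> ''W'') n (entry \<tau> ''A'')) \<rho>"
  proof (rule wlp_EXPLORE[OF sized'(1) _ refl nonneg R.nonneg_feasible_lower_bound R.lower_bound_le])
    show "(\<Sum>p<N. num_active (entry \<rho> ''W'') p (R.lower_bound b p)) \<le> N * m" if "b < n" for b
      using R.sum_active_le[of b] that n_le_N by (simp add: active_targets_def)
  qed (use n_le_N in \<open>auto simp: same\<close>)
  from wlpD[OF this exec(2)] obtain K R where
    explored: "\<And>b. b < n \<Longrightarrow> dijkstra_result N ?M (entry \<rho> ''W'') False (entry \<rho> ''W'' b) (K b) (R b)"
    and shortcuts: "\<And>b w. b < n \<Longrightarrow> w < n \<Longrightarrow> entry \<tau> ''A'' b w = R b w" unfolding explored_def by blast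
  interpret E: explored_reweighting n N m s ?M "entry \<rho> ''W''" \<phi> h "entry \<tau> ''A''" K R
    by (intro explored_reweighting.intro exploration.intro R.reweighting_axioms n_le_N s_less R.feasible_reweighted
        feasible_h nonneg explored shortcuts) (auto simp: W M_diagonal)
  obtain listed g where "filled n N levels (entry \<tau> ''A'') listed g (entry \<upsilon> ''M'') (\<lambda>x. h x + \<phi> x)"
    using wlpD[OF wlp_INSERT_SHORTCUTS[OF sized'(2) refl E.feasible_shortcuts E.card_negative_shortcuts_le] exec(3)]
    by blast
  from E.reaching_potential_halved[OF reaching this] obtain h'
    where "\<And>x. x < n \<Longrightarrow> h' x = h x + \<phi> x" "reaching_potential n N s ((k + 1) div 2) (entry \<upsilon> ''M'') h'" by blast
  then show "round_invariant h\<^sub>0 ((k + 1) div 2) \<upsilon>"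
    unfolding round_invariant_def using h P by (intro exI[of _ h']) (simp add: same)
qed

end


section \<open>Computing the sizes\<close>

lemma COMPUTE_SIZES_modifies [simp]:
  "mod_wvars COMPUTE_LOG_SIZE = {''p'', ''l'', ''x''}" "mod_wvars COMPUTE_SQRT_SIZE = {''q'', ''x''}"
  "mod_wvars (COMPUTE_SIZES C) =
     {''p'', ''l'', ''x'', ''q'', ''blocks'', ''N'', ''levels'', ''m'', ''explore_fuel'', ''fill_fuel''}"
  "mod_warrs (COMPUTE_SIZES C) = {}" "mod_rarrs (COMPUTE_SIZES C) = {}"
  by (auto simp: COMPUTE_SIZES_def COMPUTE_LOG_SIZE_def COMPUTE_SQRT_SIZE_def)

context sizes
begin

lemma wlp_COMPUTE_LOG_SIZE:
  assumes n: "wvar \<sigma> ''n'' = n"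
  shows "wlp limit COMPUTE_LOG_SIZE (\<lambda>\<tau>. wvar \<tau> ''l'' = l) \<sigma>"
proof -
  let ?L = "l - 2"
  let ?body = "Cond (WLess (WVar ''p'') (WVar ''n''))
    (WAssign ''p'' (WAdd (WVar ''p'') (WVar ''p'')) ;; WAssign ''l'' (WAdd (WVar ''l'') (WConst 1))) Skip"
  have twice: "2 * n < limit" and "2 < limit"
    using le_power_imp_less_limit[of "2 * n" 2] n_ge_1 less_limit(3) l_ge_2 by (auto simp: power2_eq_square)
  have "wlp limit (FOR ''x'' ''n'' ?body) (\<lambda>\<tau>. wvar \<tau> ''l'' = l) (wset ''l'' 2 (wset ''p'' 1 \<sigma>))"
  proof (rule wlp_FOR[where I = "\<lambda>k \<tau>. wvar \<tau> ''p'' = 2 ^ min k ?L \<and> wvar \<tau> ''l'' = min k ?L + 2"])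
    fix k \<tau>
    assume inv: "wvar \<tau> ''p'' = 2 ^ min k ?L \<and> wvar \<tau> ''l'' = min k ?L + 2"
      and frame: "frame (FOR ''x'' ''n'' ?body) (wset ''l'' 2 (wset ''p'' 1 \<sigma>)) \<tau>"
    have n\<tau>: "wvar \<tau> ''n'' = n" by (simp add: frameD[OF frame] n)
    show "wlp limit ?body (\<lambda>\<tau>. wvar (wset ''x'' (Suc k) \<tau>) ''p'' = 2 ^ min (Suc k) ?L \<and>
        wvar (wset ''x'' (Suc k) \<tau>) ''l'' = min (Suc k) ?L + 2) \<tau>"
    proof (cases "k < ?L")
      case True
      then have k: "2 ^ k < n" using power_less_log_size[of k n] by (simp add: l_def)
      then have "2 ^ k + 2 ^ k < limit" using twice by simp
      moreover have "Suc (Suc (Suc k)) < limit" using True less_limit(3) by simp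
      ultimately show ?thesis using inv n\<tau> True k by (simp add: min_def)
    next
      case False
      then show ?thesis using inv n\<tau> n_le_power_l by (simp add: min_def)
    qed
  next
    fix \<tau>
    assume "wvar \<tau> ''p'' = 2 ^ min (wvar (wset ''l'' 2 (wset ''p'' 1 \<sigma>)) ''n'') ?L \<and>
      wvar \<tau> ''l'' = min (wvar (wset ''l'' 2 (wset ''p'' 1 \<sigma>)) ''n'') ?L + 2"
    moreover have "?L \<le> n" using log_size_le[of n] by (simp add: l_def)
    ultimately show "wvar \<tau> ''l'' = l" using n l_ge_2 by (simp add: min_absorb2)
  qed (use n less_limit(1) in auto)
  then show ?thesis using \<open>2 < limit\<close> by (simp add: COMPUTE_LOG_SIZE_def)
qed

lemma wlp_COMPUTE_SQRT_SIZE: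
  assumes n: "wvar \<sigma> ''n'' = n"
  shows "wlp limit COMPUTE_SQRT_SIZE (\<lambda>\<tau>. wvar \<tau> ''q'' = q) \<sigma>"
proof -
  let ?body = "Cond (WLess (WMult (WVar ''q'') (WVar ''q'')) (WVar ''n'')) (WAssign ''q'' (WAdd (WVar ''q'') (WConst 1))) Skip"
  have "wlp limit (FOR ''x'' ''n'' ?body) (\<lambda>\<tau>. wvar \<tau> ''q'' = q) (wset ''q'' 0 \<sigma>)"
  proof (rule wlp_FOR[where I = "\<lambda>k \<tau>. wvar \<tau> ''q'' = min k q"])
    fix k \<tau>
    assume inv: "wvar \<tau> ''q'' = min k q" and frame: "frame (FOR ''x'' ''n'' ?body) (wset ''q'' 0 \<sigma>) \<tau>"
    have n\<tau>: "wvar \<tau> ''n'' = n" by (simp add: frameD[OF frame] n)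
    show "wlp limit ?body (\<lambda>\<tau>. wvar (wset ''x'' (Suc k) \<tau>) ''q'' = min (Suc k) q) \<tau>"
    proof (cases "k < q")
      case True
      then have "k * k < n" using square_less_sqrt_size[of k n] by (simp add: q_def)
      then show ?thesis using inv n\<tau> True less_limit(1,2) by (simp add: min_def)
    next
      case False
      have "q * q \<le> (n + 1) ^ 2" unfolding power2_eq_square using q_le_n by (intro mult_le_mono) auto
      then have "q * q < limit" by (rule le_power_imp_less_limit) simp
      then show ?thesis using inv n\<tau> False n_le_q_square by (simp add: min_def)
    qed
  qed (use n q_le_n less_limit(1) in auto)
  then show ?thesis by (simp add: COMPUTE_SQRT_SIZE_def)
qed

lemma wlp_COMPUTE_SIZES:
  assumes n: "wvar \<sigma> ''n'' = n" and s: "wvar \<sigma> ''s'' = s"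
  shows "wlp limit (COMPUTE_SIZES C) sized \<sigma>"
proof (rule wlpI)
  let ?products = "WAssign ''blocks'' (WMult (WVar ''q'') (WVar ''l'')) ;;
    WAssign ''N'' (WMult (WVar ''q'') (WVar ''blocks'')) ;;
    WAssign ''levels'' (WSub (WVar ''l'') (WConst 1)) ;;
    WAssign ''m'' (WMult (WConst C) (WMult (WVar ''l'') (WVar ''blocks''))) ;;
    WAssign ''explore_fuel'' (WMult (WVar ''n'') (WMult (WVar ''N'') (WVar ''m''))) ;;
    WAssign ''fill_fuel''
      (WMult (WVar ''n'') (WMult (WMult (WConst 2) (WVar ''levels'')) (WMult (WVar ''n'') (WVar ''m''))))"
  fix \<upsilon> assume "executes (COMPUTE_SIZES C) \<sigma> \<upsilon>"
  then obtain \<rho> \<tau> where exec: "executes COMPUTE_LOG_SIZE \<sigma> \<rho>" "executes COMPUTE_SQRT_SIZE \<rho> \<tau>"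
    "executes ?products \<tau> \<upsilon>"
    unfolding COMPUTE_SIZES_def executes_Seq[of COMPUTE_LOG_SIZE] executes_Seq[of COMPUTE_SQRT_SIZE] by blast
  note same = frameD[OF executes_frame[OF exec(1)]] frameD[OF executes_frame[OF exec(2)]]
  have "wvar \<rho> ''n'' = n" by (simp add: same n)
  then have \<tau>: "wvar \<tau> ''n'' = n" "wvar \<tau> ''s'' = s" "wvar \<tau> ''l'' = l" "wvar \<tau> ''q'' = q"
    using wlpD[OF wlp_COMPUTE_LOG_SIZE[OF n] exec(1)] wlpD[OF wlp_COMPUTE_SQRT_SIZE exec(2)]
    by (simp_all add: same n s)
  have "l * blocks \<le> N * l" using q_ge_1 by (simp add: N_def)
  also have "\<dots> \<le> (n + 1) ^ 4 * (n + 1) ^ 2" by (intro mult_le_mono size_le_power)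
  finally have "l * blocks < limit" by (intro le_power_imp_less_limit[of _ 6]) (simp_all flip: power_add)
  moreover have "2 < limit" using less_limit(11) levels_pos by simp
  ultimately have small: "q * l mod limit = blocks" "q * blocks mod limit = N" "C mod limit = C" "2 mod limit = 2"
    "l * blocks mod limit = l * blocks" "C * (l * blocks) mod limit = m"
    "N * m mod limit = N * m" "n * (N * m) mod limit = explore_fuel" "n * m mod limit = n * m"
    "2 * levels mod limit = 2 * levels" "2 * levels * (n * m) mod limit = 2 * levels * (n * m)"
    "n * (2 * levels * (n * m)) mod limit = fill_fuel"
    using less_limit
    by (simp_all add: blocks_def[symmetric] N_def[symmetric] m_def[symmetric] explore_fuel_def[symmetric]
        fill_fuel_def[symmetric])
  have "l - Suc 0 = levels" by (simp add: levels_def)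
  then have "wlp limit ?products sized \<tau>" by (simp add: sized_def size_table_def \<tau> small)
  from wlpD[OF this exec(3)] show "sized \<upsilon>" .
qed

lemma COMPUTE_SIZES_time:
  assumes n: "wvar \<sigma> ''n'' = n"
  obtains t \<tau> where "big_step limit (COMPUTE_SIZES C) \<sigma> t \<tau>" "t \<le> 50 + 20 * n"
proof -
  interpret T: constant_words limit "\<lambda>\<sigma>. wvar \<sigma> ''n'' = n" "{''n''}"
    by unfold_locales (use limit_gt_1 in auto)
  have "T.cost_le (50 + 20 * n) (COMPUTE_SIZES C)"
    unfolding COMPUTE_SIZES_def COMPUTE_LOG_SIZE_def COMPUTE_SQRT_SIZE_def
    by (rule T.cost_le_mono, (rule T.cost_le_Skip T.cost_le_assign T.cost_le_Seq T.cost_le_Cond T.cost_le_FOR[where b = n] |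
        (simp add: less_limit(1); fail))+)
  then obtain t \<tau> where t: "big_step limit (COMPUTE_SIZES C) \<sigma> t \<tau>"
    "t + 50 * wvar \<tau> ''fuel'' \<le> 50 + 20 * n + 50 * wvar \<sigma> ''fuel''" using n by (auto simp: T.cost_le_def)
  moreover have "wvar \<tau> ''fuel'' = wvar \<sigma> ''fuel''"
    using frameD(1)[OF big_step_frame[OF t(1)], of "''fuel''"] by simp
  ultimately show thesis by (intro that) auto
qed

lemma wval_input_index [simp]:
  assumes "wvar \<sigma> ''n'' = n" "wvar \<sigma> a < n" "wvar \<sigma> b < n"
  shows "wval limit \<sigma> (input_index a b) = wvar \<sigma> a * n + wvar \<sigma> b"
proof -
  have "wvar \<sigma> a * n + wvar \<sigma> b \<le> wvar \<sigma> a * N + wvar \<sigma> b" using n_le_N by simp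
  also have "\<dots> < limit" using assms n_le_N by (intro pair_less_limit) auto
  finally show ?thesis using assms(1) by (simp add: input_index_def)
qed

end


section \<open>Reading the graph\<close>

lemma SUM_ABS_WEIGHTS_modifies [simp]:
  "mod_wvars SUM_ABS_WEIGHTS = {''x'', ''y''}" "mod_warrs SUM_ABS_WEIGHTS = {}" "mod_rarrs SUM_ABS_WEIGHTS = {}"
  by (auto simp: SUM_ABS_WEIGHTS_def)

lemma reaching_potential_padded:
  assumes h: "shortest_potential n G w s h" and s: "s < n" and n_le_N: "n \<le> N"
    and bounded: "\<And>u v. u < n \<Longrightarrow> v < n \<Longrightarrow> \<bar>adjacency G w u v\<bar> \<le> g"
    and M: "\<And>u v. u < N \<Longrightarrow> v < N \<Longrightarrow> M u v = padded_weights n (adjacency G w) g u v"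
  shows "reaching_potential n N s n M (\<lambda>x. if x < n then h x else h s)" (is "reaching_potential _ _ _ _ _ ?h")
proof -
  interpret shortest_potential n G w s h by (rule h)
  have M_eq: "M u v = adjacency G w u v" if "u < n" "v < n" for u v
    using that n_le_N by (simp add: M padded_weights_def adjacency_def)
  have "0 \<le> g" using bounded[OF s s] by linarith
  then have "\<exists>w<n. \<bar>?h x - h w\<bar> \<le> g" for x using s by (intro exI[of _ "if x < n then x else s"]) simp
  from padding_le[where h' = ?h, OF feasible bounded this]
  have far: "?h y \<le> ?h x + 3 * g" for x y .
  have "?h y \<le> ?h x + M x y" if "x < N" "y < N" for x y
    using far[of y x] feasibleD[OF feasible, of x y] that by (auto simp: M padded_weights_def)
  moreover have "\<exists>j\<le>n. counted_reach s (tight_edge n M ?h) (free_token n N M M ?h) j y" if y: "y < n" for y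
  proof -
    obtain j where j: "j \<le> n" "counted_reach s (tight_edge n (adjacency G w) h) (\<lambda>_ _. False) j y"
      using tight_reach[OF y] by blast
    then have "counted_reach s (tight_edge n M ?h) (free_token n N M M ?h) j y"
      by (elim counted_reach_mono) (auto simp: tight_edge_def M_eq)
    then show ?thesis using j(1) by blast
  qed
  ultimately show ?thesis by (simp add: reaching_potential_def feasible_def M padded_weights_def)
qed

locale sssp_problem = sizes n s C for n s C +
  fixes G :: "nat pair_pre_digraph" and w :: "nat \<times> nat \<Rightarrow> real"
  assumes instance_G: "sssp_instance n G s"
begin

definition holds_input :: "machine_state \<Rightarrow> bool" where
  "holds_input \<sigma> \<longleftrightarrow> sized \<sigma> \<and> warr \<sigma> ''edge'' = warr (sssp_input n G w s) ''edge'' \<and>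
     rarr \<sigma> ''weight'' = rarr (sssp_input n G w s) ''weight''"

lemma holds_inputD:
  assumes "holds_input \<sigma>"
  shows "sized \<sigma>"
    and "x < n \<Longrightarrow> y < n \<Longrightarrow> warr \<sigma> ''edge'' (x * n + y) = (if (x, y) \<in> parcs G then 1 else 0)"
    and "x < n \<Longrightarrow> y < n \<Longrightarrow> rarr \<sigma> ''weight'' (x * n + y) = (if (x, y) \<in> parcs G then w (x, y) else 0)"
  using assms by (simp_all add: holds_input_def sssp_input_def)

lemma holds_input_frame:
  "frame c \<sigma> \<tau> \<Longrightarrow> holds_input \<sigma> \<Longrightarrow> mod_wvars c \<inter> size_vars = {} \<Longrightarrow> ''edge'' \<notin> mod_warrs c \<Longrightarrow>
    ''weight'' \<notin> mod_rarrs c \<Longrightarrow> holds_input \<tau>"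
  unfolding holds_input_def
  using sized_frame frameD(2)[of c \<sigma> \<tau> "''edge''"] frameD(4)[of c \<sigma> \<tau> "''weight''"] by simp

lemma holds_input_update [simp]:
  "x \<notin> size_vars \<Longrightarrow> holds_input (\<sigma>\<lparr>wvar := f(x := v)\<rparr>) = holds_input (\<sigma>\<lparr>wvar := f\<rparr>)"
  "holds_input (\<sigma>\<lparr>rvar := r\<rparr>) = holds_input \<sigma>"
  by (simp_all add: holds_input_def)

lemma arc_less: "(x, y) \<in> parcs G \<Longrightarrow> x < n" "(x, y) \<in> parcs G \<Longrightarrow> y < n"
  using sssp_instance_arc_less[OF instance_G] by auto

lemma sum_input_weights:
  "(\<Sum>x<n. \<Sum>y<n. if (x, y) \<in> parcs G then \<bar>w (x, y)\<bar> else 0) = total_weight G w"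
proof -
  have "(\<Sum>x<n. \<Sum>y<n. if (x, y) \<in> parcs G then \<bar>w (x, y)\<bar> else 0) =
      (\<Sum>e\<in>{..<n} \<times> {..<n}. if e \<in> parcs G then \<bar>w e\<bar> else 0)"
    unfolding sum.cartesian_product by (rule sum.cong) auto
  also have "\<dots> = (\<Sum>e\<in>({..<n} \<times> {..<n}) \<inter> parcs G. \<bar>w e\<bar>)" by (rule sum.inter_restrict[symmetric]) simp
  also have "({..<n} \<times> {..<n}) \<inter> parcs G = parcs G" using arc_less by auto
  finally show ?thesis by (simp add: total_weight_def)
qed

lemma wlp_SUM_ABS_WEIGHTS:
  assumes input: "holds_input \<sigma>"
  shows "wlp limit SUM_ABS_WEIGHTS (\<lambda>\<tau>. rvar \<tau> ''z'' = total_weight G w) \<sigma>"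
proof -
  let ?c = "\<lambda>x y. if (x, y) \<in> parcs G then \<bar>w (x, y)\<bar> else 0"
  let ?body = "Cond (RLess (RArr ''weight'' (input_index ''x'' ''y'')) RZero)
    (RAssign ''z'' (RSub (RVar ''z'') (RArr ''weight'' (input_index ''x'' ''y''))))
    (RAssign ''z'' (RAdd (RVar ''z'') (RArr ''weight'' (input_index ''x'' ''y''))))"
  let ?\<sigma> = "\<sigma>\<lparr>rvar := (rvar \<sigma>)(''z'' := 0)\<rparr>"
  have "wlp limit (FOR ''x'' ''n'' (FOR ''y'' ''n'' ?body)) (\<lambda>\<tau>. rvar \<tau> ''z'' = total_weight G w) ?\<sigma>"
  proof (rule wlp_FOR2_size[where I = "\<lambda>x y \<tau>. rvar \<tau> ''z'' = (\<Sum>u<x. \<Sum>v<n. ?c u v) + (\<Sum>v<y. ?c x v)",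
      OF _ size_table_simps(1) size_table_simps(1)])
    fix x y \<tau>
    assume xy: "x < n" "y < n" "wvar \<tau> ''x'' = x" "wvar \<tau> ''y'' = y" and sized: "sized \<tau>"
      and frame: "frame (FOR ''x'' ''n'' (FOR ''y'' ''n'' ?body)) ?\<sigma> \<tau>"
      and inv: "rvar \<tau> ''z'' = (\<Sum>u<x. \<Sum>v<n. ?c u v) + (\<Sum>v<y. ?c x v)"
    have "rval limit \<tau> (RArr ''weight'' (input_index ''x'' ''y'')) = (if (x, y) \<in> parcs G then w (x, y) else 0)"
      using xy sized holds_inputD(3)[OF input] by (simp add: sizedD frameD[OF frame])
    then show "wlp limit ?body (\<lambda>\<tau>. rvar \<tau> ''z'' = (\<Sum>u<x. \<Sum>v<n. ?c u v) + (\<Sum>v<Suc y. ?c x v)) \<tau>"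
      using inv by simp
  qed (use holds_inputD(1)[OF input] in \<open>auto simp: size_vars_eq sum_input_weights\<close>)
  then show ?thesis by (simp add: SUM_ABS_WEIGHTS_def)
qed

lemma wlp_LOAD_GRAPH:
  assumes input: "holds_input \<sigma>"
  shows "wlp limit LOAD_GRAPH (\<lambda>\<tau>. \<forall>x<n. \<forall>y<n. entry \<tau> ''A'' x y = adjacency G w x y) \<sigma>"
proof (rule wlpI)
  let ?body = "Cond (WEq (WVar ''x'') (WVar ''y'')) (RStore ''A'' (index ''x'' ''y'') RZero)
    (Cond (WEq (WArr ''edge'' (input_index ''x'' ''y'')) (WConst 0)) (RStore ''A'' (index ''x'' ''y'') (RVar ''z''))
       (RStore ''A'' (index ''x'' ''y'') (RArr ''weight'' (input_index ''x'' ''y''))))"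
  fix \<upsilon> assume "executes LOAD_GRAPH \<sigma> \<upsilon>"
  then obtain \<tau> where \<tau>: "executes SUM_ABS_WEIGHTS \<sigma> \<tau>"
    and \<upsilon>: "executes (FOR ''x'' ''n'' (FOR ''y'' ''n'' ?body)) (\<tau>\<lparr>rvar := (rvar \<tau>)(''z'' :=
        rvar \<tau> ''z'' + rvar \<tau> ''z'')\<rparr>) \<upsilon>"
      (is "executes _ ?\<tau> _")
    by (auto simp: LOAD_GRAPH_def executes_Seq executes_RAssign)
  have z: "rvar ?\<tau> ''z'' = 2 * total_weight G w" using wlpD[OF wlp_SUM_ABS_WEIGHTS[OF input] \<tau>] by simp
  have input': "holds_input ?\<tau>" using holds_input_frame[OF executes_frame[OF \<tau>] input] by (simp add: size_vars_eq)
  have "wlp limit (FOR ''x'' ''n'' (FOR ''y'' ''n'' ?body)) (\<lambda>\<upsilon>. \<forall>x<n. \<forall>y<n. entry \<upsilon> ''A'' x y =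
      adjacency G w x y) ?\<tau>"
  proof (rule wlp_FOR2_store[OF holds_inputD(1)[OF input'] size_table_simps(1) n_le_N])
    fix x y \<upsilon>
    assume xy: "x < n" "y < n" "wvar \<upsilon> ''x'' = x" "wvar \<upsilon> ''y'' = y" and sized: "sized \<upsilon>"
      and frame: "frame (FOR ''x'' ''n'' (FOR ''y'' ''n'' ?body)) ?\<tau> \<upsilon>"
    have "rvar \<upsilon> ''z'' = 2 * total_weight G w" "holds_input \<upsilon>"
      using z holds_input_frame[OF frame input'] by (auto simp: frameD[OF frame] size_vars_eq)
    then show "wlp limit ?body (\<lambda>\<omega>. rarr \<omega> ''A'' = (rarr \<upsilon> ''A'')(x * N + y := adjacency G w x y)) \<upsilon>"
      using xy sized n_le_N holds_inputD(2,3)[of \<upsilon> x y] by (simp add: sizedD adjacency_def)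
  qed (auto simp: size_vars_eq)
  from wlpD[OF this \<upsilon>] show "\<forall>x<n. \<forall>y<n. entry \<upsilon> ''A'' x y = adjacency G w x y" .
qed

lemma wlp_LOAD:
  assumes input: "holds_input \<sigma>" and P: "rarr \<sigma> ''P'' = (\<lambda>_. 0)" and h: "shortest_potential n G w s h"
  shows "wlp limit (LOAD_GRAPH ;; INIT_MATRIX) (round_invariant h n) \<sigma>"
proof (rule wlpI)
  fix \<upsilon> assume "executes (LOAD_GRAPH ;; INIT_MATRIX) \<sigma> \<upsilon>"
  then obtain \<tau> where exec: "executes LOAD_GRAPH \<sigma> \<tau>" "executes INIT_MATRIX \<tau> \<upsilon>" by (auto simp: executes_Seq)
  note frames = exec[THEN executes_frame]
  have A: "entry \<tau> ''A'' x y = adjacency G w x y" if "x < n" "y < n" for x y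
    using wlpD[OF wlp_LOAD_GRAPH[OF input] exec(1)] that by blast
  have "sized \<tau>" using executes_sized[OF exec(1) holds_inputD(1)[OF input]] by (simp add: size_vars_eq)
  from wlpD[OF wlp_INIT_MATRIX[OF this] exec(2)]
  obtain g where g: "\<forall>u<n. \<forall>v<n. \<bar>adjacency G w u v\<bar> \<le> g"
    and M: "\<forall>u<N. \<forall>v<N. entry \<upsilon> ''M'' u v = padded_weights n (entry \<tau> ''A'') g u v" using A by auto
  have "padded_weights n (entry \<tau> ''A'') g u v = padded_weights n (adjacency G w) g u v" for u v
    using A by (simp add: padded_weights_def)
  from reaching_potential_padded[OF h s_less n_le_N g[rule_format] M[unfolded this, rule_format]]
  have "reaching_potential n N s n (entry \<upsilon> ''M'') (\<lambda>x. if x < n then h x else h s)" .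
  moreover have "rarr \<upsilon> ''P'' = (\<lambda>_. 0)" by (simp add: frameD[OF frames(1)] frameD[OF frames(2)] P)
  ultimately show "round_invariant h n \<upsilon>" unfolding round_invariant_def by (intro exI conjI) auto
qed

end


section \<open>The answer\<close>

lemma (in sizes) wlp_COMPUTE_DISTANCES:
  assumes sized: "sized \<sigma>" and inv: "round_invariant h\<^sub>0 1 \<sigma>"
  shows "wlp limit COMPUTE_DISTANCES (\<lambda>\<tau>. \<forall>x<n. rarr \<tau> ''dist'' x = h\<^sub>0 x - h\<^sub>0 s) \<sigma>"
proof (rule wlpI)
  let ?M = "entry \<sigma> ''M''"
  let ?store = "FOR ''x'' ''n'' (RStore ''dist'' (WVar ''x'')
    (RAdd (RSub (RArr ''K'' (WVar ''x'')) (RArr ''P'' (WVar ''x''))) (RArr ''P'' (WVar ''s''))))"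
  fix \<upsilon> assume "executes COMPUTE_DISTANCES \<sigma> \<upsilon>"
  then obtain \<rho> \<tau> where exec: "executes (LOAD_KEYS ''M'' (index ''s'' ''x'')) \<sigma> \<rho>"
    "executes (DIJKSTRA_TWICE ''M'' (index ''p'' ''w'')) \<rho> \<tau>" "executes ?store \<tau> \<upsilon>"
    by (auto simp: COMPUTE_DISTANCES_def executes_Seq)
  note same = frameD[OF executes_frame[OF exec(1)]] frameD[OF executes_frame[OF exec(2)]]
  have sized': "sized \<rho>" "sized \<tau>" using exec(1,2)[THEN executes_sized] sized by (auto simp: size_vars_eq)
  obtain h where h: "\<And>x. x < n \<Longrightarrow> h x = h\<^sub>0 x + rarr \<sigma> ''P'' x" and reaching: "reaching_potential n N s 1 ?M h"
    using inv by (auto simp: round_invariant_def)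
  have sN: "s < N" using s_less n_le_N by simp
  have "wlp limit (LOAD_KEYS ''M'' (index ''s'' ''x'')) (\<lambda>\<tau>. \<forall>x<N. rarr \<tau> ''K'' x = rarr \<sigma> ''M'' (s * N + x)) \<sigma>"
    by (rule wlp_LOAD_KEYS[OF sized]) (use sN in \<open>auto simp: sizedD\<close>)
  from wlpD[OF this exec(1)] have "\<And>x. x < N \<Longrightarrow> rarr \<rho> ''K'' x = ?M s x" by simp
  from wlpD[OF wlp_DIJKSTRA_TWICE[OF sized'(1) this _ index_of_index(1)] exec(2)]
  obtain K R where runs: "dijkstra_result N ?M ?M True (?M s) K R"
    "dijkstra_result N ?M ?M True R (rarr \<tau> ''K'') (rarr \<tau> ''R'')" by (auto simp: same)
  have K: "rarr \<tau> ''K'' y = h y - h s" if y: "y < n" for y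
  proof -
    obtain j where "j \<le> 1" "counted_reach s (tight_edge n ?M h) (free_token n N ?M ?M h) j y"
      using reaching_potentialD(3)[OF reaching y] by blast
    then show ?thesis
      using distances_if_one_counted_edge[OF n_le_N s_less reaching_potentialD(1)[OF reaching]
          reaching_potentialD(2)[OF reaching] runs] y by blast
  qed
  have "wlp limit ?store (\<lambda>\<upsilon>. \<forall>x<n. rarr \<upsilon> ''dist'' x = rarr \<tau> ''K'' x - rarr \<sigma> ''P'' x + rarr \<sigma> ''P'' s) \<tau>"
    by (rule wlp_FOR_vector[OF sized'(2) size_table_simps(1)]) (auto simp: size_vars_eq sizedD same frame_def)
  from wlpD[OF this exec(3)] show "\<forall>x<n. rarr \<upsilon> ''dist'' x = h\<^sub>0 x - h\<^sub>0 s" using K h s_less by simp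
qed

context sssp_problem
begin

lemma wlp_CHECK_POTENTIAL:
  assumes input: "holds_input \<sigma>" and unset: "wvar \<sigma> ''negative_cycle'' = 0"
  shows "wlp limit CHECK_POTENTIAL (\<lambda>\<tau>. wvar \<tau> ''negative_cycle'' = 0 \<longleftrightarrow>
    (\<forall>(x, y)\<in>parcs G. rarr \<sigma> ''dist'' y \<le> rarr \<sigma> ''dist'' x + w (x, y))) \<sigma>"
proof -
  let ?ok = "\<lambda>x y. (x, y) \<in> parcs G \<longrightarrow> rarr \<sigma> ''dist'' y \<le> rarr \<sigma> ''dist'' x + w (x, y)"
  let ?body = "Cond (BAnd (BNot (WEq (WArr ''edge'' (input_index ''x'' ''y'')) (WConst 0)))
      (RLess (RAdd (RArr ''dist'' (WVar ''x'')) (RArr ''weight'' (input_index ''x'' ''y''))) (RArr ''dist'' (WVar ''y''))))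
    (WAssign ''negative_cycle'' (WConst 1)) Skip"
  let ?inv = "\<lambda>x y \<tau>. wvar \<tau> ''negative_cycle'' = 0 \<longleftrightarrow> (\<forall>u<x. \<forall>v<n. ?ok u v) \<and> (\<forall>v<y. ?ok x v)"
  have "wlp limit (FOR ''x'' ''n'' (FOR ''y'' ''n'' ?body)) (?inv n 0) \<sigma>"
  proof (rule wlp_FOR2_size[where I = ?inv, OF holds_inputD(1)[OF input] size_table_simps(1) size_table_simps(1)])
    fix x y \<tau>
    assume xy: "x < n" "y < n" "wvar \<tau> ''x'' = x" "wvar \<tau> ''y'' = y" and sized: "sized \<tau>"
      and frame: "frame (FOR ''x'' ''n'' (FOR ''y'' ''n'' ?body)) \<sigma> \<tau>" and inv: "?inv x y \<tau>"
    have "bval limit \<tau> (BAnd (BNot (WEq (WArr ''edge'' (input_index ''x'' ''y'')) (WConst 0)))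
      (RLess (RAdd (RArr ''dist'' (WVar ''x'')) (RArr ''weight'' (input_index ''x'' ''y''))) (RArr ''dist'' (WVar ''y''))))
        \<longleftrightarrow> \<not> ?ok x y"
      using xy sized holds_inputD(2,3)[OF input xy(1,2)] by (simp add: sizedD frameD[OF frame] not_le)
    then show "wlp limit ?body (?inv x (Suc y)) \<tau>" using inv by (auto simp: less_Suc_eq simp del: bval.simps)
  qed (use unset in \<open>auto simp: size_vars_eq less_Suc_eq\<close>)
  then show ?thesis
    unfolding CHECK_POTENTIAL_def by (rule wlp_mono) (use arc_less in auto)
qed

definition marked :: "machine_state \<Rightarrow> nat set" where
  "marked \<sigma> = {x. x < n \<and> warr \<sigma> ''reachable'' x \<noteq> 0}"

definition scanned :: "machine_state \<Rightarrow> nat set" where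
  "scanned \<sigma> = {x. x < n \<and> warr \<sigma> ''scanned'' x \<noteq> 0}"

lemma scanned_marked_wset [simp]: "marked (wset x v \<sigma>) = marked \<sigma>" "scanned (wset x v \<sigma>) = scanned \<sigma>"
  by (simp_all add: marked_def scanned_def)

lemma wlp_FIND_UNSCANNED:
  assumes sized: "sized \<sigma>"
  shows "wlp limit FIND_UNSCANNED (\<lambda>\<tau>. wvar \<tau> ''p'' = n \<and> marked \<sigma> \<subseteq> scanned \<sigma> \<or>
    wvar \<tau> ''p'' \<in> marked \<sigma> - scanned \<sigma>) \<sigma>"
proof -
  let ?body = "Cond (BAnd (BNot (WEq (WArr ''reachable'' (WVar ''x'')) (WConst 0)))
    (WEq (WArr ''scanned'' (WVar ''x'')) (WConst 0))) (WAssign ''p'' (WVar ''x'')) Skip"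
  let ?inv = "\<lambda>k \<tau>. wvar \<tau> ''p'' = n \<and> marked \<sigma> \<inter> {..<k} \<subseteq> scanned \<sigma> \<or> wvar \<tau> ''p'' \<in> marked \<sigma> - scanned \<sigma>"
  have "wlp limit (FOR ''x'' ''n'' ?body) (?inv n) (wset ''p'' n \<sigma>)"
  proof (rule wlp_FOR_size[where I = ?inv, OF _ size_table_simps(1)])
    fix k \<tau>
    assume k: "k < n" "wvar \<tau> ''x'' = k" and frame: "frame (FOR ''x'' ''n'' ?body) (wset ''p'' n \<sigma>) \<tau>"
      and inv: "?inv k \<tau>"
    have "bval limit \<tau> (BAnd (BNot (WEq (WArr ''reachable'' (WVar ''x'')) (WConst 0)))
        (WEq (WArr ''scanned'' (WVar ''x'')) (WConst 0))) \<longleftrightarrow> k \<in> marked \<sigma> - scanned \<sigma>"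
      using k by (simp add: frameD[OF frame] marked_def scanned_def)
    moreover have "marked \<sigma> \<inter> {..<Suc k} \<subseteq> scanned \<sigma> \<longleftrightarrow> marked \<sigma> \<inter> {..<k} \<subseteq> scanned \<sigma> \<and> k \<notin> marked \<sigma> - scanned \<sigma>"
      by (auto simp: less_Suc_eq)
    ultimately show "wlp limit ?body (?inv (Suc k)) \<tau>" using k(2) inv by (simp del: bval.simps)
  qed (use sized in \<open>auto simp: size_vars_eq\<close>)
  then show ?thesis
    using sized by (simp add: FIND_UNSCANNED_def sizedD) (erule wlp_mono, auto simp: marked_def)
qed

lemma wlp_SCAN_VERTEX:
  assumes input: "holds_input \<sigma>" and p: "wvar \<sigma> ''p'' = p" "p < n"
  shows "wlp limit SCAN_VERTEX (\<lambda>\<tau>. marked \<tau> = marked \<sigma> \<union> {x. (p, x) \<in> parcs G} \<and>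
    scanned \<tau> = insert p (scanned \<sigma>)) \<sigma>"
proof -
  let ?\<sigma> = "\<sigma>\<lparr>warr := (warr \<sigma>)(''scanned'' := (warr \<sigma> ''scanned'')(p := 1))\<rparr>"
  let ?body = "Cond (WEq (WArr ''edge'' (input_index ''p'' ''x'')) (WConst 0)) Skip (WStore ''reachable'' (WVar ''x'') (WConst 1))"
  let ?inv = "\<lambda>k \<tau>. marked \<tau> = marked \<sigma> \<union> {x. x < k \<and> (p, x) \<in> parcs G}"
  have "wlp limit (FOR ''x'' ''n'' ?body) (?inv n) ?\<sigma>"
  proof (rule wlp_FOR_size[where I = ?inv, OF _ size_table_simps(1)])
    fix k \<tau>
    assume k: "k < n" "wvar \<tau> ''x'' = k" and frame: "frame (FOR ''x'' ''n'' ?body) ?\<sigma> \<tau>" and sized: "sized \<tau>"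
      and inv: "?inv k \<tau>"
    have "warr \<tau> ''edge'' (p * n + k) = (if (p, k) \<in> parcs G then 1 else 0)"
      using holds_inputD(2)[OF input p(2) k(1)] by (simp add: frameD[OF frame])
    moreover have "wval limit \<tau> (input_index ''p'' ''x'') = p * n + k"
      using p k sized by (simp add: sizedD frameD[OF frame])
    moreover have "marked (\<tau>\<lparr>warr := (warr \<tau>)(''reachable'' := (warr \<tau> ''reachable'')(k := 1))\<rparr>) =
        insert k (marked \<tau>)"
      using k by (auto simp: marked_def)
    ultimately show "wlp limit ?body (?inv (Suc k)) \<tau>" using k inv by (auto simp: less_Suc_eq)
  qed (use holds_inputD(1)[OF input] in \<open>auto simp: size_vars_eq marked_def\<close>)
  then have "wlp limit (FOR ''x'' ''n'' ?body) (\<lambda>\<tau>. marked \<tau> = marked \<sigma> \<union> {x. (p, x) \<in> parcs G} \<and>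
      scanned \<tau> = insert p (scanned \<sigma>)) ?\<sigma>"
  proof (rule wlp_mono)
    fix \<tau> assume frame: "frame (FOR ''x'' ''n'' ?body) ?\<sigma> \<tau>" and "?inv n \<tau>"
    moreover have "scanned \<tau> = insert p (scanned \<sigma>)" using p by (auto simp: scanned_def frameD[OF frame])
    ultimately show "marked \<tau> = marked \<sigma> \<union> {x. (p, x) \<in> parcs G} \<and> scanned \<tau> = insert p (scanned \<sigma>)"
      using arc_less by auto
  qed
  then show ?thesis using p by (simp add: SCAN_VERTEX_def)
qed

definition search_invariant :: "nat \<Rightarrow> machine_state \<Rightarrow> bool" where
  "search_invariant k \<sigma> \<longleftrightarrow> s \<in> marked \<sigma> \<and> marked \<sigma> \<subseteq> {x. (s, x) \<in> (parcs G)\<^sup>*} \<and> scanned \<sigma> \<subseteq> marked \<sigma> \<and>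
     parcs G `` scanned \<sigma> \<subseteq> marked \<sigma> \<and> (card (scanned \<sigma>) = k \<or> scanned \<sigma> = marked \<sigma>)"

lemma search_invariant_wset [simp]: "search_invariant k (wset x v \<sigma>) = search_invariant k \<sigma>"
  by (simp add: search_invariant_def)

lemma search_invariant_step:
  assumes inv: "search_invariant k \<sigma>" and p: "p \<in> marked \<sigma> - scanned \<sigma>"
    and "marked \<tau> = marked \<sigma> \<union> {x. (p, x) \<in> parcs G}" "scanned \<tau> = insert p (scanned \<sigma>)"
  shows "search_invariant (Suc k) \<tau>"
proof -
  have "finite (scanned \<sigma>)" by (simp add: scanned_def)
  then have "card (scanned \<tau>) = Suc k" using inv p assms(4) by (auto simp: search_invariant_def)
  moreover have "(s, x) \<in> (parcs G)\<^sup>*" if "(p, x) \<in> parcs G" for x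
  proof (rule rtrancl_into_rtrancl[OF _ that])
    show "(s, p) \<in> (parcs G)\<^sup>*" using inv p by (auto simp: search_invariant_def)
  qed
  ultimately show ?thesis using inv p unfolding search_invariant_def assms(3,4) by auto
qed

lemma wlp_search_step:
  assumes input: "holds_input \<sigma>" and inv: "search_invariant k \<sigma>"
  shows "wlp limit (FIND_UNSCANNED ;; Cond (WLess (WVar ''p'') (WVar ''n'')) SCAN_VERTEX Skip) (search_invariant (Suc k)) \<sigma>"
  unfolding wlp_Seq
proof (rule wlp_mono[OF wlp_FIND_UNSCANNED[OF holds_inputD(1)[OF input]]])
  fix \<tau>
  assume frame: "frame FIND_UNSCANNED \<sigma> \<tau>"
    and found: "wvar \<tau> ''p'' = n \<and> marked \<sigma> \<subseteq> scanned \<sigma> \<or> wvar \<tau> ''p'' \<in> marked \<sigma> - scanned \<sigma>"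
  have input': "holds_input \<tau>" by (rule holds_input_frame[OF frame input]) (auto simp: size_vars_eq)
  have same: "marked \<tau> = marked \<sigma>" "scanned \<tau> = scanned \<sigma>"
    by (simp_all add: marked_def scanned_def frameD[OF frame])
  from found show "wlp limit (Cond (WLess (WVar ''p'') (WVar ''n'')) SCAN_VERTEX Skip) (search_invariant (Suc k)) \<tau>"
  proof
    assume "wvar \<tau> ''p'' = n \<and> marked \<sigma> \<subseteq> scanned \<sigma>"
    then show ?thesis
      using inv sizedD(1)[OF holds_inputD(1)[OF input']] by (auto simp: search_invariant_def same)
  next
    assume p: "wvar \<tau> ''p'' \<in> marked \<sigma> - scanned \<sigma>"
    then have "wvar \<tau> ''p'' < n" by (simp add: marked_def)
    moreover from this have "wlp limit SCAN_VERTEX (search_invariant (Suc k)) \<tau>"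
      using search_invariant_step[OF inv p] same by (intro wlp_mono[OF wlp_SCAN_VERTEX[OF input' refl]]) auto
    ultimately show ?thesis using sizedD(1)[OF holds_inputD(1)[OF input']] by simp
  qed
qed

lemma marked_eq_reachable:
  assumes inv: "search_invariant n \<sigma>"
  shows "marked \<sigma> = {x. (s, x) \<in> (parcs G)\<^sup>*}"
proof -
  have "scanned \<sigma> = marked \<sigma>"
  proof (rule ccontr)
    assume ne: "scanned \<sigma> \<noteq> marked \<sigma>"
    have less: "scanned \<sigma> \<subseteq> {..<n}" "marked \<sigma> \<subseteq> {..<n}" by (auto simp: marked_def scanned_def)
    have "card (scanned \<sigma>) = card {..<n}" using ne inv by (simp add: search_invariant_def)
    then have "scanned \<sigma> = {..<n}" using less(1) by (intro card_subset_eq) auto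
    then show False using ne less(2) inv by (auto simp: search_invariant_def)
  qed
  then have closed: "x \<in> marked \<sigma>" if "p \<in> marked \<sigma>" "(p, x) \<in> parcs G" for p x
    using inv that by (auto simp: search_invariant_def)
  have "x \<in> marked \<sigma>" if "(s, x) \<in> (parcs G)\<^sup>*" for x
    using that by induction (use closed inv in \<open>auto simp: search_invariant_def\<close>)
  then show ?thesis using inv by (auto simp: search_invariant_def)
qed

lemma wlp_MARK_REACHABLE:
  assumes input: "holds_input \<sigma>" and unset: "warr \<sigma> ''reachable'' = (\<lambda>_. 0)" "warr \<sigma> ''scanned'' = (\<lambda>_. 0)"
  shows "wlp limit MARK_REACHABLE (\<lambda>\<tau>. marked \<tau> = {x. (s, x) \<in> (parcs G)\<^sup>*}) \<sigma>"
proof -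
  let ?body = "FIND_UNSCANNED ;; Cond (WLess (WVar ''p'') (WVar ''n'')) SCAN_VERTEX Skip"
  let ?\<sigma> = "\<sigma>\<lparr>warr := (warr \<sigma>)(''reachable'' := (warr \<sigma> ''reachable'')(s := 1))\<rparr>"
  have input': "holds_input ?\<sigma>" using input by (simp add: holds_input_def)
  have "wlp limit (FOR ''c'' ''n'' ?body) (\<lambda>\<tau>. marked \<tau> = {x. (s, x) \<in> (parcs G)\<^sup>*}) ?\<sigma>"
  proof (rule wlp_FOR_size[where I = search_invariant, OF holds_inputD(1)[OF input'] size_table_simps(1)])
    have "marked ?\<sigma> = {s}" "scanned ?\<sigma> = {}" using s_less unset by (auto simp: marked_def scanned_def)
    then show "search_invariant 0 ?\<sigma>" by (simp add: search_invariant_def)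
    fix k \<tau> assume frame: "frame (FOR ''c'' ''n'' ?body) ?\<sigma> \<tau>" and inv: "search_invariant k \<tau>"
    have "holds_input \<tau>" by (rule holds_input_frame[OF frame input']) (auto simp: size_vars_eq)
    then show "wlp limit ?body (search_invariant (Suc k)) \<tau>" using inv by (rule wlp_search_step)
  qed (simp_all add: size_vars_eq marked_eq_reachable)
  then show ?thesis using sizedD(2)[OF holds_inputD(1)[OF input]] by (simp add: MARK_REACHABLE_def)
qed

end

section \<open>The probability of failure\<close>

lemma expected_le_Random:
  assumes b: "\<And>\<sigma>. P \<sigma> \<Longrightarrow> wval M \<sigma> e = b" "0 < b" and Q: "\<And>\<sigma> v. P \<sigma> \<Longrightarrow> v < b \<Longrightarrow> Q (wset x v \<sigma>)"
    and average: "\<And>\<sigma>. P \<sigma> \<Longrightarrow> (\<Sum>v<b. g (wset x v \<sigma>)) / of_nat b \<le> f \<sigma>"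
  shows "expected_le M 1 P f (Random x e) Q g"
  unfolding expected_le_def
proof (intro allI impI)
  fix \<sigma> assume P: "P \<sigma>"
  let ?p = "map_pmf (\<lambda>v. wset x v \<sigma>) (pmf_of_set {..<b})"
  have "0 \<in> {..<b}" using b(2) by simp
  then have b': "finite {..<b}" "{..<b} \<noteq> {}" by blast+
  have "max 1 b = b" using b(2) by simp
  then have "halts M 1 (Random x e) \<sigma> ?p"
    using b(1)[OF P] by (simp add: halts_def bind_return_pmf' map_pmf_def bind_assoc_pmf bind_return_pmf)
  moreover have "(\<integral>\<^sup>+\<tau>. g \<tau> \<partial>measure_pmf ?p) \<le> f \<sigma>"
    using average[OF P] b' by (simp add: nn_integral_pmf_of_set)
  moreover have "\<forall>\<tau>\<in>set_pmf ?p. Q \<tau>" using Q[OF P] b' by (auto simp: set_pmf_of_set)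
  ultimately show "\<exists>p. halts M 1 (Random x e) \<sigma> p \<and> (\<forall>\<tau>\<in>set_pmf p. Q \<tau>) \<and> (\<integral>\<^sup>+\<tau>. g \<tau> \<partial>measure_pmf p) \<le> f \<sigma>"
    by blast
qed

context sizes
begin

lemma expected_le_poly_cost:
  assumes cost: "poly_cost k i j c" and sized: "\<And>\<sigma>. P \<sigma> \<Longrightarrow> sized \<sigma> \<and> wvar \<sigma> ''fuel'' = 0"
    and wlp: "\<And>\<sigma>. P \<sigma> \<Longrightarrow> wlp limit c (\<lambda>\<tau>. Q \<tau> \<and> g \<tau> \<le> f \<sigma>) \<sigma>"
  shows "expected_le limit (k * q ^ i * l ^ j) P f c Q g"
proof (rule expected_le_big_step)
  fix \<sigma> assume P: "P \<sigma>"
  then obtain t \<tau> where t: "big_step limit c \<sigma> t \<tau>" "t \<le> k * q ^ i * l ^ j" using sized_time[OF cost] sized by metis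
  moreover have "Q \<tau> \<and> g \<tau> \<le> f \<sigma>" using wlp[OF P] t(1) unfolding wlp_def by blast
  ultimately show "\<exists>u \<tau>. big_step limit c \<sigma> u \<tau> \<and> u \<le> k * q ^ i * l ^ j \<and> Q \<tau> \<and> g \<tau> \<le> f \<sigma>" by blast
qed

text \<open>A bound for the probability that a random node is not a good hub for a given pair.\<close>

definition miss_rate :: real where
  "miss_rate = (real N - real (min N (Suc m))) / real N"

lemma miss_rate_nonneg: "0 \<le> miss_rate" and miss_rate_le_1: "miss_rate \<le> 1"
  using N_ge_1 by (auto simp: miss_rate_def field_simps)

text \<open>The expected number of pairs that are missed by all \<open>q\<close> hubs, the first \<open>k\<close> of which are given by \<open>a\<close>.\<close>

definition expected_misses :: "weights \<Rightarrow> (nat \<Rightarrow> nat) \<Rightarrow> nat \<Rightarrow> real" where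
  "expected_misses M a k = real (card (missed_pairs N m M a k)) * miss_rate ^ (q - k)"

lemma expected_misses_nonneg: "0 \<le> expected_misses M a k"
  using miss_rate_nonneg by (simp add: expected_misses_def)

lemma expected_misses_step:
  assumes k: "k < q"
  shows "(\<Sum>v<N. expected_misses M (a(k := v)) (Suc k)) \<le> expected_misses M a k * real N"
proof -
  let ?U = "real (card (missed_pairs N m M a k))" and ?r = "miss_rate ^ (q - Suc k)"
  have "(\<Sum>v<N. real (card (missed_pairs N m M (a(k := v)) (Suc k)))) =
      real (\<Sum>v<N. card (missed_pairs N m M (a(k := v)) (Suc k)))" by simp
  also have "\<dots> \<le> real (card (missed_pairs N m M a k) * (N - min N (Suc m)))"
    using sum_missed_pairs_le of_nat_le_iff by blast
  also have "\<dots> = ?U * (miss_rate * real N)" using N_ge_1 by (simp add: miss_rate_def of_nat_diff)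
  finally have "(\<Sum>v<N. expected_misses M (a(k := v)) (Suc k)) \<le> ?U * (miss_rate * real N) * ?r"
    unfolding expected_misses_def sum_distrib_right[symmetric]
    using miss_rate_nonneg by (intro mult_right_mono) auto
  also have "\<dots> = ?U * (miss_rate * ?r) * real N" by simp
  also have "miss_rate * ?r = miss_rate ^ (q - k)" using k by (simp add: Suc_diff_Suc flip: power_Suc)
  finally show ?thesis unfolding expected_misses_def[of M a k] .
qed

definition failure_rate :: real where
  "failure_rate = (real N)\<^sup>2 * miss_rate ^ q"

lemma failure_rate_nonneg: "0 \<le> failure_rate"
  unfolding failure_rate_def using miss_rate_nonneg by simp

lemma expected_misses_0_le: "expected_misses M a 0 \<le> failure_rate"
proof -
  have "real (card (missed_pairs N m M a 0)) \<le> real (N * N)"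
    using card_missed_pairs_le of_nat_le_iff by blast
  then show ?thesis
    unfolding expected_misses_def failure_rate_def
    using miss_rate_nonneg by (intro mult_mono) (auto simp: power2_eq_square)
qed

lemma expected_le_sample_hub:
  fixes M :: weights
  assumes sized: "sized \<sigma>" and k: "k < q"
  defines "I \<equiv> \<lambda>k \<tau>. frame SAMPLE_HUBS \<sigma> \<tau> \<and> (\<forall>j<k. warr \<tau> ''hub'' j < N)"
    and "f \<equiv> \<lambda>k \<tau>. ennreal (expected_misses M (warr \<tau> ''hub'') k)"
  shows "expected_le limit 3 (\<lambda>\<tau>. I k \<tau> \<and> wvar \<tau> ''h'' = k) (f k)
    (Random ''x'' (WVar ''N'') ;; WStore ''hub'' (WVar ''h'') (WVar ''x''))
    (\<lambda>\<tau>. I (Suc k) (wset ''h'' (Suc k) \<tau>) \<and> wvar \<tau> ''h'' = k) (\<lambda>\<tau>. f (Suc k) (wset ''h'' (Suc k) \<tau>))"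
proof -
  let ?drawn = "\<lambda>\<tau>. I k \<tau> \<and> wvar \<tau> ''h'' = k \<and> wvar \<tau> ''x'' < N"
  let ?f = "\<lambda>\<tau>. ennreal (expected_misses M ((warr \<tau> ''hub'')(k := wvar \<tau> ''x'')) (Suc k))"
  have draw: "expected_le limit 1 (\<lambda>\<tau>. I k \<tau> \<and> wvar \<tau> ''h'' = k) (f k) (Random ''x'' (WVar ''N'')) ?drawn ?f"
  proof (rule expected_le_Random[where b = N])
    fix \<tau> assume \<tau>: "I k \<tau> \<and> wvar \<tau> ''h'' = k"
    then show "wval limit \<tau> (WVar ''N'') = N"
      using sized frameD(1)[of SAMPLE_HUBS \<sigma> \<tau> "''N''"] by (simp add: I_def sizedD)
    show "?drawn (wset ''x'' v \<tau>)" if "v < N" for v using \<tau> that by (auto simp: I_def frame_def)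
    have "(\<Sum>v<N. ennreal (expected_misses M ((warr \<tau> ''hub'')(k := v)) (Suc k))) / of_nat N =
        ennreal ((\<Sum>v<N. expected_misses M ((warr \<tau> ''hub'')(k := v)) (Suc k)) / real N)"
      using N_ge_1 expected_misses_nonneg
      by (simp add: sum_ennreal divide_ennreal sum_nonneg ennreal_of_nat_eq_real_of_nat)
    also have "\<dots> \<le> f k \<tau>"
      unfolding f_def using expected_misses_step[OF k] N_ge_1 by (intro ennreal_leI) (simp add: field_simps)
    finally show "(\<Sum>v<N. ?f (wset ''x'' v \<tau>)) / of_nat N \<le> f k \<tau>" by simp
  qed (use N_ge_1 in simp)
  have store: "expected_le limit 1 ?drawn ?f (WStore ''hub'' (WVar ''h'') (WVar ''x''))
      (\<lambda>\<tau>. I (Suc k) (wset ''h'' (Suc k) \<tau>) \<and> wvar \<tau> ''h'' = k) (\<lambda>\<tau>. f (Suc k) (wset ''h'' (Suc k) \<tau>))"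
    by (intro expected_le_big_step exI conjI, rule big_step.WStore)
      (auto simp: I_def f_def frame_def less_Suc_eq)
  from expected_le_Seq[OF draw store] show ?thesis by (simp add: numeral_3_eq_3)
qed

lemma expected_le_SAMPLE_HUBS:
  assumes sized: "sized \<sigma>"
  shows "expected_le limit (q * 7 + 3) (\<lambda>\<tau>. \<tau> = \<sigma>) (\<lambda>_. ennreal failure_rate) SAMPLE_HUBS
    (\<lambda>\<tau>. frame SAMPLE_HUBS \<sigma> \<tau> \<and> hubs \<tau> \<subseteq> {..<N})
    (\<lambda>\<tau>. ennreal (real (card (missed_pairs N m M (warr \<tau> ''hub'') q))))"
proof -
  let ?I = "\<lambda>k \<tau>. frame SAMPLE_HUBS \<sigma> \<tau> \<and> (\<forall>j<k. warr \<tau> ''hub'' j < N)"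
  let ?f = "\<lambda>k \<tau>. ennreal (expected_misses M (warr \<tau> ''hub'') k)"
  have "expected_le limit (q * (3 + 4) + 3) (\<lambda>\<tau>. ?I 0 (wset ''h'' 0 \<tau>)) (\<lambda>\<tau>. ?f 0 (wset ''h'' 0 \<tau>))
      (FOR ''h'' ''q'' (Random ''x'' (WVar ''N'') ;; WStore ''hub'' (WVar ''h'') (WVar ''x''))) (?I q) (?f q)"
  proof (rule expected_le_FOR[where I = ?I and f = ?f, OF expected_le_sample_hub[OF sized] _ less_limit(2)])
    show "wvar \<tau> ''q'' = q" if "?I k \<tau>" for k \<tau>
      using that sized frameD(1)[of SAMPLE_HUBS \<sigma> \<tau> "''q''"] by (simp add: sizedD)
  qed
  note loop = this[folded SAMPLE_HUBS_def]
  have "?I 0 (wset ''h'' 0 \<sigma>)" by (simp add: frame_def)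
  then have "expected_le limit (q * 7 + 3) (\<lambda>\<tau>. \<tau> = \<sigma>) (\<lambda>_. ennreal failure_rate) SAMPLE_HUBS (?I q) (?f q)"
    by (intro expected_le_mono[OF loop]) (auto intro!: ennreal_leI expected_misses_0_le)
  then show ?thesis
    unfolding expected_misses_def expected_le_def by (auto simp: image_subset_iff)
qed

text \<open>
  A fixed pair of nodes is missed by all hubs of a round with probability at most
  \<open>(1 - m/N)\<^sup>q \<le> exp (- m q/N)\<close>, and \<open>m q / N = C l\<close>.
\<close>

lemma miss_rate_power_le: "miss_rate ^ q \<le> exp (- (real C * real l))"
proof (cases "N \<le> Suc m")
  case True
  then have "miss_rate = 0" by (simp add: miss_rate_def min_def)
  then show ?thesis using q_ge_1 by (simp add: power_0_left)
next
  case False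
  have "miss_rate \<le> 1 + (- (real m / real N))" using False N_ge_1 by (simp add: miss_rate_def min_def field_simps)
  also have "\<dots> \<le> exp (- (real m / real N))" by (rule exp_ge_add_one_self)
  finally have "miss_rate ^ q \<le> exp (- (real m / real N)) ^ q" using miss_rate_nonneg by (intro power_mono)
  also have "\<dots> = exp (- (real q * (real m / real N)))" by (simp add: exp_of_nat_mult[symmetric])
  also have "real q * (real m / real N) = real C * real l"
    using q_ge_1 l_ge_2 by (simp add: m_def N_def blocks_def field_simps)
  finally show ?thesis .
qed

lemma l_mult_N_square_le: "real l * (real N)\<^sup>2 \<le> exp (7 * real l)"
proof -
  have "q \<le> 2 ^ (l - 2)" using q_le_n n_le_power_l by simp
  also have "\<dots> \<le> 2 ^ l" by (rule power_increasing) auto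
  finally have ql: "q \<le> 2 ^ l" .
  have ll: "l \<le> 2 ^ l" by (simp add: less_imp_le)
  have "l * (N * N) = l * (l * (l * (q * (q * (q * q)))))" by (simp add: N_def blocks_def ac_simps)
  also have "\<dots> \<le> 2 ^ l * (2 ^ l * (2 ^ l * (2 ^ l * (2 ^ l * (2 ^ l * 2 ^ l)))))" by (intro mult_le_mono ql ll)
  also have "\<dots> = 2 ^ (7 * l)" by (simp add: power_add[symmetric])
  finally have "real (l * (N * N)) \<le> real (2 ^ (7 * l))" using of_nat_le_iff by blast
  also have "\<dots> \<le> exp 1 ^ (7 * l)" using exp_ge_add_one_self[of 1] by (simp add: power_mono)
  also have "\<dots> = exp (7 * real l)" using exp_of_nat_mult[of "7 * l" "1 :: real"] by simp
  finally show ?thesis by (simp add: power2_eq_square)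
qed

lemma n_powr_le:
  assumes c: "0 < c"
  shows "real n powr c \<le> exp (c * real l)"
proof -
  have "(2 :: nat) ^ (l - 2) \<le> 2 ^ l" by (rule power_increasing) auto
  then have "n \<le> 2 ^ l" by (rule order_trans[OF n_le_power_l])
  then have "real n \<le> 2 ^ l" by (metis of_nat_le_iff of_nat_numeral of_nat_power)
  also have "\<dots> \<le> exp 1 ^ l" using exp_ge_add_one_self[of 1] by (intro power_mono) auto
  also have "\<dots> = exp (real l)" using exp_of_nat_mult[of l "1 :: real"] by simp
  finally have "real n powr c \<le> exp (real l) powr c" using c by (intro powr_mono2) auto
  then show ?thesis by (simp add: powr_def)
qed

lemma failure_rate_le:
  assumes C: "7 + c \<le> real C" and c: "0 < c"
  shows "real l * failure_rate \<le> 1 / real n powr c" and "real l * failure_rate \<le> 1"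
proof -
  have "real l * failure_rate = real l * (real N)\<^sup>2 * miss_rate ^ q" by (simp add: failure_rate_def)
  also have "\<dots> \<le> exp (7 * real l) * exp (- (real C * real l))"
    using l_mult_N_square_le miss_rate_power_le miss_rate_nonneg by (intro mult_mono) auto
  also have "\<dots> = exp (7 * real l - real C * real l)" by (simp add: exp_add[symmetric])
  also have "\<dots> \<le> exp (- (c * real l))"
    using mult_right_mono[OF C, of "real l"] by (simp add: algebra_simps)
  finally have le: "real l * failure_rate \<le> exp (- (c * real l))" .
  moreover have "0 < real n powr c" using n_ge_1 by simp
  then have "1 / exp (c * real l) \<le> 1 / real n powr c" using n_powr_le[OF c] by (intro divide_left_mono) auto
  ultimately show "real l * failure_rate \<le> 1 / real n powr c" by (simp add: exp_minus inverse_eq_divide)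
  have "exp (- (c * real l)) \<le> 1" using c by simp
  with le show "real l * failure_rate \<le> 1" by (rule order_trans)
qed

lemma round_invariant_mono: "round_invariant h k \<sigma> \<Longrightarrow> k \<le> k' \<Longrightarrow> round_invariant h k' \<sigma>"
  unfolding round_invariant_def reaching_potential_def by (meson order_trans)

lemma round_invariant_cong:
  "rarr \<tau> ''P'' = rarr \<sigma> ''P'' \<Longrightarrow> rarr \<tau> ''M'' = rarr \<sigma> ''M'' \<Longrightarrow> round_invariant h k \<tau> = round_invariant h k \<sigma>"
  by (simp add: round_invariant_def)

end


section \<open>Correctness with high probability\<close>

locale sssp_run = sssp_problem +
  fixes h :: potential
  assumes potential: "\<not> has_negative_cycle G w \<Longrightarrow> shortest_potential n G w s h"
    and failure_rate_small: "real l * failure_rate \<le> 1"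
begin

definition prepared :: "machine_state \<Rightarrow> bool" where
  "prepared \<sigma> \<longleftrightarrow> holds_input \<sigma> \<and> wvar \<sigma> ''fuel'' = 0 \<and> wvar \<sigma> ''negative_cycle'' = 0 \<and>
     warr \<sigma> ''reachable'' = (\<lambda>_. 0) \<and> warr \<sigma> ''scanned'' = (\<lambda>_. 0)"

lemma preparedD:
  assumes "prepared \<sigma>"
  shows "holds_input \<sigma>" "sized \<sigma>" "wvar \<sigma> ''fuel'' = 0" "wvar \<sigma> ''negative_cycle'' = 0"
    "warr \<sigma> ''reachable'' = (\<lambda>_. 0)" "warr \<sigma> ''scanned'' = (\<lambda>_. 0)"
  using assms holds_inputD(1) by (auto simp: prepared_def)

lemma prepared_frame:
  assumes "frame c \<sigma> \<tau>" "prepared \<sigma>" "mod_wvars c \<inter> size_vars = {}" "''negative_cycle'' \<notin> mod_wvars c"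
    "mod_warrs c \<inter> {''edge'', ''reachable'', ''scanned''} = {}" "''weight'' \<notin> mod_rarrs c"
  shows "prepared (wset ''fuel'' 0 \<tau>)"
  using assms holds_input_frame[OF assms(1)] by (simp add: prepared_def frameD[OF assms(1)] size_vars_eq)

lemma prepared_wset [simp]:
  "x \<notin> size_vars \<Longrightarrow> x \<notin> {''fuel'', ''negative_cycle''} \<Longrightarrow>
    prepared (\<sigma>\<lparr>wvar := f(x := v)\<rparr>) = prepared (\<sigma>\<lparr>wvar := f\<rparr>)"
  by (auto simp: prepared_def)

definition on_schedule :: "nat \<Rightarrow> machine_state \<Rightarrow> bool" where
  "on_schedule r \<sigma> \<longleftrightarrow> has_negative_cycle G w \<or> round_invariant h (2 ^ (l - 2 - r)) \<sigma>"

lemma on_schedule_cong: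
  "rarr \<tau> ''P'' = rarr \<sigma> ''P'' \<Longrightarrow> rarr \<tau> ''M'' = rarr \<sigma> ''M'' \<Longrightarrow> on_schedule r \<tau> = on_schedule r \<sigma>"
  using round_invariant_cong[of \<tau> \<sigma>] by (simp add: on_schedule_def)

text \<open>A bound for the probability of a wrong answer, given the state before round \<open>r\<close>.\<close>

definition risk :: "nat \<Rightarrow> machine_state \<Rightarrow> ennreal" where
  "risk r \<sigma> = (if on_schedule r \<sigma> then ennreal (real (l - r) * failure_rate) else 1)"

lemma risk_wset [simp]: "risk r (\<sigma>\<lparr>wvar := f\<rparr>) = risk r \<sigma>"
  using on_schedule_cong[of "\<sigma>\<lparr>wvar := f\<rparr>" \<sigma>] by (simp add: risk_def)

lemma risk_le_1: "risk r \<sigma> \<le> 1"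
proof -
  have "real (l - r) * failure_rate \<le> real l * failure_rate"
    using failure_rate_nonneg by (intro mult_right_mono) auto
  then show ?thesis using failure_rate_small by (simp add: risk_def)
qed

definition missed :: "machine_state \<Rightarrow> (nat \<times> nat) set" where
  "missed \<sigma> = missed_pairs N m (entry \<sigma> ''M'') (warr \<sigma> ''hub'') q"

text \<open>The bound after the hubs of round \<open>k\<close> have been sampled.\<close>

definition sampled_risk :: "nat \<Rightarrow> machine_state \<Rightarrow> ennreal" where
  "sampled_risk k \<sigma> = (if on_schedule k \<sigma>
     then ennreal (real (l - Suc k) * failure_rate) + ennreal (real (card (missed \<sigma>))) else 1)"

lemma expected_sampled_risk_le:
  fixes p :: "machine_state pmf"
  assumes k: "k < l" and frame: "\<And>\<tau>. \<tau> \<in> set_pmf p \<Longrightarrow> frame SAMPLE_HUBS \<sigma> \<tau>"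
    and expected: "(\<integral>\<^sup>+\<tau>. ennreal (real (card (missed_pairs N m (entry \<sigma> ''M'') (warr \<tau> ''hub'') q))) \<partial>measure_pmf p)
      \<le> ennreal failure_rate"
  shows "(\<integral>\<^sup>+\<tau>. sampled_risk k \<tau> \<partial>measure_pmf p) \<le> risk k \<sigma>"
proof -
  let ?c = "real (l - Suc k) * failure_rate"
  let ?missed = "\<lambda>\<tau>. ennreal (real (card (missed_pairs N m (entry \<sigma> ''M'') (warr \<tau> ''hub'') q)))"
  have "(\<integral>\<^sup>+\<tau>. sampled_risk k \<tau> \<partial>measure_pmf p) =
      (\<integral>\<^sup>+\<tau>. (if on_schedule k \<sigma> then ennreal ?c + ?missed \<tau> else 1) \<partial>measure_pmf p)"
  proof (rule nn_integral_cong_AE, unfold AE_measure_pmf_iff, rule ballI)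
    fix \<tau> assume "\<tau> \<in> set_pmf p"
    then have "rarr \<tau> ''P'' = rarr \<sigma> ''P''" "rarr \<tau> ''M'' = rarr \<sigma> ''M''" using frameD[OF frame] by simp_all
    then show "sampled_risk k \<tau> = (if on_schedule k \<sigma> then ennreal ?c + ?missed \<tau> else 1)"
      using on_schedule_cong[of \<tau> \<sigma>] by (simp add: sampled_risk_def missed_def)
  qed
  also have "\<dots> \<le> (if on_schedule k \<sigma> then ennreal ?c + ennreal failure_rate else 1)"
    using expected by (simp add: nn_integral_add)
  also have "ennreal ?c + ennreal failure_rate = ennreal (?c + failure_rate)"
    using failure_rate_nonneg by (intro ennreal_plus[symmetric]) auto
  also have "?c + failure_rate = real (l - k) * failure_rate" using k by (simp add: of_nat_diff algebra_simps)
  finally show ?thesis by (simp add: risk_def)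
qed

lemma expected_le_sample_round:
  assumes k: "k < l"
  shows "expected_le limit (q * 7 + 3) (\<lambda>\<sigma>. prepared \<sigma> \<and> wvar \<sigma> ''g'' = k) (risk k) SAMPLE_HUBS
    (\<lambda>\<tau>. prepared \<tau> \<and> wvar \<tau> ''g'' = k \<and> hubs \<tau> \<subseteq> {..<N}) (sampled_risk k)"
  unfolding expected_le_def
proof (intro allI impI)
  fix \<sigma> assume \<sigma>: "prepared \<sigma> \<and> wvar \<sigma> ''g'' = k"
  let ?missed = "\<lambda>\<tau>. ennreal (real (card (missed_pairs N m (entry \<sigma> ''M'') (warr \<tau> ''hub'') q)))"
  have "sized \<sigma>" using \<sigma> preparedD(2) by blast
  from expected_le_SAMPLE_HUBS[OF this, of "entry \<sigma> ''M''", unfolded expected_le_def, rule_format, OF refl]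
  obtain p where p: "halts limit (q * 7 + 3) SAMPLE_HUBS \<sigma> p"
    and sampled: "\<forall>\<tau>\<in>set_pmf p. frame SAMPLE_HUBS \<sigma> \<tau> \<and> hubs \<tau> \<subseteq> {..<N}"
    and expected: "(\<integral>\<^sup>+\<tau>. ?missed \<tau> \<partial>measure_pmf p) \<le> ennreal failure_rate" by (elim exE conjE)
  have frame: "frame SAMPLE_HUBS \<sigma> \<tau>" and hubs: "hubs \<tau> \<subseteq> {..<N}" if "\<tau> \<in> set_pmf p" for \<tau>
    using sampled that by auto
  have "prepared \<tau> \<and> wvar \<tau> ''g'' = k \<and> hubs \<tau> \<subseteq> {..<N}" if "\<tau> \<in> set_pmf p" for \<tau>
  proof -
    have "wvar \<tau> ''fuel'' = 0" using preparedD(3) \<sigma> by (simp add: frameD[OF frame[OF that]])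
    then have "wset ''fuel'' 0 \<tau> = \<tau>" by (simp add: fun_upd_idem)
    then show ?thesis
      using prepared_frame[OF frame[OF that]] \<sigma> hubs[OF that] by (simp add: size_vars_eq frameD[OF frame[OF that]])
  qed
  moreover have "(\<integral>\<^sup>+\<tau>. sampled_risk k \<tau> \<partial>measure_pmf p) \<le> risk k \<sigma>"
    by (rule expected_sampled_risk_le[OF k frame expected])
  ultimately show "\<exists>p. halts limit (q * 7 + 3) SAMPLE_HUBS \<sigma> p \<and>
      (\<forall>\<tau>\<in>set_pmf p. prepared \<tau> \<and> wvar \<tau> ''g'' = k \<and> hubs \<tau> \<subseteq> {..<N}) \<and>
      (\<integral>\<^sup>+\<tau>. sampled_risk k \<tau> \<partial>measure_pmf p) \<le> risk k \<sigma>"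
    using p by blast
qed

lemma wlp_ROUND_on_schedule:
  assumes \<sigma>: "prepared \<sigma>" "hubs \<sigma> \<subseteq> {..<N}" and "on_schedule k \<sigma>" "missed \<sigma> = {}"
  shows "wlp limit ROUND (on_schedule (Suc k)) \<sigma>"
proof (cases "has_negative_cycle G w")
  case False
  have "hubs \<sigma> \<inter> good_hubs N m (entry \<sigma> ''M'') x y \<noteq> {}" if "x < N" "y < N" for x y
    using assms(4) that unfolding missed_def missed_pairs_def by blast
  moreover have "round_invariant h (2 ^ (l - 2 - k)) \<sigma>" using assms(3) False by (simp add: on_schedule_def)
  ultimately have "wlp limit ROUND (round_invariant h ((2 ^ (l - 2 - k) + 1) div 2)) \<sigma>"
    by (intro wlp_ROUND preparedD(2)[OF \<sigma>(1)] \<sigma>(2))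
  then show ?thesis
  proof (rule wlp_mono)
    fix \<tau> assume "round_invariant h ((2 ^ (l - 2 - k) + 1) div 2) \<tau>"
    moreover have "(2 ^ (l - 2 - k) + 1) div 2 \<le> (2 :: nat) ^ (l - 2 - Suc k)"
    proof (cases "l - 2 - k")
      case (Suc j)
      then have "l - 2 - Suc k = j" by simp
      then show ?thesis using Suc by simp
    qed simp
    ultimately show "on_schedule (Suc k) \<tau>" using round_invariant_mono by (simp add: on_schedule_def)
  qed
qed (simp add: on_schedule_def wlp_def)

lemma wlp_ROUND_risk:
  assumes \<sigma>: "prepared \<sigma>" "hubs \<sigma> \<subseteq> {..<N}"
  shows "wlp limit ROUND (\<lambda>\<tau>. risk (Suc k) \<tau> \<le> sampled_risk k \<sigma>) \<sigma>"
proof (cases "on_schedule k \<sigma> \<and> missed \<sigma> = {}")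
  case True
  then show ?thesis
    by (intro wlp_mono[OF wlp_ROUND_on_schedule[OF \<sigma>]]) (auto simp: risk_def sampled_risk_def)
next
  case False
  have "1 \<le> sampled_risk k \<sigma>"
  proof (cases "on_schedule k \<sigma>")
    case True
    then have "0 < card (missed \<sigma>)" using False finite_missed_pairs by (simp add: card_gt_0_iff missed_def)
    then have "ennreal 1 \<le> ennreal (real (card (missed \<sigma>)))" by (intro ennreal_leI) simp
    then have "1 \<le> ennreal (real (l - Suc k) * failure_rate) + ennreal (real (card (missed \<sigma>)))"
      by (intro add_increasing) auto
    then show ?thesis using True by (simp add: sampled_risk_def)
  qed (simp add: sampled_risk_def)
  then show ?thesis unfolding wlp_def using risk_le_1 order_trans by blast
qed

lemma expected_le_PASS:
  assumes k: "k < l"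
  shows "expected_le limit (q * 7 + 3 + 1 + ((5000 + 150 * C) * q ^ 5 * l ^ 3 + 1 + 1))
    (\<lambda>\<sigma>. prepared \<sigma> \<and> wvar \<sigma> ''g'' = k) (risk k) PASS
    (\<lambda>\<tau>. prepared (wset ''g'' (Suc k) \<tau>) \<and> wvar \<tau> ''g'' = k) (\<lambda>\<tau>. risk (Suc k) (wset ''g'' (Suc k) \<tau>))"
  unfolding PASS_def
proof (rule expected_le_Seq[OF expected_le_sample_round[OF k] expected_le_Seq])
  show "expected_le limit ((5000 + 150 * C) * q ^ 5 * l ^ 3)
      (\<lambda>\<sigma>. prepared \<sigma> \<and> wvar \<sigma> ''g'' = k \<and> hubs \<sigma> \<subseteq> {..<N}) (sampled_risk k) ROUND
      (\<lambda>\<tau>. prepared (wset ''fuel'' 0 \<tau>) \<and> wvar \<tau> ''g'' = k) (risk (Suc k))"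
  proof (rule expected_le_poly_cost[OF poly_cost_ROUND])
    fix \<sigma> assume \<sigma>: "prepared \<sigma> \<and> wvar \<sigma> ''g'' = k \<and> hubs \<sigma> \<subseteq> {..<N}"
    then show "sized \<sigma> \<and> wvar \<sigma> ''fuel'' = 0" using preparedD by blast
    show "wlp limit ROUND (\<lambda>\<tau>. (prepared (wset ''fuel'' 0 \<tau>) \<and> wvar \<tau> ''g'' = k) \<and>
        risk (Suc k) \<tau> \<le> sampled_risk k \<sigma>) \<sigma>"
    proof (rule wlp_mono[OF wlp_ROUND_risk])
      fix \<tau> assume frame: "frame ROUND \<sigma> \<tau>" and "risk (Suc k) \<tau> \<le> sampled_risk k \<sigma>"
      moreover have "prepared (wset ''fuel'' 0 \<tau>)"
        using \<sigma> by (intro prepared_frame[OF frame]) (auto simp: size_vars_eq)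
      ultimately show "(prepared (wset ''fuel'' 0 \<tau>) \<and> wvar \<tau> ''g'' = k) \<and> risk (Suc k) \<tau> \<le> sampled_risk k \<sigma>"
        using \<sigma> by (simp add: frameD[OF frame])
    qed (use \<sigma> in auto)
  qed
  show "expected_le limit 1 (\<lambda>\<tau>. prepared (wset ''fuel'' 0 \<tau>) \<and> wvar \<tau> ''g'' = k)
      (risk (Suc k)) (WAssign ''fuel'' (WConst 0))
      (\<lambda>\<tau>. prepared (wset ''g'' (Suc k) \<tau>) \<and> wvar \<tau> ''g'' = k) (\<lambda>\<tau>. risk (Suc k) (wset ''g'' (Suc k) \<tau>))"
    by (rule expected_le_WAssign) (auto simp: size_vars_eq)
qed

lemma reachable_iff_rtrancl: "(s, v) \<in> (parcs G)\<^sup>* \<longleftrightarrow> (\<exists>p. pre_digraph.awalk (with_proj G) s p v)"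
proof -
  interpret pair_fin_digraph G by (rule sssp_instanceD(1)[OF instance_G])
  show ?thesis
    using reachable_conv'[of s v] reachable_awalk[of s v] sssp_instanceD(4)[OF instance_G] by simp
qed

lemma correct_answer_if_distances:
  assumes dist: "\<And>x. \<not> has_negative_cycle G w \<Longrightarrow> x < n \<Longrightarrow> rarr \<sigma> ''dist'' x = h x"
    and marked: "marked \<sigma> = {x. (s, x) \<in> (parcs G)\<^sup>*}"
    and checked: "wvar \<sigma> ''negative_cycle'' = 0 \<longleftrightarrow>
      (\<forall>(x, y)\<in>parcs G. rarr \<sigma> ''dist'' y \<le> rarr \<sigma> ''dist'' x + w (x, y))"
  shows "correct_answer G w s (sssp_output \<sigma>)"
proof (cases "has_negative_cycle G w")
  case True
  have "wvar \<sigma> ''negative_cycle'' \<noteq> 0"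
  proof
    assume "wvar \<sigma> ''negative_cycle'' = 0"
    then have "rarr \<sigma> ''dist'' y \<le> rarr \<sigma> ''dist'' x + w (x, y)" if "(x, y) \<in> parcs G" for x y
      using checked that by blast
    from potential_imp_no_negative_cycle[where d = "rarr \<sigma> ''dist''" and w = w,
        OF sssp_instanceD(1)[OF instance_G] this] show False using True by simp
  qed
  then show ?thesis using True by (simp add: sssp_output_def)
next
  case False
  interpret pair_fin_digraph G by (rule sssp_instanceD(1)[OF instance_G])
  interpret shortest_potential n G w s h by (rule potential[OF False])
  have "rarr \<sigma> ''dist'' y \<le> rarr \<sigma> ''dist'' x + w (x, y)" if "(x, y) \<in> parcs G" for x y
    using arc[OF that] dist[OF False] arc_less[OF that] by simp
  then have "wvar \<sigma> ''negative_cycle'' = 0" using checked by blast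
  moreover have "(if warr \<sigma> ''reachable'' v \<noteq> 0 then ereal (rarr \<sigma> ''dist'' v) else \<infinity>) = sssp_dist G w s v"
    if v: "v < n" for v
  proof (cases "\<exists>p. awalk s p v")
    case True
    then have "v \<in> marked \<sigma>" "ereal (h v) = sssp_dist G w s v"
      using marked reachable_iff_rtrancl is_dist by auto
    then show ?thesis using dist[OF False v] by (simp add: marked_def)
  next
    case False
    then have "v \<notin> marked \<sigma>" "sssp_dist G w s v = \<infinity>"
      using marked reachable_iff_rtrancl shortest_path_inf[of s v w] reachable_awalk[of s v]
      by (auto simp: sssp_dist_def)
    then show ?thesis using v by (simp add: marked_def)
  qed
  ultimately show ?thesis using sssp_instanceD(2)[OF instance_G] by (simp add: sssp_output_def)
qed

lemma wlp_ANSWER: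
  assumes \<sigma>: "prepared \<sigma>" and schedule: "on_schedule l \<sigma>"
  shows "wlp limit ANSWER (\<lambda>\<tau>. correct_answer G w s (sssp_output \<tau>)) \<sigma>"
proof (rule wlpI)
  fix \<upsilon> assume "executes ANSWER \<sigma> \<upsilon>"
  then obtain \<rho> \<tau> where exec: "executes COMPUTE_DISTANCES \<sigma> \<rho>" "executes MARK_REACHABLE \<rho> \<tau>"
    "executes CHECK_POTENTIAL \<tau> \<upsilon>"
    by (auto simp: ANSWER_def executes_Seq)
  note frames = exec[THEN executes_frame]
  note same = frameD[OF frames(1)] frameD[OF frames(2)] frameD[OF frames(3)]
  have input: "holds_input \<rho>" "holds_input \<tau>"
    using holds_input_frame[OF frames(1) preparedD(1)[OF \<sigma>]] holds_input_frame[OF frames(2)]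
    by (auto simp: size_vars_eq)
  have dist: "rarr \<rho> ''dist'' x = h x" if "\<not> has_negative_cycle G w" "x < n" for x
  proof -
    have "round_invariant h 1 \<sigma>" using schedule that(1) by (simp add: on_schedule_def)
    then show ?thesis
      using wlpD[OF wlp_COMPUTE_DISTANCES[OF preparedD(2)[OF \<sigma>]] exec(1)] that
        shortest_potential.at_source[OF potential] by simp
  qed
  have "marked \<tau> = {x. (s, x) \<in> (parcs G)\<^sup>*}"
    by (rule wlpD[OF wlp_MARK_REACHABLE[OF input(1)] exec(2)]) (simp_all add: same preparedD[OF \<sigma>])
  then have "marked \<upsilon> = {x. (s, x) \<in> (parcs G)\<^sup>*}" by (simp add: marked_def same)
  moreover have "wvar \<tau> ''negative_cycle'' = 0" by (simp add: same preparedD[OF \<sigma>])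
  note checked = wlpD[OF wlp_CHECK_POTENTIAL[OF input(2) this] exec(3)]
  ultimately show "correct_answer G w s (sssp_output \<upsilon>)"
    by (intro correct_answer_if_distances) (use dist checked in \<open>simp_all add: same\<close>)
qed

definition wrong :: "machine_state \<Rightarrow> ennreal" where
  "wrong = indicator {\<sigma>. \<not> correct_answer G w s (sssp_output \<sigma>)}"

lemma expected_le_LOAD:
  "expected_le limit (300 * q ^ 4 * l ^ 2) (\<lambda>\<sigma>. prepared \<sigma> \<and> rarr \<sigma> ''P'' = (\<lambda>_. 0))
      (\<lambda>_. ennreal (real l * failure_rate))
     (LOAD_GRAPH ;; INIT_MATRIX) prepared (risk 0)"
proof (rule expected_le_poly_cost[OF poly_cost_LOAD])
  fix \<sigma> assume \<sigma>: "prepared \<sigma> \<and> rarr \<sigma> ''P'' = (\<lambda>_. 0)"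
  then show "sized \<sigma> \<and> wvar \<sigma> ''fuel'' = 0" using preparedD by blast
  have "wlp limit (LOAD_GRAPH ;; INIT_MATRIX) (on_schedule 0) \<sigma>"
  proof (cases "has_negative_cycle G w")
    case False
    have "wlp limit (LOAD_GRAPH ;; INIT_MATRIX) (round_invariant h n) \<sigma>"
      using \<sigma> preparedD(1) by (intro wlp_LOAD potential[OF False]) auto
    then show ?thesis
      by (rule wlp_mono) (use n_le_power_l round_invariant_mono in \<open>auto simp: on_schedule_def\<close>)
  qed (simp add: on_schedule_def wlp_def)
  then show "wlp limit (LOAD_GRAPH ;; INIT_MATRIX) (\<lambda>\<tau>. prepared \<tau> \<and> risk 0 \<tau> \<le> ennreal (real l * failure_rate)) \<sigma>"
  proof (rule wlp_mono)
    fix \<tau> assume frame: "frame (LOAD_GRAPH ;; INIT_MATRIX) \<sigma> \<tau>" and "on_schedule 0 \<tau>"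
    moreover have "prepared (wset ''fuel'' 0 \<tau>)"
      by (rule prepared_frame[OF frame]) (use \<sigma> in \<open>auto simp: size_vars_eq\<close>)
    moreover have "wvar \<tau> ''fuel'' = 0" using \<sigma> by (simp add: frameD[OF frame] preparedD)
    ultimately show "prepared \<tau> \<and> risk 0 \<tau> \<le> ennreal (real l * failure_rate)" by (simp add: risk_def fun_upd_idem)
  qed
qed

lemma expected_le_ANSWER: "expected_le limit (2000 * q ^ 4 * l ^ 2) prepared (risk l) ANSWER (\<lambda>_. True) wrong"
proof (rule expected_le_poly_cost[OF poly_cost_ANSWER])
  fix \<sigma> assume \<sigma>: "prepared \<sigma>"
  then show "sized \<sigma> \<and> wvar \<sigma> ''fuel'' = 0" using preparedD by blast
  show "wlp limit ANSWER (\<lambda>\<tau>. True \<and> wrong \<tau> \<le> risk l \<sigma>) \<sigma>"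
  proof (cases "on_schedule l \<sigma>")
    case True
    then show ?thesis by (intro wlp_mono[OF wlp_ANSWER[OF \<sigma>]]) (auto simp: wrong_def)
  next
    case False
    then show ?thesis by (auto simp: wlp_def wrong_def risk_def indicator_def)
  qed
qed

lemma expected_le_COMPUTE_SIZES:
  "expected_le limit (50 + 20 * n) (\<lambda>\<sigma>. \<sigma> = sssp_input n G w s)
      (\<lambda>_. ennreal (real l * failure_rate)) (COMPUTE_SIZES C)
     (\<lambda>\<tau>. prepared \<tau> \<and> rarr \<tau> ''P'' = (\<lambda>_. 0)) (\<lambda>_. ennreal (real l * failure_rate))"
proof (rule expected_le_big_step)
  fix \<sigma> assume \<sigma>: "\<sigma> = sssp_input n G w s"
  then have words: "wvar \<sigma> ''n'' = n" "wvar \<sigma> ''s'' = s" by (simp_all add: sssp_input_def)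
  obtain t \<tau> where t: "big_step limit (COMPUTE_SIZES C) \<sigma> t \<tau>" "t \<le> 50 + 20 * n"
    by (rule COMPUTE_SIZES_time[OF words(1)])
  have "sized \<tau>" using wlp_COMPUTE_SIZES[OF words] t(1) unfolding wlp_def by blast
  moreover note same = frameD[OF big_step_frame[OF t(1)]]
  ultimately have "prepared \<tau> \<and> rarr \<tau> ''P'' = (\<lambda>_. 0)"
    by (simp add: prepared_def holds_input_def same \<sigma>) (simp add: sssp_input_def)
  then show "\<exists>u \<tau>. big_step limit (COMPUTE_SIZES C) \<sigma> u \<tau> \<and> u \<le> 50 + 20 * n \<and>
      (prepared \<tau> \<and> rarr \<tau> ''P'' = (\<lambda>_. 0)) \<and>
      ennreal (real l * failure_rate) \<le> ennreal (real l * failure_rate)" using t by blast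
qed

end

definition program_time :: "nat \<Rightarrow> nat \<Rightarrow> nat" where
  "program_time C n = (10000 + 150 * C) * sqrt_size n ^ 5 * log_size n ^ 4"

lemma (in sizes) total_time:
  "50 + 20 * n + 1 + (300 * q ^ 4 * l ^ 2 + 1 +
     (l * (q * 7 + 3 + 1 + ((5000 + 150 * C) * q ^ 5 * l ^ 3 + 1 + 1) + 4) + 3 + 1 + 2000 * q ^ 4 * l ^ 2)) \<le>
       program_time C n"
proof -
  define X where "X = q ^ 5 * l ^ 4"
  have le: "q ^ i * l ^ j \<le> X" if "i \<le> 5" "j \<le> 4" for i j
    unfolding X_def using that q_ge_1 l_ge_2 by (intro mult_mono power_increasing) auto
  have "1 \<le> X" "q ^ 4 * l ^ 2 \<le> X" "l \<le> X" "q * l \<le> X" "q * q \<le> X"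
    using le[of 0 0] le[of 4 2] le[of 0 1] le[of 1 1] le[of 2 0] by (auto simp: power2_eq_square)
  moreover note n_le_q_square
  moreover have "l * (q * 7 + 3 + 1 + ((5000 + 150 * C) * q ^ 5 * l ^ 3 + 1 + 1) + 4) =
      10 * l + 7 * (q * l) + (5000 + 150 * C) * X"
    by (simp add: X_def algebra_simps power_numeral_reduce)
  moreover have "300 * q ^ 4 * l ^ 2 = 300 * (q ^ 4 * l ^ 2)" "2000 * q ^ 4 * l ^ 2 = 2000 * (q ^ 4 * l ^ 2)"
    by simp_all
  moreover have "program_time C n = 10000 * X + 150 * (C * X)" "(5000 + 150 * C) * X = 5000 * X + 150 * (C * X)"
    by (simp_all add: program_time_def X_def algebra_simps flip: q_def l_def)
  ultimately show ?thesis by linarith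
qed

lemma (in sssp_run) expected_le_SSSP:
  "expected_le limit (program_time C n) (\<lambda>\<sigma>. \<sigma> = sssp_input n G w s) (\<lambda>_. ennreal (real l * failure_rate)) (SSSP C)
     (\<lambda>_. True) wrong"
proof -
  have "expected_le limit (l * (q * 7 + 3 + 1 + ((5000 + 150 * C) * q ^ 5 * l ^ 3 + 1 + 1) + 4) + 3)
      (\<lambda>\<sigma>. prepared (wset ''g'' 0 \<sigma>)) (\<lambda>\<sigma>. risk 0 (wset ''g'' 0 \<sigma>)) (FOR ''g'' ''l'' PASS) prepared (risk l)"
    by (rule expected_le_FOR[where I = "\<lambda>_. prepared" and f = risk])
      (use expected_le_PASS less_limit(3) preparedD(2) sizedD(4) in auto)
  then have "expected_le limit (l * (q * 7 + 3 + 1 + ((5000 + 150 * C) * q ^ 5 * l ^ 3 + 1 + 1) + 4) + 3)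
      prepared (risk 0) (FOR ''g'' ''l'' PASS) prepared (risk l)" by (simp add: size_vars_eq)
  from expected_le_Seq[OF expected_le_COMPUTE_SIZES expected_le_Seq[OF expected_le_LOAD
        expected_le_Seq[OF this expected_le_ANSWER]]]
  show ?thesis unfolding SSSP_def by (rule expected_le_mono) (use total_time in auto)
qed

lemma SSSP_correct:
  assumes inst: "sssp_instance n G s" and C: "7 + c \<le> real C" and c: "0 < c"
  obtains p where "run (word_bound (C + 12) n) (program_time C n) (SSSP C) (sssp_input n G w s) =
      map_pmf (Pair Skip) p"
    and "1 - 1 / real n powr c \<le> measure_pmf.prob p {\<sigma>. correct_answer G w s (sssp_output \<sigma>)}"
proof -
  let ?A = "{\<sigma>. correct_answer G w s (sssp_output \<sigma>)}"
  have s: "s < n" by (rule sssp_instanceD(3)[OF inst])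
  then interpret sssp_problem n s C G w by unfold_locales (use inst in auto)
  obtain h where "\<not> has_negative_cycle G w \<Longrightarrow> shortest_potential n G w s h"
    using shortest_potential_exists[OF inst] by blast
  then interpret sssp_run n s C G w h
    by (intro sssp_run.intro sssp_run_axioms.intro sssp_problem_axioms failure_rate_le(2)[OF C c])
  obtain p where p: "halts limit (program_time C n) (SSSP C) (sssp_input n G w s) p"
    and "(\<integral>\<^sup>+\<sigma>. wrong \<sigma> \<partial>measure_pmf p) \<le> ennreal (real l * failure_rate)"
    using expected_le_SSSP unfolding expected_le_def by blast
  then have "emeasure (measure_pmf p) (- ?A) \<le> ennreal (real l * failure_rate)"
    by (simp add: wrong_def Collect_neg_eq)
  then have "measure_pmf.prob p (- ?A) \<le> real l * failure_rate"
    using failure_rate_nonneg by (simp add: measure_pmf.emeasure_eq_measure)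
  also have "\<dots> \<le> 1 / real n powr c" by (rule failure_rate_le(1)[OF C c])
  finally have "1 - 1 / real n powr c \<le> measure_pmf.prob p ?A"
    using measure_pmf.prob_compl[of ?A p] by (simp add: Compl_eq_Diff_UNIV)
  with p show thesis by (intro that) (auto simp: halts_def limit_def)
qed

corollary SSSP_runs_in_time:
  assumes "7 + c \<le> real C" "0 < c"
  shows "runs_in_time (C + 12) (SSSP C) (program_time C)"
  unfolding runs_in_time_def
proof (intro allI impI)
  fix n G w s assume inst: "sssp_instance n G s"
  obtain p where run: "run (word_bound (C + 12) n) (program_time C n) (SSSP C) (sssp_input n G w s) =
      map_pmf (Pair Skip) p"
    by (rule SSSP_correct[OF inst assms])
  show "\<forall>(d, \<sigma>)\<in>set_pmf (run (word_bound (C + 12) n) (program_time C n) (SSSP C) (sssp_input n G w s)). d = Skip"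
    unfolding run by auto
qed

corollary SSSP_solves_whp:
  assumes "7 + c \<le> real C" "0 < c"
  shows "solves_sssp_whp (C + 12) (SSSP C) (program_time C) c"
  unfolding solves_sssp_whp_def
proof (intro allI impI)
  fix n G w s assume inst: "sssp_instance n G s"
  obtain p where p: "run (word_bound (C + 12) n) (program_time C n) (SSSP C) (sssp_input n G w s) =
      map_pmf (Pair Skip) p"
    "1 - 1 / real n powr c \<le> measure_pmf.prob p {\<sigma>. correct_answer G w s (sssp_output \<sigma>)}"
    by (rule SSSP_correct[OF inst assms])
  have "Pair Skip -` {(D, \<sigma>). D = Skip \<and> correct_answer G w s (sssp_output \<sigma>)} =
      {\<sigma>. correct_answer G w s (sssp_output \<sigma>)}"
    by auto
  then show "1 - 1 / real n powr c \<le> measure_pmf.prob (run (word_bound (C + 12) n) (program_time C n) (SSSP C) (sssp_input n G w s))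
      {(D, \<sigma>). D = Skip \<and> correct_answer G w s (sssp_output \<sigma>)}"
    unfolding p(1) using p(2) by simp
qed


section \<open>The asymptotic running time\<close>

lemma sqrt_size_le_sqrt:
  assumes n: "1 \<le> n"
  shows "real (sqrt_size n) \<le> 2 * sqrt (real n)"
proof -
  have "real (sqrt_size n) \<le> sqrt (real n) + 1"
  proof (cases "sqrt_size n")
    case (Suc k)
    then have "k * k < n" using square_less_sqrt_size[of k n] by simp
    then have "(real k)\<^sup>2 \<le> real n" unfolding power2_eq_square by (metis less_imp_le of_nat_le_iff of_nat_mult)
    then have "real k \<le> sqrt (real n)" by (rule real_le_rsqrt)
    then show ?thesis using Suc by simp
  qed simp
  also have "\<dots> \<le> 2 * sqrt (real n)" using n by simp
  finally show ?thesis .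
qed

lemma log_size_le_log:
  assumes n: "2 \<le> n"
  shows "real (log_size n) \<le> 4 * log 2 (real n)"
proof -
  have log: "1 \<le> log 2 (real n)" using n by (simp add: le_log_iff)
  have "real (log_size n) \<le> log 2 (real n) + 3"
  proof (cases "log_size n - 2")
    case (Suc k)
    then have "2 ^ k < n" using power_less_log_size[of k n] by simp
    then have "real (2 ^ k) \<le> real n" by simp
    then have "2 powr real k \<le> real n" by (simp add: powr_realpow)
    then have "real k \<le> log 2 (real n)" using n by (simp add: le_log_iff)
    then show ?thesis using Suc by simp
  qed (use log in simp)
  then show ?thesis using log by simp
qed

lemma program_time_bigo: "(\<lambda>n. real (program_time C n)) \<in> O(\<lambda>n. real n powr 2.5 * log 2 (real n) powr 4.5)"
proof (rule bigoI[where c = "real (10000 + 150 * C) * 2 ^ 5 * 4 ^ 4"], rule eventually_at_top_linorderI[of 2])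
  let ?c = "real (10000 + 150 * C)"
  fix n :: nat assume n: "2 \<le> n"
  have log: "1 \<le> log 2 (real n)" using n by (simp add: le_log_iff)
  have sqrt: "sqrt (real n) ^ 5 = real n powr 2.5"
    using n by (simp add: powr_half_sqrt[symmetric] powr_power)
  have "log 2 (real n) ^ 4 = log 2 (real n) powr 4" using log powr_realpow[of "log 2 (real n)" 4] by simp
  also have "\<dots> \<le> log 2 (real n) powr 4.5" using log by (intro powr_mono) auto
  finally have log4: "log 2 (real n) ^ 4 \<le> log 2 (real n) powr 4.5" .
  have "real (program_time C n) = ?c * real (sqrt_size n) ^ 5 * real (log_size n) ^ 4"
    by (simp add: program_time_def)
  also have "\<dots> \<le> ?c * (2 * sqrt (real n)) ^ 5 * (4 * log 2 (real n)) ^ 4"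
    using sqrt_size_le_sqrt[of n] log_size_le_log[OF n] n by (intro mult_mono power_mono) auto
  also have "\<dots> = ?c * 2 ^ 5 * 4 ^ 4 * (sqrt (real n) ^ 5 * log 2 (real n) ^ 4)" by (simp add: power_mult_distrib)
  also have "\<dots> \<le> ?c * 2 ^ 5 * 4 ^ 4 * (real n powr 2.5 * log 2 (real n) powr 4.5)"
    unfolding sqrt using log4 by (intro mult_left_mono) auto
  finally show "norm (real (program_time C n)) \<le>
      ?c * 2 ^ 5 * 4 ^ 4 * norm (real n powr 2.5 * log 2 (real n) powr 4.5)"
    by simp
qed

theorem theorem1p1:
  shows "\<forall>c>0. \<exists>(P :: com) (k :: nat) (T :: nat \<Rightarrow> nat).
    runs_in_time k P T \<and>
    solves_sssp_whp k P T c \<and>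
    (\<lambda>n. real (T n)) \<in> O(\<lambda>n. real n powr 2.5 * log 2 (real n) powr 4.5)"
proof (intro allI impI)
  fix c :: real assume c: "0 < c"
  define C where "C = 7 + nat \<lceil>c\<rceil>"
  have "7 + c \<le> real C" using c by (simp add: C_def)
  then show "\<exists>(P :: com) (k :: nat) (T :: nat \<Rightarrow> nat). runs_in_time k P T \<and> solves_sssp_whp k P T c \<and>
      (\<lambda>n. real (T n)) \<in> O(\<lambda>n. real n powr 2.5 * log 2 (real n) powr 4.5)"
    using SSSP_runs_in_time SSSP_solves_whp c program_time_bigo by blast
qed

end
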